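(* (a) Let $\ell\ge1$. For every $m\in\mathbb N$, the character $\chi_{E_\ell^m}$ is expressed by (i.e. equals the image under $\rho_m$ of) the following polynomial of $\mathbb Q[X_1,\dots,X_\ell]$, of weight $\ell$ and independent of $m$: $$\mathbf E_\ell=\phi(\ell)\,X_\ell+\sum_{ed=\ell,\ e\ne1}\phi(d)\,\frac{d^{e}}{\ell}\,X_d(X_d-1)\cdots(X_d-(e-1)),$$ where $\phi$ is Euler's totient function. The $\mathrm{FI}$-module $E_\ell=\{E_\ell^m\hookrightarrow E_\ell^{m+1}\}_m$ has the ranks $$\operatorname{rank}_{\mathrm{PC}}(E_\ell)=0\quad\text{and}\quad \operatorname{rank}_{\mathrm{RS}}(E_\ell)=\operatorname{rank}^{\mathrm{FI}}_{\mathrm{RS}}(E_\ell)=2\ell.$$ (b) Given an ordered sequence $(Z_1,\dots,Z_N)$ of polynomials of $\mathbb Q[\overline X]$ and $d\in\mathbb N$, denote by $\mathbb Q^{\le d}[Z_1,\dots,Z_N]$ the subspace spanned by the elements $Z_1^{a_1}\cdots Z_N^{a_N}$ with $\sum_i i\,a_i\le d$. Then, for all $N\in\mathbb N$ and all $d\in\mathbb N$, the inclusion $$\mathbb Q^{\le d}[\mathbf E_1,\dots,\mathbf E_N]\subseteq\mathbb Q^{\le d}[X_1,\dots,X_N]$$ is an equality. (c) For every nonempty partition $\nu=(1^{n_1},2^{n_2},\dots,N^{n_N})$: (i) $w(E_\nu^m)\le\min\{m,|\nu|\}$ for all $m$; (ii) the $\mathrm{FI}$-module $E_\nu=\{E_\nu^m\hookrightarrow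 E_\nu^{m+1}\}_m$ has the ranks $$\operatorname{rank}_{\mathrm{PC}}(E_\nu)=0\quad\text{and}\quad \operatorname{rank}_{\mathrm{RS}}(E_\nu)=\operatorname{rank}^{\mathrm{FI}}_{\mathrm{RS}}(E_\nu)=2|\nu|.$$
   Context: $\mathbb N=\{0,1,2,\dots\}$. $\mathfrak S_m$ is the symmetric group on $\{1,\dots,m\}$; for $n\le m$, $\mathfrak S_n\subseteq\mathfrak S_m$ is the subgroup fixing every $i>n$, and $\mathbf 1_n\boxtimes\mathfrak S_{m-n}\subseteq\mathfrak S_m$ is the subgroup fixing every $i\le n$. An $\mathfrak S_m$-module is a finite dimensional $\mathbb Q$-representation. An $\mathrm{FB}$-module is a family $\{W_m\}_{m\in\mathbb N}$ with $W_m$ an $\mathfrak S_m$-module. An $\mathrm{FI}$-module is an $\mathrm{FB}$-module with linear interior maps $\phi_m:W_m\to W_{m+1}$ that are $\mathfrak S_m$-equivariant and such that, for all $n\ge m$, the image of the composite $W_m\to W_n$ consists of vectors invariant under $\mathbf 1_m\boxtimes\mathfrak S_{n-m}$ (equivalently, a covariant functor from finite sets and injections to finite dimensional $\mathbb Q$-vector spaces). The map $\phi_m$ is exhaustive if $\phi_m(W_m)$ generates $W_{m+1}$ as an $\mathfrak S_{m+1}$-module. Cycles: for $\ell\ge1$, $\Gamma_\ell^m$ is the set of $\ell$-tuples $(i_1,\dots,i_\ell)$ of pairwise distinct elements of $\{1,\dots,m\}$ modulo cyclic permutation, with action $g\cdot(i_1,\dots,i_\ell)=(g(i_1),\dots,g(i_\ell))$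 of $\mathfrak S_m$ (so $\Gamma_1^m=\{1,\dots,m\}$ and $\Gamma_\ell^m=\emptyset$ for $m<\ell$). $E_\ell^m$ is the $\mathbb Q$-vector space with basis $\Gamma_\ell^m$ and the induced permutation action; $E_\ell$ is the $\mathrm{FI}$-module with interior maps induced by $\Gamma_\ell^m\subseteq\Gamma_\ell^{m+1}$. For a partition $\nu=(1^{n_1},\dots,N^{n_N})$ (with $n_i$ parts equal to $i$, so $|\nu|=\sum_i i\,n_i$), $E_\nu^m:=(E_1^m)^{\otimes n_1}\otimes\cdots\otimes(E_N^m)^{\otimes n_N}$ with diagonal $\mathfrak S_m$-action, and the interior maps of $E_\nu$ are the tensor products of those of the $E_i$. Polynomials: $\mathbb Q[\overline X]=\mathbb Q[X_1,X_2,\dots]$; $\rho_m$ is the algebra homomorphism from $\mathbb Q[\overline X]$ to $\mathbb Q$-valued class functions on $\mathfrak S_m$ sending $X_i$ to $g\mapsto$ the number of $i$-cycles in the disjoint cycle decomposition of $g\in\mathfrak S_m$ (fixed points are $1$-cycles). The weight of a polynomial is its weighted degree with $X_i$ of degree $i$. An $\mathrm{FB}$-module is $\mathrm{PC}_{m\ge N}$ if there is $P\in\mathbb Q[\overline X]$ with $\chi_{W_m}=\rho_m(P)$ for all $m\ge N$; $\operatorname{rank}_{\mathrm{PC}}$ is the smallest such $N\in\mathbb N$. Representations: for $\mu\vdash m$, $V_\mu$ is the associated simple $\mathfrak S_m$-module ($V_{(m)}$ is trivial); $w(\mu)=\mu_2+\mu_3+\cdots$; and $w(W_m)$ is the supremum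 of $w(\mu)$ over the $\mu$ with $V_\mu$ a factor of $W_m$ ($-\infty$ if $W_m=0$). For a partition $\lambda$ (possibly empty) and $m\ge|\lambda|+\lambda_1$, $\lambda[m]:=(m-|\lambda|,\lambda_1,\lambda_2,\dots)$. An $\mathrm{FB}$-module is $\mathrm{RS}_{m\ge N}$ if there are natural numbers $n_\lambda$ independent of $m$, indexed by the partitions $\lambda$ with $|\lambda|+\lambda_1\le N$, such that $W_m\cong\bigoplus_\lambda V_{\lambda[m]}^{\,n_\lambda}$ for all $m\ge N$; $\operatorname{rank}_{\mathrm{RS}}$ is the smallest such $N$ (for an $\mathrm{FI}$-module, that of the underlying $\mathrm{FB}$-module). For an $\mathrm{FI}$-module, $\operatorname{rank}^{\mathrm{FI}}_{\mathrm{RS}}$ is the smallest $N$ for which this decomposition condition holds and in addition the interior maps $\phi_m$ are injective, and are exhaustive for $m\ge N$. *)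

theory Defs
  imports
    "HOL-Library.Poly_Mapping"
    "HOL-Library.Extended_Nat"
    "HOL-Library.Extended_Real"
    "HOL-Combinatorics.Permutations"
    "HOL-Combinatorics.Orbits"
    "HOL-Number_Theory.Totient"
begin

section \<open>Rational vector spaces\<close>

text \<open>
  The type \<^typ>\<open>'a \<Rightarrow>\<^sub>0 rat\<close> is the rational vector space with basis \<^typ>\<open>'a\<close>;
  the basis vector of \<open>a\<close> is \<open>bvec a\<close>. All vector spaces below are subspaces of
  spaces of this form. This is no restriction, since every vector space has a basis.
\<close>

definition qscale :: "rat \<Rightarrow> ('a \<Rightarrow>\<^sub>0 rat) \<Rightarrow> ('a \<Rightarrow>\<^sub>0 rat)" where
  "qscale c = Poly_Mapping.map (\<lambda>x. c * x)"

lemma lookup_qscale [simp]: "Poly_Mapping.lookup (qscale c x) a = c * Poly_Mapping.lookup x a"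
  by (simp add: qscale_def Poly_Mapping.map.rep_eq when_def)

global_interpretation qvs: vector_space "qscale :: rat \<Rightarrow> ('a \<Rightarrow>\<^sub>0 rat) \<Rightarrow> ('a \<Rightarrow>\<^sub>0 rat)"
  by unfold_locales (auto intro!: poly_mapping_eqI simp: lookup_add algebra_simps)

abbreviation bvec :: "'a \<Rightarrow> ('a \<Rightarrow>\<^sub>0 rat)" where
  "bvec a \<equiv> Poly_Mapping.single a 1"

text \<open>The linear map with prescribed values on the basis vectors.\<close>

definition lin_ext :: "('a \<Rightarrow> ('b \<Rightarrow>\<^sub>0 rat)) \<Rightarrow> ('a \<Rightarrow>\<^sub>0 rat) \<Rightarrow> ('b \<Rightarrow>\<^sub>0 rat)" where
  "lin_ext F x = (\<Sum>a\<in>Poly_Mapping.keys x. qscale (Poly_Mapping.lookup x a) (F a))"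

definition linear_on :: "('a \<Rightarrow>\<^sub>0 rat) set \<Rightarrow> (('a \<Rightarrow>\<^sub>0 rat) \<Rightarrow> ('b \<Rightarrow>\<^sub>0 rat)) \<Rightarrow> bool" where
  "linear_on V f \<longleftrightarrow>
     (\<forall>x\<in>V. \<forall>y\<in>V. f (x + y) = f x + f y) \<and> (\<forall>c. \<forall>x\<in>V. f (qscale c x) = qscale c (f x))"

text \<open>
  The trace of a linear endomorphism \<open>f\<close> of the finite dimensional space \<open>V\<close>,
  computed in some basis of \<open>V\<close>.
\<close>

definition trace_on :: "('a \<Rightarrow>\<^sub>0 rat) set \<Rightarrow> (('a \<Rightarrow>\<^sub>0 rat) \<Rightarrow> ('a \<Rightarrow>\<^sub>0 rat)) \<Rightarrow> rat" where
  "trace_on V f =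
     (let B = (SOME B. qvs.independent B \<and> qvs.span B = V)
      in \<Sum>b\<in>B. qvs.representation B (f b) b)"


section \<open>Representations of symmetric groups\<close>

text \<open>
  Elements of the symmetric group on \<open>{1..m}\<close> are the functions \<open>g :: nat \<Rightarrow> nat\<close> with
  \<open>g permutes {1..m}\<close>; being the identity outside \<open>{1..m}\<close>, they are also elements of
  the larger symmetric groups, as in the standard embeddings. The action is only meaningful on
  the underlying space and for such \<open>g\<close>.
\<close>

record 'a rep =
  space :: "('a \<Rightarrow>\<^sub>0 rat) set"
  act :: "(nat \<Rightarrow> nat) \<Rightarrow> ('a \<Rightarrow>\<^sub>0 rat) \<Rightarrow> ('a \<Rightarrow>\<^sub>0 rat)"

definition Sm_module :: "nat \<Rightarrow> 'a rep \<Rightarrow> bool" where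
  "Sm_module m W \<longleftrightarrow>
     qvs.subspace (space W) \<and>
     (\<exists>B. finite B \<and> space W \<subseteq> qvs.span B) \<and>
     (\<forall>g. g permutes {1..m} \<longrightarrow> linear_on (space W) (act W g) \<and> act W g ` space W \<subseteq> space W) \<and>
     (\<forall>x\<in>space W. act W id x = x) \<and>
     (\<forall>g h. g permutes {1..m} \<longrightarrow> h permutes {1..m} \<longrightarrow>
        (\<forall>x\<in>space W. act W (g \<circ> h) x = act W g (act W h x)))"

definition equivariant ::
  "nat \<Rightarrow> 'a rep \<Rightarrow> 'b rep \<Rightarrow> (('a \<Rightarrow>\<^sub>0 rat) \<Rightarrow> ('b \<Rightarrow>\<^sub>0 rat)) \<Rightarrow> bool" where
  "equivariant m V W f \<longleftrightarrow>
     (\<forall>g. g permutes {1..m} \<longrightarrow> (\<forall>x\<in>space V. f (act V g x) = act W g (f x)))"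

definition rep_iso :: "nat \<Rightarrow> 'a rep \<Rightarrow> 'b rep \<Rightarrow> bool" where
  "rep_iso m V W \<longleftrightarrow>
     (\<exists>f. linear_on (space V) f \<and> bij_betw f (space V) (space W) \<and> equivariant m V W f)"

definition invariant_subspace :: "nat \<Rightarrow> 'a rep \<Rightarrow> ('a \<Rightarrow>\<^sub>0 rat) set \<Rightarrow> bool" where
  "invariant_subspace m W U \<longleftrightarrow>
     qvs.subspace U \<and> U \<subseteq> space W \<and> (\<forall>g. g permutes {1..m} \<longrightarrow> act W g ` U \<subseteq> U)"

text \<open>
  A factor is a direct summand; by complete reducibility this agrees with being a
  submodule, a quotient or a composition factor, up to isomorphism, when \<open>V\<close> is simple.
\<close>

definition is_factor :: "nat \<Rightarrow> 'a rep \<Rightarrow> 'b rep \<Rightarrow> bool" where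
  "is_factor m V W \<longleftrightarrow>
     (\<exists>U U'. invariant_subspace m W U \<and> invariant_subspace m W U' \<and>
        U \<inter> U' = {0} \<and> {u + u' | u u'. u \<in> U \<and> u' \<in> U'} = space W \<and>
        rep_iso m V (W\<lparr>space := U\<rparr>))"

definition character :: "'a rep \<Rightarrow> (nat \<Rightarrow> nat) \<Rightarrow> rat" where
  "character W g = trace_on (space W) (act W g)"

definition perm_module :: "'a set \<Rightarrow> ((nat \<Rightarrow> nat) \<Rightarrow> 'a \<Rightarrow> 'a) \<Rightarrow> 'a rep" where
  "perm_module A \<alpha> = \<lparr>space = {x. Poly_Mapping.keys x \<subseteq> A}, act = (\<lambda>g. lin_ext (\<lambda>a. bvec (\<alpha> g a)))\<rparr>"

definition component :: "'i \<Rightarrow> ('i \<times> 'a \<Rightarrow>\<^sub>0 rat) \<Rightarrow> ('a \<Rightarrow>\<^sub>0 rat)" where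
  "component i = lin_ext (\<lambda>(j, a). if j = i then bvec a else 0)"

definition inject :: "'i \<Rightarrow> ('a \<Rightarrow>\<^sub>0 rat) \<Rightarrow> ('i \<times> 'a \<Rightarrow>\<^sub>0 rat)" where
  "inject i = lin_ext (\<lambda>a. bvec (i, a))"

definition direct_sum :: "'i set \<Rightarrow> ('i \<Rightarrow> 'a rep) \<Rightarrow> ('i \<times> 'a) rep" where
  "direct_sum I V =
     \<lparr>space = {x. fst ` Poly_Mapping.keys x \<subseteq> I \<and> (\<forall>i\<in>I. component i x \<in> space (V i))},
      act = (\<lambda>g x. \<Sum>i\<in>I. inject i (act (V i) g (component i x)))\<rparr>"

text \<open>
  Tensor products of finitely many spaces. The tensor product of the full spaces
  \<open>'a \<Rightarrow>\<^sub>0 rat\<close> (\<open>n\<close> factors) has the words of length \<open>n\<close> as basis, the word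
  \<open>[a\<^sub>1, \<dots>, a\<^sub>n]\<close> standing for the tensor product of the \<open>bvec a\<^sub>i\<close>. The tensor product
  of subspaces is the span of their pure tensors in it. For linear maps \<open>fs\<close>
  defined on the full spaces, \<open>tensor_map fs\<close> is their tensor product.
\<close>

definition pure_tensor :: "('a \<Rightarrow>\<^sub>0 rat) list \<Rightarrow> ('a list \<Rightarrow>\<^sub>0 rat)" where
  "pure_tensor vs =
     (\<Sum>w\<in>listset (map Poly_Mapping.keys vs). Poly_Mapping.single w (\<Prod>i<length vs. Poly_Mapping.lookup (vs ! i) (w ! i)))"

definition tensor_map ::
  "(('a \<Rightarrow>\<^sub>0 rat) \<Rightarrow> ('b \<Rightarrow>\<^sub>0 rat)) list \<Rightarrow> ('a list \<Rightarrow>\<^sub>0 rat) \<Rightarrow> ('b list \<Rightarrow>\<^sub>0 rat)" where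
  "tensor_map fs = lin_ext (\<lambda>w. pure_tensor (map2 (\<lambda>f a. f (bvec a)) fs w))"

definition tensor_rep :: "'a rep list \<Rightarrow> 'a list rep" where
  "tensor_rep Ws =
     \<lparr>space = qvs.span {pure_tensor vs | vs. list_all2 (\<lambda>v W. v \<in> space W) vs Ws},
      act = (\<lambda>g. tensor_map (map (\<lambda>W. act W g) Ws))\<rparr>"


section \<open>Partitions and the simple modules\<close>

definition is_partition :: "nat list \<Rightarrow> bool" where
  "is_partition \<mu> \<longleftrightarrow> sorted_wrt (\<ge>) \<mu> \<and> 0 \<notin> set \<mu>"

definition first_part :: "nat list \<Rightarrow> nat" where
  "first_part \<mu> = (case \<mu> of [] \<Rightarrow> 0 | k # _ \<Rightarrow> k)"

text \<open>
  The partition \<open>(m - |\<mu>|, \<mu>\<^sub>1, \<mu>\<^sub>2, \<dots>)\<close>, for \<open>m \<ge> |\<mu>| + \<mu>\<^sub>1\<close>. The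
  first entry is zero only for \<open>m = 0\<close> and empty \<open>\<mu>\<close>, and then it is dropped.
\<close>

definition padded :: "nat list \<Rightarrow> nat \<Rightarrow> nat list" where
  "padded \<mu> m = removeAll 0 ((m - sum_list \<mu>) # \<mu>)"

text \<open>
  The simple module of a partition \<open>\<mu>\<close> of \<open>m\<close> is the Specht module. A tableau is
  the list of its rows; the tabloid of a tableau is the list of the sets of
  entries of its rows.
\<close>

definition tableaux :: "nat list \<Rightarrow> nat list list set" where
  "tableaux \<mu> = {T. map length T = \<mu> \<and> distinct (concat T) \<and> set (concat T) = {1..sum_list \<mu>}}"

definition tabloid :: "nat list list \<Rightarrow> nat set list" where
  "tabloid T = map set T"

definition tabloid_action :: "(nat \<Rightarrow> nat) \<Rightarrow> nat set list \<Rightarrow> nat set list" where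
  "tabloid_action g = map (image g)"

definition column :: "nat list list \<Rightarrow> nat \<Rightarrow> nat set" where
  "column T j = {r ! j | r. r \<in> set T \<and> j < length r}"

definition column_group :: "nat list list \<Rightarrow> (nat \<Rightarrow> nat) set" where
  "column_group T = {g. g permutes set (concat T) \<and> (\<forall>j. g ` column T j = column T j)}"

definition polytabloid :: "nat list list \<Rightarrow> (nat set list \<Rightarrow>\<^sub>0 rat)" where
  "polytabloid T =
     (\<Sum>g\<in>column_group T. qscale (of_int (sign g)) (bvec (tabloid_action g (tabloid T))))"

definition specht :: "nat list \<Rightarrow> nat set list rep" where
  "specht \<mu> =
     \<lparr>space = qvs.span (polytabloid ` tableaux \<mu>),
      act = (\<lambda>g. lin_ext (\<lambda>t. bvec (tabloid_action g t)))\<rparr>"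

definition partition_weight :: "nat list \<Rightarrow> nat" where
  "partition_weight \<mu> = sum_list (tl \<mu>)"

text \<open>The supremum is taken in the extended reals, where \<open>Sup {} = -\<infinity>\<close>.\<close>

definition rep_weight :: "nat \<Rightarrow> 'a rep \<Rightarrow> ereal" where
  "rep_weight m W =
     (SUP \<mu>\<in>{\<mu>. is_partition \<mu> \<and> sum_list \<mu> = m \<and> is_factor m (specht \<mu>) W}.
        ereal (real (partition_weight \<mu>)))"


section \<open>FB-modules and FI-modules\<close>

definition FB_module :: "(nat \<Rightarrow> 'a rep) \<Rightarrow> bool" where
  "FB_module W \<longleftrightarrow> (\<forall>m. Sm_module m (W m))"

text \<open>\<open>interior_comp \<phi> m k\<close> is the composite from degree \<open>m\<close> to degree \<open>m + k\<close>.\<close>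

primrec interior_comp ::
  "(nat \<Rightarrow> ('a \<Rightarrow>\<^sub>0 rat) \<Rightarrow> ('a \<Rightarrow>\<^sub>0 rat)) \<Rightarrow> nat \<Rightarrow> nat \<Rightarrow> ('a \<Rightarrow>\<^sub>0 rat) \<Rightarrow> ('a \<Rightarrow>\<^sub>0 rat)" where
  "interior_comp \<phi> m 0 = id"
| "interior_comp \<phi> m (Suc k) = \<phi> (m + k) \<circ> interior_comp \<phi> m k"

definition FI_module ::
  "(nat \<Rightarrow> 'a rep) \<Rightarrow> (nat \<Rightarrow> ('a \<Rightarrow>\<^sub>0 rat) \<Rightarrow> ('a \<Rightarrow>\<^sub>0 rat)) \<Rightarrow> bool" where
  "FI_module W \<phi> \<longleftrightarrow>
     FB_module W \<and>
     (\<forall>m. linear_on (space (W m)) (\<phi> m) \<and> \<phi> m ` space (W m) \<subseteq> space (W (Suc m)) \<and>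
          equivariant m (W m) (W (Suc m)) (\<phi> m)) \<and>
     (\<forall>m n. m \<le> n \<longrightarrow> (\<forall>g. g permutes {m+1..n} \<longrightarrow>
        (\<forall>x\<in>space (W m). act (W n) g (interior_comp \<phi> m (n - m) x) = interior_comp \<phi> m (n - m) x)))"

definition exhaustive ::
  "(nat \<Rightarrow> 'a rep) \<Rightarrow> (nat \<Rightarrow> ('a \<Rightarrow>\<^sub>0 rat) \<Rightarrow> ('a \<Rightarrow>\<^sub>0 rat)) \<Rightarrow> nat \<Rightarrow> bool" where
  "exhaustive W \<phi> m \<longleftrightarrow>
     qvs.span {act (W (Suc m)) g (\<phi> m x) | g x. g permutes {1..Suc m} \<and> x \<in> space (W m)}
       = space (W (Suc m))"


section \<open>Polynomials and their class functions\<close>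

text \<open>
  The type of all polynomials with rational coefficients in variables indexed by \<open>nat\<close>;
  a monomial is the finitely supported function of its exponents. The ring
  \<open>\<rat>[X\<^sub>1, X\<^sub>2, \<dots>]\<close> is \<open>polys_in {1..}\<close>, since the variable of index \<open>0\<close> is not used.
\<close>

type_synonym qpoly = "(nat \<Rightarrow>\<^sub>0 nat) \<Rightarrow>\<^sub>0 rat"

definition X_var :: "nat \<Rightarrow> qpoly" where
  "X_var i = bvec (Poly_Mapping.single i 1)"

definition polys_in :: "nat set \<Rightarrow> qpoly set" where
  "polys_in I = {P. \<forall>a\<in>Poly_Mapping.keys P. Poly_Mapping.keys a \<subseteq> I}"

definition mono_weight :: "(nat \<Rightarrow>\<^sub>0 nat) \<Rightarrow> nat" where
  "mono_weight a = (\<Sum>i\<in>Poly_Mapping.keys a. i * Poly_Mapping.lookup a i)"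

text \<open>The zero polynomial gets weight \<open>0\<close>.\<close>

definition poly_weight :: "qpoly \<Rightarrow> nat" where
  "poly_weight P = Max (insert 0 (mono_weight ` Poly_Mapping.keys P))"

definition num_cycles :: "nat \<Rightarrow> nat \<Rightarrow> (nat \<Rightarrow> nat) \<Rightarrow> nat" where
  "num_cycles m i g = card {C. (\<exists>x\<in>{1..m}. C = orbit g x) \<and> card C = i}"

definition rho :: "nat \<Rightarrow> qpoly \<Rightarrow> (nat \<Rightarrow> nat) \<Rightarrow> rat" where
  "rho m P g =
     (\<Sum>a\<in>Poly_Mapping.keys P. Poly_Mapping.lookup P a * (\<Prod>i\<in>Poly_Mapping.keys a. of_nat (num_cycles m i g) ^ Poly_Mapping.lookup a i))"

definition expresses_character :: "nat \<Rightarrow> qpoly \<Rightarrow> 'a rep \<Rightarrow> bool" where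
  "expresses_character m P W \<longleftrightarrow> (\<forall>g. g permutes {1..m} \<longrightarrow> character W g = rho m P g)"

text \<open>The span of the \<open>Z\<^sub>1\<^bsup>a\<^sub>1\<^esup> \<dots> Z\<^sub>N\<^bsup>a\<^sub>N\<^esup>\<close> with \<open>\<Sum>i. i * a\<^sub>i \<le> d\<close>.\<close>

definition bounded_span :: "nat \<Rightarrow> nat \<Rightarrow> (nat \<Rightarrow> qpoly) \<Rightarrow> qpoly set" where
  "bounded_span d N Z =
     qvs.span {\<Prod>i=1..N. Z i ^ a i | a :: nat \<Rightarrow> nat. (\<Sum>i=1..N. i * a i) \<le> d}"


section \<open>Ranks\<close>

text \<open>
  Each rank is the smallest natural number with the stated property, and \<open>\<infinity>\<close> if
  there is none.
\<close>

definition PC_from :: "nat \<Rightarrow> (nat \<Rightarrow> 'a rep) \<Rightarrow> bool" where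
  "PC_from N W \<longleftrightarrow> (\<exists>P\<in>polys_in {1..}. \<forall>m\<ge>N. expresses_character m P (W m))"

definition rank_PC :: "(nat \<Rightarrow> 'a rep) \<Rightarrow> enat" where
  "rank_PC W = Inf {enat N | N. PC_from N W}"

text \<open>The index \<open>(\<mu>, k)\<close> stands for the \<open>k\<close>-th of the \<open>c \<mu>\<close> copies.\<close>

definition RS_from :: "nat \<Rightarrow> (nat \<Rightarrow> 'a rep) \<Rightarrow> bool" where
  "RS_from N W \<longleftrightarrow>
     (\<exists>c :: nat list \<Rightarrow> nat. \<forall>m\<ge>N.
        rep_iso m (W m)
          (direct_sum {(\<mu>, k). is_partition \<mu> \<and> sum_list \<mu> + first_part \<mu> \<le> N \<and> k < c \<mu>}
             (\<lambda>(\<mu>, k). specht (padded \<mu> m))))"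

definition rank_RS :: "(nat \<Rightarrow> 'a rep) \<Rightarrow> enat" where
  "rank_RS W = Inf {enat N | N. RS_from N W}"

text \<open>Injectivity is required in all degrees, exhaustivity only from \<open>N\<close> on.\<close>

definition FI_RS_from ::
  "nat \<Rightarrow> (nat \<Rightarrow> 'a rep) \<Rightarrow> (nat \<Rightarrow> ('a \<Rightarrow>\<^sub>0 rat) \<Rightarrow> ('a \<Rightarrow>\<^sub>0 rat)) \<Rightarrow> bool" where
  "FI_RS_from N W \<phi> \<longleftrightarrow>
     RS_from N W \<and> (\<forall>m. inj_on (\<phi> m) (space (W m))) \<and> (\<forall>m\<ge>N. exhaustive W \<phi> m)"

definition rank_FI_RS ::
  "(nat \<Rightarrow> 'a rep) \<Rightarrow> (nat \<Rightarrow> ('a \<Rightarrow>\<^sub>0 rat) \<Rightarrow> ('a \<Rightarrow>\<^sub>0 rat)) \<Rightarrow> enat" where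
  "rank_FI_RS W \<phi> = Inf {enat N | N. FI_RS_from N W \<phi>}"


section \<open>The modules of cycles\<close>

text \<open>A cycle is the set of all rotations of a list of pairwise distinct entries.\<close>

definition cyclic_class :: "nat list \<Rightarrow> nat list set" where
  "cyclic_class xs = {rotate k xs | k. True}"

definition cycles :: "nat \<Rightarrow> nat \<Rightarrow> nat list set set" where
  "cycles l m = {cyclic_class xs | xs. length xs = l \<and> distinct xs \<and> set xs \<subseteq> {1..m}}"

definition cycle_action :: "(nat \<Rightarrow> nat) \<Rightarrow> nat list set \<Rightarrow> nat list set" where
  "cycle_action g c = map g ` c"

definition E_rep :: "nat \<Rightarrow> nat \<Rightarrow> nat list set rep" where
  "E_rep l m = perm_module (cycles l m) cycle_action"

text \<open>
  All \<open>E_rep l m\<close> live in the same ambient space, where the map induced by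
  \<open>cycles l m \<subseteq> cycles l (Suc m)\<close> is the inclusion.
\<close>

definition E_map ::
  "nat \<Rightarrow> nat \<Rightarrow> (nat list set \<Rightarrow>\<^sub>0 rat) \<Rightarrow> (nat list set \<Rightarrow>\<^sub>0 rat)" where
  "E_map l m = id"

text \<open>
  A partition is written in decreasing order, so \<open>rev \<nu>\<close> is \<open>1, \<dots>, 1, 2, \<dots>, 2, \<dots>\<close>,
  each part repeated according to its multiplicity.
\<close>

definition E_nu_rep :: "nat list \<Rightarrow> nat \<Rightarrow> nat list set list rep" where
  "E_nu_rep \<nu> m = tensor_rep (map (\<lambda>l. E_rep l m) (rev \<nu>))"

definition E_nu_map ::
  "nat list \<Rightarrow> nat \<Rightarrow> (nat list set list \<Rightarrow>\<^sub>0 rat) \<Rightarrow> (nat list set list \<Rightarrow>\<^sub>0 rat)" where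
  "E_nu_map \<nu> m = tensor_map (map (\<lambda>l. E_map l m) (rev \<nu>))"

definition E_poly :: "nat \<Rightarrow> qpoly" where
  "E_poly l =
     qscale (of_nat (totient l)) (X_var l) +
     (\<Sum>(e, d)\<in>{(e, d). e * d = l \<and> e \<noteq> 1}.
        qscale (of_nat (totient d) * of_nat d ^ e / of_nat l) (\<Prod>j<e. X_var d - of_nat j))"

end

theory Submission
  imports Defs "HOL-Combinatorics.Cycles"
begin

text \<open>
  The modules of cycles and their tensor products are permutation modules on sets in which every
  element has a support of at most \<open>n\<close> numbers, where \<open>n\<close> is \<open>l\<close> or the size of \<open>\<nu>\<close>. The locale
  \<open>fi_set\<close> describes such families of sets, and all claims on ranks and weights follow from it.

  Multiplicities. The Specht modules are shown to be simple with scalar endomorphisms and pairwise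
  not isomorphic, by James' argument: the signed column sum of a tableau maps the tabloid module of
  the same shape to a line and kills the tabloid modules of the shapes that have a row sum \<open>\<Sum>i. i \<cdot> \<mu>\<^sub>i\<close>
  that is not larger (\<open>column_strict_tabloid\<close>). By the orthogonality of characters they are all the
  simple modules, since there are as many of them as cycle types (\<open>simple_is_specht\<close>). With Maschke's
  theorem every module is a direct sum of Specht modules, with multiplicities given by inner
  products of characters (\<open>direct_sum_decomposition\<close>).

  Weights. If \<open>specht \<mu>\<close> maps nontrivially to a permutation module, then some basis element has a
  nonzero signed column sum. No two numbers outside its support can then lie in one column, so \<open>\<mu>\<close>
  has at least \<open>m - n\<close> columns (\<open>specht_hom_weight\<close>).

  Ranks. The inner product of two permutation characters is the number of orbits on the product,
  and this number is stable as soon as the degree bounds the sizes of the supports. So the inner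
  products with the characters of the tabloid modules \<open>padded \<rho> m\<close>, \<open>|\<rho>| \<le> n\<close>, are stable for \<open>m \<ge> 2n\<close>. As
  these characters are unitriangular in those of the Specht modules, the multiplicities are stable
  too, by recursion along the row sum (\<open>stable_multiplicities\<close>). Conversely an element with
  support \<open>{1..n}\<close> produces a copy of \<open>specht [n, n]\<close> in degree \<open>2n\<close>, which no smaller rank allows
  (\<open>RS_from_bound\<close>).

  Characters. A list represents a fixed cycle of \<open>g\<close> if \<open>g\<close> rotates it by some \<open>k\<close> places. For
  \<open>e = gcd k l\<close> and \<open>d = l div e\<close> its first \<open>e\<close> entries are arbitrary points in different \<open>d\<close>-cycles of
  \<open>g\<close> and determine it; there are \<open>totient d\<close> such \<open>k\<close>. This gives \<^const>\<open>E_poly\<close>. Its only term with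
  \<open>X_var l\<close> is linear, so the variables are recovered recursively inside the filtration by weight
  (\<open>bounded_span_E_poly\<close>).
\<close>

section \<open>Linear algebra on subspaces\<close>

global_interpretation qvp: vector_space_pair
  "qscale :: rat \<Rightarrow> ('a \<Rightarrow>\<^sub>0 rat) \<Rightarrow> ('a \<Rightarrow>\<^sub>0 rat)"
  "qscale :: rat \<Rightarrow> ('b \<Rightarrow>\<^sub>0 rat) \<Rightarrow> ('b \<Rightarrow>\<^sub>0 rat)"
  by unfold_locales

abbreviation qlinear :: "(('a \<Rightarrow>\<^sub>0 rat) \<Rightarrow> ('b \<Rightarrow>\<^sub>0 rat)) \<Rightarrow> bool" where
  "qlinear \<equiv> Vector_Spaces.linear qscale qscale"

lemma qlinearI:
  assumes "\<And>x y. f (x + y) = f x + f y" "\<And>c x. f (qscale c x) = qscale c (f x)"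
  shows "qlinear f"
  using assms by (auto simp: Vector_Spaces.linear_iff qvs.vector_space_axioms)

lemma qlinear_imp_linear_on: "qlinear f \<Longrightarrow> linear_on V f"
  by (simp add: linear_on_def qvp.linear_add qvp.linear_scale)

text \<open>
  A map that is linear on a subspace agrees there with a linear map of the whole space, to which
  the theory of linear maps applies.
\<close>

lemma linear_on_extend:
  assumes V: "qvs.subspace V" and f: "linear_on V f"
  obtains F where "qlinear F" "\<And>x. x \<in> V \<Longrightarrow> F x = f x"
proof -
  obtain B where B: "B \<subseteq> V" "qvs.independent B" "V \<subseteq> qvs.span B"
    using qvs.maximal_independent_subset by blast
  obtain F where F: "qlinear F" "\<forall>x\<in>B. F x = f x"
    using qvp.linear_independent_extend[OF B(2)] by blast
  have sp: "qvs.span B \<subseteq> V" by (rule qvs.span_minimal[OF B(1) V])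
  have f0: "f 0 = 0"
    using f qvs.subspace_0[OF V] unfolding linear_on_def
    by (metis add_cancel_right_right)
  have "x \<in> V \<and> F x = f x" if "x \<in> qvs.span B" for x
    using that
  proof (induction x rule: qvs.span_induct_alt)
    case base then show ?case using f0 qvp.linear_0[OF F(1)] qvs.subspace_0[OF V] by auto
  next
    case (step c x y)
    have xV: "x \<in> V" using step B by auto
    have cx: "qscale c x \<in> V" using xV by (rule qvs.subspace_scale[OF V])
    have "f (qscale c x + y) = qscale c (f x) + f y"
      using f cx step xV unfolding linear_on_def by simp
    moreover have "F (qscale c x + y) = qscale c (F x) + F y"
      by (simp add: qvp.linear_add[OF F(1)] qvp.linear_scale[OF F(1)])
    ultimately show ?case
      using step F(2) cx V by (auto intro: qvs.subspace_add)
  qed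
  then show ?thesis using that[OF F(1)] B(3) by blast
qed

lemma linear_on_zero:
  assumes "qvs.subspace V" "linear_on V f"
  shows "f 0 = 0"
proof -
  obtain F where F: "qlinear F" "\<And>x. x \<in> V \<Longrightarrow> F x = f x"
    using linear_on_extend[OF assms] by blast
  then show ?thesis using qvp.linear_0[OF F(1)] qvs.subspace_0[OF assms(1)] by simp
qed

lemma linear_on_add: "linear_on V f \<Longrightarrow> x \<in> V \<Longrightarrow> y \<in> V \<Longrightarrow> f (x + y) = f x + f y"
  by (simp add: linear_on_def)

lemma linear_on_scale: "linear_on V f \<Longrightarrow> x \<in> V \<Longrightarrow> f (qscale c x) = qscale c (f x)"
  by (simp add: linear_on_def)

lemma linear_on_sum:
  assumes "qvs.subspace V" "linear_on V f" "\<And>i. i \<in> I \<Longrightarrow> x i \<in> V"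
  shows "f (\<Sum>i\<in>I. x i) = (\<Sum>i\<in>I. f (x i))"
proof -
  obtain F where F: "qlinear F" "\<And>x. x \<in> V \<Longrightarrow> F x = f x"
    using linear_on_extend[OF assms(1,2)] by blast
  have "(\<Sum>i\<in>I. x i) \<in> V" by (rule qvs.subspace_sum[OF assms(1,3)])
  then show ?thesis using F assms(3) qvp.linear_sum[OF F(1), of x I] by simp
qed

lemma linear_on_diff:
  assumes "qvs.subspace V" "linear_on V f" "x \<in> V" "y \<in> V"
  shows "f (x - y) = f x - f y"
proof -
  obtain F where F: "qlinear F" "\<And>x. x \<in> V \<Longrightarrow> F x = f x"
    using linear_on_extend[OF assms(1,2)] by blast
  then show ?thesis using qvp.linear_diff[OF F(1), of x y] assms qvs.subspace_diff[OF assms(1,3,4)] by simp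
qed

lemma linear_on_inj_iff:
  assumes "qvs.subspace V" "linear_on V f"
  shows "inj_on f V \<longleftrightarrow> (\<forall>x\<in>V. f x = 0 \<longrightarrow> x = 0)"
proof
  assume "inj_on f V"
  then show "\<forall>x\<in>V. f x = 0 \<longrightarrow> x = 0"
    using linear_on_zero[OF assms] qvs.subspace_0[OF assms(1)] by (auto simp: inj_on_def)
next
  assume r: "\<forall>x\<in>V. f x = 0 \<longrightarrow> x = 0"
  show "inj_on f V"
  proof (rule inj_onI)
    fix x y assume "x \<in> V" "y \<in> V" "f x = f y"
    then have "x - y \<in> V" "f (x - y) = 0"
      using linear_on_diff[OF assms] qvs.subspace_diff[OF assms(1)] by auto
    then show "x = y" using r by auto
  qed
qed

lemma linear_on_subset: "linear_on V f \<Longrightarrow> U \<subseteq> V \<Longrightarrow> linear_on U f"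
  unfolding linear_on_def by blast

lemma linear_on_comp:
  "linear_on V f \<Longrightarrow> linear_on W g \<Longrightarrow> f ` V \<subseteq> W \<Longrightarrow> linear_on V (\<lambda>x. g (f x))"
  unfolding linear_on_def by (auto simp: image_subset_iff)

lemma linear_on_image_subspace:
  assumes "qvs.subspace V" "linear_on V f"
  shows "qvs.subspace (f ` V)"
proof -
  obtain F where F: "qlinear F" "\<And>x. x \<in> V \<Longrightarrow> F x = f x"
    using linear_on_extend[OF assms(1,2)] by blast
  have "f ` V = F ` V" using F by simp
  then show ?thesis using qvp.linear_subspace_image[OF F(1) assms(1)] by simp
qed

lemma linear_on_eq_on_span:
  assumes "qvs.subspace V" "linear_on V f" "linear_on V g" "B \<subseteq> V" "V \<subseteq> qvs.span B"
    "\<And>b. b \<in> B \<Longrightarrow> f b = g b" "x \<in> V"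
  shows "f x = g x"
proof -
  obtain F where F: "qlinear F" "\<And>x. x \<in> V \<Longrightarrow> F x = f x"
    using linear_on_extend[OF assms(1,2)] by blast
  obtain G where G: "qlinear G" "\<And>x. x \<in> V \<Longrightarrow> G x = g x"
    using linear_on_extend[OF assms(1,3)] by blast
  have "F x = G x"
    by (rule qvp.linear_eq_on[OF F(1) G(1), of x B]) (use assms F G in \<open>auto simp: subset_iff\<close>)
  then show ?thesis using F G assms by simp
qed

lemma lin_ext_alt:
  assumes "finite A" "Poly_Mapping.keys x \<subseteq> A"
  shows "lin_ext F x = (\<Sum>a\<in>A. qscale (Poly_Mapping.lookup x a) (F a))"
  unfolding lin_ext_def using assms
  by (intro sum.mono_neutral_left) (auto simp: in_keys_iff)

lemma qlinear_lin_ext [simp]: "qlinear (lin_ext F)"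
proof (rule qlinearI)
  fix x y :: "'a \<Rightarrow>\<^sub>0 rat" and c
  let ?A = "Poly_Mapping.keys x \<union> Poly_Mapping.keys y"
  have "lin_ext F (x + y) = (\<Sum>a\<in>?A. qscale (Poly_Mapping.lookup (x + y) a) (F a))"
    by (rule lin_ext_alt) (auto dest: set_mp[OF Poly_Mapping.keys_add])
  then show "lin_ext F (x + y) = lin_ext F x + lin_ext F y"
    by (simp add: lin_ext_alt[of ?A] lookup_add qvs.scale_left_distrib sum.distrib)
  have "lin_ext F (qscale c x) = (\<Sum>a\<in>Poly_Mapping.keys x. qscale (Poly_Mapping.lookup (qscale c x) a) (F a))"
    by (rule lin_ext_alt) (auto simp: in_keys_iff)
  then show "lin_ext F (qscale c x) = qscale c (lin_ext F x)"
    by (simp add: lin_ext_def qvs.scale_sum_right)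
qed

lemma lin_ext_bvec [simp]: "lin_ext F (bvec a) = F a"
  by (simp add: lin_ext_def)

lemma bvec_expansion:
  assumes "finite A" "Poly_Mapping.keys x \<subseteq> A"
  shows "(\<Sum>a\<in>A. qscale (Poly_Mapping.lookup x a) (bvec a)) = x"
proof (rule poly_mapping_eqI)
  fix k
  show "Poly_Mapping.lookup (\<Sum>a\<in>A. qscale (Poly_Mapping.lookup x a) (bvec a)) k = Poly_Mapping.lookup x k"
    using assms by (auto simp: lookup_sum lookup_single when_def in_keys_iff if_distrib sum.delta cong: if_cong)
qed

lemma subspace_keys [simp]: "qvs.subspace {x :: 'a \<Rightarrow>\<^sub>0 rat. Poly_Mapping.keys x \<subseteq> A}"
proof -
  have "{x :: 'a \<Rightarrow>\<^sub>0 rat. Poly_Mapping.keys x \<subseteq> A} = {x. \<forall>a. a \<notin> A \<longrightarrow> Poly_Mapping.lookup x a = 0}"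
    by (auto simp: in_keys_iff)
  then show ?thesis by (auto intro!: qvs.subspaceI simp: lookup_add)
qed

lemma span_bvec:
  assumes "finite A"
  shows "qvs.span (bvec ` A) = {x. Poly_Mapping.keys x \<subseteq> A}"
proof
  show "qvs.span (bvec ` A) \<subseteq> {x. Poly_Mapping.keys x \<subseteq> A}"
    by (rule qvs.span_minimal) auto
  show "{x. Poly_Mapping.keys x \<subseteq> A} \<subseteq> qvs.span (bvec ` A)"
  proof
    fix x :: "'a \<Rightarrow>\<^sub>0 rat" assume "x \<in> {x. Poly_Mapping.keys x \<subseteq> A}"
    then have "x = (\<Sum>a\<in>A. qscale (Poly_Mapping.lookup x a) (bvec a))"
      using bvec_expansion[OF assms] by simp
    then show "x \<in> qvs.span (bvec ` A)"
      by (metis (no_types, lifting) imageI qvs.span_base qvs.span_scale qvs.span_sum)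
  qed
qed

lemma bvec_eq_iff [simp]: "bvec a = bvec b \<longleftrightarrow> a = b"
  by (metis lookup_single_eq lookup_single_not_eq zero_neq_one)

lemma independent_bvec:
  assumes "finite A"
  shows "qvs.independent (bvec ` A)"
proof (rule qvs.independent_if_scalars_zero)
  fix f x assume s: "(\<Sum>x\<in>bvec ` A. qscale (f x) x) = 0" and "x \<in> bvec ` A"
  then obtain a where a: "a \<in> A" "x = bvec a" by blast
  have "(\<Sum>x\<in>bvec ` A. qscale (f x) x) = (\<Sum>b\<in>A. qscale (f (bvec b)) (bvec b))"
    by (subst sum.reindex) (auto simp: inj_on_def)
  then have "Poly_Mapping.lookup (\<Sum>b\<in>A. qscale (f (bvec b)) (bvec b)) a = 0" using s by simp
  then show "f x = 0"
    using a assms by (simp add: lookup_sum lookup_single when_def if_distrib sum.delta cong: if_cong)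
qed (use assms in auto)

subsection \<open>Finite bases and traces\<close>

definition basis_of :: "('a \<Rightarrow>\<^sub>0 rat) set \<Rightarrow> ('a \<Rightarrow>\<^sub>0 rat) set \<Rightarrow> bool" where
  "basis_of B V \<longleftrightarrow> finite B \<and> qvs.independent B \<and> qvs.span B = V"

lemma basis_of_bvec: "finite A \<Longrightarrow> basis_of (bvec ` A) {x. Poly_Mapping.keys x \<subseteq> A}"
  by (simp add: basis_of_def independent_bvec span_bvec)

lemma basis_of_finite:
  assumes "basis_of B V" "qvs.independent C" "C \<subseteq> V"
  shows "finite C" "card C \<le> card B"
  using qvs.independent_span_bound[of B C] assms by (auto simp: basis_of_def)

lemma basis_of_exists:
  assumes "qvs.subspace V" "finite A" "V \<subseteq> qvs.span A"
  obtains B where "basis_of B V"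
proof -
  obtain B where B: "B \<subseteq> V" "qvs.independent B" "V \<subseteq> qvs.span B"
    using qvs.maximal_independent_subset by blast
  then have "finite B" using qvs.independent_span_bound[OF assms(2) B(2)] assms(3) by blast
  with B qvs.span_minimal[OF B(1) assms(1)] show ?thesis by (intro that[of B]) (auto simp: basis_of_def)
qed

abbreviation coord :: "('a \<Rightarrow>\<^sub>0 rat) set \<Rightarrow> ('a \<Rightarrow>\<^sub>0 rat) \<Rightarrow> ('a \<Rightarrow>\<^sub>0 rat) \<Rightarrow> rat" where
  "coord \<equiv> qvs.representation"

lemma coord_add: "basis_of B V \<Longrightarrow> x \<in> V \<Longrightarrow> y \<in> V \<Longrightarrow> coord B (x + y) b = coord B x b + coord B y b"
  by (auto simp: basis_of_def qvs.representation_add)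

lemma coord_scale: "basis_of B V \<Longrightarrow> x \<in> V \<Longrightarrow> coord B (qscale c x) b = c * coord B x b"
  by (auto simp: basis_of_def qvs.representation_scale)

lemma coord_sum: "basis_of B V \<Longrightarrow> (\<And>i. i \<in> I \<Longrightarrow> x i \<in> V) \<Longrightarrow> coord B (\<Sum>i\<in>I. x i) b = (\<Sum>i\<in>I. coord B (x i) b)"
  by (auto simp: basis_of_def qvs.representation_sum)

lemma coord_basis: "basis_of B V \<Longrightarrow> a \<in> B \<Longrightarrow> coord B a b = (if b = a then 1 else 0)"
  by (auto simp: basis_of_def qvs.representation_basis)

lemma coord_expansion: "basis_of B V \<Longrightarrow> x \<in> V \<Longrightarrow> (\<Sum>b\<in>B. qscale (coord B x b) b) = x"
  by (auto simp: basis_of_def intro!: qvs.sum_representation_eq)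

lemma basis_of_subspace: "basis_of B V \<Longrightarrow> qvs.subspace V"
  by (auto simp: basis_of_def)

lemma basis_of_subset: "basis_of B V \<Longrightarrow> B \<subseteq> V"
  by (auto simp: basis_of_def intro: qvs.span_base)

text \<open>
  Expanding a vector of one basis in the other one turns both traces into the same double
  sum over the pairs of basis vectors.
\<close>

lemma trace_basis_indep:
  assumes B: "basis_of B V" and C: "basis_of C V" and f: "linear_on V f" "f ` V \<subseteq> V"
  shows "(\<Sum>b\<in>B. coord B (f b) b) = (\<Sum>c\<in>C. coord C (f c) c)"
proof -
  note V = basis_of_subspace[OF B]
  have BV: "b \<in> V" if "b \<in> B" for b using basis_of_subset[OF B] that by auto
  have CV: "c \<in> V" if "c \<in> C" for c using basis_of_subset[OF C] that by auto
  have fV: "f x \<in> V" if "x \<in> V" for x using f that by auto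
  have "coord B (f b) b = (\<Sum>c\<in>C. coord C b c * coord B (f c) b)" if "b \<in> B" for b
  proof -
    have "f b = f (\<Sum>c\<in>C. qscale (coord C b c) c)"
      using coord_expansion[OF C BV[OF that]] by simp
    also have "\<dots> = (\<Sum>c\<in>C. qscale (coord C b c) (f c))"
      using linear_on_sum[OF V f(1), of C "\<lambda>c. qscale (coord C b c) c"]
      by (simp add: CV V linear_on_scale[OF f(1)] qvs.subspace_scale)
    finally have e: "f b = (\<Sum>c\<in>C. qscale (coord C b c) (f c))" .
    show ?thesis
      by (subst e) (simp add: coord_sum[OF B] coord_scale[OF B] CV fV V qvs.subspace_scale)
  qed
  then have "(\<Sum>b\<in>B. coord B (f b) b) = (\<Sum>b\<in>B. \<Sum>c\<in>C. coord C b c * coord B (f c) b)" by simp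
  also have "\<dots> = (\<Sum>c\<in>C. \<Sum>b\<in>B. coord B (f c) b * coord C b c)"
    by (subst sum.swap) (simp add: mult.commute)
  also have "\<dots> = (\<Sum>c\<in>C. coord C (f c) c)"
  proof (rule sum.cong[OF refl])
    fix c assume c: "c \<in> C"
    have "coord C (f c) c = coord C (\<Sum>b\<in>B. qscale (coord B (f c) b) b) c"
      using coord_expansion[OF B fV[OF CV[OF c]]] by simp
    also have "\<dots> = (\<Sum>b\<in>B. coord B (f c) b * coord C b c)"
      by (simp add: coord_sum[OF C] coord_scale[OF C] BV V qvs.subspace_scale)
    finally show "(\<Sum>b\<in>B. coord B (f c) b * coord C b c) = coord C (f c) c" by simp
  qed
  finally show ?thesis .
qed

lemma trace_on_eq:
  assumes "basis_of B V" "linear_on V f" "f ` V \<subseteq> V"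
  shows "trace_on V f = (\<Sum>b\<in>B. coord B (f b) b)"
proof -
  define C where "C = (SOME B. qvs.independent B \<and> qvs.span B = V)"
  have C: "qvs.independent C \<and> qvs.span C = V"
    unfolding C_def by (rule someI[of _ B]) (use assms(1) in \<open>auto simp: basis_of_def\<close>)
  then have "basis_of C V"
    using basis_of_finite(1)[OF assms(1)] qvs.span_superset[of C] by (auto simp: basis_of_def)
  then show ?thesis
    using trace_basis_indep[OF assms(1) _ assms(2,3), of C]
    by (simp add: trace_on_def C_def[symmetric] Let_def)
qed

lemma basis_of_image:
  assumes B: "basis_of B V" and f: "linear_on V f" "inj_on f V"
  shows "basis_of (f ` B) (f ` V)"
    and "\<And>x b. x \<in> V \<Longrightarrow> b \<in> B \<Longrightarrow> coord (f ` B) (f x) (f b) = coord B x b"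
proof -
  note V = basis_of_subspace[OF B]
  obtain F where F: "qlinear F" "\<And>x. x \<in> V \<Longrightarrow> F x = f x"
    using linear_on_extend[OF V f(1)] by blast
  have BV: "B \<subseteq> V" using basis_of_subset[OF B] .
  have inj: "inj_on F (qvs.span B)"
    using B f(2) F(2) by (auto simp: basis_of_def inj_on_def)
  have im: "F ` B = f ` B" "F ` V = f ` V" using F(2) BV by (auto simp: subset_iff)
  show bas: "basis_of (f ` B) (f ` V)"
    using B qvp.linear_independent_injective_image[OF F(1) _ inj] qvp.linear_span_image[OF F(1), of B] im
    by (auto simp: basis_of_def)
  fix x b assume x: "x \<in> V" and b: "b \<in> B"
  have "f x = f (\<Sum>b\<in>B. qscale (coord B x b) b)" using coord_expansion[OF B x] by simp
  also have "\<dots> = (\<Sum>b\<in>B. qscale (coord B x b) (f b))"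
    using linear_on_sum[OF V f(1), of B "\<lambda>b. qscale (coord B x b) b"] BV
    by (simp add: subset_iff V linear_on_scale[OF f(1)] qvs.subspace_scale)
  finally have e: "f x = (\<Sum>b\<in>B. qscale (coord B x b) (f b))" .
  have "coord (f ` B) (f x) (f b) = (\<Sum>a\<in>B. coord B x a * coord (f ` B) (f a) (f b))"
    using BV by (subst e) (auto simp: coord_sum[OF bas] coord_scale[OF bas] qvs.subspace_scale
        linear_on_image_subspace[OF V f(1)] subset_iff)
  also have "\<dots> = (\<Sum>a\<in>B. if a = b then coord B x a else 0)"
    using b BV f(2) by (intro sum.cong refl) (auto simp: coord_basis[OF bas] inj_on_def subset_iff)
  also have "\<dots> = coord B x b" using b B by (simp add: basis_of_def)
  finally show "coord (f ` B) (f x) (f b) = coord B x b" .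
qed

lemma trace_on_transport:
  assumes B: "basis_of B V" and f: "linear_on V f" "bij_betw f V W"
    and a: "linear_on V a" "a ` V \<subseteq> V"
    and a': "linear_on W a'" "a' ` W \<subseteq> W"
    and eq: "\<And>x. x \<in> V \<Longrightarrow> f (a x) = a' (f x)"
  shows "trace_on V a = trace_on W a'"
proof -
  have inj: "inj_on f V" and im: "f ` V = W" using f(2) by (auto simp: bij_betw_def)
  have B': "basis_of (f ` B) W" using basis_of_image(1)[OF B f(1) inj] im by simp
  have BV: "B \<subseteq> V" using basis_of_subset[OF B] .
  have "trace_on W a' = (\<Sum>b\<in>B. coord (f ` B) (a' (f b)) (f b))"
    using inj BV by (simp add: trace_on_eq[OF B' a'] sum.reindex inj_on_subset)
  also have "\<dots> = (\<Sum>b\<in>B. coord B (a b) b)"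
  proof (rule sum.cong[OF refl])
    fix b assume b: "b \<in> B"
    then have "b \<in> V" "a b \<in> V" using BV a by auto
    then show "coord (f ` B) (a' (f b)) (f b) = coord B (a b) b"
      using basis_of_image(2)[OF B f(1) inj _ b] eq by metis
  qed
  also have "\<dots> = trace_on V a" using trace_on_eq[OF B a] by simp
  finally show ?thesis by simp
qed

lemma basis_of_direct_sum:
  assumes B: "basis_of B U" and C: "basis_of C U'" and "U \<inter> U' = {0}"
  shows "basis_of (B \<union> C) {u + u' | u u'. u \<in> U \<and> u' \<in> U'}" "B \<inter> C = {}"
proof -
  note U = basis_of_subspace[OF B] and U' = basis_of_subspace[OF C]
  have fin: "finite B" "finite C" using B C by (auto simp: basis_of_def)
  have "x \<noteq> 0" if "x \<in> B" for x
    using that B qvs.dependent_zero[of B] by (metis basis_of_def)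
  moreover have "x = 0" if "x \<in> B" "x \<in> C" for x
    using that basis_of_subset[OF B] basis_of_subset[OF C] assms(3) by (metis IntI singletonD subsetD)
  ultimately show disj: "B \<inter> C = {}" by blast
  have "qvs.independent (B \<union> C)"
  proof (rule qvs.independent_if_scalars_zero)
    fix f x assume s: "(\<Sum>x\<in>B \<union> C. qscale (f x) x) = 0" and x: "x \<in> B \<union> C"
    let ?b = "\<Sum>x\<in>B. qscale (f x) x" and ?c = "\<Sum>x\<in>C. qscale (f x) x"
    have bc: "?b + ?c = 0" using s sum.union_disjoint[OF fin disj, of "\<lambda>x. qscale (f x) x"] by simp
    have "?b \<in> U"
      by (rule qvs.subspace_sum[OF U], rule qvs.subspace_scale[OF U], rule subsetD[OF basis_of_subset[OF B]])
    moreover have c: "?c \<in> U'"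
      by (rule qvs.subspace_sum[OF U'], rule qvs.subspace_scale[OF U'], rule subsetD[OF basis_of_subset[OF C]])
    moreover have "?b = - ?c" using bc by (simp add: eq_neg_iff_add_eq_0)
    ultimately have "?b \<in> U \<inter> U'" using qvs.subspace_neg[OF U' c] by (metis IntI)
    then have b0: "?b = 0" using assms(3) by blast
    then have c0: "?c = 0" using bc by (metis add_0_left)
    have "f x = 0" if "x \<in> B"
      by (rule qvs.independentD[OF _ fin(1) order_refl b0 that]) (use B in \<open>simp add: basis_of_def\<close>)
    moreover have "f x = 0" if "x \<in> C"
      by (rule qvs.independentD[OF _ fin(2) order_refl c0 that]) (use C in \<open>simp add: basis_of_def\<close>)
    ultimately show "f x = 0" using x by blast
  qed (use fin in auto)
  then show "basis_of (B \<union> C) {u + u' | u u'. u \<in> U \<and> u' \<in> U'}"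
    using fin B C by (simp add: basis_of_def qvs.span_Un)
qed

lemma trace_on_direct_sum:
  assumes B: "basis_of B U" and C: "basis_of C U'" and 0: "U \<inter> U' = {0}"
    and V: "V = {u + u' | u u'. u \<in> U \<and> u' \<in> U'}"
    and f: "linear_on V f" "f ` U \<subseteq> U" "f ` U' \<subseteq> U'"
  shows "trace_on V f = trace_on U f + trace_on U' f"
proof -
  note U = basis_of_subspace[OF B] and U' = basis_of_subspace[OF C]
  note BC = basis_of_direct_sum[OF B C 0, folded V]
  have sub: "U \<subseteq> V" "U' \<subseteq> V"
  proof -
    show "U \<subseteq> V"
    proof
      fix u assume "u \<in> U"
      then show "u \<in> V" unfolding V using qvs.subspace_0[OF U'] by (intro CollectI exI[of _ u] exI[of _ 0]) simp
    qed
    show "U' \<subseteq> V"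
    proof
      fix u assume "u \<in> U'"
      then show "u \<in> V" unfolding V using qvs.subspace_0[OF U] by (intro CollectI exI[of _ 0] exI[of _ u]) simp
    qed
  qed
  have fV: "f ` V \<subseteq> V"
  proof (clarsimp simp: V)
    fix u u' assume u: "u \<in> U" "u' \<in> U'"
    then have "f (u + u') = f u + f u'" using sub by (intro linear_on_add[OF f(1)]) auto
    then show "\<exists>v v'. f (u + u') = v + v' \<and> v \<in> U \<and> v' \<in> U'" using u f by blast
  qed
  have fin: "finite B" "finite C" "qvs.independent (B \<union> C)" using B C BC by (auto simp: basis_of_def)
  have B1: "coord (B \<union> C) (f b) b = coord B (f b) b" if "b \<in> B" for b
    using that basis_of_subset[OF B] f(2) B
    by (subst qvs.representation_extend[OF fin(3), of _ B]) (auto simp: basis_of_def)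
  have C1: "coord (B \<union> C) (f b) b = coord C (f b) b" if "b \<in> C" for b
    using that basis_of_subset[OF C] f(3) C
    by (subst qvs.representation_extend[OF fin(3), of _ C]) (auto simp: basis_of_def)
  show ?thesis
    using fin BC(2) sub
    by (simp add: trace_on_eq[OF BC(1) f(1) fV] trace_on_eq[OF B linear_on_subset[OF f(1)] f(2)]
       trace_on_eq[OF C linear_on_subset[OF f(1)] f(3)] sum.union_disjoint B1 C1)
qed

section \<open>Modules over symmetric groups\<close>

(* keeps the simplifier from turning {1..m} into {Suc 0..m} *)
declare One_nat_def [simp del]

lemma perms_inv: "g permutes {1..m} \<Longrightarrow> inv g permutes {1..m}"
  by (rule permutes_inv)

lemma perms_comp: "g permutes {1..m} \<Longrightarrow> h permutes {1..m} \<Longrightarrow> g \<circ> h permutes {1..m::nat}"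
  by (rule permutes_compose)

lemma finite_perms [simp]: "finite {g. g permutes {1..m::nat}}"
  by (simp add: finite_permutations)

lemma card_perms: "card {g. g permutes {1..m::nat}} = fact m"
  by (rule card_permutations) auto

lemma sum_perms_inv: "(\<Sum>g | g permutes {1..m::nat}. f (inv g)) = (\<Sum>g | g permutes {1..m}. f g)"
  using sum_permutations_inverse[of f "{1..m}"] by simp

lemma sum_perms_comp_right:
  "h permutes {1..m::nat} \<Longrightarrow> (\<Sum>g | g permutes {1..m}. f (g \<circ> h)) = (\<Sum>g | g permutes {1..m}. f g)"
  using sum_permutations_compose_right[of h "{1..m}" f] by simp

lemma sum_perms_comp_left:
  "h permutes {1..m::nat} \<Longrightarrow> (\<Sum>g | g permutes {1..m}. f (h \<circ> g)) = (\<Sum>g | g permutes {1..m}. f g)"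
  using setum_permutations_compose_left[of h "{1..m}" f] by simp

lemma Sm_subspace: "Sm_module m W \<Longrightarrow> qvs.subspace (space W)"
  by (simp add: Sm_module_def)

lemma Sm_basis:
  assumes "Sm_module m W"
  obtains B where "basis_of B (space W)"
  using assms basis_of_exists[of "space W"] unfolding Sm_module_def by metis

lemma Sm_linear: "Sm_module m W \<Longrightarrow> g permutes {1..m} \<Longrightarrow> linear_on (space W) (act W g)"
  by (simp add: Sm_module_def)

lemma Sm_image: "Sm_module m W \<Longrightarrow> g permutes {1..m} \<Longrightarrow> act W g ` space W \<subseteq> space W"
  by (simp add: Sm_module_def)

lemma Sm_closed: "Sm_module m W \<Longrightarrow> g permutes {1..m} \<Longrightarrow> x \<in> space W \<Longrightarrow> act W g x \<in> space W"
  using Sm_image by blast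

lemma Sm_id: "Sm_module m W \<Longrightarrow> x \<in> space W \<Longrightarrow> act W id x = x"
  by (simp add: Sm_module_def)

lemma Sm_comp:
  "Sm_module m W \<Longrightarrow> g permutes {1..m} \<Longrightarrow> h permutes {1..m} \<Longrightarrow> x \<in> space W
   \<Longrightarrow> act W (g \<circ> h) x = act W g (act W h x)"
  by (simp add: Sm_module_def)

lemma Sm_inv:
  assumes "Sm_module m W" "g permutes {1..m}" "x \<in> space W"
  shows "act W (inv g) (act W g x) = x" "act W g (act W (inv g) x) = x"
  using Sm_comp[OF assms(1) perms_inv[OF assms(2)] assms(2,3)]
    Sm_comp[OF assms(1,2) perms_inv[OF assms(2)] assms(3)] Sm_id[OF assms(1,3)]
    permutes_inv_o[OF assms(2)] by simp_all

lemma Sm_submodule: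
  assumes W: "Sm_module m W" and U: "invariant_subspace m W U"
  shows "Sm_module m (W\<lparr>space := U\<rparr>)"
proof -
  have US: "qvs.subspace U" and UW: "U \<subseteq> space W" using U by (auto simp: invariant_subspace_def)
  have Ug: "act W g ` U \<subseteq> U" if "g permutes {1..m}" for g
    using U that by (auto simp: invariant_subspace_def)
  obtain B where "finite B" "space W \<subseteq> qvs.span B" using W by (auto simp: Sm_module_def)
  then have fd: "\<exists>B. finite B \<and> U \<subseteq> qvs.span B" using UW by blast
  show ?thesis
    unfolding Sm_module_def
  proof (intro conjI allI impI ballI)
    fix g assume g: "g permutes {1..m}"
    show "linear_on (space (W\<lparr>space := U\<rparr>)) (act (W\<lparr>space := U\<rparr>) g)"
      using linear_on_subset[OF Sm_linear[OF W g] UW] by simp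
    show "act (W\<lparr>space := U\<rparr>) g ` space (W\<lparr>space := U\<rparr>) \<subseteq> space (W\<lparr>space := U\<rparr>)"
      using Ug[OF g] by simp
  next
    fix x assume "x \<in> space (W\<lparr>space := U\<rparr>)"
    then have x: "x \<in> space W" using UW by auto
    show "act (W\<lparr>space := U\<rparr>) id x = x" using Sm_id[OF W x] by simp
    fix g h assume "g permutes {1..m}" "h permutes {1..m}"
    then show "act (W\<lparr>space := U\<rparr>) (g \<circ> h) x = act (W\<lparr>space := U\<rparr>) g (act (W\<lparr>space := U\<rparr>) h x)"
      using Sm_comp[OF W _ _ x] by simp
  qed (use US fd in simp_all)
qed

definition module_hom_on :: "nat \<Rightarrow> 'a rep \<Rightarrow> 'b rep \<Rightarrow> (('a \<Rightarrow>\<^sub>0 rat) \<Rightarrow> ('b \<Rightarrow>\<^sub>0 rat)) \<Rightarrow> bool" where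
  "module_hom_on m V W f \<longleftrightarrow>
     linear_on (space V) f \<and> f ` space V \<subseteq> space W \<and> equivariant m V W f"

lemma module_hom_onD:
  assumes "module_hom_on m V W f"
  shows "linear_on (space V) f" "\<And>x. x \<in> space V \<Longrightarrow> f x \<in> space W"
    "\<And>g x. g permutes {1..m} \<Longrightarrow> x \<in> space V \<Longrightarrow> f (act V g x) = act W g (f x)"
  using assms by (auto simp: module_hom_on_def equivariant_def)

lemma rep_iso_iff: "rep_iso m V W \<longleftrightarrow> (\<exists>f. module_hom_on m V W f \<and> bij_betw f (space V) (space W))"
  unfolding rep_iso_def module_hom_on_def by (auto simp: bij_betw_def)

lemma module_hom_on_comp:
  assumes "module_hom_on m U V f" "module_hom_on m V W g"
  shows "module_hom_on m U W (\<lambda>x. g (f x))"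
  using linear_on_comp[OF module_hom_onD(1)[OF assms(1)] module_hom_onD(1)[OF assms(2)]]
    module_hom_onD[OF assms(1)] module_hom_onD[OF assms(2)]
  unfolding module_hom_on_def equivariant_def by auto

lemma module_hom_on_inv:
  assumes V: "Sm_module m V" and W: "Sm_module m W"
    and f: "module_hom_on m V W f" "bij_betw f (space V) (space W)"
  shows "module_hom_on m W V (the_inv_into (space V) f)"
    "bij_betw (the_inv_into (space V) f) (space W) (space V)"
proof -
  let ?i = "the_inv_into (space V) f"
  have inj: "inj_on f (space V)" and im: "f ` space V = space W" using f(2) by (auto simp: bij_betw_def)
  note fD = module_hom_onD[OF f(1)]
  show bij: "bij_betw ?i (space W) (space V)" using f(2) by (rule bij_betw_the_inv_into)
  have iV: "?i y \<in> space V" and fi: "f (?i y) = y" if "y \<in> space W" for y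
    using that inj im by (auto intro: the_inv_into_into f_the_inv_into_f)
  have eqI: "?i y = x" if "x \<in> space V" "f x = y" for x y
    using that inj by (auto intro: the_inv_into_f_f)
  note VS = Sm_subspace[OF V]
  have "linear_on (space W) ?i"
    unfolding linear_on_def
  proof (intro conjI ballI allI)
    fix x y assume "x \<in> space W" "y \<in> space W"
    then show "?i (x + y) = ?i x + ?i y"
      using iV fi by (intro eqI qvs.subspace_add[OF VS]) (auto simp: linear_on_add[OF fD(1)])
  next
    fix c x assume "x \<in> space W"
    then show "?i (qscale c x) = qscale c (?i x)"
      using iV fi by (intro eqI qvs.subspace_scale[OF VS]) (auto simp: linear_on_scale[OF fD(1)])
  qed
  moreover have "?i (act W g x) = act V g (?i x)" if "g permutes {1..m}" "x \<in> space W" for g x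
    using that iV fi by (intro eqI Sm_closed[OF V]) (auto simp: fD(3))
  ultimately show "module_hom_on m W V ?i"
    using iV by (auto simp: module_hom_on_def equivariant_def)
qed

lemma rep_iso_sym: "Sm_module m V \<Longrightarrow> Sm_module m W \<Longrightarrow> rep_iso m V W \<Longrightarrow> rep_iso m W V"
  unfolding rep_iso_iff using module_hom_on_inv by blast

lemma module_hom_on_kernel:
  assumes V: "Sm_module m V" and W: "Sm_module m W" and f: "module_hom_on m V W f"
  shows "invariant_subspace m V {x \<in> space V. f x = 0}"
proof -
  note fD = module_hom_onD[OF f] and VS = Sm_subspace[OF V]
  have "act W g 0 = 0" if "g permutes {1..m}" for g
    using linear_on_zero[OF Sm_subspace[OF W] Sm_linear[OF W that]] .
  moreover have "qvs.subspace {x \<in> space V. f x = 0}"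
    using linear_on_zero[OF VS fD(1)]
    by (intro qvs.subspaceI) (auto simp: linear_on_add[OF fD(1)] linear_on_scale[OF fD(1)]
        qvs.subspace_0[OF VS] qvs.subspace_add[OF VS] qvs.subspace_scale[OF VS])
  ultimately show ?thesis
    using fD(3) Sm_closed[OF V] by (auto simp: invariant_subspace_def)
qed

lemma module_hom_on_image:
  assumes V: "Sm_module m V" and f: "module_hom_on m V W f"
  shows "invariant_subspace m W (f ` space V)"
proof -
  note fD = module_hom_onD[OF f]
  have "act W g (f x) \<in> f ` space V" if "g permutes {1..m}" "x \<in> space V" for g x
    using fD(3)[OF that] Sm_closed[OF V that] by (metis imageI)
  then show ?thesis
    using linear_on_image_subspace[OF Sm_subspace[OF V] fD(1)] fD(2)
    by (auto simp: invariant_subspace_def)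
qed

definition simple_module :: "nat \<Rightarrow> 'a rep \<Rightarrow> bool" where
  "simple_module m V \<longleftrightarrow> Sm_module m V \<and> space V \<noteq> {0} \<and>
     (\<forall>U. invariant_subspace m V U \<longrightarrow> U = {0} \<or> U = space V)"

lemma simple_hom_inj:
  assumes V: "simple_module m V" and W: "Sm_module m W" and f: "module_hom_on m V W f"
    and ne: "x \<in> space V" "f x \<noteq> 0"
  shows "inj_on f (space V)"
proof -
  have V': "Sm_module m V" using V by (simp add: simple_module_def)
  have "{x \<in> space V. f x = 0} = {0}"
    using V module_hom_on_kernel[OF V' W f] ne by (auto simp: simple_module_def)
  then show ?thesis
    unfolding linear_on_inj_iff[OF Sm_subspace[OF V'] module_hom_onD(1)[OF f]] by blast
qed

lemma schur:
  assumes V: "simple_module m V" and W: "simple_module m W" and f: "module_hom_on m V W f"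
    and ne: "x \<in> space V" "f x \<noteq> 0"
  shows "bij_betw f (space V) (space W)"
proof -
  have V': "Sm_module m V" and W': "Sm_module m W" using V W by (auto simp: simple_module_def)
  have "f ` space V \<noteq> {0}" using ne by auto
  then have "f ` space V = space W"
    using W module_hom_on_image[OF V' f] by (auto simp: simple_module_def)
  then show ?thesis using simple_hom_inj[OF V W' f ne] by (simp add: bij_betw_def)
qed

subsection \<open>Characters\<close>

lemma character_eq:
  assumes "Sm_module m W" "basis_of B (space W)" "g permutes {1..m}"
  shows "character W g = (\<Sum>b\<in>B. coord B (act W g b) b)"
  unfolding character_def by (rule trace_on_eq[OF assms(2) Sm_linear Sm_image]) (use assms in auto)

lemma character_rep_iso:
  assumes V: "Sm_module m V" and W: "Sm_module m W" and "rep_iso m V W" and g: "g permutes {1..m}"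
  shows "character V g = character W g"
proof -
  obtain f where f: "module_hom_on m V W f" "bij_betw f (space V) (space W)"
    using assms(3) by (auto simp: rep_iso_iff)
  obtain B where B: "basis_of B (space V)" using Sm_basis[OF V] .
  show ?thesis unfolding character_def
    by (rule trace_on_transport[OF B module_hom_onD(1)[OF f(1)] f(2) Sm_linear[OF V g] Sm_image[OF V g]
          Sm_linear[OF W g] Sm_image[OF W g] module_hom_onD(3)[OF f(1) g]])
qed

lemma character_conj:
  assumes V: "Sm_module m V" and g: "g permutes {1..m}" and h: "h permutes {1..m}"
  shows "character V (h \<circ> g \<circ> inv h) = character V g"
proof -
  obtain B where B: "basis_of B (space V)" using Sm_basis[OF V] .
  have g': "h \<circ> g \<circ> inv h permutes {1..m}" by (intro permutes_compose perms_inv g h)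
  have bij: "bij_betw (act V h) (space V) (space V)"
    by (rule bij_betw_byWitness[of _ "act V (inv h)"])
      (use Sm_inv[OF V h] Sm_image[OF V h] Sm_image[OF V perms_inv[OF h]] in auto)
  have "act V h (act V g x) = act V (h \<circ> g \<circ> inv h) (act V h x)" if "x \<in> space V" for x
    using that g h Sm_comp[OF V, of "h \<circ> g" "inv h"] Sm_comp[OF V, of h g] Sm_inv[OF V h] Sm_closed[OF V]
    by (simp add: perms_comp perms_inv)
  then show ?thesis unfolding character_def
    by (rule trace_on_transport[OF B Sm_linear[OF V h] bij Sm_linear[OF V g] Sm_image[OF V g]
          Sm_linear[OF V g'] Sm_image[OF V g'], symmetric])
qed

lemma character_id:
  assumes "Sm_module m W" "basis_of B (space W)"
  shows "character W id = of_nat (card B)"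
proof -
  have "character W id = (\<Sum>b\<in>B. coord B (act W id b) b)"
    by (rule character_eq[OF assms]) (simp add: permutes_id)
  also have "\<dots> = (\<Sum>b\<in>B. 1)"
    using basis_of_subset[OF assms(2)]
    by (intro sum.cong refl) (auto simp: Sm_id[OF assms(1)] coord_basis[OF assms(2)])
  finally show ?thesis by simp
qed

lemma character_direct_sum:
  assumes W: "Sm_module m W" and U: "invariant_subspace m W U" and U': "invariant_subspace m W U'"
    and 0: "U \<inter> U' = {0}" and sum: "{u + u' | u u'. u \<in> U \<and> u' \<in> U'} = space W"
    and g: "g permutes {1..m}"
  shows "character W g = character (W\<lparr>space := U\<rparr>) g + character (W\<lparr>space := U'\<rparr>) g"
proof -
  obtain B where B: "basis_of B U" using Sm_basis[OF Sm_submodule[OF W U]] by auto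
  obtain C where C: "basis_of C U'" using Sm_basis[OF Sm_submodule[OF W U']] by auto
  show ?thesis unfolding character_def
    using trace_on_direct_sum[OF B C 0 sum[symmetric] Sm_linear[OF W g]] U U' g
    by (simp add: invariant_subspace_def)
qed

text \<open>
  The inner product of class functions; the inverse takes the place of complex conjugation.
\<close>

definition char_inner :: "nat \<Rightarrow> ((nat \<Rightarrow> nat) \<Rightarrow> rat) \<Rightarrow> ((nat \<Rightarrow> nat) \<Rightarrow> rat) \<Rightarrow> rat" where
  "char_inner m \<phi> \<psi> = (\<Sum>g | g permutes {1..m}. \<phi> g * \<psi> (inv g)) / fact m"

lemma char_inner_commute: "char_inner m \<phi> \<psi> = char_inner m \<psi> \<phi>"
proof -
  have "(\<Sum>g | g permutes {1..m}. \<phi> g * \<psi> (inv g)) = (\<Sum>g | g permutes {1..m}. \<phi> (inv g) * \<psi> (inv (inv g)))"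
    by (rule sum_perms_inv[symmetric])
  also have "\<dots> = (\<Sum>g | g permutes {1..m}. \<psi> g * \<phi> (inv g))"
    by (intro sum.cong refl) (simp add: permutes_inv_inv)
  finally show ?thesis by (simp add: char_inner_def)
qed

lemma char_inner_cong:
  assumes "\<And>g. g permutes {1..m} \<Longrightarrow> \<phi> g = \<phi>' g" "\<And>g. g permutes {1..m} \<Longrightarrow> \<psi> g = \<psi>' g"
  shows "char_inner m \<phi> \<psi> = char_inner m \<phi>' \<psi>'"
  using assms perms_inv unfolding char_inner_def by (metis (mono_tags, lifting) mem_Collect_eq sum.cong)

lemma char_inner_add: "char_inner m (\<lambda>g. \<phi> g + \<phi>' g) \<psi> = char_inner m \<phi> \<psi> + char_inner m \<phi>' \<psi>"
  by (simp add: char_inner_def sum.distrib algebra_simps add_divide_distrib)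

lemma char_inner_scale: "char_inner m (\<lambda>g. c * \<phi> g) \<psi> = c * char_inner m \<phi> \<psi>"
  by (simp add: char_inner_def sum_distrib_left algebra_simps)

lemma char_inner_sum: "char_inner m (\<lambda>g. \<Sum>i\<in>I. \<phi> i g) \<psi> = (\<Sum>i\<in>I. char_inner m (\<phi> i) \<psi>)"
  unfolding char_inner_def
  by (simp add: sum_distrib_right sum_divide_distrib[symmetric]) (subst sum.swap, rule refl)

text \<open>
  The average over the group of the rank one map \<open>x \<mapsto> coord B x b \<cdot> c\<close>. It is a homomorphism, and
  its matrix coefficients are the sums in the orthogonality relations.
\<close>

definition averaged_map where
  "averaged_map m V W B b c x =
     (\<Sum>g | g permutes {1..m}. act W (inv g) (qscale (coord B (act V g x) b) c))"

lemma averaged_map_hom: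
  assumes V: "Sm_module m V" and W: "Sm_module m W" and B: "basis_of B (space V)" and c: "c \<in> space W"
  shows "module_hom_on m V W (averaged_map m V W B b c)"
proof -
  let ?F = "averaged_map m V W B b c"
  note WS = Sm_subspace[OF W]
  have sc: "qscale k c \<in> space W" for k using qvs.subspace_scale[OF WS c] .
  have "linear_on (space V) ?F"
    unfolding linear_on_def
  proof (intro conjI ballI allI)
    fix x y assume x: "x \<in> space V" "y \<in> space V"
    have "act W (inv g) (qscale (coord B (act V g (x + y)) b) c) =
       act W (inv g) (qscale (coord B (act V g x) b) c) + act W (inv g) (qscale (coord B (act V g y) b) c)"
      if g: "g permutes {1..m}" for g
      using x g by (simp add: linear_on_add[OF Sm_linear[OF V g]] coord_add[OF B] Sm_closed[OF V g]
          qvs.scale_left_distrib linear_on_add[OF Sm_linear[OF W perms_inv[OF g]]] sc)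
    then show "?F (x + y) = ?F x + ?F y"
      by (simp add: averaged_map_def sum.distrib)
  next
    fix k x assume x: "x \<in> space V"
    have "act W (inv g) (qscale (coord B (act V g (qscale k x)) b) c) =
       qscale k (act W (inv g) (qscale (coord B (act V g x) b) c))"
      if g: "g permutes {1..m}" for g
    proof -
      have "act W (inv g) (qscale (coord B (act V g (qscale k x)) b) c) = 
        act W (inv g) (qscale k (qscale (coord B (act V g x) b) c))"
        using x g by (simp add: linear_on_scale[OF Sm_linear[OF V g]] coord_scale[OF B] Sm_closed[OF V g])
      then show ?thesis using linear_on_scale[OF Sm_linear[OF W perms_inv[OF g]] sc] by simp
    qed
    then show "?F (qscale k x) = qscale k (?F x)"
      by (simp add: averaged_map_def qvs.scale_sum_right)
  qed
  moreover have "?F x \<in> space W" for x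
    unfolding averaged_map_def
    by (intro qvs.subspace_sum[OF WS] Sm_closed[OF W] sc perms_inv) simp
  moreover have "?F (act V h x) = act W h (?F x)" if h: "h permutes {1..m}" and x: "x \<in> space V" for h x
  proof -
    let ?f = "\<lambda>g. act W (inv (g \<circ> inv h)) (qscale (coord B (act V g x) b) c)"
    have "?F (act V h x) = (\<Sum>g | g permutes {1..m}. ?f (g \<circ> h))"
      unfolding averaged_map_def
    proof (intro sum.cong refl)
      fix g assume "g \<in> {g. g permutes {1..m}}"
      then have g: "g permutes {1..m}" by simp
      have "g \<circ> h \<circ> inv h = g" using permutes_inv_o(1)[OF h] by (simp add: comp_assoc)
      then show "act W (inv g) (qscale (coord B (act V g (act V h x)) b) c) = ?f (g \<circ> h)"
        using Sm_comp[OF V g h x] by simp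
    qed
    also have "\<dots> = (\<Sum>g | g permutes {1..m}. ?f g)" by (rule sum_perms_comp_right[OF h])
    also have "\<dots> = (\<Sum>g | g permutes {1..m}. act W h (act W (inv g) (qscale (coord B (act V g x) b) c)))"
    proof (intro sum.cong refl)
      fix g assume "g \<in> {g. g permutes {1..m}}"
      then have g: "g permutes {1..m}" by simp
      have "inv (g \<circ> inv h) = h \<circ> inv g"
        using permutes_bij[OF g] permutes_bij[OF perms_inv[OF h]] h
        by (subst o_inv_distrib) (auto simp: permutes_inv_inv)
      then show "?f g = act W h (act W (inv g) (qscale (coord B (act V g x) b) c))"
        using Sm_comp[OF W h perms_inv[OF g] sc] by simp
    qed
    also have "\<dots> = act W h (?F x)"
      unfolding averaged_map_def
      by (rule linear_on_sum[OF WS Sm_linear[OF W h], symmetric]) (auto intro: Sm_closed[OF W] sc perms_inv)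
    finally show ?thesis .
  qed
  ultimately show ?thesis by (auto simp: module_hom_on_def equivariant_def)
qed

lemma averaged_map_coord:
  assumes V: "Sm_module m V" and W: "Sm_module m W" and B: "basis_of B (space V)"
    and C: "basis_of C (space W)" and c: "c \<in> space W"
  shows "coord C (averaged_map m V W B b c x) c' =
    (\<Sum>g | g permutes {1..m}. coord B (act V g x) b * coord C (act W (inv g) c) c')"
proof -
  note WS = Sm_subspace[OF W]
  have sc: "qscale k c \<in> space W" for k using qvs.subspace_scale[OF WS c] .
  have "coord C (averaged_map m V W B b c x) c' =
    (\<Sum>g | g permutes {1..m}. coord C (act W (inv g) (qscale (coord B (act V g x) b) c)) c')"
    unfolding averaged_map_def by (rule coord_sum[OF C]) (auto intro: Sm_closed[OF W] sc perms_inv)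
  also have "\<dots> = (\<Sum>g | g permutes {1..m}. coord B (act V g x) b * coord C (act W (inv g) c) c')"
    by (intro sum.cong refl)
      (auto simp: linear_on_scale[OF Sm_linear[OF W perms_inv] c] coord_scale[OF C] Sm_closed[OF W perms_inv c])
  finally show ?thesis .
qed

lemma char_inner_averaged:
  assumes V: "Sm_module m V" and W: "Sm_module m W" and B: "basis_of B (space V)"
    and C: "basis_of C (space W)"
  shows "char_inner m (character V) (character W) =
    (\<Sum>b\<in>B. \<Sum>c\<in>C. coord C (averaged_map m V W B b c b) c) / fact m"
proof -
  have "(\<Sum>g | g permutes {1..m}. character V g * character W (inv g)) =
     (\<Sum>g | g permutes {1..m}. \<Sum>b\<in>B. \<Sum>c\<in>C. coord B (act V g b) b * coord C (act W (inv g) c) c)"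
    by (intro sum.cong refl) (simp add: character_eq[OF V B] character_eq[OF W C] perms_inv sum_product)
  also have "\<dots> = (\<Sum>b\<in>B. \<Sum>c\<in>C. \<Sum>g | g permutes {1..m}. coord B (act V g b) b * coord C (act W (inv g) c) c)"
    by (subst sum.swap) (intro sum.cong refl sum.swap)
  also have "\<dots> = (\<Sum>b\<in>B. \<Sum>c\<in>C. coord C (averaged_map m V W B b c b) c)"
  proof (intro sum.cong refl)
    fix b c assume "c \<in> C"
    then have c: "c \<in> space W" using basis_of_subset[OF C] by auto
    show "(\<Sum>g | g permutes {1..m}. coord B (act V g b) b * coord C (act W (inv g) c) c) =
       coord C (averaged_map m V W B b c b) c"
      by (rule averaged_map_coord[OF V W B C c, symmetric])
  qed
  finally show ?thesis by (simp add: char_inner_def)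
qed

text \<open>
  The orthogonality relations. The inner product is a sum of matrix coefficients of averaged maps,
  which are homomorphisms. Between modules without nonzero homomorphisms they vanish; if all
  endomorphisms are scalars, then the scalar of an averaged map is determined by its trace.
\<close>

lemma char_inner_no_hom:
  assumes V: "Sm_module m V" and W: "Sm_module m W"
    and no: "\<And>f x. module_hom_on m V W f \<Longrightarrow> x \<in> space V \<Longrightarrow> f x = 0"
  shows "char_inner m (character V) (character W) = 0"
proof -
  obtain B where B: "basis_of B (space V)" using Sm_basis[OF V] .
  obtain C where C: "basis_of C (space W)" using Sm_basis[OF W] .
  have "averaged_map m V W B b c b = 0" if "b \<in> B" "c \<in> C" for b c
    using that basis_of_subset[OF B] basis_of_subset[OF C] by (intro no averaged_map_hom[OF V W B]) auto
  then show ?thesis by (simp add: char_inner_averaged[OF V W B C] qvs.representation_zero)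
qed

lemma char_inner_scalar_end:
  assumes V: "Sm_module m V" and ne: "space V \<noteq> {0}"
    and sc: "\<And>f. module_hom_on m V V f \<Longrightarrow> \<exists>k. \<forall>x\<in>space V. f x = qscale k x"
  shows "char_inner m (character V) (character V) = 1"
proof -
  note VS = Sm_subspace[OF V]
  obtain B where B: "basis_of B (space V)" using Sm_basis[OF V] .
  have BV: "b \<in> space V" if "b \<in> B" for b using that basis_of_subset[OF B] by auto
  have fin: "finite B" using B by (simp add: basis_of_def)
  have "B \<noteq> {}"
  proof
    assume "B = {}"
    then show False using B ne qvs.span_empty by (metis basis_of_def)
  qed
  then have card: "card B > 0" using fin by (simp add: card_gt_0_iff)
  have "\<exists>k. \<forall>x\<in>space V. averaged_map m V V B b c x = qscale k x" if "c \<in> B" for b c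
    using sc averaged_map_hom[OF V V B BV[OF that]] by blast
  then have kex: "\<forall>b. \<forall>c\<in>B. \<exists>k. \<forall>x\<in>space V. averaged_map m V V B b c x = qscale k x" by blast
  define k where "k b c = (SOME k. \<forall>x\<in>space V. averaged_map m V V B b c x = qscale k x)" for b c
  have k: "averaged_map m V V B b c x = qscale (k b c) x" if "c \<in> B" "x \<in> space V" for b c x
  proof -
    have "\<forall>x\<in>space V. averaged_map m V V B b c x = qscale (k b c) x"
      unfolding k_def by (rule someI_ex) (use kex that(1) in blast)
    then show ?thesis using that(2) by blast
  qed
  have "of_nat (card B) * k b b = fact m" if b: "b \<in> B" for b
  proof -
    have "(\<Sum>b'\<in>B. coord B (averaged_map m V V B b b b') b') = (\<Sum>b'\<in>B. k b b)"
      using b BV by (intro sum.cong refl) (simp add: k coord_scale[OF B] coord_basis[OF B])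
    moreover have "(\<Sum>b'\<in>B. coord B (averaged_map m V V B b b b') b') =
       (\<Sum>b'\<in>B. \<Sum>g | g permutes {1..m}. coord B (act V g b') b * coord B (act V (inv g) b) b')"
      using b BV by (simp add: averaged_map_coord[OF V V B B])
    also have "\<dots> = (\<Sum>g | g permutes {1..m}. \<Sum>b'\<in>B. coord B (act V g b') b * coord B (act V (inv g) b) b')"
      by (rule sum.swap)
    also have "\<dots> = (\<Sum>g | g permutes {1..m}. 1)"
    proof (intro sum.cong refl)
      fix g assume "g \<in> {g. g permutes {1..m}}"
      then have g: "g permutes {1..m}" by simp
      let ?y = "act V (inv g) b"
      have y: "?y \<in> space V" using Sm_closed[OF V perms_inv[OF g] BV[OF b]] .
      have "1 = coord B (act V g ?y) b"
        using Sm_inv(2)[OF V g BV[OF b]] b by (simp add: coord_basis[OF B])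
      also have "\<dots> = coord B (act V g (\<Sum>b'\<in>B. qscale (coord B ?y b') b')) b"
        using coord_expansion[OF B y] by simp
      also have "\<dots> = coord B (\<Sum>b'\<in>B. qscale (coord B ?y b') (act V g b')) b"
        using linear_on_sum[OF VS Sm_linear[OF V g], of B "\<lambda>b'. qscale (coord B ?y b') b'"] BV
        by (simp add: qvs.subspace_scale[OF VS] linear_on_scale[OF Sm_linear[OF V g]])
      also have "\<dots> = (\<Sum>b'\<in>B. coord B ?y b' * coord B (act V g b') b)"
        using BV by (simp add: coord_sum[OF B] coord_scale[OF B] Sm_closed[OF V g] qvs.subspace_scale[OF VS])
      finally show "(\<Sum>b'\<in>B. coord B (act V g b') b * coord B (act V (inv g) b) b') = 1"
        by (simp add: mult.commute)
    qed
    finally show ?thesis using fin by (simp add: card_perms)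
  qed
  then have kbb: "k b b = fact m / of_nat (card B)" if "b \<in> B" for b
    using that card by (simp add: field_simps)
  have "(\<Sum>b\<in>B. \<Sum>c\<in>B. coord B (averaged_map m V V B b c b) c) = (\<Sum>b\<in>B. \<Sum>c\<in>B. if c = b then k b b else 0)"
    using BV by (intro sum.cong refl) (auto simp: k coord_scale[OF B] coord_basis[OF B])
  also have "\<dots> = (\<Sum>b\<in>B. k b b)" using fin by simp
  also have "\<dots> = fact m" using card by (simp add: kbb)
  finally show ?thesis by (simp add: char_inner_averaged[OF V V B B])
qed

subsection \<open>Complete reducibility\<close>

text \<open>Maschke: averaging any linear projection onto \<open>U\<close> over the group makes it equivariant.\<close>

lemma invariant_complement:
  assumes W: "Sm_module m W" and U: "invariant_subspace m W U"
  obtains U' where "invariant_subspace m W U'" "U \<inter> U' = {0}"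
    "{u + u' | u u'. u \<in> U \<and> u' \<in> U'} = space W"
proof -
  note WS = Sm_subspace[OF W]
  have US: "qvs.subspace U" and UW: "U \<subseteq> space W" using U by (auto simp: invariant_subspace_def)
  have Ug: "act W g u \<in> U" if "g permutes {1..m}" "u \<in> U" for g u
    using U that by (auto simp: invariant_subspace_def)
  have "inj_on (\<lambda>x. x) U" "qlinear (\<lambda>x :: 'a \<Rightarrow>\<^sub>0 rat. x)" by (auto intro: qlinearI)
  then obtain p where p: "range p \<subseteq> U" "qlinear p" "\<forall>u\<in>U. p u = u"
    using qvp.linear_exists_left_inverse_on[of "\<lambda>x. x" U] US by metis
  have pU: "p x \<in> U" and pW: "p x \<in> space W" for x using p(1) UW by auto
  define P where "P x = qscale (1 / fact m) (\<Sum>g | g permutes {1..m}. act W g (p (act W (inv g) x)))" for x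
  have PU: "P x \<in> U" for x
    unfolding P_def using Ug pU by (intro qvs.subspace_scale[OF US] qvs.subspace_sum[OF US]) auto
  have Pu: "P u = u" if u: "u \<in> U" for u
  proof -
    have "act W g (p (act W (inv g) u)) = u" if "g permutes {1..m}" for g
      using p(3) Ug[OF perms_inv[OF that] u] Sm_inv(2)[OF W that] u UW by auto
    then have "P u = qscale (1 / fact m) (\<Sum>g | g permutes {1..m}. u)" by (simp add: P_def)
    also have "(\<Sum>g | g permutes {1..m}. u) = qscale (fact m) u"
      by (simp add: qvs.sum_constant_scale card_perms del: sum_constant)
    finally show ?thesis by simp
  qed
  have lin: "linear_on (space W) P"
  proof -
    have t: "linear_on (space W) (\<lambda>x. act W g (p (act W (inv g) x)))" if "g permutes {1..m}" for g
      using pW by (intro linear_on_comp[OF linear_on_comp[OF Sm_linear[OF W perms_inv[OF that]]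
              qlinear_imp_linear_on[OF p(2)] subset_UNIV] Sm_linear[OF W that]]) auto
    show ?thesis unfolding linear_on_def
    proof (intro conjI ballI allI)
      fix x y assume "x \<in> space W" "y \<in> space W"
      then show "P (x + y) = P x + P y"
        by (simp add: P_def linear_on_add[OF t] sum.distrib qvs.scale_right_distrib)
    next
      fix c x assume "x \<in> space W"
      then have "(\<Sum>g | g permutes {1..m}. act W g (p (act W (inv g) (qscale c x)))) =
         qscale c (\<Sum>g | g permutes {1..m}. act W g (p (act W (inv g) x)))"
        by (simp add: linear_on_scale[OF t] qvs.scale_sum_right)
      then show "P (qscale c x) = qscale c (P x)"
        by (simp add: P_def mult.commute)
    qed
  qed
  have eq: "P (act W h x) = act W h (P x)" if h: "h permutes {1..m}" and x: "x \<in> space W" for h x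
  proof -
    let ?f = "\<lambda>g. act W g (p (act W (inv g) (act W h x)))"
    have "(\<Sum>g | g permutes {1..m}. ?f g) = (\<Sum>g | g permutes {1..m}. ?f (h \<circ> g))"
      by (rule sum_perms_comp_left[OF h, symmetric])
    also have "\<dots> = (\<Sum>g | g permutes {1..m}. act W h (act W g (p (act W (inv g) x))))"
    proof (intro sum.cong refl)
      fix g assume "g \<in> {g. g permutes {1..m}}"
      then have g: "g permutes {1..m}" by simp
      have "inv (h \<circ> g) = inv g \<circ> inv h"
        using permutes_bij[OF g] permutes_bij[OF h] by (simp add: o_inv_distrib)
      then have "act W (inv (h \<circ> g)) (act W h x) = act W (inv g) x"
        using Sm_comp[OF W perms_inv[OF g] perms_inv[OF h] Sm_closed[OF W h x]] Sm_inv[OF W h x] by simp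
      then show "?f (h \<circ> g) = act W h (act W g (p (act W (inv g) x)))"
        using Sm_comp[OF W h g pW] by simp
    qed
    also have "\<dots> = act W h (\<Sum>g | g permutes {1..m}. act W g (p (act W (inv g) x)))"
      by (rule linear_on_sum[OF WS Sm_linear[OF W h], symmetric]) (auto intro: Sm_closed[OF W] pW)
    finally have e: "(\<Sum>g | g permutes {1..m}. ?f g) = act W h (\<Sum>g | g permutes {1..m}. act W g (p (act W (inv g) x)))" .
    have "(\<Sum>g | g permutes {1..m}. act W g (p (act W (inv g) x))) \<in> space W"
      by (rule qvs.subspace_sum[OF WS]) (simp add: Sm_closed[OF W] pW)
    then show ?thesis
      unfolding P_def e by (rule linear_on_scale[OF Sm_linear[OF W h], symmetric])
  qed
  let ?U' = "{x \<in> space W. P x = 0}"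
  have "module_hom_on m W W P"
    using lin eq PU UW by (auto simp: module_hom_on_def equivariant_def)
  then have "invariant_subspace m W ?U'" by (rule module_hom_on_kernel[OF W W])
  moreover have "U \<inter> ?U' = {0}"
  proof
    show "U \<inter> ?U' \<subseteq> {0}" using Pu by force
    show "{0} \<subseteq> U \<inter> ?U'" using qvs.subspace_0[OF US] qvs.subspace_0[OF WS] linear_on_zero[OF WS lin] by simp
  qed
  moreover have "{u + u' | u u'. u \<in> U \<and> u' \<in> ?U'} = space W"
  proof
    show "{u + u' | u u'. u \<in> U \<and> u' \<in> ?U'} \<subseteq> space W" using UW qvs.subspace_add[OF WS] by blast
    show "space W \<subseteq> {u + u' | u u'. u \<in> U \<and> u' \<in> ?U'}"
    proof
      fix x assume x: "x \<in> space W"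
      have PW: "P x \<in> space W" using PU UW by auto
      have "P (x - P x) = 0" using linear_on_diff[OF WS lin x PW] Pu[OF PU] by simp
      then have "x - P x \<in> ?U'" using qvs.subspace_diff[OF WS x PW] by simp
      moreover have "x = P x + (x - P x)" by simp
      ultimately show "x \<in> {u + u' | u u'. u \<in> U \<and> u' \<in> ?U'}" using PU by blast
    qed
  qed
  ultimately show ?thesis by (rule that)
qed

lemma card_basis_mono:
  assumes "basis_of B U" "basis_of C V" "U \<subseteq> V" "U \<noteq> V"
  shows "card B < card C"
proof -
  have fin: "finite B" "finite C" using assms by (auto simp: basis_of_def)
  obtain v where v: "v \<in> V" "v \<notin> U" using assms by blast
  have B: "qvs.independent B" "qvs.span B = U" using assms(1) by (auto simp: basis_of_def)
  have "qvs.independent (insert v B)" using B v qvs.independent_insertI[of v B] by simp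
  moreover have "insert v B \<subseteq> V" using v basis_of_subset[OF assms(1)] assms(3) by auto
  ultimately have "card (insert v B) \<le> card C" by (rule basis_of_finite(2)[OF assms(2)])
  moreover have "v \<notin> B" using v basis_of_subset[OF assms(1)] by auto
  ultimately show ?thesis using fin by simp
qed

text \<open>
  A nonzero invariant subspace of least dimension is simple.
\<close>

lemma exists_simple_submodule:
  assumes W: "Sm_module m W" and ne: "space W \<noteq> {0}"
  obtains U where "invariant_subspace m W U" "simple_module m (W\<lparr>space := U\<rparr>)"
proof -
  let ?Q = "\<lambda>U n. invariant_subspace m W U \<and> U \<noteq> {0} \<and> (\<exists>B. basis_of B U \<and> card B = n)"
  have inv: "invariant_subspace m W (space W)"
    using W by (simp add: invariant_subspace_def Sm_module_def)
  obtain B where "basis_of B (space W)" using Sm_basis[OF W] .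
  then have ex: "\<exists>n U. ?Q U n" using inv ne by blast
  define n where "n = (LEAST n. \<exists>U. ?Q U n)"
  have "\<exists>U. ?Q U n" unfolding n_def by (rule LeastI_ex[OF ex])
  then obtain U B where U: "invariant_subspace m W U" "U \<noteq> {0}" "basis_of B U" "card B = n" by blast
  have "V = {0} \<or> V = U" if V: "invariant_subspace m (W\<lparr>space := U\<rparr>) V" for V
  proof (rule ccontr)
    assume c: "\<not> (V = {0} \<or> V = U)"
    have V': "invariant_subspace m W V" and VU: "V \<subseteq> U" using V U by (auto simp: invariant_subspace_def)
    obtain C where C: "basis_of C V" using Sm_basis[OF Sm_submodule[OF W V']] by auto
    have "card C < n" using card_basis_mono[OF C U(3) VU] c U(4) by simp
    moreover have "?Q V (card C)" using V' c C by blast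
    ultimately show False using not_less_Least[of "card C" "\<lambda>n. \<exists>U. ?Q U n"] unfolding n_def by blast
  qed
  then show ?thesis using U that Sm_submodule[OF W U(1)] by (simp add: simple_module_def)
qed

text \<open>
  The submodules of a module can be built up by adding simple modules: split off a simple submodule
  and continue with a complement.
\<close>

lemma submodule_induct [consumes 2, case_names zero step]:
  assumes W: "Sm_module m W" and U: "invariant_subspace m W U"
    and zero: "P {0}"
    and step: "\<And>V S V'. invariant_subspace m W V \<Longrightarrow> invariant_subspace m W S \<Longrightarrow> invariant_subspace m W V' \<Longrightarrow>
       simple_module m (W\<lparr>space := S\<rparr>) \<Longrightarrow> S \<inter> V' = {0} \<Longrightarrow>
       {u + u' | u u'. u \<in> S \<and> u' \<in> V'} = V \<Longrightarrow> P V' \<Longrightarrow> P V"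
  shows "P U"
proof -
  obtain B where "basis_of B U" using Sm_basis[OF Sm_submodule[OF W U]] by auto
  then show ?thesis using U
  proof (induction "card B" arbitrary: B U rule: less_induct)
    case (less B U)
    show ?case
    proof (cases "U = {0}")
      case True then show ?thesis using zero by simp
    next
      case False
      note WU = Sm_submodule[OF W less.prems(2)]
      obtain S where S: "invariant_subspace m (W\<lparr>space := U\<rparr>) S" "simple_module m (W\<lparr>space := U, space := S\<rparr>)"
        using exists_simple_submodule[OF WU] False by auto
      obtain V' where V': "invariant_subspace m (W\<lparr>space := U\<rparr>) V'" "S \<inter> V' = {0}"
        "{u + u' | u u'. u \<in> S \<and> u' \<in> V'} = U"
        using invariant_complement[OF WU S(1)] by auto
      have S': "invariant_subspace m W S" and VW: "invariant_subspace m W V'"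
        using S(1) V'(1) less.prems(2) by (auto simp: invariant_subspace_def)
      obtain C where C: "basis_of C V'" using Sm_basis[OF Sm_submodule[OF W VW]] by auto
      have "V' \<subseteq> U" using V'(1) by (simp add: invariant_subspace_def)
      moreover have "V' \<noteq> U"
      proof
        assume "V' = U"
        moreover have "S \<subseteq> U" using S(1) by (simp add: invariant_subspace_def)
        ultimately have "S = {0}" using V'(2) by auto
        then show False using S(2) by (simp add: simple_module_def)
      qed
      ultimately have "card C < card B" using card_basis_mono[OF C less.prems(1)] by simp
      then have "P V'" using less.hyps C VW by blast
      then show ?thesis using step[OF less.prems(2) S' VW] S(2) V'(2,3) by simp
    qed
  qed
qed

section \<open>Permutation modules\<close>

definition perm_action :: "nat \<Rightarrow> 'a set \<Rightarrow> ((nat \<Rightarrow> nat) \<Rightarrow> 'a \<Rightarrow> 'a) \<Rightarrow> bool" where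
  "perm_action m A \<alpha> \<longleftrightarrow> finite A \<and> (\<forall>a\<in>A. \<alpha> id a = a) \<and>
     (\<forall>g. g permutes {1..m} \<longrightarrow> \<alpha> g ` A \<subseteq> A) \<and>
     (\<forall>g h. g permutes {1..m} \<longrightarrow> h permutes {1..m} \<longrightarrow> (\<forall>a\<in>A. \<alpha> (g \<circ> h) a = \<alpha> g (\<alpha> h a)))"

lemma perm_actionD:
  assumes "perm_action m A \<alpha>"
  shows "finite A" "\<And>a. a \<in> A \<Longrightarrow> \<alpha> id a = a" "\<And>g a. g permutes {1..m} \<Longrightarrow> a \<in> A \<Longrightarrow> \<alpha> g a \<in> A"
    "\<And>g h a. g permutes {1..m} \<Longrightarrow> h permutes {1..m} \<Longrightarrow> a \<in> A \<Longrightarrow> \<alpha> (g \<circ> h) a = \<alpha> g (\<alpha> h a)"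
  using assms by (auto simp: perm_action_def)

lemma perm_action_inv:
  assumes "perm_action m A \<alpha>" "g permutes {1..m}" "a \<in> A"
  shows "\<alpha> (inv g) (\<alpha> g a) = a" "\<alpha> g (\<alpha> (inv g) a) = a"
  using perm_actionD(4)[OF assms(1) perms_inv[OF assms(2)] assms(2,3)]
    perm_actionD(4)[OF assms(1,2) perms_inv[OF assms(2)] assms(3)]
    perm_actionD(2)[OF assms(1,3)] permutes_inv_o[OF assms(2)] by auto

lemma perm_action_bij:
  assumes "perm_action m A \<alpha>" "g permutes {1..m}"
  shows "bij_betw (\<alpha> g) A A"
  by (rule bij_betw_byWitness[of _ "\<alpha> (inv g)"])
    (use perm_action_inv[OF assms] perm_actionD(3)[OF assms(1)] perms_inv[OF assms(2)] assms(2) in auto)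

lemma space_perm_module [simp]: "space (perm_module A \<alpha>) = {x. Poly_Mapping.keys x \<subseteq> A}"
  by (simp add: perm_module_def)

lemma act_perm_module: "act (perm_module A \<alpha>) g = lin_ext (\<lambda>a. bvec (\<alpha> g a))"
  by (simp add: perm_module_def)

lemma act_perm_module_bvec [simp]: "act (perm_module A \<alpha>) g (bvec a) = bvec (\<alpha> g a)"
  by (simp add: act_perm_module)

lemma lin_ext_in_subspace:
  assumes "qvs.subspace V" "Poly_Mapping.keys x \<subseteq> A" "\<And>a. a \<in> A \<Longrightarrow> F a \<in> V"
  shows "lin_ext F x \<in> V"
  unfolding lin_ext_def using assms by (intro qvs.subspace_sum qvs.subspace_scale) auto

lemma lin_ext_eqI:
  assumes "qlinear G" "Poly_Mapping.keys x \<subseteq> A" "\<And>a. a \<in> A \<Longrightarrow> F a = G (bvec a)"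
  shows "lin_ext F x = G x"
proof -
  have "G x = G (\<Sum>a\<in>Poly_Mapping.keys x. qscale (Poly_Mapping.lookup x a) (bvec a))"
    by (simp add: bvec_expansion)
  also have "\<dots> = (\<Sum>a\<in>Poly_Mapping.keys x. qscale (Poly_Mapping.lookup x a) (G (bvec a)))"
    by (simp add: qvp.linear_sum[OF assms(1)] qvp.linear_scale[OF assms(1)])
  also have "\<dots> = lin_ext F x"
    unfolding lin_ext_def using assms(2,3) by (intro sum.cong refl) auto
  finally show ?thesis by simp
qed

lemma perm_module_Sm:
  assumes "perm_action m A \<alpha>"
  shows "Sm_module m (perm_module A \<alpha>)"
proof -
  note aD = perm_actionD[OF assms]
  have "\<exists>B. finite B \<and> space (perm_module A \<alpha>) \<subseteq> qvs.span B"
    using aD(1) by (intro exI[of _ "bvec ` A"]) (simp add: span_bvec)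
  moreover have "act (perm_module A \<alpha>) g ` space (perm_module A \<alpha>) \<subseteq> space (perm_module A \<alpha>)"
    if "g permutes {1..m}" for g
  proof
    fix y assume "y \<in> act (perm_module A \<alpha>) g ` space (perm_module A \<alpha>)"
    then obtain x where x: "Poly_Mapping.keys x \<subseteq> A" "y = lin_ext (\<lambda>a. bvec (\<alpha> g a)) x"
      by (auto simp: act_perm_module)
    show "y \<in> space (perm_module A \<alpha>)"
      unfolding x(2) by (rule lin_ext_in_subspace[OF _ x(1)]) (use aD(3)[OF that] in auto)
  qed
  moreover have "act (perm_module A \<alpha>) id x = x" if "x \<in> space (perm_module A \<alpha>)" for x
    unfolding act_perm_module using that aD(2)
    by (intro lin_ext_eqI[where A=A]) (auto intro: qlinearI)
  moreover have "act (perm_module A \<alpha>) (g \<circ> h) x = act (perm_module A \<alpha>) g (act (perm_module A \<alpha>) h x)"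
    if "g permutes {1..m}" "h permutes {1..m}" "x \<in> space (perm_module A \<alpha>)" for g h x
    unfolding act_perm_module
    by (rule lin_ext_eqI[where A=A])
      (use that aD(4)[OF that(1,2)] in \<open>auto intro: qlinearI simp: qvp.linear_add qvp.linear_scale\<close>)
  ultimately show ?thesis
    by (simp add: Sm_module_def act_perm_module qlinear_imp_linear_on)
qed

lemma lookup_act_perm_module:
  assumes "perm_action m A \<alpha>" "g permutes {1..m}" "Poly_Mapping.keys x \<subseteq> A" "a \<in> A"
  shows "Poly_Mapping.lookup (act (perm_module A \<alpha>) g x) (\<alpha> g a) = Poly_Mapping.lookup x a"
proof -
  note fin = perm_actionD(1)[OF assms(1)]
  have inj: "\<alpha> g b = \<alpha> g a \<longleftrightarrow> b = a" if "b \<in> A" for b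
    using perm_action_bij[OF assms(1,2)] that assms(4) by (auto simp: bij_betw_def inj_on_def)
  have "Poly_Mapping.lookup (act (perm_module A \<alpha>) g x) (\<alpha> g a) =
     (\<Sum>b\<in>A. Poly_Mapping.lookup x b * (if \<alpha> g b = \<alpha> g a then 1 else 0))"
    by (simp add: act_perm_module lin_ext_alt[OF fin assms(3)] lookup_sum lookup_single when_def)
  also have "\<dots> = (\<Sum>b\<in>A. if b = a then Poly_Mapping.lookup x b else 0)"
    by (intro sum.cong refl) (simp add: inj)
  finally show ?thesis using fin assms(4) by simp
qed

lemma character_perm_module:
  assumes "perm_action m A \<alpha>" "g permutes {1..m}"
  shows "character (perm_module A \<alpha>) g = of_nat (card {a\<in>A. \<alpha> g a = a})"
proof -
  note fin = perm_actionD(1)[OF assms(1)]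
  have B: "basis_of (bvec ` A) (space (perm_module A \<alpha>))"
    using basis_of_bvec[OF fin] by simp
  have "character (perm_module A \<alpha>) g =
     (\<Sum>b\<in>bvec ` A. coord (bvec ` A) (act (perm_module A \<alpha>) g b) b)"
    by (rule character_eq[OF perm_module_Sm[OF assms(1)] B assms(2)])
  also have "\<dots> = (\<Sum>a\<in>A. coord (bvec ` A) (bvec (\<alpha> g a)) (bvec a))"
    by (subst sum.reindex) (auto simp: inj_on_def)
  also have "\<dots> = (\<Sum>a\<in>A. if \<alpha> g a = a then 1 else 0)"
    using perm_actionD(3)[OF assms] by (intro sum.cong refl) (auto simp: coord_basis[OF B])
  also have "\<dots> = of_nat (card {a\<in>A. \<alpha> g a = a})"
    using fin by (simp add: sum.If_cases Int_def)
  finally show ?thesis .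
qed

definition dot :: "'a set \<Rightarrow> ('a \<Rightarrow>\<^sub>0 rat) \<Rightarrow> ('a \<Rightarrow>\<^sub>0 rat) \<Rightarrow> rat" where
  "dot A x y = (\<Sum>a\<in>A. Poly_Mapping.lookup x a * Poly_Mapping.lookup y a)"

lemma dot_act:
  assumes P: "perm_action m A \<alpha>" and g: "g permutes {1..m}"
    and x: "Poly_Mapping.keys x \<subseteq> A" and y: "Poly_Mapping.keys y \<subseteq> A"
  shows "dot A (act (perm_module A \<alpha>) g x) y = dot A x (act (perm_module A \<alpha>) (inv g) y)"
proof -
  have "dot A (act (perm_module A \<alpha>) g x) y =
     (\<Sum>a\<in>A. Poly_Mapping.lookup (act (perm_module A \<alpha>) g x) (\<alpha> g a) * Poly_Mapping.lookup y (\<alpha> g a))"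
    unfolding dot_def by (rule sum.reindex_bij_betw[OF perm_action_bij[OF P g], symmetric])
  also have "\<dots> = (\<Sum>a\<in>A. Poly_Mapping.lookup x a * Poly_Mapping.lookup (act (perm_module A \<alpha>) (inv g) y) a)"
  proof (intro sum.cong refl)
    fix a assume a: "a \<in> A"
    have "Poly_Mapping.lookup (act (perm_module A \<alpha>) (inv g) y) (\<alpha> (inv g) (\<alpha> g a)) = Poly_Mapping.lookup y (\<alpha> g a)"
      by (rule lookup_act_perm_module[OF P perms_inv[OF g] y perm_actionD(3)[OF P g a]])
    then show "Poly_Mapping.lookup (act (perm_module A \<alpha>) g x) (\<alpha> g a) * Poly_Mapping.lookup y (\<alpha> g a) =
        Poly_Mapping.lookup x a * Poly_Mapping.lookup (act (perm_module A \<alpha>) (inv g) y) a"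
      using lookup_act_perm_module[OF P g x a] perm_action_inv(1)[OF P g a] by simp
  qed
  finally show ?thesis by (simp add: dot_def)
qed

lemma dot_sum_right: "dot A x (\<Sum>i\<in>I. y i) = (\<Sum>i\<in>I. dot A x (y i))"
  unfolding dot_def by (subst sum.swap) (simp add: lookup_sum sum_distrib_left)

lemma dot_sum_left: "dot A (\<Sum>i\<in>I. y i) x = (\<Sum>i\<in>I. dot A (y i) x)"
  unfolding dot_def by (subst sum.swap) (simp add: lookup_sum sum_distrib_right)

lemma dot_scale_right: "dot A x (qscale c y) = c * dot A x y"
  by (simp add: dot_def sum_distrib_left algebra_simps)

lemma dot_scale_left: "dot A (qscale c x) y = c * dot A x y"
  by (simp add: dot_def sum_distrib_left algebra_simps)

lemma dot_eq_0_iff: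
  assumes "finite A" "Poly_Mapping.keys x \<subseteq> A"
  shows "dot A x x = 0 \<longleftrightarrow> x = 0"
proof
  assume "dot A x x = 0"
  then have "\<forall>a\<in>A. Poly_Mapping.lookup x a = 0"
    using assms(1) by (auto simp: dot_def sum_nonneg_eq_0_iff)
  then show "x = 0" using assms(2) by (intro poly_mapping_eqI) (auto simp: in_keys_iff subset_iff)
qed (simp add: dot_def)

section \<open>Tableaux and tabloids\<close>

definition tabloids :: "nat list \<Rightarrow> nat set list set" where
  "tabloids \<mu> = tabloid ` tableaux \<mu>"

lemma distinct_concat_nth:
  "distinct (concat T) \<Longrightarrow> i < length T \<Longrightarrow> j < length T \<Longrightarrow> i \<noteq> j \<Longrightarrow> set (T ! i) \<inter> set (T ! j) = {}"
proof (induction T arbitrary: i j)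
  case (Cons a T)
  have d: "set a \<inter> set (T ! k) = {}" if "k < length T" for k
    using Cons.prems(1) that by (auto simp: disjoint_iff)
  show ?case using Cons d by (cases i; cases j) (auto simp: Int_commute)
qed auto

lemma tableauxD:
  assumes "T \<in> tableaux \<mu>"
  shows "length T = length \<mu>" "\<And>i. i < length \<mu> \<Longrightarrow> length (T ! i) = \<mu> ! i"
    "\<And>i. i < length \<mu> \<Longrightarrow> distinct (T ! i)"
    "\<And>i j. i < length \<mu> \<Longrightarrow> j < length \<mu> \<Longrightarrow> i \<noteq> j \<Longrightarrow> set (T ! i) \<inter> set (T ! j) = {}"
    "set (concat T) = {1..sum_list \<mu>}" "\<And>i. i < length \<mu> \<Longrightarrow> set (T ! i) \<subseteq> {1..sum_list \<mu>}"
proof -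
  have T: "map length T = \<mu>" "distinct (concat T)" "set (concat T) = {1..sum_list \<mu>}"
    using assms by (auto simp: tableaux_def)
  show l: "length T = length \<mu>" using T(1) by (metis length_map)
  show "length (T ! i) = \<mu> ! i" if "i < length \<mu>" for i
    using that T(1) l by (metis nth_map)
  show "distinct (T ! i)" if "i < length \<mu>" for i
    using that T(2) l by (simp add: distinct_concat_iff)
  show "set (T ! i) \<inter> set (T ! j) = {}" if "i < length \<mu>" "j < length \<mu>" "i \<noteq> j" for i j
    using distinct_concat_nth[OF T(2)] that l by simp
  show "set (concat T) = {1..sum_list \<mu>}" by (rule T(3))
  show "set (T ! i) \<subseteq> {1..sum_list \<mu>}" if "i < length \<mu>" for i
    unfolding T(3)[symmetric] set_concat using that l by (intro UN_upper) simp
qed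

lemma tabloidsD:
  assumes "t \<in> tabloids \<mu>"
  shows "length t = length \<mu>" "\<And>i. i < length \<mu> \<Longrightarrow> card (t ! i) = \<mu> ! i"
    "\<And>i j. i < length \<mu> \<Longrightarrow> j < length \<mu> \<Longrightarrow> i \<noteq> j \<Longrightarrow> t ! i \<inter> t ! j = {}"
    "\<Union> (set t) = {1..sum_list \<mu>}"
proof -
  obtain T where T: "T \<in> tableaux \<mu>" "t = map set T" using assms by (auto simp: tabloids_def tabloid_def)
  note TD = tableauxD[OF T(1)]
  show "length t = length \<mu>" "\<And>i. i < length \<mu> \<Longrightarrow> card (t ! i) = \<mu> ! i"
    "\<And>i j. i < length \<mu> \<Longrightarrow> j < length \<mu> \<Longrightarrow> i \<noteq> j \<Longrightarrow> t ! i \<inter> t ! j = {}"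
    using TD(1-4) by (auto simp: T(2) distinct_card)
  show "\<Union> (set t) = {1..sum_list \<mu>}" using TD(5) by (simp add: T(2))
qed

lemma tabloidsI:
  assumes len: "length t = length \<mu>" and card: "\<And>i. i < length \<mu> \<Longrightarrow> card (t ! i) = \<mu> ! i"
    and disj: "\<And>i j. i < length \<mu> \<Longrightarrow> j < length \<mu> \<Longrightarrow> i \<noteq> j \<Longrightarrow> t ! i \<inter> t ! j = {}"
    and un: "\<Union> (set t) = {1..sum_list \<mu>}"
  shows "t \<in> tabloids \<mu>"
proof -
  let ?T = "map sorted_list_of_set t"
  have fin: "finite s" if "s \<in> set t" for s
  proof (rule finite_subset)
    show "s \<subseteq> {1..sum_list \<mu>}" using that un by blast
  qed simp
  have t: "t = map set ?T" using fin by (simp add: map_idI)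
  have lens: "map length ?T = \<mu>"
    using len card fin by (intro nth_equalityI) auto
  have st: "set (concat ?T) = {1..sum_list \<mu>}" using un fin by auto
  have "length (concat ?T) = sum_list \<mu>" by (simp only: length_concat lens)
  then have "distinct (concat ?T)" using st by (intro card_distinct) simp
  then have "?T \<in> tableaux \<mu>" using lens st by (simp add: tableaux_def)
  then show ?thesis unfolding tabloids_def tabloid_def using t by (metis imageI)
qed

lemma tabloid_in_tabloids: "T \<in> tableaux \<mu> \<Longrightarrow> tabloid T \<in> tabloids \<mu>"
  by (simp add: tabloids_def)

lemma tableaux_action:
  assumes T: "T \<in> tableaux \<mu>" and g: "g permutes {1..sum_list \<mu>}"
  shows "map (map g) T \<in> tableaux \<mu>"
proof -
  have "distinct (map g (concat T))"
    using T inj_on_subset[OF permutes_inj[OF g]] by (simp add: distinct_map tableaux_def)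
  moreover have "g ` {1..sum_list \<mu>} = {1..sum_list \<mu>}" using permutes_image[OF g] .
  ultimately show ?thesis
    using T unfolding tableaux_def by (simp add: map_concat[symmetric] comp_def) (metis image_UN)
qed

lemma tabloid_map: "tabloid (map (map g) T) = tabloid_action g (tabloid T)"
  by (simp add: tabloid_def tabloid_action_def)

lemma tabloid_action_id [simp]: "tabloid_action id t = t"
  by (simp add: tabloid_action_def)

lemma tabloid_action_comp: "tabloid_action (g \<circ> h) t = tabloid_action g (tabloid_action h t)"
  by (simp add: tabloid_action_def image_comp comp_def)

lemma perm_action_tabloids: "perm_action (sum_list \<mu>) (tabloids \<mu>) tabloid_action"
proof -
  have "tabloids \<mu> \<subseteq> {t. set t \<subseteq> Pow {1..sum_list \<mu>} \<and> length t = length \<mu>}"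
    using tabloidsD(1,4) by blast
  then have "finite (tabloids \<mu>)"
    by (rule finite_subset) (rule finite_lists_length_eq, simp)
  moreover have "tabloid_action g ` tabloids \<mu> \<subseteq> tabloids \<mu>" if "g permutes {1..sum_list \<mu>}" for g
    using tableaux_action[OF _ that] tabloid_map[of g, symmetric] by (auto simp: tabloids_def)
  ultimately show ?thesis by (simp add: perm_action_def tabloid_action_comp)
qed

lemma finite_tabloids [simp]: "finite (tabloids \<mu>)"
  using perm_action_tabloids by (rule perm_actionD)

abbreviation tabloid_module :: "nat list \<Rightarrow> nat set list rep" where
  "tabloid_module \<mu> \<equiv> perm_module (tabloids \<mu>) tabloid_action"

lemma tabloid_module_Sm: "Sm_module (sum_list \<mu>) (tabloid_module \<mu>)"
  by (rule perm_module_Sm[OF perm_action_tabloids])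

text \<open>The row index of an entry; rows are numbered from \<open>0\<close>.\<close>

definition row_of :: "nat set list \<Rightarrow> nat \<Rightarrow> nat" where
  "row_of t x = (THE i. i < length t \<and> x \<in> t ! i)"

lemma row_of_eq:
  assumes "t \<in> tabloids \<mu>" "i < length \<mu>" "x \<in> t ! i"
  shows "row_of t x = i"
  unfolding row_of_def
  by (rule the_equality) (use assms tabloidsD[OF assms(1)] in \<open>auto simp: disjoint_iff\<close>)

lemma row_of_mem:
  assumes "t \<in> tabloids \<mu>" "x \<in> {1..sum_list \<mu>}"
  shows "row_of t x < length \<mu>" "x \<in> t ! row_of t x"
proof -
  obtain i where i: "i < length \<mu>" "x \<in> t ! i"
    using assms(2) tabloidsD(1,4)[OF assms(1)] by (metis UnionE in_set_conv_nth)
  then show "row_of t x < length \<mu>" "x \<in> t ! row_of t x" using row_of_eq[OF assms(1) i] by auto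
qed

text \<open>
  The sum of all row indices. It orders the shapes: \<open>specht \<nu>\<close> with \<open>\<nu> \<noteq> \<mu>\<close> can only occur in the tabloid
  module of \<open>\<mu>\<close> if \<open>row_sum \<nu> < row_sum \<mu>\<close>.
\<close>

definition row_sum :: "nat list \<Rightarrow> nat" where
  "row_sum \<mu> = (\<Sum>i<length \<mu>. i * \<mu> ! i)"

text \<open>
  For every tabloid the sum of the row indices of the entries depends only on the shape. This is
  used both for a given tabloid and for the tabloid of the tableau that it is compared with.
\<close>

lemma sum_row_of:
  assumes t: "t \<in> tabloids \<mu>"
  shows "(\<Sum>x\<in>{1..sum_list \<mu>}. row_of t x) = row_sum \<mu>"
proof -
  note tD = tabloidsD[OF t]
  have U: "{1..sum_list \<mu>} = (\<Union>i\<in>{..<length \<mu>}. t ! i)"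
    using tD(1,4) by (auto simp: set_conv_nth)
  have fin: "finite (t ! i)" if "i < length \<mu>" for i
    using that U by (metis finite_UN finite_atLeastAtMost finite_lessThan lessThan_iff)
  have "(\<Sum>x\<in>{1..sum_list \<mu>}. row_of t x) = (\<Sum>i<length \<mu>. \<Sum>x\<in>t ! i. row_of t x)"
    unfolding U by (rule sum.UNION_disjoint) (use fin tD(3) in auto)
  also have "\<dots> = (\<Sum>i<length \<mu>. i * \<mu> ! i)"
    by (intro sum.cong refl) (simp add: row_of_eq[OF t] tD(2))
  finally show ?thesis by (simp add: row_sum_def)
qed

lemma row_of_image:
  assumes t: "t \<in> tabloids \<mu>" and p: "is_partition \<mu>"
  shows "row_of t ` {1..sum_list \<mu>} = {..<length \<mu>}"
proof
  show "row_of t ` {1..sum_list \<mu>} \<subseteq> {..<length \<mu>}" using row_of_mem[OF t] by auto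
  show "{..<length \<mu>} \<subseteq> row_of t ` {1..sum_list \<mu>}"
  proof
    fix i assume "i \<in> {..<length \<mu>}"
    then have i: "i < length \<mu>" by simp
    then have "card (t ! i) \<noteq> 0"
      using p tabloidsD(2)[OF t i] by (metis is_partition_def nth_mem)
    then obtain x where x: "x \<in> t ! i" by fastforce
    then have "x \<in> {1..sum_list \<mu>}" using tabloidsD(1,4)[OF t] i by (metis UnionI nth_mem)
    then show "i \<in> row_of t ` {1..sum_list \<mu>}" using row_of_eq[OF t i x] by (metis imageI)
  qed
qed

lemma column_eq: "column T j = {T ! i ! j | i. i < length T \<and> j < length (T ! i)}"
  unfolding column_def by (metis (no_types, lifting) in_set_conv_nth)

lemma column_subset:
  assumes T: "T \<in> tableaux \<mu>"
  shows "column T j \<subseteq> {1..sum_list \<mu>}"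
  using tableauxD(1,6)[OF T] unfolding column_eq by force

lemma column_entry_unique:
  assumes T: "T \<in> tableaux \<mu>" and "i < length \<mu>" "j < \<mu> ! i" "i' < length \<mu>" "j' < \<mu> ! i'"
    and eq: "T ! i ! j = T ! i' ! j'"
  shows "i = i'" "j = j'"
proof -
  note TD = tableauxD[OF T]
  show "i = i'"
  proof (rule ccontr)
    assume "i \<noteq> i'"
    then have "set (T ! i) \<inter> set (T ! i') = {}" using assms TD(4) by simp
    moreover have "T ! i ! j \<in> set (T ! i)" "T ! i' ! j' \<in> set (T ! i')"
      by (rule nth_mem; use assms TD(2) in simp)+
    ultimately show False using eq by auto
  qed
  then show "j = j'" using assms TD(2,3) by (auto simp: nth_eq_iff_index_eq)
qed

lemma column_disjoint:
  assumes T: "T \<in> tableaux \<mu>" and "x \<in> column T j" "x \<in> column T j'"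
  shows "j = j'"
  using assms column_entry_unique[OF T] tableauxD(1,2)[OF T] unfolding column_eq by auto

lemma column_covers:
  assumes T: "T \<in> tableaux \<mu>"
  shows "(\<Union>j\<in>{..<sum_list \<mu>}. column T j) = {1..sum_list \<mu>}"
proof
  show "(\<Union>j\<in>{..<sum_list \<mu>}. column T j) \<subseteq> {1..sum_list \<mu>}" using column_subset[OF T] by auto
  note TD = tableauxD[OF T]
  show "{1..sum_list \<mu>} \<subseteq> (\<Union>j\<in>{..<sum_list \<mu>}. column T j)"
  proof
    fix x assume "x \<in> {1..sum_list \<mu>}"
    then have "x \<in> set (concat T)" using TD(5) by simp
    then obtain r where r: "r \<in> set T" "x \<in> set r" by auto
    then obtain i j where i: "i < length T" "r = T ! i" "j < length r" "x = r ! j"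
      by (metis in_set_conv_nth)
    have "\<mu> ! i \<le> sum_list \<mu>" using i TD(1) by (simp add: elem_le_sum_list)
    then have "j < sum_list \<mu>" using i TD by simp
    then show "x \<in> (\<Union>j\<in>{..<sum_list \<mu>}. column T j)" using i r(1) unfolding column_def by blast
  qed
qed

lemma row_of_tableau:
  assumes T: "T \<in> tableaux \<mu>" and "i < length \<mu>" "j < \<mu> ! i"
  shows "row_of (tabloid T) (T ! i ! j) = i"
  by (rule row_of_eq[OF tabloid_in_tabloids[OF T] assms(2)])
    (use assms tableauxD[OF T] in \<open>auto simp: tabloid_def\<close>)

lemma down_closed_nat:
  assumes "finite S" "\<And>i j. i \<in> S \<Longrightarrow> j \<le> i \<Longrightarrow> j \<in> S"
  shows "S = {0..<card (S :: nat set)}"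
proof (cases "S = {}")
  case False
  have "S = {0..Max S}"
  proof
    show "S \<subseteq> {0..Max S}" using assms(1) by auto
    show "{0..Max S} \<subseteq> S" using assms(2)[OF Max_in[OF assms(1) False]] by auto
  qed
  then have "card S = Suc (Max S)" by (metis card_atLeastAtMost minus_nat.diff_0)
  with \<open>S = {0..Max S}\<close> show ?thesis by (metis atLeastLessThanSuc_atLeastAtMost)
qed simp

lemma row_of_column:
  assumes T: "T \<in> tableaux \<mu>" and p: "is_partition \<mu>"
  shows "inj_on (row_of (tabloid T)) (column T j)"
    and "row_of (tabloid T) ` column T j = {0..<card (column T j)}"
proof -
  let ?r = "row_of (tabloid T)"
  note TD = tableauxD[OF T]
  have r: "?r (T ! i ! j) = i" if "i < length T" "j < length (T ! i)" for i
    using row_of_tableau[OF T] that TD by simp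
  show inj: "inj_on ?r (column T j)"
    by (rule inj_onI) (auto simp: column_eq r)
  have "?r ` column T j = {i. i < length T \<and> j < length (T ! i)}" (is "_ = ?S")
  proof
    show "?r ` column T j \<subseteq> ?S" by (auto simp: column_eq r)
    show "?S \<subseteq> ?r ` column T j"
    proof
      fix i assume "i \<in> ?S"
      then have "T ! i ! j \<in> column T j" "?r (T ! i ! j) = i" using r by (auto simp: column_eq)
      then show "i \<in> ?r ` column T j" by (metis imageI)
    qed
  qed
  moreover have "?S = {0..<card ?S}"
  proof (rule down_closed_nat)
    fix i k assume i: "i \<in> ?S" and k: "k \<le> i"
    have "\<mu> ! i \<le> \<mu> ! k"
      using p i k TD(1) by (cases "k = i") (auto simp: is_partition_def sorted_wrt_iff_nth_less)
    then show "k \<in> ?S" using i k TD by auto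
  qed simp
  moreover have "card (column T j) = card (?r ` column T j)" using card_image[OF inj] by simp
  ultimately show "?r ` column T j = {0..<card (column T j)}" by simp
qed

lemma sum_nat_set_ge:
  fixes S :: "nat set"
  assumes "finite S"
  shows "\<Sum>{0..<card S} \<le> \<Sum>S \<and> (\<Sum>S = \<Sum>{0..<card S} \<longrightarrow> S = {0..<card S})"
  using assms
proof (induction "card S" arbitrary: S)
  case (Suc k)
  then have ne: "S \<noteq> {}" by auto
  let ?M = "Max S" and ?S = "S - {Max S}"
  have M: "?M \<in> S" using Suc ne by simp
  have k: "k = card ?S" using Suc M by simp
  have "S \<subseteq> {0..?M}" using Suc by auto
  then have "card S \<le> Suc ?M" using card_mono[of "{0..?M}" S] by simp
  then have Mk: "?M \<ge> k" using Suc by simp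
  have sum: "\<Sum>S = ?M + \<Sum>?S" using Suc.prems M by (rule sum.remove)
  have IH: "\<Sum>{0..<k} \<le> \<Sum>?S \<and> (\<Sum>?S = \<Sum>{0..<k} \<longrightarrow> ?S = {0..<k})"
    using Suc.hyps(1)[of ?S] k Suc.prems by simp
  have t: "\<Sum>{0..<card S} = k + \<Sum>{0..<k}" using Suc.hyps(2)[symmetric] by simp
  have "S = {0..<card S}" if "\<Sum>S = \<Sum>{0..<card S}"
  proof -
    have "?M = k" "?S = {0..<k}" using that sum t IH Mk by auto
    then have "S = insert k {0..<k}" using M by auto
    then show ?thesis using Suc.hyps(2) by auto
  qed
  then show ?case using sum t IH Mk by auto
qed simp

text \<open>
  The combinatorial heart of the theory of Specht modules. If no two entries of a column of \<open>T\<close>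
  lie in one row of \<open>t\<close>, then the row indices in \<open>t\<close> of the entries of a column of length \<open>c\<close> are
  \<open>c\<close> different numbers and have at least the sum \<open>0 + \<dots> + (c - 1)\<close> that they have in \<open>T\<close>. If
  equality holds throughout, then each column can be sorted so that the rows of \<open>T\<close> become those
  of \<open>t\<close>.
\<close>

lemma column_strict_tabloid:
  assumes T: "T \<in> tableaux \<nu>" and p: "is_partition \<nu>" and t: "t \<in> tabloids \<mu>"
    and p': "is_partition \<mu>" and m: "sum_list \<mu> = sum_list \<nu>"
    and inj: "\<And>j. inj_on (row_of t) (column T j)"
  shows "row_sum \<nu> \<le> row_sum \<mu>"
    and "row_sum \<nu> = row_sum \<mu> \<Longrightarrow> \<exists>g\<in>column_group T. t = tabloid_action g (tabloid T)"
proof -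
  let ?m = "sum_list \<nu>" and ?r = "row_of t" and ?s = "row_of (tabloid T)" and ?C = "column T"
  note t0 = tabloid_in_tabloids[OF T]
  have fin: "finite (?C j)" for j by (rule finite_subset[OF column_subset[OF T]]) simp
  have split: "(\<Sum>x\<in>{1..?m}. f x) = (\<Sum>j<?m. \<Sum>x\<in>?C j. f x)" for f :: "nat \<Rightarrow> nat"
    unfolding column_covers[OF T, symmetric]
    by (rule sum.UNION_disjoint) (use fin column_disjoint[OF T] in auto)
  have r: "(\<Sum>x\<in>?C j. ?r x) = \<Sum>(?r ` ?C j)" for j
    using sum.reindex[OF inj[of j], of "\<lambda>x. x"] by simp
  have r0: "(\<Sum>x\<in>?C j. ?s x) = \<Sum>{0..<card (?C j)}" for j
    using sum.reindex[OF row_of_column(1)[OF T p, of j], of "\<lambda>x. x"] row_of_column(2)[OF T p, of j] by simp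
  have ge: "(\<Sum>x\<in>?C j. ?s x) \<le> (\<Sum>x\<in>?C j. ?r x)"
    and eq: "(\<Sum>x\<in>?C j. ?s x) = (\<Sum>x\<in>?C j. ?r x) \<Longrightarrow> ?r ` ?C j = ?s ` ?C j" for j
    using sum_nat_set_ge[of "?r ` ?C j"] card_image[OF inj[of j]] fin[of j] row_of_column(2)[OF T p, of j]
    by (auto simp: r r0)
  have s: "row_sum \<nu> = (\<Sum>j<?m. \<Sum>x\<in>?C j. ?s x)" "row_sum \<mu> = (\<Sum>j<?m. \<Sum>x\<in>?C j. ?r x)"
    using sum_row_of[OF t0] sum_row_of[OF t] m by (simp_all add: split)
  show "row_sum \<nu> \<le> row_sum \<mu>" unfolding s by (intro sum_mono ge)
  assume "row_sum \<nu> = row_sum \<mu>"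
  then have sums: "(\<Sum>j<?m. \<Sum>x\<in>?C j. ?s x) = (\<Sum>j<?m. \<Sum>x\<in>?C j. ?r x)" by (simp only: s)
  have img: "?r ` ?C j = ?s ` ?C j" if "j < ?m" for j
    by (rule eq[OF sum_mono_inv[OF sums ge]]) (use that in auto)
  define col where "col x = (THE j. x \<in> ?C j)" for x
  have col: "col x = j" if "x \<in> ?C j" for x j
    unfolding col_def using that column_disjoint[OF T] by blast
  define g where "g x = (if x \<in> {1..?m} then the_inv_into (?C (col x)) ?r (?s x) else x)" for x
  have jm: "j < ?m" if x: "x \<in> ?C j" for x j
  proof -
    have "x \<in> (\<Union>j\<in>{..<?m}. ?C j)" using column_covers[OF T] column_subset[OF T] x by blast
    then obtain j' where "j' < ?m" "x \<in> ?C j'" by blast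
    then show ?thesis using column_disjoint[OF T x] by blast
  qed
  have g: "g x \<in> ?C j \<and> ?r (g x) = ?s x" if x: "x \<in> ?C j" for x j
  proof -
    have "g x = the_inv_into (?C j) ?r (?s x)" using x col[OF x] column_subset[OF T, of j] by (auto simp: g_def)
    moreover have "?s x \<in> ?r ` ?C j" using img[OF jm[OF x]] x by simp
    ultimately show ?thesis
      using the_inv_into_into[OF inj _ order_refl] f_the_inv_into_f[OF inj] by simp
  qed
  have gC: "g ` ?C j = ?C j" for j
  proof
    show "g ` ?C j \<subseteq> ?C j" using g by blast
    show "?C j \<subseteq> g ` ?C j"
    proof
      fix y assume y: "y \<in> ?C j"
      then have "?r y \<in> ?s ` ?C j" using img[OF jm[OF y]] by blast
      then obtain x where x: "x \<in> ?C j" "?r y = ?s x" by blast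
      then have "g x = y" using g[OF x(1)] y inj[of j] by (auto simp: inj_on_def)
      then show "y \<in> g ` ?C j" using x by blast
    qed
  qed
  have gm: "g ` {1..?m} = {1..?m}"
    unfolding column_covers[OF T, symmetric] image_UN gC ..
  then have "inj_on g {1..?m}" by (intro eq_card_imp_inj_on) auto
  then have "g permutes {1..?m}"
    using gm by (intro bij_imp_permutes) (auto simp: bij_betw_def g_def)
  then have gG: "g \<in> column_group T"
    using gC tableauxD(5)[OF T] by (simp add: column_group_def)
  have len: "length \<mu> = length \<nu>"
  proof -
    have "?r ` {1..?m} = ?s ` {1..?m}"
      unfolding column_covers[OF T, symmetric] image_UN using img by auto
    then have "{..<length \<mu>} = {..<length \<nu>}"
      using row_of_image[OF t p'] row_of_image[OF t0 p] m by simp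
    then show ?thesis by simp
  qed
  have rg: "?r (g x) = ?s x" if "x \<in> {1..?m}" for x
    using that g unfolding column_covers[OF T, symmetric] by blast
  have "t = tabloid_action g (tabloid T)"
  proof (rule nth_equalityI)
    show "length t = length (tabloid_action g (tabloid T))"
      using len tabloidsD(1)[OF t] tabloidsD(1)[OF t0] by (simp add: tabloid_action_def)
    fix i assume "i < length t"
    then have i: "i < length \<mu>" "i < length \<nu>" "i < length (tabloid T)"
      using len tabloidsD(1)[OF t] tabloidsD(1)[OF t0] by auto
    have "t ! i = g ` (tabloid T ! i)"
    proof
      show "t ! i \<subseteq> g ` (tabloid T ! i)"
      proof
        fix y assume y: "y \<in> t ! i"
        have "y \<in> {1..?m}" using y i tabloidsD(1,4)[OF t] m by (metis UnionI nth_mem)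
        then obtain x where x: "x \<in> {1..?m}" "y = g x" using gm by blast
        have "?s x = i" using rg[OF x(1)] x(2) row_of_eq[OF t i(1) y] by simp
        then show "y \<in> g ` (tabloid T ! i)" using row_of_mem(2)[OF t0 x(1)] x(2) by blast
      qed
      show "g ` (tabloid T ! i) \<subseteq> t ! i"
      proof
        fix y assume "y \<in> g ` (tabloid T ! i)"
        then obtain x where x: "x \<in> tabloid T ! i" "y = g x" by blast
        have xm: "x \<in> {1..?m}" using x(1) i tabloidsD(1,4)[OF t0] by (metis UnionI nth_mem)
        then have "y \<in> {1..?m}" using x(2) gm by blast
        moreover have "?r y = i" using rg[OF xm] x(2) row_of_eq[OF t0 i(2) x(1)] by simp
        ultimately show "y \<in> t ! i" using row_of_mem(2)[OF t, of y] m by simp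
      qed
    qed
    then show "t ! i = tabloid_action g (tabloid T) ! i" using i by (simp add: tabloid_action_def)
  qed
  then show "\<exists>g\<in>column_group T. t = tabloid_action g (tabloid T)" using gG by blast
qed

section \<open>Specht modules\<close>

lemma column_groupD:
  assumes T: "T \<in> tableaux \<nu>" and "g \<in> column_group T"
  shows "g permutes {1..sum_list \<nu>}" "\<And>j. g ` column T j = column T j"
  using assms tableauxD(5)[OF T] by (auto simp: column_group_def)

lemma column_groupI:
  assumes T: "T \<in> tableaux \<nu>" and "g permutes {1..sum_list \<nu>}" "\<And>j. g ` column T j = column T j"
  shows "g \<in> column_group T"
  using assms tableauxD(5)[OF T] by (auto simp: column_group_def)

lemma finite_column_group: "T \<in> tableaux \<nu> \<Longrightarrow> finite (column_group T)"
  by (rule finite_subset[OF _ finite_perms[of "sum_list \<nu>"]]) (auto dest: column_groupD(1))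

lemma column_group_id: "T \<in> tableaux \<nu> \<Longrightarrow> id \<in> column_group T"
  by (rule column_groupI) (auto simp: permutes_id)

lemma column_group_comp:
  assumes T: "T \<in> tableaux \<nu>" and g: "g \<in> column_group T" and h: "h \<in> column_group T"
  shows "g \<circ> h \<in> column_group T"
proof (rule column_groupI[OF T])
  show "g \<circ> h permutes {1..sum_list \<nu>}"
    using column_groupD(1)[OF T g] column_groupD(1)[OF T h] by (rule perms_comp)
  show "(g \<circ> h) ` column T j = column T j" for j
    by (simp only: image_comp[symmetric] column_groupD(2)[OF T g] column_groupD(2)[OF T h])
qed

lemma column_group_inv:
  assumes T: "T \<in> tableaux \<nu>" and g: "g \<in> column_group T"
  shows "inv g \<in> column_group T"
proof (rule column_groupI[OF T])
  note gD = column_groupD[OF T g]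
  show "inv g permutes {1..sum_list \<nu>}" by (rule perms_inv[OF gD(1)])
  show "inv g ` column T j = column T j" for j
  proof -
    have "inv g ` column T j = (inv g \<circ> g) ` column T j" by (simp only: image_comp[symmetric] gD(2))
    then show ?thesis by (simp add: permutes_inv_o(2)[OF gD(1)])
  qed
qed

lemma column_group_transpose:
  assumes T: "T \<in> tableaux \<nu>" and x: "x \<in> column T j" and y: "y \<in> column T j"
  shows "transpose x y \<in> column_group T"
proof (rule column_groupI[OF T])
  show "transpose x y permutes {1..sum_list \<nu>}"
    using column_subset[OF T, of j] x y by (intro permutes_swap_id) auto
  fix k
  show "transpose x y ` column T k = column T k"
  proof (cases "k = j")
    case True then show ?thesis using x y by auto
  next
    case False
    then have "x \<notin> column T k" "y \<notin> column T k" using column_disjoint[OF T] x y by blast+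
    then have "transpose x y z = z" if "z \<in> column T k" for z
      using that by (auto simp: transpose_def)
    then show ?thesis by simp
  qed
qed

lemma sum_column_group_comp:
  assumes T: "T \<in> tableaux \<nu>" and h: "h \<in> column_group T"
  shows "(\<Sum>g\<in>column_group T. f (g \<circ> h)) = (\<Sum>g\<in>column_group T. f g)"
    and "(\<Sum>g\<in>column_group T. f (h \<circ> g)) = (\<Sum>g\<in>column_group T. f g)"
proof -
  note io = permutes_inv_o[OF column_groupD(1)[OF T h]]
  note h' = column_group_inv[OF T h]
  show "(\<Sum>g\<in>column_group T. f (g \<circ> h)) = (\<Sum>g\<in>column_group T. f g)"
    by (rule sum.reindex_bij_witness[of _ "\<lambda>g. g \<circ> inv h" "\<lambda>g. g \<circ> h"])
      (auto simp: io comp_assoc intro: column_group_comp[OF T _ h] column_group_comp[OF T _ h'])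
  show "(\<Sum>g\<in>column_group T. f (h \<circ> g)) = (\<Sum>g\<in>column_group T. f g)"
    by (rule sum.reindex_bij_witness[of _ "\<lambda>g. inv h \<circ> g" "\<lambda>g. h \<circ> g"])
      (auto simp: io comp_assoc[symmetric] intro: column_group_comp[OF T h] column_group_comp[OF T h'])
qed

abbreviation sgn_rat :: "(nat \<Rightarrow> nat) \<Rightarrow> rat" where
  "sgn_rat g \<equiv> of_int (sign g)"

lemma sgn_rat_comp:
  "g permutes {1..m} \<Longrightarrow> h permutes {1..m::nat} \<Longrightarrow> sgn_rat (g \<circ> h) = sgn_rat g * sgn_rat h"
  by (metis finite_atLeastAtMost permutation_permutes sign_compose of_int_mult)

lemma sgn_rat_inv: "g permutes {1..m::nat} \<Longrightarrow> sgn_rat (inv g) = sgn_rat g"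
  by (metis finite_atLeastAtMost permutation_permutes sign_inverse)

lemma sgn_rat_square [simp]: "sgn_rat g * sgn_rat g = 1" "sgn_rat g * (sgn_rat g * c) = c"
  by (simp_all flip: of_int_mult mult.assoc)

text \<open>The signed column sum of a tableau, as an operator on any module.\<close>

definition column_sum :: "nat list list \<Rightarrow> 'a rep \<Rightarrow> ('a \<Rightarrow>\<^sub>0 rat) \<Rightarrow> ('a \<Rightarrow>\<^sub>0 rat)" where
  "column_sum T W x = (\<Sum>g\<in>column_group T. qscale (sgn_rat g) (act W g x))"

lemma column_sum_closed:
  assumes T: "T \<in> tableaux \<nu>" and W: "Sm_module (sum_list \<nu>) W" and x: "x \<in> space W"
  shows "column_sum T W x \<in> space W"
  unfolding column_sum_def
  using Sm_closed[OF W column_groupD(1)[OF T] x]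
  by (intro qvs.subspace_sum[OF Sm_subspace[OF W]] qvs.subspace_scale[OF Sm_subspace[OF W]])

lemma column_sum_linear:
  assumes T: "T \<in> tableaux \<nu>" and W: "Sm_module (sum_list \<nu>) W"
  shows "linear_on (space W) (column_sum T W)"
  unfolding linear_on_def
proof (intro conjI ballI allI)
  note gl = Sm_linear[OF W column_groupD(1)[OF T]]
  fix x y assume x: "x \<in> space W" "y \<in> space W"
  have "column_sum T W (x + y) = (\<Sum>g\<in>column_group T. qscale (sgn_rat g) (act W g x) + qscale (sgn_rat g) (act W g y))"
    unfolding column_sum_def using x by (intro sum.cong refl) (simp add: linear_on_add[OF gl] qvs.scale_right_distrib)
  then show "column_sum T W (x + y) = column_sum T W x + column_sum T W y"
    by (simp add: column_sum_def sum.distrib)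
next
  note gl = Sm_linear[OF W column_groupD(1)[OF T]]
  fix c x assume x: "x \<in> space W"
  have "column_sum T W (qscale c x) = (\<Sum>g\<in>column_group T. qscale c (qscale (sgn_rat g) (act W g x)))"
    unfolding column_sum_def using x by (intro sum.cong refl) (simp add: linear_on_scale[OF gl] mult.commute)
  then show "column_sum T W (qscale c x) = qscale c (column_sum T W x)"
    by (simp add: column_sum_def qvs.scale_sum_right)
qed

lemma column_sum_act:
  assumes T: "T \<in> tableaux \<nu>" and W: "Sm_module (sum_list \<nu>) W" and x: "x \<in> space W"
    and h: "h \<in> column_group T"
  shows "column_sum T W (act W h x) = qscale (sgn_rat h) (column_sum T W x)"
    and "act W h (column_sum T W x) = qscale (sgn_rat h) (column_sum T W x)"
proof -
  note CP = column_groupD(1)[OF T] and WS = Sm_subspace[OF W]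
  note hp = CP[OF h]
  let ?f = "\<lambda>g. qscale (sgn_rat h * sgn_rat g) (act W g x)"
  have f: "(\<Sum>g\<in>column_group T. ?f g) = qscale (sgn_rat h) (column_sum T W x)"
    by (simp add: column_sum_def qvs.scale_sum_right)
  have "column_sum T W (act W h x) = (\<Sum>g\<in>column_group T. ?f (g \<circ> h))"
    unfolding column_sum_def
    by (intro sum.cong refl) (simp add: sgn_rat_comp[OF CP hp] Sm_comp[OF W CP hp x] mult.commute mult.left_commute)
  then show "column_sum T W (act W h x) = qscale (sgn_rat h) (column_sum T W x)"
    using f sum_column_group_comp(1)[OF T h, of ?f] by simp
  have "act W h (column_sum T W x) = (\<Sum>g\<in>column_group T. act W h (qscale (sgn_rat g) (act W g x)))"
    unfolding column_sum_def
    by (rule linear_on_sum[OF WS Sm_linear[OF W hp]]) (intro qvs.subspace_scale[OF WS] Sm_closed[OF W CP x])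
  also have "\<dots> = (\<Sum>g\<in>column_group T. ?f (h \<circ> g))"
    by (intro sum.cong refl)
      (simp add: sgn_rat_comp[OF hp CP] Sm_comp[OF W hp CP x] linear_on_scale[OF Sm_linear[OF W hp]] Sm_closed[OF W CP x])
  finally show "act W h (column_sum T W x) = qscale (sgn_rat h) (column_sum T W x)"
    using f sum_column_group_comp(2)[OF T h, of ?f] by simp
qed

lemma column_sum_twice:
  assumes T: "T \<in> tableaux \<nu>" and W: "Sm_module (sum_list \<nu>) W" and x: "x \<in> space W"
  shows "column_sum T W (column_sum T W x) = qscale (of_nat (card (column_group T))) (column_sum T W x)"
proof -
  have "column_sum T W (column_sum T W x) = (\<Sum>g\<in>column_group T. column_sum T W x)"
    unfolding column_sum_def[of T W "column_sum T W x"]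
    by (intro sum.cong refl) (simp add: column_sum_act(2)[OF T W x])
  then show ?thesis by (simp add: qvs.sum_constant_scale del: sum_constant)
qed

lemma column_group_card: "T \<in> tableaux \<nu> \<Longrightarrow> card (column_group T) > 0"
  using finite_column_group column_group_id by (metis card_gt_0_iff empty_iff)

lemma column_sum_hom:
  assumes T: "T \<in> tableaux \<nu>" and V: "Sm_module (sum_list \<nu>) V"
    and f: "module_hom_on (sum_list \<nu>) V W f" and x: "x \<in> space V"
  shows "f (column_sum T V x) = column_sum T W (f x)"
proof -
  note CP = column_groupD(1)[OF T] and VS = Sm_subspace[OF V] and fD = module_hom_onD[OF f]
  have "f (column_sum T V x) = (\<Sum>g\<in>column_group T. f (qscale (sgn_rat g) (act V g x)))"
    unfolding column_sum_def
    by (rule linear_on_sum[OF VS fD(1)]) (intro qvs.subspace_scale[OF VS] Sm_closed[OF V CP x])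
  then show ?thesis
    unfolding column_sum_def using x
    by (simp add: linear_on_scale[OF fD(1)] Sm_closed[OF V CP x] fD(3)[OF CP])
qed

lemma column_sum_dot:
  assumes T: "T \<in> tableaux \<nu>" and P: "perm_action (sum_list \<nu>) A \<alpha>"
    and x: "Poly_Mapping.keys x \<subseteq> A" and y: "Poly_Mapping.keys y \<subseteq> A"
  shows "dot A (column_sum T (perm_module A \<alpha>) x) y = dot A x (column_sum T (perm_module A \<alpha>) y)"
proof -
  let ?W = "perm_module A \<alpha>"
  note CP = column_groupD(1)[OF T]
  have "dot A (column_sum T ?W x) y = (\<Sum>g\<in>column_group T. sgn_rat g * dot A x (act ?W (inv g) y))"
    by (simp add: column_sum_def dot_sum_left dot_scale_left dot_act[OF P CP x y])
  also have "\<dots> = (\<Sum>g\<in>column_group T. sgn_rat g * dot A x (act ?W g y))"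
    by (rule sum.reindex_bij_witness[of _ inv inv])
      (auto simp: permutes_inv_inv[OF CP] sgn_rat_inv[OF CP] intro: column_group_inv[OF T])
  also have "\<dots> = dot A x (column_sum T ?W y)"
    by (simp add: column_sum_def dot_sum_right dot_scale_right)
  finally show ?thesis .
qed

lemma polytabloid_eq: "polytabloid T = column_sum T (tabloid_module \<nu>) (bvec (tabloid T))"
  by (simp add: polytabloid_def column_sum_def)

lemma bvec_in_tabloid_module: "t \<in> tabloids \<mu> \<Longrightarrow> bvec t \<in> space (tabloid_module \<mu>)"
  by simp

text \<open>A transposition in the column group that fixes a vector makes its signed column sum cancel.\<close>

lemma column_sum_transpose_fixed:
  assumes T: "T \<in> tableaux \<nu>" and W: "Sm_module (sum_list \<nu>) W" and v: "v \<in> space W"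
    and x: "x \<in> column T j" and y: "y \<in> column T j" and ne: "x \<noteq> y"
    and fixed: "act W (transpose x y) v = v"
  shows "column_sum T W v = 0"
proof -
  have "column_sum T W v = qscale (-1) (column_sum T W v)"
    using column_sum_act(1)[OF T W v column_group_transpose[OF T x y]] fixed ne
    by (simp add: sign_swap_id)
  then have "qscale 2 (column_sum T W v) = 0"
    using qvs.scale_left_distrib[of 1 1 "column_sum T W v"]
    by (simp add: eq_neg_iff_add_eq_0)
  then show ?thesis by simp
qed

lemma column_sum_tabloid_inj:
  assumes T: "T \<in> tableaux \<nu>" and t: "t \<in> tabloids \<mu>" and m: "sum_list \<mu> = sum_list \<nu>"
    and ne: "column_sum T (tabloid_module \<mu>) (bvec t) \<noteq> 0"
  shows "inj_on (row_of t) (column T j)"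
proof (rule inj_onI, rule ccontr)
  fix x y assume xy: "x \<in> column T j" "y \<in> column T j" "row_of t x = row_of t y" "x \<noteq> y"
  let ?s = "transpose x y"
  have xm: "x \<in> {1..sum_list \<mu>}" "y \<in> {1..sum_list \<mu>}" using column_subset[OF T, of j] xy(1,2) m by auto
  have "?s ` R = R" if R: "R \<in> set t" for R
  proof -
    obtain i where i: "i < length \<mu>" "R = t ! i" using R tabloidsD(1)[OF t] by (metis in_set_conv_nth)
    have "x \<in> R \<longleftrightarrow> y \<in> R"
      using row_of_eq[OF t i(1)] row_of_mem[OF t] xm xy(3) i by metis
    then show ?thesis by (metis image_empty transpose_image_eq)
  qed
  then have "tabloid_action ?s t = t"
    unfolding tabloid_action_def by (intro map_idI)
  then show False
    using column_sum_transpose_fixed[OF T tabloid_module_Sm[of \<mu>, unfolded m] _ xy(1,2,4), of "bvec t"] ne t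
    by simp
qed

lemma column_sum_expand:
  assumes T: "T \<in> tableaux \<nu>" and m: "sum_list \<mu> = sum_list \<nu>" and x: "Poly_Mapping.keys x \<subseteq> tabloids \<mu>"
  shows "column_sum T (tabloid_module \<mu>) x =
    (\<Sum>t\<in>tabloids \<mu>. qscale (Poly_Mapping.lookup x t) (column_sum T (tabloid_module \<mu>) (bvec t)))"
proof -
  let ?W = "tabloid_module \<mu>"
  note WS = tabloid_module_Sm[of \<mu>, unfolded m]
  note lin = column_sum_linear[OF T WS]
  have "column_sum T ?W x = column_sum T ?W (\<Sum>t\<in>tabloids \<mu>. qscale (Poly_Mapping.lookup x t) (bvec t))"
    using bvec_expansion[OF finite_tabloids x] by simp
  also have "\<dots> = (\<Sum>t\<in>tabloids \<mu>. column_sum T ?W (qscale (Poly_Mapping.lookup x t) (bvec t)))"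
    by (rule linear_on_sum[OF Sm_subspace[OF WS] lin])
      (intro qvs.subspace_scale[OF Sm_subspace[OF WS]] bvec_in_tabloid_module)
  also have "\<dots> = (\<Sum>t\<in>tabloids \<mu>. qscale (Poly_Mapping.lookup x t) (column_sum T ?W (bvec t)))"
    by (intro sum.cong refl linear_on_scale[OF lin] bvec_in_tabloid_module)
  finally show ?thesis .
qed

text \<open>
  By the comparison of row indices, the signed column sum of a tableau of shape \<open>\<nu>\<close> kills the tabloid
  modules of the other shapes that do not have a larger row sum, and maps the tabloid module of \<open>\<nu>\<close>
  to the line of the polytabloid.
\<close>

lemma column_sum_zero:
  assumes T: "T \<in> tableaux \<nu>" and p: "is_partition \<nu>" "is_partition \<mu>" and m: "sum_list \<mu> = sum_list \<nu>"
    and le: "row_sum \<mu> \<le> row_sum \<nu>" and ne: "\<mu> \<noteq> \<nu>" and x: "Poly_Mapping.keys x \<subseteq> tabloids \<mu>"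
  shows "column_sum T (tabloid_module \<mu>) x = 0"
proof -
  have "column_sum T (tabloid_module \<mu>) (bvec t) = 0" if t: "t \<in> tabloids \<mu>" for t
  proof (rule ccontr)
    assume c: "column_sum T (tabloid_module \<mu>) (bvec t) \<noteq> 0"
    note strict = column_strict_tabloid[OF T p(1) t p(2) m column_sum_tabloid_inj[OF T t m c]]
    obtain g where g: "g \<in> column_group T" "t = tabloid_action g (tabloid T)"
      using strict le by force
    have "t \<in> tabloids \<nu>"
      unfolding g(2)
      by (rule perm_actionD(3)[OF perm_action_tabloids column_groupD(1)[OF T g(1)] tabloid_in_tabloids[OF T]])
    then have "\<mu> = \<nu>"
      using tabloidsD(1,2)[OF t] tabloidsD(1,2)[of t \<nu>] by (intro nth_equalityI) auto
    then show False using ne by simp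
  qed
  then show ?thesis by (simp add: column_sum_expand[OF T m x])
qed

lemma column_sum_specht:
  assumes T: "T \<in> tableaux \<nu>" and p: "is_partition \<nu>" and x: "Poly_Mapping.keys x \<subseteq> tabloids \<nu>"
  shows "\<exists>c. column_sum T (tabloid_module \<nu>) x = qscale c (polytabloid T)"
proof -
  let ?W = "tabloid_module \<nu>"
  have ex: "\<exists>c. column_sum T ?W (bvec t) = qscale c (polytabloid T)" if t: "t \<in> tabloids \<nu>" for t
  proof (cases "column_sum T ?W (bvec t) = 0")
    case True then show ?thesis by (metis qvs.scale_zero_left)
  next
    case False
    obtain g where g: "g \<in> column_group T" "t = tabloid_action g (tabloid T)"
      using column_strict_tabloid(2)[OF T p t p refl column_sum_tabloid_inj[OF T t refl False]] by auto
    have "column_sum T ?W (act ?W g (bvec (tabloid T))) = qscale (sgn_rat g) (polytabloid T)"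
      unfolding polytabloid_eq[of T \<nu>]
      by (rule column_sum_act(1)[OF T tabloid_module_Sm bvec_in_tabloid_module[OF tabloid_in_tabloids[OF T]] g(1)])
    then show ?thesis using g(2) by auto
  qed
  define c where "c t = (SOME c. column_sum T ?W (bvec t) = qscale c (polytabloid T))" for t
  have c: "column_sum T ?W (bvec t) = qscale (c t) (polytabloid T)" if "t \<in> tabloids \<nu>" for t
    unfolding c_def by (rule someI_ex[OF ex[OF that]])
  have "column_sum T ?W x = (\<Sum>t\<in>tabloids \<nu>. qscale (Poly_Mapping.lookup x t * c t) (polytabloid T))"
    by (simp add: column_sum_expand[OF T refl x] c)
  then have "column_sum T ?W x = qscale (\<Sum>t\<in>tabloids \<nu>. Poly_Mapping.lookup x t * c t) (polytabloid T)"
    by (simp add: qvs.scale_sum_left)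
  then show ?thesis by blast
qed

lemma column_map: "column (map (map g) T) j = g ` column T j"
proof -
  have "column (map (map g) T) j = {map g r ! j | r. r \<in> set T \<and> j < length r}"
    unfolding column_def by auto
  also have "\<dots> = {g (r ! j) | r. r \<in> set T \<and> j < length r}" by (metis (no_types, lifting) nth_map)
  finally show ?thesis unfolding column_def by auto
qed

lemma polytabloid_map:
  assumes T: "T \<in> tableaux \<nu>" and g: "g permutes {1..sum_list \<nu>}"
  shows "polytabloid (map (map g) T) = act (tabloid_module \<nu>) g (polytabloid T)"
proof -
  let ?W = "tabloid_module \<nu>" and ?T' = "map (map g) T"
  note T' = tableaux_action[OF T g] and io = permutes_inv_o[OF g] and g' = perms_inv[OF g]
  have 1: "g \<circ> h \<circ> inv g \<in> column_group ?T'" if h: "h \<in> column_group T" for h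
  proof (rule column_groupI[OF T'])
    show "g \<circ> h \<circ> inv g permutes {1..sum_list \<nu>}"
      using g column_groupD(1)[OF T h] g' by (intro permutes_compose)
    show "(g \<circ> h \<circ> inv g) ` column ?T' j = column ?T' j" for j
    proof -
      have "(g \<circ> h \<circ> inv g) ` g ` column T j = g ` h ` (inv g \<circ> g) ` column T j"
        by (simp add: image_comp comp_assoc)
      then show ?thesis by (simp add: column_map io column_groupD(2)[OF T h])
    qed
  qed
  have 2: "inv g \<circ> h \<circ> g \<in> column_group T" if h: "h \<in> column_group ?T'" for h
  proof (rule column_groupI[OF T])
    show "inv g \<circ> h \<circ> g permutes {1..sum_list \<nu>}"
      using g column_groupD(1)[OF T' h] g' by (intro permutes_compose)
    show "(inv g \<circ> h \<circ> g) ` column T j = column T j" for j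
    proof -
      have "(inv g \<circ> h \<circ> g) ` column T j = inv g ` (h ` (g ` column T j))" by (simp add: image_comp comp_assoc)
      also have "\<dots> = (inv g \<circ> g) ` column T j"
        using column_groupD(2)[OF T' h, of j] by (simp add: column_map image_comp)
      finally show ?thesis by (simp add: io)
    qed
  qed
  have "polytabloid ?T' = (\<Sum>h\<in>column_group T. qscale (sgn_rat h) (bvec (tabloid_action (g \<circ> h) (tabloid T))))"
    unfolding polytabloid_def
  proof (rule sum.reindex_bij_witness[of _ "\<lambda>h. g \<circ> h \<circ> inv g" "\<lambda>h. inv g \<circ> h \<circ> g"])
    fix h assume h: "h \<in> column_group ?T'"
    then have hp: "h permutes {1..sum_list \<nu>}" using column_groupD(1)[OF T'] by simp
    show "g \<circ> (inv g \<circ> h \<circ> g) \<circ> inv g = h" by (metis comp_assoc comp_id id_comp io)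
    have "g \<circ> (inv g \<circ> h \<circ> g) = h \<circ> g" by (metis comp_assoc id_comp io(1))
    moreover have "sgn_rat (inv g \<circ> h \<circ> g) = sgn_rat h"
      by (simp add: sgn_rat_comp[OF perms_comp[OF g' hp] g] sgn_rat_comp[OF g' hp] sgn_rat_inv[OF g] mult.commute)
    ultimately show "qscale (sgn_rat (inv g \<circ> h \<circ> g)) (bvec (tabloid_action (g \<circ> (inv g \<circ> h \<circ> g)) (tabloid T))) =
       qscale (sgn_rat h) (bvec (tabloid_action h (tabloid ?T')))"
      by (simp add: tabloid_map tabloid_action_comp)
  next
    fix h assume "h \<in> column_group T"
    show "inv g \<circ> (g \<circ> h \<circ> inv g) \<circ> g = h" by (metis comp_assoc comp_id id_comp io)
  qed (use 1 2 in auto)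
  also have "\<dots> = act ?W g (polytabloid T)"
  proof -
    note WS = tabloid_module_Sm[of \<nu>]
    have "act ?W g (polytabloid T) = (\<Sum>h\<in>column_group T. act ?W g (qscale (sgn_rat h) (bvec (tabloid_action h (tabloid T)))))"
      unfolding polytabloid_def act_perm_module by (rule qvp.linear_sum[OF qlinear_lin_ext])
    then show ?thesis
      by (simp add: act_perm_module qvp.linear_scale[OF qlinear_lin_ext] tabloid_action_comp)
  qed
  finally show ?thesis .
qed

lemma distinct_lists_permutation:
  assumes "distinct xs" "distinct ys" "set xs = S" "set ys = S"
  shows "\<exists>g. g permutes S \<and> map g xs = ys"
proof -
  have len: "length xs = length ys" using assms distinct_card by metis
  define g where "g x = (case map_of (zip xs ys) x of None \<Rightarrow> x | Some y \<Rightarrow> y)" for x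
  have gi: "g (xs ! i) = ys ! i" if "i < length xs" for i
    using map_of_zip_nth[OF len assms(1), of i] that len by (simp add: g_def)
  then have map: "map g xs = ys" using len by (intro nth_equalityI) auto
  then have "g ` S = S" using assms(3,4) by (metis set_map)
  moreover have "inj_on g S" using map assms by (metis distinct_map)
  moreover have "g x = x" if "x \<notin> S" for x
    using that assms(3) len by (simp add: g_def map_of_eq_None_iff split: option.split)
      (metis map_of_zip_is_None option.distinct(1))
  ultimately show ?thesis using map bij_imp_permutes[of g S] by (auto simp: bij_betw_def)
qed

lemma concat_same_shape:
  "map length T = map length T' \<Longrightarrow> concat T = concat T' \<Longrightarrow> T = T'"
proof (induction T arbitrary: T')
  case (Cons a T)
  then obtain b S where "T' = b # S" by (cases T') auto
  then show ?case using Cons by auto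
qed simp

lemma tableaux_transitive:
  assumes "T \<in> tableaux \<nu>" "T' \<in> tableaux \<nu>"
  shows "\<exists>g. g permutes {1..sum_list \<nu>} \<and> map (map g) T = T'"
proof -
  obtain g where g: "g permutes {1..sum_list \<nu>}" "map g (concat T) = concat T'"
    using assms distinct_lists_permutation[of "concat T" "concat T'"] unfolding tableaux_def by auto
  have "map (map g) T = T'"
    by (rule concat_same_shape) (use assms g in \<open>auto simp: tableaux_def map_concat[symmetric] comp_def\<close>)
  then show ?thesis using g by blast
qed

lemma split_by_lengths: "length xs = sum_list \<nu> \<Longrightarrow> \<exists>T. map length T = \<nu> \<and> concat T = xs"
proof (induction \<nu> arbitrary: xs)
  case (Cons a \<nu>)
  obtain T where "map length T = \<nu>" "concat T = drop a xs" using Cons.IH[of "drop a xs"] Cons.prems by auto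
  then show ?case using Cons.prems by (intro exI[of _ "take a xs # T"]) simp
qed auto

lemma tableaux_exists:
  obtains T where "T \<in> tableaux \<nu>"
proof -
  obtain T where T: "map length T = \<nu>" "concat T = [1..<Suc (sum_list \<nu>)]"
    using split_by_lengths[of "[1..<Suc (sum_list \<nu>)]" \<nu>] unfolding length_upt by auto
  have "distinct (concat T)" "set (concat T) = {1..sum_list \<nu>}" unfolding T(2) by auto
  then show ?thesis using T(1) by (intro that[of T]) (simp add: tableaux_def)
qed

lemma polytabloid_in_tabloid_module:
  assumes T: "T \<in> tableaux \<nu>"
  shows "Poly_Mapping.keys (polytabloid T) \<subseteq> tabloids \<nu>"
  using column_sum_closed[OF T tabloid_module_Sm bvec_in_tabloid_module[OF tabloid_in_tabloids[OF T]]]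
  by (simp add: polytabloid_eq[of T \<nu>])

lemma specht_eq: "specht \<nu> = (tabloid_module \<nu>)\<lparr>space := qvs.span (polytabloid ` tableaux \<nu>)\<rparr>"
  by (simp add: specht_def perm_module_def)

lemma space_specht: "space (specht \<nu>) = qvs.span (polytabloid ` tableaux \<nu>)"
  by (simp add: specht_def)

lemma act_specht: "act (specht \<nu>) = act (tabloid_module \<nu>)"
  by (simp add: specht_eq)

lemma polytabloid_in_specht: "T \<in> tableaux \<nu> \<Longrightarrow> polytabloid T \<in> space (specht \<nu>)"
  by (simp add: space_specht qvs.span_base)

text \<open>
  A Specht module is generated by any one of its polytabloids, since any two tableaux of the same
  shape differ by a permutation of the entries.
\<close>

lemma specht_subset_invariant:
  assumes T: "T \<in> tableaux \<nu>" and e: "polytabloid T \<in> U" and U: "qvs.subspace U"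
    and inv: "\<And>g x. g permutes {1..sum_list \<nu>} \<Longrightarrow> x \<in> U \<Longrightarrow> act (tabloid_module \<nu>) g x \<in> U"
  shows "space (specht \<nu>) \<subseteq> U"
  unfolding space_specht
proof (rule qvs.span_minimal[OF _ U])
  show "polytabloid ` tableaux \<nu> \<subseteq> U"
  proof
    fix x assume "x \<in> polytabloid ` tableaux \<nu>"
    then obtain T' where T': "T' \<in> tableaux \<nu>" "x = polytabloid T'" by auto
    then obtain g where "g permutes {1..sum_list \<nu>}" "map (map g) T = T'" using tableaux_transitive[OF T] by blast
    then show "x \<in> U" using T'(2) polytabloid_map[OF T] inv e by auto
  qed
qed

lemma specht_invariant: "invariant_subspace (sum_list \<nu>) (tabloid_module \<nu>) (space (specht \<nu>))"
proof -
  have sub: "space (specht \<nu>) \<subseteq> space (tabloid_module \<nu>)"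
    unfolding space_specht
    by (rule qvs.span_minimal[OF _ Sm_subspace[OF tabloid_module_Sm]]) (use polytabloid_in_tabloid_module in auto)
  have "act (tabloid_module \<nu>) g ` space (specht \<nu>) \<subseteq> space (specht \<nu>)" if g: "g permutes {1..sum_list \<nu>}" for g
  proof -
    have "act (tabloid_module \<nu>) g ` qvs.span (polytabloid ` tableaux \<nu>) =
        qvs.span (act (tabloid_module \<nu>) g ` polytabloid ` tableaux \<nu>)"
      unfolding act_perm_module by (rule qvp.linear_span_image[OF qlinear_lin_ext, symmetric])
    also have "\<dots> \<subseteq> qvs.span (polytabloid ` tableaux \<nu>)"
      using polytabloid_map[OF _ g, symmetric] tableaux_action[OF _ g]
      by (intro qvs.span_mono) auto
    finally show ?thesis by (simp add: space_specht)
  qed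
  then show ?thesis using sub by (simp add: invariant_subspace_def space_specht)
qed

lemma specht_Sm: "Sm_module (sum_list \<nu>) (specht \<nu>)"
  using Sm_submodule[OF tabloid_module_Sm specht_invariant, of \<nu>] by (simp add: specht_eq)

lemma specht_subset: "space (specht \<nu>) \<subseteq> {x. Poly_Mapping.keys x \<subseteq> tabloids \<nu>}"
  using specht_invariant[of \<nu>] by (simp add: invariant_subspace_def)

text \<open>
  Only the identity preserves every row and every column of \<open>T\<close>, so the tabloid of \<open>T\<close> has
  coefficient \<open>1\<close>.
\<close>

lemma polytabloid_nonzero:
  assumes T: "T \<in> tableaux \<nu>" and p: "is_partition \<nu>"
  shows "polytabloid T \<noteq> 0"
proof -
  note t = tabloid_in_tabloids[OF T]
  have fixed: "g = id" if g: "g \<in> column_group T" "tabloid_action g (tabloid T) = tabloid T" for g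
  proof
    fix x
    show "g x = id x"
    proof (cases "x \<in> {1..sum_list \<nu>}")
      case False then show ?thesis using column_groupD(1)[OF T g(1)] by (simp add: permutes_not_in)
    next
      case True
      then obtain j where j: "x \<in> column T j" using column_covers[OF T] by blast
      then have gj: "g x \<in> column T j" using column_groupD(2)[OF T g(1)] by blast
      let ?i = "row_of (tabloid T) x"
      note i = row_of_mem[OF t True]
      have "g x \<in> tabloid_action g (tabloid T) ! ?i"
        using i tabloidsD(1)[OF t] by (simp add: tabloid_action_def)
      then have "row_of (tabloid T) (g x) = ?i" using row_of_eq[OF t i(1)] g(2) by simp
      then show ?thesis using row_of_column(1)[OF T p, of j] j gj by (simp add: inj_on_def)
    qed
  qed
  have "Poly_Mapping.lookup (polytabloid T) (tabloid T) =
     (\<Sum>g\<in>column_group T. sgn_rat g * (if tabloid_action g (tabloid T) = tabloid T then 1 else 0))"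
    by (simp add: polytabloid_def lookup_sum lookup_single when_def)
  also have "\<dots> = (\<Sum>g\<in>column_group T. if g = id then 1 else 0)"
    using fixed by (intro sum.cong refl) auto
  also have "\<dots> = 1" using finite_column_group[OF T] column_group_id[OF T] by simp
  finally show ?thesis by auto
qed

lemma specht_hom_zero:
  assumes T: "T \<in> tableaux \<nu>" and W: "Sm_module (sum_list \<nu>) W"
    and f: "module_hom_on (sum_list \<nu>) (specht \<nu>) W f" and z: "f (polytabloid T) = 0"
    and x: "x \<in> space (specht \<nu>)"
  shows "f x = 0"
proof -
  have inv: "invariant_subspace (sum_list \<nu>) (specht \<nu>) {x \<in> space (specht \<nu>). f x = 0}"
    by (rule module_hom_on_kernel[OF specht_Sm W f])
  have "space (specht \<nu>) \<subseteq> {x \<in> space (specht \<nu>). f x = 0}"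
    by (rule specht_subset_invariant[OF T])
      (use inv polytabloid_in_specht[OF T] z in \<open>auto simp: invariant_subspace_def act_specht[symmetric]\<close>)
  then show ?thesis using x by blast
qed

lemma column_sum_specht_eq: "column_sum T (specht \<nu>) = column_sum T (tabloid_module \<nu>)"
  by (rule ext) (simp add: column_sum_def act_specht)

lemma specht_hom_column_sum:
  assumes T: "T \<in> tableaux \<nu>" and f: "module_hom_on (sum_list \<nu>) (specht \<nu>) W f"
  shows "column_sum T W (f (polytabloid T)) = qscale (of_nat (card (column_group T))) (f (polytabloid T))"
proof -
  have "column_sum T (specht \<nu>) (polytabloid T) = qscale (of_nat (card (column_group T))) (polytabloid T)"
    unfolding column_sum_specht_eq polytabloid_eq[of T \<nu>]
    by (rule column_sum_twice[OF T tabloid_module_Sm bvec_in_tabloid_module[OF tabloid_in_tabloids[OF T]]])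
  then have "f (qscale (of_nat (card (column_group T))) (polytabloid T)) = column_sum T W (f (polytabloid T))"
    using column_sum_hom[OF T specht_Sm f polytabloid_in_specht[OF T]] by simp
  then show ?thesis
    using linear_on_scale[OF module_hom_onD(1)[OF f] polytabloid_in_specht[OF T]] by simp
qed

text \<open>
  James' submodule theorem: an invariant subspace on which some signed column sum is nonzero
  contains a polytabloid; otherwise it is orthogonal to all polytabloids.
\<close>

lemma specht_simple:
  assumes p: "is_partition \<nu>"
  shows "simple_module (sum_list \<nu>) (specht \<nu>)"
  unfolding simple_module_def
proof (intro conjI allI impI)
  obtain T0 where T0: "T0 \<in> tableaux \<nu>" using tableaux_exists .
  show "Sm_module (sum_list \<nu>) (specht \<nu>)" by (rule specht_Sm)
  show "space (specht \<nu>) \<noteq> {0}"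
    using polytabloid_in_specht[OF T0] polytabloid_nonzero[OF T0 p] by auto
  fix U assume U: "invariant_subspace (sum_list \<nu>) (specht \<nu>) U"
  then have US: "qvs.subspace U" and Usub: "U \<subseteq> space (specht \<nu>)"
    and Ug: "\<And>g x. g permutes {1..sum_list \<nu>} \<Longrightarrow> x \<in> U \<Longrightarrow> act (tabloid_module \<nu>) g x \<in> U"
    by (auto simp: invariant_subspace_def act_specht)
  have Uk: "Poly_Mapping.keys u \<subseteq> tabloids \<nu>" if "u \<in> U" for u using that Usub specht_subset by blast
  show "U = {0} \<or> U = space (specht \<nu>)"
  proof (cases "\<exists>T\<in>tableaux \<nu>. \<exists>u\<in>U. column_sum T (tabloid_module \<nu>) u \<noteq> 0")
    case True
    then obtain T u where T: "T \<in> tableaux \<nu>" and u: "u \<in> U" "column_sum T (tabloid_module \<nu>) u \<noteq> 0" by blast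
    obtain c where c: "column_sum T (tabloid_module \<nu>) u = qscale c (polytabloid T)"
      using column_sum_specht[OF T p Uk[OF u(1)]] by blast
    have "column_sum T (tabloid_module \<nu>) u \<in> U"
      unfolding column_sum_def
      by (intro qvs.subspace_sum[OF US] qvs.subspace_scale[OF US] Ug u(1) column_groupD(1)[OF T])
    then have "qscale (inverse c) (qscale c (polytabloid T)) \<in> U"
      unfolding c by (rule qvs.subspace_scale[OF US])
    moreover have "c \<noteq> 0" using u(2) c by auto
    ultimately have "polytabloid T \<in> U" by simp
    then have "space (specht \<nu>) \<subseteq> U" by (rule specht_subset_invariant[OF T _ US Ug])
    then show ?thesis using Usub by blast
  next
    case False
    have "u = 0" if u: "u \<in> U" for u
    proof -
      have orth: "dot (tabloids \<nu>) u (polytabloid T) = 0" if T: "T \<in> tableaux \<nu>" for T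
      proof -
        have "dot (tabloids \<nu>) (column_sum T (tabloid_module \<nu>) u) (bvec (tabloid T)) = dot (tabloids \<nu>) u (polytabloid T)"
          unfolding polytabloid_eq[of T \<nu>]
          by (rule column_sum_dot[OF T perm_action_tabloids Uk[OF u]]) (use tabloid_in_tabloids[OF T] in simp)
        then show ?thesis using False T u by (simp add: dot_def)
      qed
      have "dot (tabloids \<nu>) u x = 0" if "x \<in> qvs.span (polytabloid ` tableaux \<nu>)" for x
        using that
      proof (induction rule: qvs.span_induct_alt)
        case base then show ?case by (simp add: dot_def)
      next
        case (step c x y)
        then have "dot (tabloids \<nu>) u x = 0" using orth by auto
        then show ?case using step dot_scale_right[of "tabloids \<nu>" u c x]
          by (simp add: dot_def lookup_add ring_distribs sum.distrib)
      qed
      then have "dot (tabloids \<nu>) u u = 0" using u Usub by (auto simp: space_specht)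
      then show "u = 0" using dot_eq_0_iff[OF finite_tabloids Uk[OF u]] by simp
    qed
    then show ?thesis using qvs.subspace_0[OF US] by auto
  qed
qed

text \<open>
  An endomorphism commutes with the signed column sum, of which the polytabloid spans the image. So
  it multiplies the polytabloid, a generator, by a scalar.
\<close>

lemma specht_end_scalar:
  assumes p: "is_partition \<nu>" and f: "module_hom_on (sum_list \<nu>) (specht \<nu>) (specht \<nu>) f"
  shows "\<exists>k. \<forall>x\<in>space (specht \<nu>). f x = qscale k x"
proof -
  obtain T where T: "T \<in> tableaux \<nu>" using tableaux_exists .
  let ?n = "of_nat (card (column_group T)) :: rat" and ?e = "polytabloid T"
  note fD = module_hom_onD[OF f] and S = specht_Sm[of \<nu>]
  have n: "?n \<noteq> 0" using column_group_card[OF T] by simp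
  note e = polytabloid_in_specht[OF T]
  have "Poly_Mapping.keys (f ?e) \<subseteq> tabloids \<nu>" using fD(2)[OF e] specht_subset by auto
  then obtain c where "column_sum T (tabloid_module \<nu>) (f ?e) = qscale c ?e"
    using column_sum_specht[OF T p] by blast
  then have "qscale ?n (f ?e) = qscale c ?e"
    using specht_hom_column_sum[OF T f] by (simp add: column_sum_specht_eq)
  then have "qscale (1 / ?n) (qscale ?n (f ?e)) = qscale (1 / ?n) (qscale c ?e)" by simp
  then have fe: "f ?e = qscale (c / ?n) ?e" using n by simp
  let ?h = "\<lambda>x. f x - qscale (c / ?n) x"
  have "linear_on (space (specht \<nu>)) ?h"
    by (simp add: linear_on_def linear_on_add[OF fD(1)] linear_on_scale[OF fD(1)] algebra_simps
        qvs.scale_right_distrib qvs.scale_right_diff_distrib mult.commute)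
  moreover have "?h x \<in> space (specht \<nu>)" if "x \<in> space (specht \<nu>)" for x
    using that fD(2) by (intro qvs.subspace_diff[OF Sm_subspace[OF S]] qvs.subspace_scale[OF Sm_subspace[OF S]])
  moreover have "?h (act (specht \<nu>) g x) = act (specht \<nu>) g (?h x)"
    if g: "g permutes {1..sum_list \<nu>}" and x: "x \<in> space (specht \<nu>)" for g x
    using x fD(2,3) g
    by (simp add: linear_on_diff[OF Sm_subspace[OF S] Sm_linear[OF S g]] linear_on_scale[OF Sm_linear[OF S g]]
        qvs.subspace_scale[OF Sm_subspace[OF S]])
  ultimately have h: "module_hom_on (sum_list \<nu>) (specht \<nu>) (specht \<nu>) ?h"
    by (auto simp: module_hom_on_def equivariant_def)
  have "?h x = 0" if "x \<in> space (specht \<nu>)" for x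
    by (rule specht_hom_zero[OF T S h _ that]) (simp add: fe)
  then show ?thesis by (intro exI[of _ "c / ?n"]) simp
qed

lemma specht_hom_tabloid_zero:
  assumes p: "is_partition \<nu>" "is_partition \<mu>" and m: "sum_list \<mu> = sum_list \<nu>"
    and le: "row_sum \<mu> \<le> row_sum \<nu>" and ne: "\<mu> \<noteq> \<nu>"
    and W: "Sm_module (sum_list \<nu>) W" "act W = act (tabloid_module \<mu>)" "space W \<subseteq> space (tabloid_module \<mu>)"
    and f: "module_hom_on (sum_list \<nu>) (specht \<nu>) W f" and x: "x \<in> space (specht \<nu>)"
  shows "f x = 0"
proof -
  obtain T where T: "T \<in> tableaux \<nu>" using tableaux_exists .
  have "f (polytabloid T) \<in> space W" by (rule module_hom_onD(2)[OF f polytabloid_in_specht[OF T]])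
  then have "column_sum T (tabloid_module \<mu>) (f (polytabloid T)) = 0"
    using W(3) by (intro column_sum_zero[OF T p m le ne]) auto
  then have "column_sum T W (f (polytabloid T)) = 0" by (simp add: column_sum_def W(2))
  then have "f (polytabloid T) = 0"
    using specht_hom_column_sum[OF T f] column_group_card[OF T] by simp
  then show ?thesis by (rule specht_hom_zero[OF T W(1) f _ x])
qed

definition partitions_of :: "nat \<Rightarrow> nat list set" where
  "partitions_of m = {\<nu>. is_partition \<nu> \<and> sum_list \<nu> = m}"

text \<open>
  Homomorphisms from \<open>specht \<nu>\<close> to \<open>specht \<mu>\<close> vanish if \<open>\<mu>\<close> does not have the larger row sum. The
  inner product is symmetric, so this may be assumed for different shapes.
\<close>

lemma specht_orthonormal:
  assumes "\<nu> \<in> partitions_of m" "\<mu> \<in> partitions_of m"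
  shows "char_inner m (character (specht \<nu>)) (character (specht \<mu>)) = (if \<nu> = \<mu> then 1 else 0)"
proof -
  have orth: "char_inner m (character (specht \<nu>)) (character (specht \<mu>)) = 0"
    if "\<nu> \<in> partitions_of m" "\<mu> \<in> partitions_of m" "\<nu> \<noteq> \<mu>" "row_sum \<mu> \<le> row_sum \<nu>" for \<nu> \<mu>
  proof (rule char_inner_no_hom)
    show "Sm_module m (specht \<nu>)" "Sm_module m (specht \<mu>)"
      using that(1,2) specht_Sm[of \<nu>] specht_Sm[of \<mu>] by (simp_all add: partitions_of_def)
    fix f x assume "module_hom_on m (specht \<nu>) (specht \<mu>) f" "x \<in> space (specht \<nu>)"
    then show "f x = 0"
      using that specht_Sm[of \<mu>] specht_subset[of \<mu>]
      by (intro specht_hom_tabloid_zero[of \<nu> \<mu> "specht \<mu>"]) (auto simp: partitions_of_def act_specht)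
  qed
  show ?thesis
  proof (cases "\<nu> = \<mu>")
    case True
    have "Sm_module m (specht \<nu>)" "space (specht \<nu>) \<noteq> {0}"
      using specht_simple[of \<nu>] assms by (auto simp: simple_module_def partitions_of_def)
    then have "char_inner m (character (specht \<nu>)) (character (specht \<nu>)) = 1"
      using specht_end_scalar[of \<nu>] assms by (intro char_inner_scalar_end) (auto simp: partitions_of_def)
    then show ?thesis using True by simp
  next
    case False
    then show ?thesis
      using orth[OF assms] orth[OF assms(2,1)] char_inner_commute[of m "character (specht \<nu>)"]
      by (cases "row_sum \<mu> \<le> row_sum \<nu>") auto
  qed
qed

section \<open>Cycle types and the classification of the simple modules\<close>

lemma permutes_permutation: "g permutes {1..m::nat} \<Longrightarrow> permutation g"
  by (metis finite_atLeastAtMost permutation_permutes)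

lemma card_orbit:
  assumes "permutation g"
  shows "card (orbit g x) = least_power g x"
proof -
  have "orbit g x = set (support g x)"
    unfolding support_set[OF assms] orbit_altdef_permutation[OF assms] by auto
  then show ?thesis
    using distinct_card[OF cycle_of_permutation[OF assms, of x]] by simp
qed

lemma card_orbit_pos: "permutation g \<Longrightarrow> card (orbit g x) > 0"
  by (simp add: card_orbit least_power_of_permutation)

text \<open>
  On a cycle of length \<open>c\<close> only the exponents modulo \<open>c\<close> matter.
\<close>

lemma funpow_eq_iff_cong:
  assumes g: "permutation g"
  shows "(g ^^ i) x = (g ^^ j) x \<longleftrightarrow> [i = j] (mod card (orbit g x))"
proof -
  have *: "(g ^^ i) x = (g ^^ j) x \<longleftrightarrow> [i = j] (mod card (orbit g x))" if "i \<le> j" for i j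
  proof -
    have "(g ^^ j) x = (g ^^ i) ((g ^^ (j - i)) x)"
      using that by (metis comp_apply funpow_add le_add_diff_inverse)
    moreover have "inj (g ^^ i)" using g by (simp add: bij_is_inj permutation_bijective inj_fn)
    ultimately have "(g ^^ i) x = (g ^^ j) x \<longleftrightarrow> (g ^^ (j - i)) x = x"
      by (metis injD)
    also have "\<dots> \<longleftrightarrow> card (orbit g x) dvd (j - i)"
      by (simp add: card_orbit[OF g] least_power_dvd[OF g])
    also have "\<dots> \<longleftrightarrow> [i = j] (mod card (orbit g x))"
      using that by (metis cong_altdef_nat cong_sym_eq)
    finally show ?thesis .
  qed
  show ?thesis using *[of i j] *[of j i] by (metis cong_sym_eq nat_le_linear)
qed

definition orbits :: "nat \<Rightarrow> (nat \<Rightarrow> nat) \<Rightarrow> nat set set" where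
  "orbits m g = orbit g ` {1..m}"

lemma finite_orbits [simp]: "finite (orbits m g)"
  by (simp add: orbits_def)

lemma orbits_orbit:
  assumes g: "g permutes {1..m}" and C: "C \<in> orbits m g" and x: "x \<in> C"
  shows "C = orbit g x" "x \<in> {1..m}"
proof -
  obtain y where y: "y \<in> {1..m}" "C = orbit g y" using C by (auto simp: orbits_def)
  show "C = orbit g x"
    using orbit_cyclic_eq3[OF cyclic_on_orbit[OF g finite_atLeastAtMost, of y]] x y by simp
  show "x \<in> {1..m}" using permutes_orbit_subset[OF g y(1)] x y(2) by auto
qed

lemma self_in_orbit: "g permutes {1..m::nat} \<Longrightarrow> x \<in> orbit g x"
  by (rule permutation_self_in_orbit[OF permutes_permutation])

lemma orbits_disjoint:
  assumes g: "g permutes {1..m}" and "C \<in> orbits m g" "D \<in> orbits m g" "x \<in> C" "x \<in> D"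
  shows "C = D"
  using orbits_orbit(1)[OF g] assms by metis

lemma Union_orbits:
  assumes g: "g permutes {1..m}"
  shows "\<Union> (orbits m g) = {1..m}"
proof
  show "\<Union> (orbits m g) \<subseteq> {1..m}" using orbits_orbit(2)[OF g] by blast
  show "{1..m} \<subseteq> \<Union> (orbits m g)"
    unfolding orbits_def using self_in_orbit[OF g] by blast
qed

definition cycle_type :: "nat \<Rightarrow> (nat \<Rightarrow> nat) \<Rightarrow> nat list" where
  "cycle_type m g = rev (sorted_list_of_multiset (image_mset card (mset_set (orbits m g))))"

lemma mset_cycle_type: "mset (cycle_type m g) = image_mset card (mset_set (orbits m g))"
  by (simp add: cycle_type_def)

lemma cycle_type_partition:
  assumes g: "g permutes {1..m}"
  shows "cycle_type m g \<in> partitions_of m"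
proof -
  have pos: "card C > 0" if "C \<in> orbits m g" for C
    using that card_orbit_pos[OF permutes_permutation[OF g]] by (auto simp: orbits_def)
  have "set (cycle_type m g) = card ` orbits m g"
    by (metis finite_orbits finite_set_mset_mset_set mset_cycle_type set_image_mset set_mset_mset)
  then have "0 \<notin> set (cycle_type m g)" using pos by force
  moreover have "sorted_wrt (\<ge>) (cycle_type m g)"
    unfolding cycle_type_def sorted_wrt_rev by (simp add: sorted_sorted_list_of_multiset)
  moreover have "sum_list (cycle_type m g) = m"
  proof -
    have "sum_list (cycle_type m g) = (\<Sum>C\<in>orbits m g. card C)"
      by (metis mset_cycle_type sum_mset_sum_list sum_unfold_sum_mset)
    also have "\<dots> = card (\<Union> (orbits m g))"
    proof (rule card_Union_disjoint[symmetric])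
      show "pairwise disjnt (orbits m g)"
        using orbits_disjoint[OF g] by (auto simp: pairwise_def disjnt_def)
      show "finite C" if "C \<in> orbits m g" for C
        using that pos by (metis card_gt_0_iff)
    qed
    finally show ?thesis by (simp add: Union_orbits[OF g])
  qed
  ultimately show ?thesis by (simp add: partitions_of_def is_partition_def)
qed

lemma cycle_type_inv:
  assumes "g permutes {1..m}"
  shows "cycle_type m (inv g) = cycle_type m g"
  by (simp add: cycle_type_def orbits_def orbit_inv_eq[OF permutes_permutation[OF assms]])

lemma mset_card_bij:
  assumes "finite A" "finite B" and eq: "image_mset card (mset_set A) = image_mset card (mset_set B)"
  obtains \<beta> where "bij_betw \<beta> A B" "\<And>C. C \<in> A \<Longrightarrow> card (\<beta> C) = card C"
proof -
  have "card {C\<in>A. card C = i} = card {C\<in>B. card C = i}" for i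
  proof -
    have "count (image_mset card (mset_set A)) i = count (image_mset card (mset_set B)) i" using eq by simp
    then show ?thesis
      using assms(1,2) by (simp add: count_image_mset vimage_def Int_def sum.If_cases count_mset_set' conj_commute)
  qed
  then have ex: "\<exists>b. bij_betw b {C\<in>A. card C = i} {C\<in>B. card C = i}" for i
    using assms by (intro finite_same_card_bij) auto
  define b where "b i = (SOME b. bij_betw b {C\<in>A. card C = i} {C\<in>B. card C = i})" for i
  have b: "bij_betw (b i) {C\<in>A. card C = i} {C\<in>B. card C = i}" for i
    unfolding b_def by (rule someI_ex[OF ex])
  define \<beta> where "\<beta> C = b (card C) C" for C
  have im: "\<beta> C \<in> B \<and> card (\<beta> C) = card C" if "C \<in> A" for C
    using bij_betwE[OF b[of "card C"]] that by (auto simp: \<beta>_def)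
  have "inj_on \<beta> A"
  proof (rule inj_onI)
    fix C D assume C: "C \<in> A" "D \<in> A" "\<beta> C = \<beta> D"
    then have "card C = card D" using im by metis
    then show "C = D" using C bij_betw_imp_inj_on[OF b[of "card C"]] by (auto simp: \<beta>_def inj_on_def)
  qed
  moreover have "B \<subseteq> \<beta> ` A"
  proof
    fix D assume "D \<in> B"
    then have "D \<in> b (card D) ` {C\<in>A. card C = card D}"
      using bij_betw_imp_surj_on[OF b[of "card D"]] by auto
    then obtain C where "C \<in> A" "card C = card D" "D = b (card D) C" by blast
    then have "D = \<beta> C" by (simp add: \<beta>_def)
    then show "D \<in> \<beta> ` A" using \<open>C \<in> A\<close> by blast
  qed
  ultimately have "bij_betw \<beta> A B" using im by (auto simp: bij_betw_def)
  then show ?thesis using im that by blast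
qed

text \<open>
  Match the cycles of \<open>g\<close> with cycles of \<open>h\<close> of the same length, choose a base point in each cycle and
  send \<open>g\<^sup>k b\<close> to \<open>h\<^sup>k b'\<close> for matching base points \<open>b\<close> and \<open>b'\<close>.
\<close>

lemma same_cycle_type_conjugate:
  assumes g: "g permutes {1..m}" and h: "h permutes {1..m}" and eq: "cycle_type m g = cycle_type m h"
  obtains s where "s permutes {1..m}" "h = s \<circ> g \<circ> inv s"
proof -
  note gp = permutes_permutation[OF g] and hp = permutes_permutation[OF h]
  have "image_mset card (mset_set (orbits m g)) = image_mset card (mset_set (orbits m h))"
    using eq mset_cycle_type by metis
  then obtain \<beta> where \<beta>: "bij_betw \<beta> (orbits m g) (orbits m h)" "\<And>C. C \<in> orbits m g \<Longrightarrow> card (\<beta> C) = card C"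
    by (rule mset_card_bij[rotated 2]) auto
  define b where "b C = (SOME x. x \<in> C)" for C :: "nat set"
  have b: "b C \<in> C" if "C \<in> orbits m g \<or> C \<in> orbits m h" for C
  proof -
    have "C \<noteq> {}" using that orbit_nonempty unfolding orbits_def by (metis imageE)
    then show ?thesis unfolding b_def by (simp add: some_in_eq)
  qed
  define k where "k x = (SOME k. (g ^^ k) (b (orbit g x)) = x)" for x
  have og: "orbit g x \<in> orbits m g" if "x \<in> {1..m}" for x using that by (simp add: orbits_def)
  have k: "(g ^^ k x) (b (orbit g x)) = x" if x: "x \<in> {1..m}" for x
    unfolding k_def
  proof (rule someI_ex)
    have "b (orbit g x) \<in> orbit g x" using b og[OF x] by blast
    then have "x \<in> orbit g (b (orbit g x))"
      using orbits_orbit(1)[OF g og[OF x]] self_in_orbit[OF g] by metis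
    moreover have "\<exists>k. (g ^^ k) y = x" if "x \<in> orbit g y" for y
      using that orbit_altdef_permutation[OF gp, of y] by auto
    ultimately show "\<exists>k. (g ^^ k) (b (orbit g x)) = x" by blast
  qed
  define b' where "b' x = b (\<beta> (orbit g x))" for x
  have b': "\<beta> (orbit g x) = orbit h (b' x)" "b' x \<in> {1..m}" "card (orbit h (b' x)) = card (orbit g (b (orbit g x)))"
    if x: "x \<in> {1..m}" for x
  proof -
    have B: "\<beta> (orbit g x) \<in> orbits m h" using \<beta>(1) og[OF x] by (auto simp: bij_betw_def)
    then have bb: "b' x \<in> \<beta> (orbit g x)" using b by (simp add: b'_def)
    show 1: "\<beta> (orbit g x) = orbit h (b' x)" "b' x \<in> {1..m}" using orbits_orbit[OF h B bb] by auto
    have "orbit g (b (orbit g x)) = orbit g x" using orbits_orbit(1)[OF g og[OF x]] b og[OF x] by metis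
    then show "card (orbit h (b' x)) = card (orbit g (b (orbit g x)))" using \<beta>(2)[OF og[OF x]] 1 by simp
  qed
  define s where "s x = (if x \<in> {1..m} then (h ^^ k x) (b' x) else x)" for x
  have s: "s x = (h ^^ k x) (b' x)" if "x \<in> {1..m}" for x using that by (simp add: s_def)
  have s_orbit: "s x \<in> orbit h (b' x)" if "x \<in> {1..m}" for x
    unfolding s[OF that] by (rule funpow_in_orbit[OF self_in_orbit[OF h]])
  have sm: "s x \<in> {1..m}" if "x \<in> {1..m}" for x
    using s_orbit[OF that] permutes_orbit_subset[OF h b'(2)[OF that]] by blast
  have inj: "inj_on s {1..m}"
  proof (rule inj_onI)
    fix x y assume xy: "x \<in> {1..m}" "y \<in> {1..m}" "s x = s y"
    have "\<beta> (orbit g x) = orbit h (s x)" if "x \<in> {1..m}" for x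
      using b'(1)[OF that] s_orbit[OF that] orbits_orbit(1)[OF h] b'(2)[OF that]
      by (metis imageI orbits_def)
    then have "\<beta> (orbit g x) = \<beta> (orbit g y)" using xy by metis
    then have o: "orbit g x = orbit g y"
      using \<beta>(1) og xy by (auto simp: bij_betw_def inj_on_def)
    then have bb: "b' x = b' y" by (simp add: b'_def)
    then have "[k x = k y] (mod card (orbit g (b (orbit g x))))"
      using xy s funpow_eq_iff_cong[OF hp] b'(3)[OF xy(1)] by metis
    then show "x = y" using funpow_eq_iff_cong[OF gp] k xy o by metis
  qed
  have "s ` {1..m} \<subseteq> {1..m}" using sm by blast
  then have "s ` {1..m} = {1..m}" using inj by (simp add: endo_inj_surj)
  then have sp: "s permutes {1..m}"
    using inj by (intro bij_imp_permutes) (auto simp: bij_betw_def s_def)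
  have "h (s x) = s (g x)" for x
  proof (cases "x \<in> {1..m}")
    case True
    then have gx: "g x \<in> {1..m}" using permutes_in_image[OF g] by blast
    have o: "orbit g (g x) = orbit g x" using permutation_orbit_step[OF gp] .
    have "(g ^^ k (g x)) (b (orbit g x)) = (g ^^ Suc (k x)) (b (orbit g x))"
      using k[OF gx] k[OF True] o by simp
    then have "[k (g x) = Suc (k x)] (mod card (orbit h (b' x)))"
      using funpow_eq_iff_cong[OF gp] b'(3)[OF True] by metis
    then have "(h ^^ k (g x)) (b' x) = (h ^^ Suc (k x)) (b' x)"
      using funpow_eq_iff_cong[OF hp] by metis
    then show ?thesis using s[OF gx] s[OF True] o by (simp add: b'_def)
  next
    case False
    then show ?thesis using permutes_not_in[OF g] permutes_not_in[OF h] by (auto simp: s_def)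
  qed
  then have "h \<circ> s = s \<circ> g" by auto
  then have "h = s \<circ> g \<circ> inv s"
    using permutes_inv_o(1)[OF sp] by (metis comp_assoc comp_id)
  then show ?thesis using that sp by blast
qed

lemma character_cycle_type:
  assumes W: "Sm_module m W" and g: "g permutes {1..m}" and h: "h permutes {1..m}"
    and eq: "cycle_type m g = cycle_type m h"
  shows "character W g = character W h"
proof -
  obtain s where "s permutes {1..m}" "h = s \<circ> g \<circ> inv s" using same_cycle_type_conjugate[OF g h eq] .
  then show ?thesis using character_conj[OF W g] by simp
qed

lemma character_inv: "Sm_module m W \<Longrightarrow> g permutes {1..m} \<Longrightarrow> character W (inv g) = character W g"
  by (intro character_cycle_type perms_inv cycle_type_inv)

lemma finite_partitions_of: "finite (partitions_of m)"
proof (rule finite_subset)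
  have "length \<nu> \<le> sum_list \<nu>" if "0 \<notin> set \<nu>" for \<nu> :: "nat list"
    using that by (induction \<nu>) auto
  then show "partitions_of m \<subseteq> {\<nu>. set \<nu> \<subseteq> {0..m} \<and> length \<nu> \<le> m}"
    by (auto simp: partitions_of_def is_partition_def member_le_sum_list)
  show "finite {\<nu>. set \<nu> \<subseteq> {0..m} \<and> length \<nu> \<le> m}"
    by (rule finite_lists_length_le) simp
qed

lemma character_nonzero_id:
  assumes W: "Sm_module m W" and ne: "space W \<noteq> {0}"
  shows "character W id \<noteq> 0"
proof -
  obtain B where B: "basis_of B (space W)" using Sm_basis[OF W] .
  have "B \<noteq> {}"
  proof
    assume "B = {}"
    then show False using B ne qvs.span_empty by (metis basis_of_def)
  qed
  then show ?thesis using B character_id[OF W B] by (simp add: basis_of_def)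
qed

lemma char_inner_self_pos:
  assumes W: "Sm_module m W" and ne: "space W \<noteq> {0}"
  shows "char_inner m (character W) (character W) > 0"
proof -
  have "(\<Sum>g | g permutes {1..m}. character W g * character W (inv g)) =
        (\<Sum>g | g permutes {1..m}. character W g * character W g)"
    by (intro sum.cong refl) (simp add: character_inv[OF W])
  moreover have "(\<Sum>g | g permutes {1..m}. character W g * character W g) > 0"
    by (rule sum_pos2[of _ id])
      (use character_nonzero_id[OF W ne] in \<open>auto simp: permutes_id zero_less_mult_iff linorder_neq_iff\<close>)
  ultimately show ?thesis by (simp add: char_inner_def)
qed

text \<open>
  A class function as a vector, so that linear independence and dimension bounds apply to it.
\<close>

definition class_vec :: "nat \<Rightarrow> ((nat \<Rightarrow> nat) \<Rightarrow> rat) \<Rightarrow> ((nat \<Rightarrow> nat) \<Rightarrow>\<^sub>0 rat)" where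
  "class_vec m \<phi> = (\<Sum>g | g permutes {1..m}. qscale (\<phi> g) (bvec g))"

lemma class_vec_in_span:
  assumes "\<And>g h. g permutes {1..m} \<Longrightarrow> h permutes {1..m} \<Longrightarrow> cycle_type m g = cycle_type m h \<Longrightarrow> \<phi> g = \<phi> h"
  shows "class_vec m \<phi> \<in> qvs.span ((\<lambda>\<nu>. \<Sum>g | g permutes {1..m} \<and> cycle_type m g = \<nu>. bvec g) ` partitions_of m)"
proof -
  define r where "r \<nu> = (SOME g. g permutes {1..m} \<and> cycle_type m g = \<nu>)" for \<nu>
  have r: "\<phi> g = \<phi> (r (cycle_type m g))" if g: "g permutes {1..m}" for g
  proof -
    have "r (cycle_type m g) permutes {1..m} \<and> cycle_type m (r (cycle_type m g)) = cycle_type m g"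
      unfolding r_def by (rule someI[of _ g]) (use g in simp)
    then show ?thesis using assms g by metis
  qed
  have "class_vec m \<phi> = (\<Sum>\<nu>\<in>partitions_of m. \<Sum>g | g \<in> {g. g permutes {1..m}} \<and> cycle_type m g = \<nu>. qscale (\<phi> g) (bvec g))"
    unfolding class_vec_def
    by (rule sum.group[symmetric]) (auto simp: finite_partitions_of cycle_type_partition)
  also have "\<dots> = (\<Sum>\<nu>\<in>partitions_of m. qscale (\<phi> (r \<nu>)) (\<Sum>g | g permutes {1..m} \<and> cycle_type m g = \<nu>. bvec g))"
    unfolding qvs.scale_sum_right by (intro sum.cong refl) (auto simp: r)
  also have "\<dots> \<in> qvs.span ((\<lambda>\<nu>. \<Sum>g | g permutes {1..m} \<and> cycle_type m g = \<nu>. bvec g) ` partitions_of m)"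
    by (intro qvs.span_sum qvs.span_scale qvs.span_base) auto
  finally show ?thesis .
qed

text \<open>
  Class functions are determined by their values on the cycle types, which are partitions of \<open>m\<close>.
  Orthogonal ones with nonzero squares are linearly independent.
\<close>

lemma orthogonal_class_functions_bound:
  assumes fin: "finite I"
    and cl: "\<And>i g h. i \<in> I \<Longrightarrow> g permutes {1..m} \<Longrightarrow> h permutes {1..m} \<Longrightarrow> cycle_type m g = cycle_type m h \<Longrightarrow> \<Phi> i g = \<Phi> i h"
    and orth: "\<And>i j. i \<in> I \<Longrightarrow> j \<in> I \<Longrightarrow> i \<noteq> j \<Longrightarrow> char_inner m (\<Phi> i) (\<Phi> j) = 0"
    and ne: "\<And>i. i \<in> I \<Longrightarrow> char_inner m (\<Phi> i) (\<Phi> i) \<noteq> 0"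
  shows "card I \<le> card (partitions_of m)"
proof -
  let ?v = "\<lambda>i. class_vec m (\<Phi> i)"
  let ?Z = "(\<lambda>\<nu>. \<Sum>g | g permutes {1..m} \<and> cycle_type m g = \<nu>. bvec g) ` partitions_of m"
  define F where "F j x = (\<Sum>g | g permutes {1..m}. Poly_Mapping.lookup x g * \<Phi> j (inv g)) / fact m" for j x
  have F: "F j (?v i) = char_inner m (\<Phi> i) (\<Phi> j)" for i j
  proof -
    have "Poly_Mapping.lookup (?v i) g = \<Phi> i g" if "g permutes {1..m}" for g
      using that unfolding class_vec_def
      by (simp add: lookup_sum lookup_single when_def if_distrib sum.delta cong: if_cong)
    then show ?thesis by (simp add: F_def char_inner_def)
  qed
  have Fsum: "F j (\<Sum>i\<in>I. qscale (c i) (x i)) = (\<Sum>i\<in>I. c i * F j (x i))" for j c x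
    unfolding F_def
    by (simp add: lookup_sum sum_distrib_right sum_divide_distrib sum_distrib_left algebra_simps) (rule sum.swap)
  have inj: "inj_on ?v I"
  proof (rule inj_onI, rule ccontr)
    fix i j assume "i \<in> I" "j \<in> I" "?v i = ?v j" "i \<noteq> j"
    then show False using F[of j i] F[of j j] orth[of i j] ne[of j] by simp
  qed
  have "qvs.independent (?v ` I)"
  proof (rule qvs.independent_if_scalars_zero)
    fix f x assume s: "(\<Sum>x\<in>?v ` I. qscale (f x) x) = 0" and "x \<in> ?v ` I"
    then obtain j where j: "j \<in> I" "x = ?v j" by blast
    have "(\<Sum>i\<in>I. qscale (f (?v i)) (?v i)) = 0" using s by (simp add: sum.reindex[OF inj])
    then have "(\<Sum>i\<in>I. f (?v i) * char_inner m (\<Phi> i) (\<Phi> j)) = F j 0"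
      using Fsum[of j "\<lambda>i. f (?v i)" ?v] by (simp add: F)
    also have "F j 0 = 0" by (simp add: F_def)
    also have "(\<Sum>i\<in>I. f (?v i) * char_inner m (\<Phi> i) (\<Phi> j)) = (\<Sum>i\<in>I. if i = j then f x * char_inner m (\<Phi> j) (\<Phi> j) else 0)"
      using j orth by (intro sum.cong refl) auto
    also have "\<dots> = f x * char_inner m (\<Phi> j) (\<Phi> j)" using j fin by simp
    finally show "f x = 0" using ne[OF j(1)] by simp
  qed (use fin in simp)
  moreover have "?v ` I \<subseteq> qvs.span ?Z"
  proof
    fix x assume "x \<in> ?v ` I"
    then obtain i where "i \<in> I" "x = ?v i" by blast
    moreover have "?v i \<in> qvs.span ?Z" by (rule class_vec_in_span) (rule cl[OF \<open>i \<in> I\<close>])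
    ultimately show "x \<in> qvs.span ?Z" by simp
  qed
  ultimately have "card (?v ` I) \<le> card ?Z"
    using qvs.independent_span_bound[of ?Z "?v ` I"] finite_partitions_of by simp
  also have "\<dots> \<le> card (partitions_of m)" by (rule card_image_le[OF finite_partitions_of])
  finally show ?thesis by (simp add: card_image[OF inj])
qed

lemma partitions_of_Sm: "\<nu> \<in> partitions_of m \<Longrightarrow> Sm_module m (specht \<nu>)"
  using specht_Sm[of \<nu>] by (simp add: partitions_of_def)

lemma partitions_of_simple: "\<nu> \<in> partitions_of m \<Longrightarrow> simple_module m (specht \<nu>)"
  using specht_simple[of \<nu>] by (auto simp: partitions_of_def)

text \<open>
  The characters of the Specht modules already are as many orthogonal class functions as there are
  cycle types. The character of another simple module would be one more.
\<close>

theorem simple_is_specht: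
  assumes W: "simple_module m W"
  obtains \<nu> where "\<nu> \<in> partitions_of m" "rep_iso m (specht \<nu>) W"
proof -
  have "\<exists>\<nu>\<in>partitions_of m. rep_iso m (specht \<nu>) W"
  proof (rule ccontr)
    assume no: "\<not> (\<exists>\<nu>\<in>partitions_of m. rep_iso m (specht \<nu>) W)"
    have WS: "Sm_module m W" and Wne: "space W \<noteq> {0}" using W by (auto simp: simple_module_def)
    have orth: "char_inner m (character (specht \<nu>)) (character W) = 0" if \<nu>: "\<nu> \<in> partitions_of m" for \<nu>
    proof (rule char_inner_no_hom[OF partitions_of_Sm[OF \<nu>] WS], rule ccontr)
      fix f x assume f: "module_hom_on m (specht \<nu>) W f" "x \<in> space (specht \<nu>)" "f x \<noteq> 0"
      have "rep_iso m (specht \<nu>) W"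
        using schur[OF partitions_of_simple[OF \<nu>] W f] f(1) by (auto simp: rep_iso_iff)
      then show False using no \<nu> by blast
    qed
    let ?I = "insert None (Some ` partitions_of m)"
    let ?\<Phi> = "\<lambda>i. case i of None \<Rightarrow> character W | Some \<nu> \<Rightarrow> character (specht \<nu>)"
    have "card ?I \<le> card (partitions_of m)"
    proof (rule orthogonal_class_functions_bound[where \<Phi> = ?\<Phi>])
      show "finite ?I" by (simp add: finite_partitions_of)
    next
      fix i g h assume "i \<in> ?I" "g permutes {1..m}" "h permutes {1..m}" "cycle_type m g = cycle_type m h"
      then show "?\<Phi> i g = ?\<Phi> i h"
        using character_cycle_type[OF WS, of g h] character_cycle_type[OF partitions_of_Sm, of _ m g h] by auto
    next
      fix i j assume "i \<in> ?I" "j \<in> ?I" "i \<noteq> j"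
      then show "char_inner m (?\<Phi> i) (?\<Phi> j) = 0"
        using orth specht_orthonormal[of _ m] char_inner_commute[of m "character W"]
        by (auto split: if_splits)
    next
      fix i assume "i \<in> ?I"
      then show "char_inner m (?\<Phi> i) (?\<Phi> i) \<noteq> 0"
        using char_inner_self_pos[OF WS Wne] specht_orthonormal[of _ m] by auto
    qed
    moreover have "card ?I = Suc (card (partitions_of m))"
      using finite_partitions_of by (subst card_insert_disjoint) (auto simp: card_image)
    ultimately show False by simp
  qed
  then show ?thesis using that by blast
qed

subsection \<open>Multiplicities\<close>

lemma zero_module_character:
  assumes "space W = {0}"
  shows "character W g = 0"
proof -
  have "C = {}" if "qvs.independent C \<and> qvs.span C = {0}" for C :: "('a \<Rightarrow>\<^sub>0 rat) set"
  proof -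
    have "C \<subseteq> {0}" "0 \<notin> C" using that qvs.span_superset[of C] qvs.dependent_zero[of C] by auto
    then show ?thesis by blast
  qed
  moreover have "qvs.independent ({} :: ('a \<Rightarrow>\<^sub>0 rat) set) \<and> qvs.span ({} :: ('a \<Rightarrow>\<^sub>0 rat) set) = {0}"
    using qvs.independent_empty by simp
  ultimately have "(SOME C. qvs.independent C \<and> qvs.span C = space W) = ({} :: ('a \<Rightarrow>\<^sub>0 rat) set)"
    unfolding assms by (rule some_equality[rotated])
  then show ?thesis by (simp add: character_def trace_on_def)
qed

lemma direct_summands_subset:
  assumes "invariant_subspace m W S" "invariant_subspace m W V'"
    and V: "{u + u' | u u'. u \<in> S \<and> u' \<in> V'} = V"
  shows "S \<subseteq> V" "V' \<subseteq> V"
proof -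
  have 0: "0 \<in> S" "0 \<in> V'" using assms(1,2) qvs.subspace_0 by (auto simp: invariant_subspace_def)
  show "S \<subseteq> V"
  proof
    fix u assume "u \<in> S"
    then show "u \<in> V" using 0 V by (metis (mono_tags, lifting) add_0_right mem_Collect_eq)
  qed
  show "V' \<subseteq> V"
  proof
    fix u assume "u \<in> V'"
    then show "u \<in> V" using 0 V by (metis (mono_tags, lifting) add_0_left mem_Collect_eq)
  qed
qed

text \<open>
  The decomposition of a module into Specht modules, on the level of characters. A constituent with
  positive multiplicity can be embedded.
\<close>

lemma character_decomposition:
  assumes W: "Sm_module m W" and U: "invariant_subspace m W U"
  shows "\<exists>c :: nat list \<Rightarrow> nat.
    (\<forall>g. g permutes {1..m} \<longrightarrow>
       character (W\<lparr>space := U\<rparr>) g = (\<Sum>\<nu>\<in>partitions_of m. of_nat (c \<nu>) * character (specht \<nu>) g)) \<and>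
    (\<forall>\<nu>\<in>partitions_of m. c \<nu> > 0 \<longrightarrow> (\<exists>f. module_hom_on m (specht \<nu>) (W\<lparr>space := U\<rparr>) f \<and> inj_on f (space (specht \<nu>))))"
  using W U
proof (induction rule: submodule_induct)
  case zero
  show ?case by (rule exI[of _ "\<lambda>_. 0"]) (simp add: zero_module_character)
next
  case (step V S V')
  note WV = Sm_submodule[OF W step.hyps(1)] and WS = Sm_submodule[OF W step.hyps(2)]
  obtain c where c: "\<And>g. g permutes {1..m} \<Longrightarrow>
       character (W\<lparr>space := V'\<rparr>) g = (\<Sum>\<nu>\<in>partitions_of m. of_nat (c \<nu>) * character (specht \<nu>) g)"
    "\<And>\<nu>. \<nu> \<in> partitions_of m \<Longrightarrow> c \<nu> > 0 \<Longrightarrow>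
       \<exists>f. module_hom_on m (specht \<nu>) (W\<lparr>space := V'\<rparr>) f \<and> inj_on f (space (specht \<nu>))"
    using step.IH by blast
  obtain \<mu> where \<mu>: "\<mu> \<in> partitions_of m" "rep_iso m (specht \<mu>) (W\<lparr>space := S\<rparr>)"
    using simple_is_specht[OF step.hyps(4)] .
  note sub = direct_summands_subset[OF step.hyps(2,3,6)]
  have extend: "module_hom_on m (specht \<nu>) (W\<lparr>space := V\<rparr>) f"
    if "module_hom_on m (specht \<nu>) (W\<lparr>space := X\<rparr>) f" "X \<subseteq> V" for X \<nu> f
    using that by (auto simp: module_hom_on_def equivariant_def)
  let ?c = "\<lambda>\<nu>. if \<nu> = \<mu> then Suc (c \<nu>) else c \<nu>"
  have "character (W\<lparr>space := V\<rparr>) g = (\<Sum>\<nu>\<in>partitions_of m. of_nat (?c \<nu>) * character (specht \<nu>) g)"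
    if g: "g permutes {1..m}" for g
  proof -
    have S': "invariant_subspace m (W\<lparr>space := V\<rparr>) S" "invariant_subspace m (W\<lparr>space := V\<rparr>) V'"
      using step.hyps(2,3) sub by (auto simp: invariant_subspace_def)
    have "character (W\<lparr>space := V\<rparr>) g = character (W\<lparr>space := S\<rparr>) g + character (W\<lparr>space := V'\<rparr>) g"
      using character_direct_sum[OF WV S' step.hyps(5) _ g] step.hyps(6) by simp
    also have "character (W\<lparr>space := S\<rparr>) g = character (specht \<mu>) g"
      by (rule character_rep_iso[OF partitions_of_Sm[OF \<mu>(1)] WS \<mu>(2) g, symmetric])
    also have "\<dots> = (\<Sum>\<nu>\<in>partitions_of m. if \<nu> = \<mu> then character (specht \<nu>) g else 0)"
      using \<mu>(1) finite_partitions_of by simp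
    also have "\<dots> + character (W\<lparr>space := V'\<rparr>) g =
       (\<Sum>\<nu>\<in>partitions_of m. (if \<nu> = \<mu> then character (specht \<nu>) g else 0) + of_nat (c \<nu>) * character (specht \<nu>) g)"
      by (simp add: c(1)[OF g] sum.distrib)
    also have "\<dots> = (\<Sum>\<nu>\<in>partitions_of m. of_nat (?c \<nu>) * character (specht \<nu>) g)"
      by (intro sum.cong refl) (simp add: algebra_simps)
    finally show ?thesis .
  qed
  moreover have "\<exists>f. module_hom_on m (specht \<nu>) (W\<lparr>space := V\<rparr>) f \<and> inj_on f (space (specht \<nu>))"
    if \<nu>: "\<nu> \<in> partitions_of m" "?c \<nu> > 0" for \<nu>
  proof (cases "\<nu> = \<mu>")
    case True
    obtain f where "module_hom_on m (specht \<mu>) (W\<lparr>space := S\<rparr>) f" "bij_betw f (space (specht \<mu>)) S"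
      using \<mu>(2) by (auto simp: rep_iso_iff)
    then show ?thesis using extend sub(1) True by (auto simp: bij_betw_def)
  next
    case False
    then show ?thesis using c(2)[OF \<nu>(1)] \<nu>(2) extend sub(2) by fastforce
  qed
  ultimately show ?case by (intro exI[of _ ?c]) blast
qed

definition mult :: "nat \<Rightarrow> ((nat \<Rightarrow> nat) \<Rightarrow> rat) \<Rightarrow> nat list \<Rightarrow> rat" where
  "mult m \<phi> \<nu> = char_inner m \<phi> (character (specht \<nu>))"

lemma mult_combination:
  assumes "\<And>g. g permutes {1..m} \<Longrightarrow> \<phi> g = (\<Sum>\<nu>\<in>partitions_of m. c \<nu> * character (specht \<nu>) g)"
    and \<nu>: "\<nu> \<in> partitions_of m"
  shows "mult m \<phi> \<nu> = c \<nu>"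
proof -
  have "mult m \<phi> \<nu> = char_inner m (\<lambda>g. \<Sum>\<mu>\<in>partitions_of m. c \<mu> * character (specht \<mu>) g) (character (specht \<nu>))"
    unfolding mult_def by (rule char_inner_cong) (use assms(1) in auto)
  also have "\<dots> = (\<Sum>\<mu>\<in>partitions_of m. c \<mu> * (if \<mu> = \<nu> then 1 else 0))"
    using \<nu> by (simp add: char_inner_sum char_inner_scale specht_orthonormal)
  also have "\<dots> = c \<nu>" using \<nu> finite_partitions_of by (simp add: if_distrib sum.delta cong: if_cong)
  finally show ?thesis .
qed

lemma
  assumes W: "Sm_module m W"
  shows character_expansion:
      "g permutes {1..m} \<Longrightarrow> character W g = (\<Sum>\<nu>\<in>partitions_of m. mult m (character W) \<nu> * character (specht \<nu>) g)"
    and mult_nat: "\<nu> \<in> partitions_of m \<Longrightarrow> \<exists>n. mult m (character W) \<nu> = of_nat n"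
    and mult_embedding: "\<nu> \<in> partitions_of m \<Longrightarrow> mult m (character W) \<nu> \<noteq> 0 \<Longrightarrow>
      \<exists>f. module_hom_on m (specht \<nu>) W f \<and> inj_on f (space (specht \<nu>))"
proof -
  have inv: "invariant_subspace m W (space W)"
    using W by (simp add: invariant_subspace_def Sm_module_def)
  obtain c :: "nat list \<Rightarrow> nat" where c:
    "\<And>g. g permutes {1..m} \<Longrightarrow> character W g = (\<Sum>\<nu>\<in>partitions_of m. of_nat (c \<nu>) * character (specht \<nu>) g)"
    "\<And>\<nu>. \<nu> \<in> partitions_of m \<Longrightarrow> c \<nu> > 0 \<Longrightarrow> \<exists>f. module_hom_on m (specht \<nu>) W f \<and> inj_on f (space (specht \<nu>))"
    using character_decomposition[OF W inv] by auto
  have mc: "mult m (character W) \<nu> = of_nat (c \<nu>)" if "\<nu> \<in> partitions_of m" for \<nu>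
    by (rule mult_combination[OF _ that]) (use c(1) in simp)
  show "g permutes {1..m} \<Longrightarrow> character W g = (\<Sum>\<nu>\<in>partitions_of m. mult m (character W) \<nu> * character (specht \<nu>) g)"
    using c(1) mc by simp
  show "\<nu> \<in> partitions_of m \<Longrightarrow> \<exists>n. mult m (character W) \<nu> = of_nat n" using mc by blast
  show "\<nu> \<in> partitions_of m \<Longrightarrow> mult m (character W) \<nu> \<noteq> 0 \<Longrightarrow>
      \<exists>f. module_hom_on m (specht \<nu>) W f \<and> inj_on f (space (specht \<nu>))" using mc c(2) by simp
qed

subsection \<open>Decomposition into a direct sum of Specht modules\<close>

lemma lookup_component [simp]: "Poly_Mapping.lookup (component i x) a = Poly_Mapping.lookup x (i, a)"
proof -
  have "Poly_Mapping.lookup (component i x) a =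
     (\<Sum>k\<in>Poly_Mapping.keys x. Poly_Mapping.lookup x k * (if k = (i, a) then 1 else 0))"
    unfolding component_def lin_ext_def lookup_sum
    by (intro sum.cong refl) (auto simp: lookup_single when_def split: prod.splits)
  also have "\<dots> = (\<Sum>k\<in>Poly_Mapping.keys x. if k = (i, a) then Poly_Mapping.lookup x k else 0)"
    by (intro sum.cong refl) auto
  finally show ?thesis by (simp add: in_keys_iff)
qed

lemma lookup_inject [simp]:
  "Poly_Mapping.lookup (inject i x) k = (if fst k = i then Poly_Mapping.lookup x (snd k) else 0)"
proof -
  have "Poly_Mapping.lookup (inject i x) k =
     (\<Sum>a\<in>Poly_Mapping.keys x. Poly_Mapping.lookup x a * (if (i, a) = k then 1 else 0))"
    unfolding inject_def lin_ext_def lookup_sum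
    by (intro sum.cong refl) (auto simp: lookup_single when_def)
  also have "\<dots> = (\<Sum>a\<in>Poly_Mapping.keys x. if a = snd k then (if fst k = i then Poly_Mapping.lookup x a else 0) else 0)"
    by (intro sum.cong refl) (auto split: prod.splits)
  finally show ?thesis by (simp add: in_keys_iff)
qed

lemma component_inject: "component j (inject i x) = (if i = j then x else 0)"
  by (rule poly_mapping_eqI) auto

lemma component_add: "component i (x + y) = component i x + component i y"
  by (rule poly_mapping_eqI) (simp add: lookup_add)

lemma inject_add: "inject i (x + y) = inject i x + inject i y"
  by (rule poly_mapping_eqI) (simp add: lookup_add)

lemma inject_scale: "inject i (qscale c x) = qscale c (inject i x)"
  by (rule poly_mapping_eqI) simp

lemma inject_zero [simp]: "inject i 0 = 0"
  by (rule poly_mapping_eqI) simp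

lemma component_zero [simp]: "component i 0 = 0"
  by (rule poly_mapping_eqI) simp

lemma component_scale: "component i (qscale c x) = qscale c (component i x)"
  by (rule poly_mapping_eqI) simp

lemma component_outside: "fst ` Poly_Mapping.keys x \<subseteq> I \<Longrightarrow> i \<notin> I \<Longrightarrow> component i x = 0"
proof (rule poly_mapping_eqI)
  fix k assume "fst ` Poly_Mapping.keys x \<subseteq> I" "i \<notin> I"
  then have "(i, k) \<notin> Poly_Mapping.keys x" by force
  then show "Poly_Mapping.lookup (component i x) k = Poly_Mapping.lookup 0 k" by (simp add: in_keys_iff)
qed

lemma sum_inject_component:
  assumes "finite I" "fst ` Poly_Mapping.keys x \<subseteq> I"
  shows "(\<Sum>i\<in>I. inject i (component i x)) = x"
proof (rule poly_mapping_eqI)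
  fix k
  have "Poly_Mapping.lookup (\<Sum>i\<in>I. inject i (component i x)) k =
     (\<Sum>i\<in>I. if i = fst k then Poly_Mapping.lookup x k else 0)"
    unfolding lookup_sum by (intro sum.cong refl) auto
  also have "\<dots> = Poly_Mapping.lookup x k"
    using assms by (auto simp: in_keys_iff image_subset_iff)
  finally show "Poly_Mapping.lookup (\<Sum>i\<in>I. inject i (component i x)) k = Poly_Mapping.lookup x k" .
qed

lemma space_direct_sum:
  "x \<in> space (direct_sum I V) \<longleftrightarrow> fst ` Poly_Mapping.keys x \<subseteq> I \<and> (\<forall>i\<in>I. component i x \<in> space (V i))"
  by (simp add: direct_sum_def)

lemma act_direct_sum: "act (direct_sum I V) g x = (\<Sum>i\<in>I. inject i (act (V i) g (component i x)))"
  by (simp add: direct_sum_def)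

lemma keys_inject: "Poly_Mapping.keys (inject i x) \<subseteq> {i} \<times> Poly_Mapping.keys x"
  by (auto simp: in_keys_iff split: if_splits)

lemma keys_sum_inject: "fst ` Poly_Mapping.keys (\<Sum>i\<in>I. inject i (f i)) \<subseteq> I"
proof -
  have "Poly_Mapping.keys (\<Sum>i\<in>I. inject i (f i)) \<subseteq> (\<Union>i\<in>I. Poly_Mapping.keys (inject i (f i)))"
    by (rule keys_sum)
  then show ?thesis using keys_inject by fastforce
qed

lemma direct_sum_empty: "space (direct_sum {} V) = {0}"
  by (auto simp: direct_sum_def)

text \<open>
  The induction step of the decomposition: one more internal summand corresponds to one more index
  of the external direct sum.
\<close>

lemma direct_sum_insert:
  assumes fin: "finite I" and i: "i \<notin> I"
    and W: "Sm_module m W" and S: "invariant_subspace m W S" and V': "invariant_subspace m W V'"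
    and 0: "S \<inter> V' = {0}" and sum: "{u + u' | u u'. u \<in> S \<and> u' \<in> V'} = U"
    and isoS: "rep_iso m (W\<lparr>space := S\<rparr>) (V i)"
    and isoV: "rep_iso m (W\<lparr>space := V'\<rparr>) (direct_sum I V)"
    and sp: "\<And>j. j \<in> I \<Longrightarrow> qvs.subspace (space (V j))"
    and z: "\<And>j g. j \<in> insert i I \<Longrightarrow> g permutes {1..m} \<Longrightarrow> act (V j) g 0 = 0"
  shows "rep_iso m (W\<lparr>space := U\<rparr>) (direct_sum (insert i I) V)"
proof -
  obtain \<alpha> where \<alpha>: "module_hom_on m (W\<lparr>space := S\<rparr>) (V i) \<alpha>" "bij_betw \<alpha> S (space (V i))"
    using isoS by (auto simp: rep_iso_iff)
  obtain \<beta> where \<beta>: "module_hom_on m (W\<lparr>space := V'\<rparr>) (direct_sum I V) \<beta>" "bij_betw \<beta> V' (space (direct_sum I V))"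
    using isoV by (auto simp: rep_iso_iff)
  note \<alpha>D = module_hom_onD[OF \<alpha>(1), simplified] and \<beta>D = module_hom_onD[OF \<beta>(1), simplified]
  have Sg: "act W g x \<in> S" if "g permutes {1..m}" "x \<in> S" for g x
    using S that by (auto simp: invariant_subspace_def)
  have Vg: "act W g x \<in> V'" if "g permutes {1..m}" "x \<in> V'" for g x
    using V' that by (auto simp: invariant_subspace_def)
  have SS: "qvs.subspace S" and VS: "qvs.subspace V'" and SW: "S \<subseteq> space W" and VW: "V' \<subseteq> space W"
    using S V' by (auto simp: invariant_subspace_def)
  define pr where "pr x = (SOME u. u \<in> S \<and> (\<exists>u'\<in>V'. x = u + u'))" for x
  have uniq: "u = v \<and> u' = v'" if "u \<in> S" "v \<in> S" "u' \<in> V'" "v' \<in> V'" "u + u' = v + v'" for u v u' v'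
  proof -
    have "u - v = v' - u'" using that(5) by (simp add: algebra_simps)
    moreover have "u - v \<in> S" "v' - u' \<in> V'" using qvs.subspace_diff[OF SS] qvs.subspace_diff[OF VS] that by auto
    ultimately have "u - v \<in> S \<inter> V'" by simp
    then have "u - v = 0" using 0 by blast
    then show ?thesis using that(5) by simp
  qed
  have pr: "pr (u + u') = u" if "u \<in> S" "u' \<in> V'" for u u'
  proof -
    have "pr (u + u') \<in> S \<and> (\<exists>w\<in>V'. u + u' = pr (u + u') + w)"
      unfolding pr_def by (rule someI[of _ u]) (use that in blast)
    then obtain w where "pr (u + u') \<in> S" "w \<in> V'" "u + u' = pr (u + u') + w" by blast
    then show ?thesis using uniq[of "pr (u + u')" u w u'] that by simp
  qed
  define F where "F x = inject i (\<alpha> (pr x)) + \<beta> (x - pr x)" for x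
  have F: "F (u + u') = inject i (\<alpha> u) + \<beta> u'" if "u \<in> S" "u' \<in> V'" for u u'
    using pr[OF that] by (simp add: F_def)
  have UE: "\<exists>u\<in>S. \<exists>u'\<in>V'. x = u + u'" if "x \<in> U" for x using that sum by blast
  have \<beta>sp: "fst ` Poly_Mapping.keys (\<beta> u') \<subseteq> I" "\<And>j. j \<in> I \<Longrightarrow> component j (\<beta> u') \<in> space (V j)" if "u' \<in> V'" for u'
    using \<beta>D(2)[OF that] by (auto simp: space_direct_sum)
  have ci: "component i (\<beta> u') = 0" if "u' \<in> V'" for u' by (rule component_outside[OF \<beta>sp(1)[OF that] i])
  have cF: "component j (F (u + u')) = (if j = i then \<alpha> u else component j (\<beta> u'))" if "u \<in> S" "u' \<in> V'" for u u' j
    using that ci by (simp add: F component_add component_inject)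
  have Fsp: "F (u + u') \<in> space (direct_sum (insert i I) V)" if u: "u \<in> S" "u' \<in> V'" for u u'
  proof -
    have "Poly_Mapping.keys (F (u + u')) \<subseteq> Poly_Mapping.keys (inject i (\<alpha> u)) \<union> Poly_Mapping.keys (\<beta> u')"
      unfolding F[OF u] by (rule Poly_Mapping.keys_add)
    then have "fst ` Poly_Mapping.keys (F (u + u')) \<subseteq> insert i I"
      using \<beta>sp(1)[OF u(2)] keys_inject[of i "\<alpha> u"] by fastforce
    then show ?thesis using cF[OF u] \<alpha>D(2)[OF u(1)] \<beta>sp(2)[OF u(2)] i by (auto simp: space_direct_sum)
  qed
  have lin: "linear_on U F"
    unfolding linear_on_def
  proof (intro conjI ballI allI)
    fix x y assume "x \<in> U" "y \<in> U"
    then obtain u u' v v' where uv: "u \<in> S" "u' \<in> V'" "x = u + u'" "v \<in> S" "v' \<in> V'" "y = v + v'"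
      using UE by meson
    have "x + y = (u + v) + (u' + v')" using uv by (simp add: algebra_simps)
    then have "F (x + y) = inject i (\<alpha> (u + v)) + \<beta> (u' + v')"
      using F[of "u + v" "u' + v'"] qvs.subspace_add[OF SS uv(1,4)] qvs.subspace_add[OF VS uv(2,5)] by simp
    then show "F (x + y) = F x + F y"
      using F[OF uv(1,2)] F[OF uv(4,5)] uv
      by (simp add: linear_on_add[OF \<alpha>D(1)] linear_on_add[OF \<beta>D(1)] inject_add algebra_simps)
  next
    fix c x assume "x \<in> U"
    then obtain u u' where uv: "u \<in> S" "u' \<in> V'" "x = u + u'" using UE by meson
    have "F (qscale c x) = inject i (\<alpha> (qscale c u)) + \<beta> (qscale c u')"
      using F[of "qscale c u" "qscale c u'"] qvs.subspace_scale[OF SS uv(1)] qvs.subspace_scale[OF VS uv(2)] uv(3)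
      by (simp add: qvs.scale_right_distrib)
    then show "F (qscale c x) = qscale c (F x)"
      using F[OF uv(1,2)] uv
      by (simp add: linear_on_scale[OF \<alpha>D(1)] linear_on_scale[OF \<beta>D(1)] inject_scale qvs.scale_right_distrib)
  qed
  have US: "qvs.subspace U" unfolding sum[symmetric] by (rule qvs.subspace_sums[OF SS VS])
  have inj: "inj_on F U"
    unfolding linear_on_inj_iff[OF US lin]
  proof (intro ballI impI)
    fix x assume "x \<in> U" "F x = 0"
    then obtain u u' where uv: "u \<in> S" "u' \<in> V'" "x = u + u'" using UE by meson
    have "\<alpha> u = 0" using cF[OF uv(1,2), of i] uv(3) \<open>F x = 0\<close> by simp
    moreover have "\<alpha> u = 0 \<Longrightarrow> u = 0"
      using \<alpha>(2) linear_on_inj_iff[OF SS \<alpha>D(1)] uv(1) by (auto simp: bij_betw_def)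
    ultimately have u: "u = 0" by simp
    then have "\<beta> u' = 0" using F[OF uv(1,2)] uv(3) \<open>F x = 0\<close> \<open>\<alpha> u = 0\<close> by simp
    moreover have "\<beta> u' = 0 \<Longrightarrow> u' = 0"
      using \<beta>(2) linear_on_inj_iff[OF VS \<beta>D(1)] uv(2) by (auto simp: bij_betw_def)
    ultimately show "x = 0" using u uv(3) by simp
  qed
  have surj: "space (direct_sum (insert i I) V) \<subseteq> F ` U"
  proof
    fix y assume y: "y \<in> space (direct_sum (insert i I) V)"
    define y' where "y' = (\<Sum>j\<in>I. inject j (component j y))"
    have y_eq: "y = inject i (component i y) + y'"
      using sum_inject_component[of "insert i I" y] fin i y by (simp add: y'_def space_direct_sum)
    have cy: "component j y' = component j y" if "j \<in> I" for j
    proof -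
      have "component j y = component j (inject i (component i y)) + component j y'"
        using arg_cong[OF y_eq, of "component j"] by (simp only: component_add)
      moreover have "component j (inject i (component i y)) = 0" using that i by (auto simp: component_inject)
      ultimately show ?thesis by simp
    qed
    have "fst ` Poly_Mapping.keys y' \<subseteq> I" unfolding y'_def by (rule keys_sum_inject)
    moreover have "component j y' \<in> space (V j)" if "j \<in> I" for j
      using y that cy[OF that] by (simp add: space_direct_sum)
    ultimately have "y' \<in> \<beta> ` V'"
      unfolding bij_betw_imp_surj_on[OF \<beta>(2)] space_direct_sum by blast
    then obtain u' where u': "u' \<in> V'" "\<beta> u' = y'" by blast
    have "component i y \<in> \<alpha> ` S"
      unfolding bij_betw_imp_surj_on[OF \<alpha>(2)] using y by (simp add: space_direct_sum)
    then obtain u where u: "u \<in> S" "\<alpha> u = component i y" by (metis imageE)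
    have "F (u + u') = y" using F[OF u(1) u'(1)] u u' y_eq by simp
    moreover have "u + u' \<in> U" using sum u u' by blast
    ultimately show "y \<in> F ` U" by blast
  qed
  have bij: "bij_betw F U (space (direct_sum (insert i I) V))"
    unfolding bij_betw_def using inj surj
  proof (intro conjI equalityI)
    show "F ` U \<subseteq> space (direct_sum (insert i I) V)" using Fsp UE by blast
  qed
  have "F (act W g x) = act (direct_sum (insert i I) V) g (F x)" if g: "g permutes {1..m}" and x: "x \<in> U" for g x
  proof -
    obtain u u' where uv: "u \<in> S" "u' \<in> V'" "x = u + u'" using UE[OF x] by meson
    have "act W g x = act W g u + act W g u'"
      using uv SW VW by (simp add: linear_on_add[OF Sm_linear[OF W g]] subset_iff)
    then have "F (act W g x) = inject i (act (V i) g (\<alpha> u)) + act (direct_sum I V) g (\<beta> u')"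
      using F[OF Sg[OF g uv(1)] Vg[OF g uv(2)]] \<alpha>D(3)[OF g uv(1)] \<beta>D(3)[OF g uv(2)] by simp
    also have "\<dots> = inject i (act (V i) g (component i (F x))) + (\<Sum>j\<in>I. inject j (act (V j) g (component j (F x))))"
      unfolding act_direct_sum uv(3) using i
      by (intro arg_cong2[where f="(+)"] sum.cong) (auto simp: cF[OF uv(1,2)])
    also have "\<dots> = act (direct_sum (insert i I) V) g (F x)"
      using fin i by (simp add: act_direct_sum)
    finally show ?thesis .
  qed
  then show ?thesis
    using lin bij unfolding rep_iso_def equivariant_def by (intro exI[of _ F]) simp
qed

lemma mult_cong:
  "(\<And>g. g permutes {1..m} \<Longrightarrow> \<phi> g = \<psi> g) \<Longrightarrow> mult m \<phi> \<nu> = mult m \<psi> \<nu>"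
  unfolding mult_def by (rule char_inner_cong) auto

lemma mult_add: "mult m (\<lambda>g. \<phi> g + \<psi> g) \<nu> = mult m \<phi> \<nu> + mult m \<psi> \<nu>"
  unfolding mult_def by (rule char_inner_add)

lemma mult_specht:
  "\<nu> \<in> partitions_of m \<Longrightarrow> \<mu> \<in> partitions_of m \<Longrightarrow> mult m (character (specht \<mu>)) \<nu> = (if \<mu> = \<nu> then 1 else 0)"
  unfolding mult_def by (rule specht_orthonormal)

text \<open>
  The labels in \<open>L\<close> stand for the partitions \<open>p \<mu>\<close>. The multiplicities \<open>c\<close> are quantified in the
  statement because those of the complement of a simple submodule are smaller by one at one label.
\<close>

lemma direct_sum_decomposition_aux:
  assumes W: "Sm_module m W" and U: "invariant_subspace m W U"
    and L: "finite L" and p: "inj_on p L" "p ` L \<subseteq> partitions_of m"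
  shows "\<forall>c :: 'l \<Rightarrow> nat.
    (\<forall>\<nu>\<in>partitions_of m. mult m (character (W\<lparr>space := U\<rparr>)) \<nu> \<noteq> 0 \<longrightarrow> \<nu> \<in> p ` L) \<longrightarrow>
    (\<forall>\<mu>\<in>L. mult m (character (W\<lparr>space := U\<rparr>)) (p \<mu>) = of_nat (c \<mu>)) \<longrightarrow>
    rep_iso m (W\<lparr>space := U\<rparr>) (direct_sum {(\<mu>, k). \<mu> \<in> L \<and> k < c \<mu>} (\<lambda>(\<mu>, k). specht (p \<mu>)))"
  using W U
proof (induction rule: submodule_induct)
  case zero
  show ?case
  proof (intro allI impI)
    fix c :: "'l \<Rightarrow> nat"
    assume "\<forall>\<mu>\<in>L. mult m (character (W\<lparr>space := {0}\<rparr>)) (p \<mu>) = of_nat (c \<mu>)"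
    then have "c \<mu> = 0" if "\<mu> \<in> L" for \<mu>
      using that by (simp add: mult_def zero_module_character char_inner_def cong: sum.cong)
    then have e: "{(\<mu>, k). \<mu> \<in> L \<and> k < c \<mu>} = {}" by auto
    have "act W g 0 = 0" if "g permutes {1..m}" for g
      using linear_on_zero[OF Sm_subspace[OF W] Sm_linear[OF W that]] .
    then show "rep_iso m (W\<lparr>space := {0}\<rparr>) (direct_sum {(\<mu>, k). \<mu> \<in> L \<and> k < c \<mu>} (\<lambda>(\<mu>, k). specht (p \<mu>)))"
      unfolding e rep_iso_def direct_sum_empty
      by (intro exI[of _ "\<lambda>_. 0"]) (simp add: linear_on_def equivariant_def bij_betw_def act_direct_sum)
  qed
next
  case (step V S V')
  note WV = Sm_submodule[OF W step.hyps(1)] and WS = Sm_submodule[OF W step.hyps(2)]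
    and WV' = Sm_submodule[OF W step.hyps(3)]
  let ?\<chi> = "\<lambda>X. character (W\<lparr>space := X\<rparr>)"
  obtain \<mu>' where \<mu>': "\<mu>' \<in> partitions_of m" "rep_iso m (specht \<mu>') (W\<lparr>space := S\<rparr>)"
    using simple_is_specht[OF step.hyps(4)] .
  note sub = direct_summands_subset[OF step.hyps(2,3,6)]
  have S': "invariant_subspace m (W\<lparr>space := V\<rparr>) S" "invariant_subspace m (W\<lparr>space := V\<rparr>) V'"
    using step.hyps(2,3) sub by (auto simp: invariant_subspace_def)
  have mV: "mult m (?\<chi> V) \<nu> = (if \<nu> = \<mu>' then 1 else 0) + mult m (?\<chi> V') \<nu>" if \<nu>: "\<nu> \<in> partitions_of m" for \<nu>
  proof -
    have "?\<chi> V g = character (specht \<mu>') g + ?\<chi> V' g" if g: "g permutes {1..m}" for g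
      using character_direct_sum[OF WV S' step.hyps(5) _ g] step.hyps(6)
        character_rep_iso[OF partitions_of_Sm[OF \<mu>'(1)] WS \<mu>'(2) g] by simp
    then have "mult m (?\<chi> V) \<nu> = mult m (\<lambda>g. character (specht \<mu>') g + ?\<chi> V' g) \<nu>" by (rule mult_cong)
    then show ?thesis using mult_specht[OF \<nu> \<mu>'(1)] by (auto simp: mult_add)
  qed
  show ?case
  proof (intro allI impI)
    fix c :: "'l \<Rightarrow> nat"
    assume c: "\<forall>\<nu>\<in>partitions_of m. mult m (?\<chi> V) \<nu> \<noteq> 0 \<longrightarrow> \<nu> \<in> p ` L"
      "\<forall>\<mu>\<in>L. mult m (?\<chi> V) (p \<mu>) = of_nat (c \<mu>)"
    obtain n where n: "mult m (?\<chi> V') \<mu>' = of_nat n" using mult_nat[OF WV' \<mu>'(1)] by blast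
    have "mult m (?\<chi> V) \<mu>' = of_nat (Suc n)" using mV[OF \<mu>'(1)] n by simp
    then have "mult m (?\<chi> V) \<mu>' \<noteq> 0" by (simp only: of_nat_eq_0_iff)
    then obtain \<mu> where \<mu>: "\<mu> \<in> L" "p \<mu> = \<mu>'" using c(1) \<mu>'(1) by blast
    have c\<mu>: "c \<mu> = Suc n" using c(2) \<mu> \<open>mult m (?\<chi> V) \<mu>' = of_nat (Suc n)\<close> by (metis of_nat_eq_iff)
    define c' where "c' = c(\<mu> := n)"
    have "mult m (?\<chi> V') (p \<sigma>) = of_nat (c' \<sigma>)" if \<sigma>: "\<sigma> \<in> L" for \<sigma>
    proof (cases "\<sigma> = \<mu>")
      case True then show ?thesis using n \<mu> by (simp add: c'_def)
    next
      case False
      then have "p \<sigma> \<noteq> \<mu>'" using p(1) \<mu> \<sigma> by (auto simp: inj_on_def)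
      then show ?thesis using mV[of "p \<sigma>"] p(2) \<sigma> c(2) False by (auto simp: c'_def)
    qed
    moreover have "\<nu> \<in> p ` L" if \<nu>: "\<nu> \<in> partitions_of m" "mult m (?\<chi> V') \<nu> \<noteq> 0" for \<nu>
    proof (cases "\<nu> = \<mu>'")
      case True then show ?thesis using \<mu> by blast
    next
      case False then show ?thesis using c(1) \<nu> mV[OF \<nu>(1)] by simp
    qed
    ultimately have iso: "rep_iso m (W\<lparr>space := V'\<rparr>) (direct_sum {(\<mu>, k). \<mu> \<in> L \<and> k < c' \<mu>} (\<lambda>(\<mu>, k). specht (p \<mu>)))"
      using step.IH by blast
    have ins: "{(\<mu>, k). \<mu> \<in> L \<and> k < c \<mu>} = insert (\<mu>, n) {(\<mu>, k). \<mu> \<in> L \<and> k < c' \<mu>}"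
      using \<mu>(1) c\<mu> by (auto simp: c'_def less_Suc_eq split: if_splits)
    have "finite {(\<mu>, k). \<mu> \<in> L \<and> k < c' \<mu>}"
    proof (rule finite_subset)
      show "{(\<mu>, k). \<mu> \<in> L \<and> k < c' \<mu>} \<subseteq> Sigma L (\<lambda>\<mu>. {..<c' \<mu>})" by auto
    qed (use L in simp)
    then have "rep_iso m (W\<lparr>space := V\<rparr>) (direct_sum (insert (\<mu>, n) {(\<mu>, k). \<mu> \<in> L \<and> k < c' \<mu>}) (\<lambda>(\<mu>, k). specht (p \<mu>)))"
    proof (rule direct_sum_insert[OF _ _ W step.hyps(2,3,5,6) _ iso])
      show "(\<mu>, n) \<notin> {(\<mu>, k). \<mu> \<in> L \<and> k < c' \<mu>}" by (simp add: c'_def)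
      show "rep_iso m (W\<lparr>space := S\<rparr>) (case (\<mu>, n) of (\<mu>, k) \<Rightarrow> specht (p \<mu>))"
        using rep_iso_sym[OF partitions_of_Sm[OF \<mu>'(1)] WS \<mu>'(2)] \<mu>(2) by simp
    next
      fix j assume "j \<in> {(\<mu>, k). \<mu> \<in> L \<and> k < c' \<mu>}"
      then show "qvs.subspace (space (case j of (\<mu>, k) \<Rightarrow> specht (p \<mu>)))"
        using p(2) Sm_subspace[OF partitions_of_Sm] by (auto split: prod.splits)
    next
      fix j :: "'l \<times> nat" and g
      show "act (case j of (\<mu>, k) \<Rightarrow> specht (p \<mu>)) g 0 = 0"
        by (auto simp: act_specht act_perm_module qvp.linear_0 split: prod.splits)
    qed
    then show "rep_iso m (W\<lparr>space := V\<rparr>) (direct_sum {(\<mu>, k). \<mu> \<in> L \<and> k < c \<mu>} (\<lambda>(\<mu>, k). specht (p \<mu>)))"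
      by (simp only: ins)
  qed
qed

theorem direct_sum_decomposition:
  assumes W: "Sm_module m W" and L: "finite L" and p: "inj_on p L" "p ` L \<subseteq> partitions_of m"
    and "\<And>\<nu>. \<nu> \<in> partitions_of m \<Longrightarrow> mult m (character W) \<nu> \<noteq> 0 \<Longrightarrow> \<nu> \<in> p ` L"
    and "\<And>\<mu>. \<mu> \<in> L \<Longrightarrow> mult m (character W) (p \<mu>) = of_nat (c \<mu>)"
  shows "rep_iso m W (direct_sum {(\<mu>, k). \<mu> \<in> L \<and> k < c \<mu>} (\<lambda>(\<mu>, k). specht (p \<mu>)))"
proof -
  have inv: "invariant_subspace m W (space W)"
    using W by (simp add: invariant_subspace_def Sm_module_def)
  show ?thesis using direct_sum_decomposition_aux[OF W inv L p] assms(5,6) by simp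
qed

subsection \<open>Multiplicities in the tabloid modules\<close>

lemma partitions_of_tabloid_Sm: "\<mu> \<in> partitions_of m \<Longrightarrow> Sm_module m (tabloid_module \<mu>)"
  using tabloid_module_Sm[of \<mu>] by (simp add: partitions_of_def)

lemma mult_tabloid_zero:
  assumes \<nu>: "\<nu> \<in> partitions_of m" and \<mu>: "\<mu> \<in> partitions_of m"
    and le: "row_sum \<mu> \<le> row_sum \<nu>" and ne: "\<mu> \<noteq> \<nu>"
  shows "mult m (character (tabloid_module \<mu>)) \<nu> = 0"
proof (rule ccontr)
  note M = partitions_of_tabloid_Sm[OF \<mu>] and S = partitions_of_Sm[OF \<nu>]
  assume "mult m (character (tabloid_module \<mu>)) \<nu> \<noteq> 0"
  then obtain f where f: "module_hom_on m (specht \<nu>) (tabloid_module \<mu>) f" "inj_on f (space (specht \<nu>))"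
    using mult_embedding[OF M \<nu>] by blast
  have m: "sum_list \<nu> = m" "sum_list \<mu> = m" "is_partition \<nu>" "is_partition \<mu>"
    using \<nu> \<mu> by (auto simp: partitions_of_def)
  have "f x = 0" if "x \<in> space (specht \<nu>)" for x
    by (rule specht_hom_tabloid_zero[OF m(3,4) _ le ne _ refl order_refl _ that]) (use m M f in simp_all)
  then have "x = 0" if "x \<in> space (specht \<nu>)" for x
    using f(2) that unfolding linear_on_inj_iff[OF Sm_subspace[OF S] module_hom_onD(1)[OF f(1)]] by blast
  then have "space (specht \<nu>) = {0}" using qvs.subspace_0[OF Sm_subspace[OF S]] by blast
  then show False using partitions_of_simple[OF \<nu>] by (simp add: simple_module_def)
qed

text \<open>
  A homomorphism from the Specht module into a complement of it in the tabloid module would map the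
  polytabloid to a multiple of itself that lies in this complement, hence to \<open>0\<close>.
\<close>

lemma mult_tabloid_one:
  assumes \<nu>: "\<nu> \<in> partitions_of m"
  shows "mult m (character (tabloid_module \<nu>)) \<nu> = 1"
proof -
  note M = partitions_of_tabloid_Sm[OF \<nu>]
  have m: "sum_list \<nu> = m" "is_partition \<nu>" using \<nu> by (auto simp: partitions_of_def)
  let ?W = "tabloid_module \<nu>"
  have inv: "invariant_subspace m ?W (space (specht \<nu>))" using specht_invariant[of \<nu>] m by simp
  obtain U where U: "invariant_subspace m ?W U" "space (specht \<nu>) \<inter> U = {0}"
    "{u + u' | u u'. u \<in> space (specht \<nu>) \<and> u' \<in> U} = space ?W"
    using invariant_complement[OF M inv] .
  note WU = Sm_submodule[OF M U(1)]
  have "character ?W g = character (specht \<nu>) g + character (?W\<lparr>space := U\<rparr>) g" if "g permutes {1..m}" for g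
    using character_direct_sum[OF M inv U that] by (simp add: specht_eq)
  then have "mult m (character ?W) \<nu> = mult m (\<lambda>g. character (specht \<nu>) g + character (?W\<lparr>space := U\<rparr>) g) \<nu>"
    by (rule mult_cong)
  also have "\<dots> = 1 + mult m (character (?W\<lparr>space := U\<rparr>)) \<nu>"
    by (simp add: mult_add mult_specht[OF \<nu> \<nu>])
  also have "mult m (character (?W\<lparr>space := U\<rparr>)) \<nu> = 0"
  proof (rule ccontr)
    assume "mult m (character (?W\<lparr>space := U\<rparr>)) \<nu> \<noteq> 0"
    then obtain f where f: "module_hom_on m (specht \<nu>) (?W\<lparr>space := U\<rparr>) f" "inj_on f (space (specht \<nu>))"
      using mult_embedding[OF WU \<nu>] by blast
    obtain T where T: "T \<in> tableaux \<nu>" using tableaux_exists .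
    let ?e = "polytabloid T" and ?n = "of_nat (card (column_group T)) :: rat"
    note e = polytabloid_in_specht[OF T]
    have fe: "f ?e \<in> U" using module_hom_onD(2)[OF f(1) e] by simp
    then have "Poly_Mapping.keys (f ?e) \<subseteq> tabloids \<nu>" using U(1) by (auto simp: invariant_subspace_def)
    then obtain c where "column_sum T ?W (f ?e) = qscale c ?e" using column_sum_specht[OF T m(2)] by blast
    moreover have "column_sum T (?W\<lparr>space := U\<rparr>) (f ?e) = qscale ?n (f ?e)"
      using specht_hom_column_sum[OF T, of "?W\<lparr>space := U\<rparr>" f] f(1) m by simp
    ultimately have "qscale ?n (f ?e) = qscale c ?e" by (simp add: column_sum_def)
    then have "qscale ?n (f ?e) \<in> space (specht \<nu>)"
      using qvs.subspace_scale[OF Sm_subspace[OF partitions_of_Sm[OF \<nu>]] e] by simp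
    moreover have "qscale ?n (f ?e) \<in> U" using U(1) fe by (auto simp: invariant_subspace_def intro: qvs.subspace_scale)
    ultimately have "qscale ?n (f ?e) = 0" using U(2) by blast
    then have "f ?e = 0" using column_group_card[OF T] by simp
    then have "?e = 0"
      using f(2) e unfolding linear_on_inj_iff[OF Sm_subspace[OF partitions_of_Sm[OF \<nu>]] module_hom_onD(1)[OF f(1)]] by blast
    then show False using polytabloid_nonzero[OF T m(2)] by simp
  qed
  finally show ?thesis by simp
qed

subsection \<open>Counting orbits\<close>

definition action_orbit :: "nat \<Rightarrow> ((nat \<Rightarrow> nat) \<Rightarrow> 'a \<Rightarrow> 'a) \<Rightarrow> 'a \<Rightarrow> 'a set" where
  "action_orbit m \<alpha> a = (\<lambda>g. \<alpha> g a) ` {g. g permutes {1..m}}"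

lemma action_orbit_eq_iff:
  assumes P: "perm_action m A \<alpha>" and a: "a \<in> A" and b: "b \<in> A"
  shows "action_orbit m \<alpha> a = action_orbit m \<alpha> b \<longleftrightarrow> (\<exists>g. g permutes {1..m} \<and> \<alpha> g a = b)"
proof
  assume "action_orbit m \<alpha> a = action_orbit m \<alpha> b"
  moreover have "b \<in> action_orbit m \<alpha> b"
    unfolding action_orbit_def using perm_actionD(2)[OF P b] permutes_id by (metis imageI mem_Collect_eq)
  ultimately have "b \<in> action_orbit m \<alpha> a" by simp
  then show "\<exists>g. g permutes {1..m} \<and> \<alpha> g a = b" by (auto simp: action_orbit_def)
next
  have sub: "action_orbit m \<alpha> (\<alpha> h c) \<subseteq> action_orbit m \<alpha> c" if "h permutes {1..m}" "c \<in> A" for h c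
  proof
    fix x assume "x \<in> action_orbit m \<alpha> (\<alpha> h c)"
    then obtain k where "k permutes {1..m}" "x = \<alpha> k (\<alpha> h c)" by (auto simp: action_orbit_def)
    then have "k \<circ> h permutes {1..m}" "x = \<alpha> (k \<circ> h) c"
      using perm_actionD(4)[OF P _ that(1,2)] that(1) by (auto intro: perms_comp)
    then show "x \<in> action_orbit m \<alpha> c" by (auto simp: action_orbit_def)
  qed
  assume "\<exists>g. g permutes {1..m} \<and> \<alpha> g a = b"
  then obtain g where g: "g permutes {1..m}" "\<alpha> g a = b" by blast
  have "\<alpha> (inv g) b = a" using perm_action_inv(1)[OF P g(1) a] g(2) by simp
  then show "action_orbit m \<alpha> a = action_orbit m \<alpha> b"
    using sub[OF g(1) a] sub[OF perms_inv[OF g(1)] b] g(2) by auto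
qed

text \<open>Burnside's orbit counting lemma.\<close>

lemma sum_fixed_points:
  assumes P: "perm_action m A \<alpha>"
  shows "(\<Sum>g | g permutes {1..m}. card {a\<in>A. \<alpha> g a = a}) = fact m * card (action_orbit m \<alpha> ` A)"
proof -
  note aD = perm_actionD[OF P]
  let ?G = "{g. g permutes {1..m}}" and ?o = "action_orbit m \<alpha>"
  have "(\<Sum>g\<in>?G. card {a\<in>A. \<alpha> g a = a}) = (\<Sum>g\<in>?G. \<Sum>a\<in>A. if \<alpha> g a = a then 1 else 0)"
    using aD(1) by (intro sum.cong refl) (simp add: sum.If_cases Int_def)
  also have "\<dots> = (\<Sum>a\<in>A. \<Sum>g\<in>?G. if \<alpha> g a = a then 1 else 0)" by (rule sum.swap)
  also have "\<dots> = (\<Sum>a\<in>A. card {g\<in>?G. \<alpha> g a = a})"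
    by (intro sum.cong refl) (simp add: sum.If_cases Int_def)
  also have "\<dots> = (\<Sum>Q\<in>?o ` A. \<Sum>a | a \<in> A \<and> ?o a = Q. card {g\<in>?G. \<alpha> g a = a})"
    by (rule sum.group[symmetric]) (use aD(1) in auto)
  also have "\<dots> = (\<Sum>Q\<in>?o ` A. fact m)"
  proof (rule sum.cong[OF refl])
    fix Q assume "Q \<in> ?o ` A"
    then obtain b where b: "b \<in> A" "Q = ?o b" by blast
    have OA: "{a. a \<in> A \<and> ?o a = Q} = (\<lambda>g. \<alpha> g b) ` ?G"
    proof
      show "{a. a \<in> A \<and> ?o a = Q} \<subseteq> (\<lambda>g. \<alpha> g b) ` ?G"
      proof
        fix a assume "a \<in> {a. a \<in> A \<and> ?o a = Q}"
        then have "a \<in> A" "?o b = ?o a" using b(2) by auto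
        then obtain g where "g permutes {1..m}" "\<alpha> g b = a" using action_orbit_eq_iff[OF P b(1)] by blast
        then show "a \<in> (\<lambda>g. \<alpha> g b) ` ?G" by blast
      qed
      show "(\<lambda>g. \<alpha> g b) ` ?G \<subseteq> {a. a \<in> A \<and> ?o a = Q}"
        using action_orbit_eq_iff[OF P b(1)] aD(3)[OF _ b(1)] b(2) by blast
    qed
    have stab: "card {g\<in>?G. \<alpha> g a = a} = card {g\<in>?G. \<alpha> g b = a}" if a: "a \<in> A" "?o a = Q" for a
    proof -
      obtain h where h: "h permutes {1..m}" "\<alpha> h b = a"
        using action_orbit_eq_iff[OF P b(1) a(1)] a(2) b(2) by auto
      note h' = perms_inv[OF h(1)]
      have h'a: "\<alpha> (inv h) a = b" using perm_action_inv(1)[OF P h(1) b(1)] h(2) by simp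
      have "bij_betw (\<lambda>g. g \<circ> h) {g\<in>?G. \<alpha> g a = a} {g\<in>?G. \<alpha> g b = a}"
        by (rule bij_betw_byWitness[of _ "\<lambda>g. g \<circ> inv h"])
          (use h h' h'a b a aD(4) permutes_inv_o[OF h(1)] in \<open>auto simp: comp_assoc intro: perms_comp\<close>)
      then show ?thesis by (rule bij_betw_same_card)
    qed
    have "(\<Sum>a | a \<in> A \<and> ?o a = Q. card {g\<in>?G. \<alpha> g a = a}) = (\<Sum>a\<in>(\<lambda>g. \<alpha> g b) ` ?G. card {g\<in>?G. \<alpha> g b = a})"
      unfolding OA[symmetric] by (intro sum.cong refl) (use stab in blast)
    also have "\<dots> = card ?G"
      using sum.group[of ?G "(\<lambda>g. \<alpha> g b) ` ?G" "\<lambda>g. \<alpha> g b" "\<lambda>_. 1 :: nat"] by simp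
    finally show "(\<Sum>a | a \<in> A \<and> ?o a = Q. card {g\<in>?G. \<alpha> g a = a}) = fact m" by (simp add: card_perms)
  qed
  finally show ?thesis by (simp add: mult.commute)
qed

lemma perm_action_times:
  assumes "perm_action m A \<alpha>" "perm_action m B \<beta>"
  shows "perm_action m (A \<times> B) (\<lambda>g (a, b). (\<alpha> g a, \<beta> g b))"
  using perm_actionD[OF assms(1)] perm_actionD[OF assms(2)] by (auto simp: perm_action_def)

lemma char_inner_perm_modules:
  assumes A: "perm_action m A \<alpha>" and B: "perm_action m B \<beta>"
  shows "char_inner m (character (perm_module A \<alpha>)) (character (perm_module B \<beta>)) =
    of_nat (card (action_orbit m (\<lambda>g (a, b). (\<alpha> g a, \<beta> g b)) ` (A \<times> B)))"
proof -
  let ?\<gamma> = "\<lambda>g (a, b). (\<alpha> g a, \<beta> g b)"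
  have "(\<Sum>g | g permutes {1..m}. character (perm_module A \<alpha>) g * character (perm_module B \<beta>) (inv g)) =
     (\<Sum>g | g permutes {1..m}. of_nat (card {x\<in>A \<times> B. ?\<gamma> g x = x}))"
  proof (intro sum.cong refl)
    fix g assume "g \<in> {g. g permutes {1..m}}"
    then have g: "g permutes {1..m}" by simp
    have "{x\<in>A \<times> B. ?\<gamma> g x = x} = {a\<in>A. \<alpha> g a = a} \<times> {b\<in>B. \<beta> g b = b}" by auto
    then show "character (perm_module A \<alpha>) g * character (perm_module B \<beta>) (inv g) = of_nat (card {x\<in>A \<times> B. ?\<gamma> g x = x})"
      by (simp add: character_inv[OF perm_module_Sm[OF B] g] character_perm_module[OF A g]
          character_perm_module[OF B g] card_cartesian_product)
  qed
  also have "\<dots> = of_nat (\<Sum>g | g permutes {1..m}. card {x\<in>A \<times> B. ?\<gamma> g x = x})" by simp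
  also have "\<dots> = fact m * of_nat (card (action_orbit m ?\<gamma> ` (A \<times> B)))"
    by (subst sum_fixed_points[OF perm_action_times[OF A B]]) simp
  finally show ?thesis by (simp add: char_inner_def)
qed

section \<open>Sets with actions of all symmetric groups\<close>

lemma extend_to_permutation:
  assumes "finite S" "X \<subseteq> S" "inj_on f X" "f ` X \<subseteq> S"
  obtains h where "h permutes S" "\<And>x. x \<in> X \<Longrightarrow> h x = f x"
proof -
  have "card (S - X) = card (S - f ` X)"
    using assms by (simp add: card_Diff_subset card_image finite_subset)
  then obtain k where k: "bij_betw k (S - X) (S - f ` X)"
    using assms(1) finite_same_card_bij[of "S - X" "S - f ` X"] by auto
  define h where "h x = (if x \<in> X then f x else if x \<in> S then k x else x)" for x
  have "bij_betw h X (f ` X)"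
    using assms(3) by (simp add: bij_betw_def h_def inj_on_def image_def)
  moreover have "bij_betw h (S - X) (S - f ` X)"
    using k by (subst bij_betw_cong[of _ h k]) (auto simp: h_def)
  ultimately have "bij_betw h (X \<union> (S - X)) (f ` X \<union> (S - f ` X))"
    by (rule bij_betw_combine) auto
  moreover have "X \<union> (S - X) = S" "f ` X \<union> (S - f ` X) = S" using assms by auto
  ultimately have "h permutes S"
    using assms(2) by (intro bij_imp_permutes) (auto simp: h_def)
  then show ?thesis using that[of h] by (simp add: h_def)
qed

text \<open>
  A family of \<open>\<SS>\<^sub>m\<close>-sets in which every element depends only on its support, a set of at most \<open>n\<close>
  numbers.
\<close>

locale fi_set =
  fixes A :: "nat \<Rightarrow> 'a set" and \<alpha> :: "(nat \<Rightarrow> nat) \<Rightarrow> 'a \<Rightarrow> 'a" and supp :: "'a \<Rightarrow> nat set" and n :: nat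
  assumes action: "perm_action m (A m) \<alpha>"
    and supp_subset: "a \<in> A m \<Longrightarrow> supp a \<subseteq> {1..m}"
    and supp_card: "a \<in> A m \<Longrightarrow> card (supp a) \<le> n"
    and supp_action: "a \<in> A m \<Longrightarrow> g permutes {1..m} \<Longrightarrow> supp (\<alpha> g a) = g ` supp a"
    and restrict: "a \<in> A k \<Longrightarrow> supp a \<subseteq> {1..m} \<Longrightarrow> a \<in> A m"
    and supp_fixed: "a \<in> A m \<Longrightarrow> g permutes {1..m} \<Longrightarrow> (\<And>x. x \<in> supp a \<Longrightarrow> g x = x) \<Longrightarrow> \<alpha> g a = a"
begin

lemma mono: "m \<le> k \<Longrightarrow> A m \<subseteq> A k"
proof
  fix a assume "m \<le> k" "a \<in> A m"
  then have "supp a \<subseteq> {1..k}" using supp_subset[of a m] by auto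
  then show "a \<in> A k" using restrict \<open>a \<in> A m\<close> by blast
qed

lemma finite_supp: "a \<in> A m \<Longrightarrow> finite (supp a)"
  by (rule finite_subset[OF supp_subset]) auto

abbreviation W :: "nat \<Rightarrow> 'a rep" where
  "W m \<equiv> perm_module (A m) \<alpha>"

lemma W_Sm: "Sm_module m (W m)"
  by (rule perm_module_Sm[OF action])

lemma move_into:
  assumes a: "a \<in> A m" and k: "n \<le> k" "k \<le> m"
  obtains g where "g permutes {1..m}" "\<alpha> g a \<in> A k"
proof -
  have "card (supp a) \<le> card {1..k}" using supp_card[OF a] k by simp
  then obtain f where f: "inj_on f (supp a)" "f ` supp a \<subseteq> {1..k}"
    using card_le_inj[OF finite_supp[OF a], of "{1..k}"] by auto
  have "f ` supp a \<subseteq> {1..m}" using f(2) k by auto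
  then obtain g where g: "g permutes {1..m}" "\<And>x. x \<in> supp a \<Longrightarrow> g x = f x"
    using extend_to_permutation[OF finite_atLeastAtMost supp_subset[OF a] f(1)] by blast
  have "supp (\<alpha> g a) = f ` supp a" using supp_action[OF a g(1)] g(2) by simp
  then have "\<alpha> g a \<in> A k" using restrict[OF perm_actionD(3)[OF action g(1) a]] f(2) by simp
  then show ?thesis using that g(1) by blast
qed

lemma permutes_mono: "g permutes {1..k} \<Longrightarrow> k \<le> m \<Longrightarrow> g permutes {1..m::nat}"
  by (rule permutes_subset) auto

text \<open>
  From degree \<open>n\<close> on every orbit has a representative in degree \<open>n\<close>, and only the restriction of a
  permutation to the support of the representative matters.
\<close>

lemma orbits_stable:
  assumes nm: "n \<le> m"
  shows "card (action_orbit m \<alpha> ` A m) = card (action_orbit n \<alpha> ` A n)"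
proof -
  let ?o = "\<lambda>k. action_orbit k \<alpha>"
  have sub: "A n \<subseteq> A m" using mono[OF nm] .
  have same: "?o n a = ?o n b \<longleftrightarrow> ?o m a = ?o m b" if a: "a \<in> A n" and b: "b \<in> A n" for a b
  proof -
    have am: "a \<in> A m" "b \<in> A m" using a b sub by auto
    have "\<exists>h. h permutes {1..n} \<and> \<alpha> h a = b" if g: "g permutes {1..m}" "\<alpha> g a = b" for g
    proof -
      have "g ` supp a = supp b" using supp_action[OF am(1) g(1)] g(2) by simp
      then have "g ` supp a \<subseteq> {1..n}" using supp_subset[OF b] by simp
      then obtain h where h: "h permutes {1..n}" "\<And>x. x \<in> supp a \<Longrightarrow> h x = g x"
        using extend_to_permutation[OF finite_atLeastAtMost supp_subset[OF a]
            inj_on_subset[OF permutes_inj[OF g(1)] subset_UNIV]] by blast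
      note hm = permutes_mono[OF h(1) nm] and g' = perms_inv[OF g(1)]
      have k: "h \<circ> inv g permutes {1..m}" using perms_comp[OF hm g'] .
      have "(h \<circ> inv g) x = x" if "x \<in> supp b" for x
      proof -
        have "x \<in> g ` supp a" using \<open>g ` supp a = supp b\<close> that by simp
        then obtain y where y: "y \<in> supp a" "x = g y" by blast
        then have "inv g x = y" using permutes_inverses(2)[OF g(1)] by simp
        then show ?thesis using h(2)[OF y(1)] y(2) by simp
      qed
      then have "\<alpha> (h \<circ> inv g) b = b" using supp_fixed[OF am(2) k] by blast
      moreover have "\<alpha> (h \<circ> inv g) b = \<alpha> h (\<alpha> (inv g) b)" by (rule perm_actionD(4)[OF action hm g' am(2)])
      moreover have "\<alpha> (inv g) b = a" using perm_action_inv(1)[OF action g(1) am(1)] g(2) by simp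
      ultimately show ?thesis using h(1) by auto
    qed
    then show ?thesis
      unfolding action_orbit_eq_iff[OF action a b] action_orbit_eq_iff[OF action am]
      using permutes_mono[OF _ nm] by blast
  qed
  have "?o m ` A m = ?o m ` A n"
  proof
    show "?o m ` A n \<subseteq> ?o m ` A m" using sub by blast
    show "?o m ` A m \<subseteq> ?o m ` A n"
    proof
      fix Q assume "Q \<in> ?o m ` A m"
      then obtain a where a: "a \<in> A m" "Q = ?o m a" by blast
      obtain g where g: "g permutes {1..m}" "\<alpha> g a \<in> A n" using move_into[OF a(1) order_refl nm] .
      have "?o m a = ?o m (\<alpha> g a)"
        using action_orbit_eq_iff[OF action a(1), of "\<alpha> g a"] g sub by blast
      then show "Q \<in> ?o m ` A n" using a(2) g(2) by blast
    qed
  qed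
  moreover have "bij_betw (\<lambda>Q. ?o m (SOME a. a \<in> A n \<and> ?o n a = Q)) (?o n ` A n) (?o m ` A n)"
  proof -
    define r where "r Q = (SOME a. a \<in> A n \<and> ?o n a = Q)" for Q
    have r: "r (?o n a) \<in> A n \<and> ?o n (r (?o n a)) = ?o n a" if "a \<in> A n" for a
      unfolding r_def by (rule someI[of _ a]) (use that in simp)
    have e: "?o m (r (?o n a)) = ?o m a" if "a \<in> A n" for a using same r that by blast
    have "inj_on (\<lambda>Q. ?o m (r Q)) (?o n ` A n)"
      using same e by (auto simp: inj_on_def)
    moreover have "(\<lambda>Q. ?o m (r Q)) ` ?o n ` A n = ?o m ` A n"
      unfolding image_image by (rule image_cong[OF refl e])
    ultimately show ?thesis by (simp add: bij_betw_def r_def)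
  qed
  ultimately show ?thesis by (simp add: bij_betw_same_card)
qed

subsection \<open>Weights\<close>

text \<open>
  A nonzero homomorphism from \<open>specht \<nu>\<close> gives a basis element with nonzero signed column sum. Two
  entries of one column that are both outside its support would cancel the sum, so the complement of
  the support embeds into the set of columns.
\<close>

lemma specht_hom_weight:
  assumes \<nu>: "\<nu> \<in> partitions_of m" and V: "Sm_module m V" "act V = act (W m)" "space V \<subseteq> space (W m)"
    and f: "module_hom_on m (specht \<nu>) V f" and x: "x \<in> space (specht \<nu>)" "f x \<noteq> 0"
  shows "partition_weight \<nu> \<le> n"
proof -
  obtain T where T: "T \<in> tableaux \<nu>" using tableaux_exists .
  have m: "sum_list \<nu> = m" and p: "is_partition \<nu>" using \<nu> by (auto simp: partitions_of_def)
  let ?y = "f (polytabloid T)"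
  note WS = W_Sm[of m]
  have "?y \<noteq> 0" using specht_hom_zero[OF T _ _ _ x(1), of V f] V(1) f x(2) m by blast
  moreover have "column_sum T V ?y = qscale (of_nat (card (column_group T))) ?y"
    using specht_hom_column_sum[OF T, of V f] f m by simp
  ultimately have ne: "column_sum T (W m) ?y \<noteq> 0"
    using column_group_card[OF T] V(2) by (simp add: column_sum_def)
  have y: "?y \<in> space (W m)" using module_hom_onD(2)[OF f polytabloid_in_specht[OF T]] V(3) by blast
  note lin = column_sum_linear[OF T, of "W m", unfolded m, OF WS]
  have "\<exists>a\<in>A m. column_sum T (W m) (bvec a) \<noteq> 0"
  proof (rule ccontr)
    assume c: "\<not> (\<exists>a\<in>A m. column_sum T (W m) (bvec a) \<noteq> 0)"
    have "column_sum T (W m) ?y = (\<lambda>_. 0) ?y"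
    proof (rule linear_on_eq_on_span[OF Sm_subspace[OF WS] lin, where B = "bvec ` A m"])
      show "linear_on (space (W m)) (\<lambda>_. 0 :: 'a \<Rightarrow>\<^sub>0 rat)" by (simp add: linear_on_def)
      show "space (W m) \<subseteq> qvs.span (bvec ` A m)"
        using perm_actionD(1)[OF action] by (simp add: span_bvec)
    qed (use c y in auto)
    then show False using ne by simp
  qed
  then obtain a where a: "a \<in> A m" "column_sum T (W m) (bvec a) \<noteq> 0" by blast
  define col where "col x = (THE j. x \<in> column T j)" for x
  have col: "col x = j" if "x \<in> column T j" for x j
    unfolding col_def using that column_disjoint[OF T] by blast
  have colx: "x \<in> column T (col x)" if "x \<in> {1..m}" for x
    using that column_covers[OF T] col m by blast
  have "inj_on col ({1..m} - supp a)"
  proof (rule inj_onI, rule ccontr)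
    fix x y assume xy: "x \<in> {1..m} - supp a" "y \<in> {1..m} - supp a" "col x = col y" "x \<noteq> y"
    have "x \<in> column T (col x)" using colx xy(1) by blast
    moreover have "y \<in> column T (col x)" unfolding xy(3) using colx xy(2) by blast
    ultimately have cxy: "x \<in> column T (col x)" "y \<in> column T (col x)" .
    have "transpose x y permutes {1..m}" using xy by (intro permutes_swap_id) auto
    then have "\<alpha> (transpose x y) a = a"
      by (rule supp_fixed[OF a(1)]) (use xy in \<open>auto simp: transpose_def\<close>)
    then have "column_sum T (W m) (bvec a) = 0"
      using column_sum_transpose_fixed[OF T _ _ cxy xy(4), of "W m" "bvec a"] WS a(1) m by simp
    then show False using a(2) by simp
  qed
  moreover have "col ` ({1..m} - supp a) \<subseteq> {..<first_part \<nu>}"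
  proof (clarsimp simp del: atLeastAtMost_iff)
    fix x assume "x \<in> {1..m}"
    then obtain i where i: "i < length T" "col x < length (T ! i)" using colx unfolding column_eq by blast
    then have "col x < \<nu> ! i" "i < length \<nu>" using tableauxD[OF T] by auto
    moreover have "\<nu> ! i \<le> first_part \<nu>" if "i < length \<nu>" for i
      using p that by (cases \<nu>; cases i) (auto simp: is_partition_def first_part_def)
    ultimately show "col x < first_part \<nu>" by (meson less_le_trans)
  qed
  ultimately have "card ({1..m} - supp a) \<le> card {..<first_part \<nu>}"
    by (metis card_image card_mono finite_lessThan)
  moreover have "card ({1..m} - supp a) = m - card (supp a)"
    using supp_subset[OF a(1)] finite_supp[OF a(1)] by (simp add: card_Diff_subset)
  ultimately have "m \<le> first_part \<nu> + n" using supp_card[OF a(1)] by simp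
  moreover have "partition_weight \<nu> + first_part \<nu> = m"
    using m by (cases \<nu>) (auto simp: partition_weight_def first_part_def)
  ultimately show ?thesis by simp
qed

lemma mult_weight:
  assumes \<nu>: "\<nu> \<in> partitions_of m" and ne: "mult m (character (W m)) \<nu> \<noteq> 0"
  shows "partition_weight \<nu> \<le> n"
proof -
  obtain f where f: "module_hom_on m (specht \<nu>) (W m) f" "inj_on f (space (specht \<nu>))"
    using mult_embedding[OF W_Sm \<nu> ne] by blast
  note S = Sm_subspace[OF partitions_of_Sm[OF \<nu>]]
  have "space (specht \<nu>) \<noteq> {0}" using partitions_of_simple[OF \<nu>] by (simp add: simple_module_def)
  then obtain x where "x \<in> space (specht \<nu>)" "x \<noteq> 0" using qvs.subspace_0[OF S] by blast
  then have "f x \<noteq> 0" using f(2) linear_on_inj_iff[OF S module_hom_onD(1)[OF f(1)]] by blast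
  then show ?thesis using specht_hom_weight[OF \<nu> W_Sm refl order_refl f(1) \<open>x \<in> _\<close>] by blast
qed

lemma rep_weight_bound: "rep_weight m (W m) \<le> ereal (real (min m n))"
  unfolding rep_weight_def
proof (rule SUP_least)
  fix \<nu> assume "\<nu> \<in> {\<mu>. is_partition \<mu> \<and> sum_list \<mu> = m \<and> is_factor m (specht \<mu>) (W m)}"
  then have \<nu>: "\<nu> \<in> partitions_of m" and fac: "is_factor m (specht \<nu>) (W m)" by (auto simp: partitions_of_def)
  obtain U where U: "invariant_subspace m (W m) U" "rep_iso m (specht \<nu>) (W m\<lparr>space := U\<rparr>)"
    using fac by (auto simp: is_factor_def)
  obtain f where f: "module_hom_on m (specht \<nu>) (W m\<lparr>space := U\<rparr>) f" "bij_betw f (space (specht \<nu>)) U"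
    using U(2) by (auto simp: rep_iso_iff)
  note S = Sm_subspace[OF partitions_of_Sm[OF \<nu>]]
  have "space (specht \<nu>) \<noteq> {0}" using partitions_of_simple[OF \<nu>] by (simp add: simple_module_def)
  then obtain x where x: "x \<in> space (specht \<nu>)" "x \<noteq> 0" using qvs.subspace_0[OF S] by blast
  then have "f x \<noteq> 0"
    using f(2) linear_on_inj_iff[OF S module_hom_onD(1)[OF f(1)]] by (auto simp: bij_betw_def)
  then have "partition_weight \<nu> \<le> n"
    using specht_hom_weight[OF \<nu> Sm_submodule[OF W_Sm U(1)] _ _ f(1) x(1)] U(1)
    by (simp add: invariant_subspace_def)
  moreover have "partition_weight \<nu> \<le> m"
    using \<nu> by (cases \<nu>) (auto simp: partitions_of_def partition_weight_def)
  ultimately show "ereal (real (partition_weight \<nu>)) \<le> ereal (real (min m n))" by simp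
qed

end

lemma fi_set_times:
  assumes "fi_set A \<alpha> s n" "fi_set B \<beta> t k"
  shows "fi_set (\<lambda>m. A m \<times> B m) (\<lambda>g (a, b). (\<alpha> g a, \<beta> g b)) (\<lambda>(a, b). s a \<union> t b) (n + k)"
proof -
  interpret A: fi_set A \<alpha> s n by fact
  interpret B: fi_set B \<beta> t k by fact
  show ?thesis
  proof
    show "perm_action m (A m \<times> B m) (\<lambda>g (a, b). (\<alpha> g a, \<beta> g b))" for m
      by (rule perm_action_times[OF A.action B.action])
  next
    fix x m assume "x \<in> A m \<times> B m"
    then show "(case x of (a, b) \<Rightarrow> s a \<union> t b) \<subseteq> {1..m}"
      using A.supp_subset[of _ m] B.supp_subset[of _ m] by auto
  next
    fix x m assume "x \<in> A m \<times> B m"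
    then obtain a b where "x = (a, b)" "a \<in> A m" "b \<in> B m" by blast
    then show "card (case x of (a, b) \<Rightarrow> s a \<union> t b) \<le> n + k"
      using A.supp_card[of a m] B.supp_card[of b m] card_Un_le[of "s a" "t b"] by simp
  next
    fix x m g assume "x \<in> A m \<times> B m" "g permutes {1..m}"
    then show "(case case x of (a, b) \<Rightarrow> (\<alpha> g a, \<beta> g b) of (a, b) \<Rightarrow> s a \<union> t b) = g ` (case x of (a, b) \<Rightarrow> s a \<union> t b)"
      using A.supp_action[of _ m g] B.supp_action[of _ m g] by (auto simp: image_Un split: prod.splits)
  next
    fix x m l assume "x \<in> A l \<times> B l" "(case x of (a, b) \<Rightarrow> s a \<union> t b) \<subseteq> {1..m}"
    then show "x \<in> A m \<times> B m" using A.restrict[of _ l m] B.restrict[of _ l m] by auto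
  next
    fix x m g assume "x \<in> A m \<times> B m" "g permutes {1..m}" "\<And>y. y \<in> (case x of (a, b) \<Rightarrow> s a \<union> t b) \<Longrightarrow> g y = y"
    then show "(case x of (a, b) \<Rightarrow> (\<alpha> g a, \<beta> g b)) = x"
      using A.supp_fixed[of _ m g] B.supp_fixed[of _ m g] by (auto split: prod.splits)
  qed
qed

subsection \<open>Partial tabloids\<close>

text \<open>The tabloids of a shape \<open>padded \<rho> m\<close>, with the first row left out.\<close>

definition partial_tabloids :: "nat list \<Rightarrow> nat \<Rightarrow> nat set list set" where
  "partial_tabloids \<rho> m = {t. length t = length \<rho> \<and> (\<forall>i<length \<rho>. card (t ! i) = \<rho> ! i) \<and>
     (\<forall>i<length \<rho>. \<forall>j<length \<rho>. i \<noteq> j \<longrightarrow> t ! i \<inter> t ! j = {}) \<and> \<Union> (set t) \<subseteq> {1..m}}"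

lemma card_Union_partial_tabloid:
  assumes t: "t \<in> partial_tabloids \<rho> m"
  shows "card (\<Union> (set t)) = sum_list \<rho>"
proof -
  have "\<Union> (set t) = (\<Union>i\<in>{..<length \<rho>}. t ! i)" using t by (auto simp: partial_tabloids_def set_conv_nth)
  also have "card \<dots> = (\<Sum>i<length \<rho>. card (t ! i))"
  proof (rule card_UN_disjoint)
    show "\<forall>i\<in>{..<length \<rho>}. finite (t ! i)"
    proof
      fix i assume "i \<in> {..<length \<rho>}"
      then have "t ! i \<in> set t" using t by (simp add: partial_tabloids_def)
      then have "t ! i \<subseteq> {1..m}" using t by (auto simp: partial_tabloids_def)
      then show "finite (t ! i)" by (rule finite_subset) simp
    qed
  qed (use t in \<open>auto simp: partial_tabloids_def\<close>)
  also have "\<dots> = sum_list \<rho>"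
    using t by (simp add: partial_tabloids_def sum_list_sum_nth atLeast0LessThan)
  finally show ?thesis .
qed

lemma fi_set_partial_tabloids:
  "fi_set (partial_tabloids \<rho>) tabloid_action (\<lambda>t. \<Union> (set t)) (sum_list \<rho>)"
proof
  fix m
  show "perm_action m (partial_tabloids \<rho> m) tabloid_action"
    unfolding perm_action_def
  proof (intro conjI allI impI ballI)
    have "partial_tabloids \<rho> m \<subseteq> {t. set t \<subseteq> Pow {1..m} \<and> length t = length \<rho>}"
      by (auto simp: partial_tabloids_def)
    then show "finite (partial_tabloids \<rho> m)"
      by (rule finite_subset) (rule finite_lists_length_eq, simp)
    fix g assume g: "g permutes {1..m}"
    note gi = permutes_inj[OF g]
    show "tabloid_action g ` partial_tabloids \<rho> m \<subseteq> partial_tabloids \<rho> m"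
    proof
      fix y assume "y \<in> tabloid_action g ` partial_tabloids \<rho> m"
      then obtain t where t: "t \<in> partial_tabloids \<rho> m" "y = map (image g) t" by (auto simp: tabloid_action_def)
      have "\<Union> (set y) = g ` \<Union> (set t)" unfolding t(2) by auto
      also have "\<dots> \<subseteq> g ` {1..m}" using t(1) by (intro image_mono) (auto simp: partial_tabloids_def)
      finally have "\<Union> (set y) \<subseteq> {1..m}" using permutes_image[OF g] by simp
      moreover have "card (y ! i) = \<rho> ! i" if "i < length \<rho>" for i
        using t that card_image[OF inj_on_subset[OF gi subset_UNIV]] by (simp add: partial_tabloids_def)
      moreover have "y ! i \<inter> y ! j = {}" if "i < length \<rho>" "j < length \<rho>" "i \<noteq> j" for i j
        using t that image_Int[OF gi, of "t ! i" "t ! j"] by (simp add: partial_tabloids_def)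
      ultimately show "y \<in> partial_tabloids \<rho> m" using t by (simp add: partial_tabloids_def)
    qed
  qed (simp_all add: tabloid_action_comp)
next
  fix t m assume t: "t \<in> partial_tabloids \<rho> m"
  show "\<Union> (set t) \<subseteq> {1..m}" using t by (simp add: partial_tabloids_def)
  show "card (\<Union> (set t)) \<le> sum_list \<rho>" using card_Union_partial_tabloid[OF t] by simp
  show "t \<in> partial_tabloids \<rho> k" if "\<Union> (set t) \<subseteq> {1..k}" for k
    using t that by (simp add: partial_tabloids_def)
  fix g
  show "\<Union> (set (tabloid_action g t)) = g ` \<Union> (set t)" by (auto simp: tabloid_action_def)
  assume fixed: "\<And>x. x \<in> \<Union> (set t) \<Longrightarrow> g x = x"
  show "tabloid_action g t = t"
    unfolding tabloid_action_def
  proof (rule map_idI)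
    fix R assume "R \<in> set t"
    then have "g x = x" if "x \<in> R" for x using fixed that by blast
    then show "g ` R = R" by simp
  qed
qed

lemma character_partial_tabloids:
  assumes m: "sum_list \<rho> \<le> m" and g: "g permutes {1..m}"
  shows "character (tabloid_module ((m - sum_list \<rho>) # \<rho>)) g =
    character (perm_module (partial_tabloids \<rho> m) tabloid_action) g"
proof -
  let ?\<nu> = "(m - sum_list \<rho>) # \<rho>"
  have sm: "sum_list ?\<nu> = m" using m by simp
  interpret P: fi_set "partial_tabloids \<rho>" tabloid_action "\<lambda>t. \<Union> (set t)" "sum_list \<rho>"
    by (rule fi_set_partial_tabloids)
  note act1 = perm_action_tabloids[of ?\<nu>, unfolded sm]
  have split: "\<exists>s. t = ({1..m} - \<Union> (set s)) # s \<and> s \<in> partial_tabloids \<rho> m" if t: "t \<in> tabloids ?\<nu>" for t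
  proof -
    note tD = tabloidsD[OF t]
    obtain R s where Rs: "t = R # s" using tD(1) by (cases t) auto
    have "R \<union> \<Union> (set s) = {1..m}" using tD(4) sm Rs by simp
    moreover have "R \<inter> S = {}" if S: "S \<in> set s" for S
    proof -
      obtain i where "i < length s" "S = s ! i" using S by (metis in_set_conv_nth)
      then show ?thesis using tD(3)[of 0 "Suc i"] tD(1) Rs by simp
    qed
    ultimately have "R = {1..m} - \<Union> (set s)" by blast
    moreover have "s \<in> partial_tabloids \<rho> m"
    proof -
      have "card (s ! i) = \<rho> ! i" if "i < length \<rho>" for i using tD(2)[of "Suc i"] that Rs by simp
      moreover have "s ! i \<inter> s ! j = {}" if "i < length \<rho>" "j < length \<rho>" "i \<noteq> j" for i j
        using tD(3)[of "Suc i" "Suc j"] that Rs by simp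
      moreover have "\<Union> (set s) \<subseteq> {1..m}" using \<open>R \<union> \<Union> (set s) = {1..m}\<close> by (metis Un_upper2)
      moreover have "length s = length \<rho>" using tD(1) Rs by simp
      ultimately show ?thesis unfolding partial_tabloids_def by blast
    qed
    ultimately show ?thesis using Rs by blast
  qed
  have join: "({1..m} - \<Union> (set s)) # s \<in> tabloids ?\<nu>" if s: "s \<in> partial_tabloids \<rho> m" for s
  proof (rule tabloidsI)
    have sub: "\<Union> (set s) \<subseteq> {1..m}" using s by (simp add: partial_tabloids_def)
    have len: "length s = length \<rho>" using s by (simp add: partial_tabloids_def)
    show "length (({1..m} - \<Union> (set s)) # s) = length ?\<nu>" using len by simp
    show "\<Union> (set (({1..m} - \<Union> (set s)) # s)) = {1..sum_list ?\<nu>}" using sub sm by auto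
    have c: "card ({1..m} - \<Union> (set s)) = m - sum_list \<rho>"
      using sub card_Union_partial_tabloid[OF s] by (simp add: card_Diff_subset finite_subset[OF sub])
    show "card ((({1..m} - \<Union> (set s)) # s) ! i) = ?\<nu> ! i" if "i < length ?\<nu>" for i
      using that s c by (cases i) (auto simp: partial_tabloids_def)
    have d: "s ! i \<inter> ({1..m} - \<Union> (set s)) = {}" if "i < length \<rho>" for i
      using that len by (auto dest: nth_mem)
    show "(({1..m} - \<Union> (set s)) # s) ! i \<inter> (({1..m} - \<Union> (set s)) # s) ! j = {}"
      if "i < length ?\<nu>" "j < length ?\<nu>" "i \<noteq> j" for i j
      using that s d by (cases i; cases j) (auto simp: partial_tabloids_def Int_commute)
  qed
  have "bij_betw tl {t \<in> tabloids ?\<nu>. tabloid_action g t = t} {s \<in> partial_tabloids \<rho> m. tabloid_action g s = s}"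
  proof (rule bij_betw_byWitness[of _ "\<lambda>s. ({1..m} - \<Union> (set s)) # s"])
    show "\<forall>t\<in>{t \<in> tabloids ?\<nu>. tabloid_action g t = t}. ({1..m} - \<Union> (set (tl t))) # tl t = t"
      using split by fastforce
    show "tl ` {t \<in> tabloids ?\<nu>. tabloid_action g t = t} \<subseteq> {s \<in> partial_tabloids \<rho> m. tabloid_action g s = s}"
    proof
      fix s assume "s \<in> tl ` {t \<in> tabloids ?\<nu>. tabloid_action g t = t}"
      then obtain t where t: "t \<in> tabloids ?\<nu>" "tabloid_action g t = t" "s = tl t" by blast
      then have "tabloid_action g s = s" by (cases t) (auto simp: tabloid_action_def)
      then show "s \<in> {s \<in> partial_tabloids \<rho> m. tabloid_action g s = s}" using split[OF t(1)] t(3) by auto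
    qed
    show "(\<lambda>s. ({1..m} - \<Union> (set s)) # s) ` {s \<in> partial_tabloids \<rho> m. tabloid_action g s = s}
      \<subseteq> {t \<in> tabloids ?\<nu>. tabloid_action g t = t}"
    proof
      fix t assume "t \<in> (\<lambda>s. ({1..m} - \<Union> (set s)) # s) ` {s \<in> partial_tabloids \<rho> m. tabloid_action g s = s}"
      then obtain s where s: "s \<in> partial_tabloids \<rho> m" "tabloid_action g s = s" "t = ({1..m} - \<Union> (set s)) # s" by blast
      have t: "t \<in> tabloids ?\<nu>" using join[OF s(1)] s(3) by simp
      then have "tabloid_action g t \<in> tabloids ?\<nu>" using perm_actionD(3)[OF act1 g] by blast
      then obtain s' where "tabloid_action g t = ({1..m} - \<Union> (set s')) # s'" using split by blast
      moreover have "tl (tabloid_action g t) = s" using s(2,3) by (simp add: tabloid_action_def)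
      ultimately have "tabloid_action g t = t" using s(3) by simp
      then show "t \<in> {t \<in> tabloids ?\<nu>. tabloid_action g t = t}" using t by simp
    qed
  qed auto
  then show ?thesis
    unfolding character_perm_module[OF act1 g] character_perm_module[OF P.action g]
    by (simp add: bij_betw_same_card)
qed

subsection \<open>Stability of multiplicities\<close>

lemma padded_eq: "is_partition \<rho> \<Longrightarrow> sum_list \<rho> < m \<Longrightarrow> padded \<rho> m = (m - sum_list \<rho>) # \<rho>"
  unfolding padded_def is_partition_def by (simp add: removeAll_id)

lemma inj_on_padded: "inj_on (\<lambda>\<rho>. padded \<rho> m) {\<rho>. is_partition \<rho> \<and> sum_list \<rho> < m}"
  by (rule inj_onI) (simp add: padded_eq)

lemma padded_partition:
  assumes "is_partition \<rho>" "sum_list \<rho> < m" "sum_list \<rho> + first_part \<rho> \<le> m"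
  shows "padded \<rho> m \<in> partitions_of m"
proof -
  have "x \<le> m - sum_list \<rho>" if "x \<in> set \<rho>" for x
    using assms(1,3) that by (cases \<rho>) (auto simp: is_partition_def first_part_def)
  then show ?thesis
    using assms by (simp add: padded_eq partitions_of_def is_partition_def)
qed

lemma first_part_le: "first_part \<rho> \<le> sum_list \<rho>"
  by (cases \<rho>) (auto simp: first_part_def)

lemma row_sum_Cons: "row_sum (k # \<rho>) = (\<Sum>i<length \<rho>. Suc i * \<rho> ! i)"
  unfolding row_sum_def length_Cons sum.lessThan_Suc_shift by simp

lemma finite_bounded_partitions: "finite {\<rho>. is_partition \<rho> \<and> sum_list \<rho> \<le> n}"
proof -
  have "{\<rho>. is_partition \<rho> \<and> sum_list \<rho> \<le> n} = (\<Union>k\<in>{..n}. partitions_of k)" by (auto simp: partitions_of_def)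
  then show ?thesis by (simp add: finite_partitions_of)
qed

lemma partition_of_small_weight:
  assumes \<nu>: "\<nu> \<in> partitions_of m" and w: "partition_weight \<nu> \<le> n" and m: "2 * n \<le> m" "0 < n"
  shows "tl \<nu> \<in> {\<rho>. is_partition \<rho> \<and> sum_list \<rho> \<le> n}" "\<nu> = padded (tl \<nu>) m"
proof -
  obtain k \<rho> where k: "\<nu> = k # \<rho>" using \<nu> m by (cases \<nu>) (auto simp: partitions_of_def)
  have p: "is_partition \<rho>" and km: "k + sum_list \<rho> = m" using \<nu> k by (auto simp: partitions_of_def is_partition_def)
  have r: "sum_list \<rho> \<le> n" using w k by (simp add: partition_weight_def)
  show "tl \<nu> \<in> {\<rho>. is_partition \<rho> \<and> sum_list \<rho> \<le> n}" using k p r by simp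
  show "\<nu> = padded (tl \<nu>) m" using padded_eq[OF p, of m] r m km k by simp
qed

abbreviation tabloid_character :: "nat list \<Rightarrow> nat \<Rightarrow> (nat \<Rightarrow> nat) \<Rightarrow> rat" where
  "tabloid_character \<rho> m \<equiv> character (perm_module (partial_tabloids \<rho> m) tabloid_action)"

lemma tabloid_character_eq:
  assumes "is_partition \<rho>" "sum_list \<rho> < m" "g permutes {1..m}"
  shows "character (tabloid_module (padded \<rho> m)) g = tabloid_character \<rho> m g"
  using character_partial_tabloids[of \<rho> m g] padded_eq[of \<rho> m] assms by simp

lemma mult_tabloid_character:
  assumes "is_partition \<rho>" "sum_list \<rho> < m" "\<nu> \<in> partitions_of m"
  shows "mult m (tabloid_character \<rho> m) \<nu> = mult m (character (tabloid_module (padded \<rho> m))) \<nu>"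
  using tabloid_character_eq[OF assms(1,2)] by (intro mult_cong) simp

definition stable_pairings :: "nat \<Rightarrow> (nat \<Rightarrow> (nat \<Rightarrow> nat) \<Rightarrow> rat) \<Rightarrow> bool" where
  "stable_pairings n \<omega> \<longleftrightarrow> (\<forall>\<rho>. is_partition \<rho> \<longrightarrow> sum_list \<rho> \<le> n \<longrightarrow>
     (\<exists>G. \<forall>m\<ge>2 * n. char_inner m (tabloid_character \<rho> m) (\<omega> m) = G))"

text \<open>
  The pairing counts the orbits on a product, where the supports have at most \<open>sum_list \<rho> + n\<close> elements.
\<close>

lemma (in fi_set) stable_pairings_W:
  assumes "n \<le> N"
  shows "stable_pairings N (\<lambda>m. character (W m))"
  unfolding stable_pairings_def
proof (intro allI impI)
  fix \<rho> assume \<rho>: "is_partition \<rho>" "sum_list \<rho> \<le> N"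
  interpret T: fi_set "partial_tabloids \<rho>" tabloid_action "\<lambda>t. \<Union> (set t)" "sum_list \<rho>"
    by (rule fi_set_partial_tabloids)
  interpret TA: fi_set "\<lambda>m. partial_tabloids \<rho> m \<times> A m" "\<lambda>g (a, b). (tabloid_action g a, \<alpha> g b)"
    "\<lambda>(a, b). \<Union> (set a) \<union> supp b" "sum_list \<rho> + n"
    by (rule fi_set_times[OF T.fi_set_axioms fi_set_axioms])
  have "char_inner m (tabloid_character \<rho> m) (character (W m)) =
     of_nat (card (action_orbit (sum_list \<rho> + n) (\<lambda>g (a, b). (tabloid_action g a, \<alpha> g b)) `
       (partial_tabloids \<rho> (sum_list \<rho> + n) \<times> A (sum_list \<rho> + n))))"
    if "2 * N \<le> m" for m
    unfolding char_inner_perm_modules[OF T.action action]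
    using TA.orbits_stable[of m] that assms \<rho>(2) by simp
  then show "\<exists>G. \<forall>m\<ge>2 * N. char_inner m (tabloid_character \<rho> m) (character (W m)) = G" by blast
qed

text \<open>
  The tabloid characters are unitriangular in the characters of the Specht modules, if the shapes
  are ordered by the sum of the row indices, which the length of the first row does not affect. So
  the multiplicities can be computed recursively from the pairings with the tabloid characters. The
  coefficients of this recursion are themselves multiplicities that occur earlier in it.
\<close>

theorem stable_multiplicities:
  assumes "0 < n" "is_partition \<rho>" "sum_list \<rho> \<le> n" "stable_pairings n \<omega>"
  shows "\<exists>k. \<forall>m\<ge>2 * n. mult m (\<omega> m) (padded \<rho> m) = k"
  using assms
proof (induction "\<Sum>i<length \<rho>. Suc i * \<rho> ! i" arbitrary: \<rho> \<omega> rule: less_induct)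
  case less
  define s where "s \<sigma> = (\<Sum>i<length \<sigma>. Suc i * \<sigma> ! i)" for \<sigma> :: "nat list"
  let ?L = "{\<sigma>. is_partition \<sigma> \<and> sum_list \<sigma> \<le> n}"
  let ?L' = "{\<sigma>\<in>?L. s \<sigma> < s \<rho>}"
  note finL = finite_bounded_partitions[of n]
  let ?\<pi> = "tabloid_character \<rho>"
  interpret T: fi_set "partial_tabloids \<rho>" tabloid_action "\<lambda>t. \<Union> (set t)" "sum_list \<rho>"
    by (rule fi_set_partial_tabloids)
  obtain G where G: "\<And>m. 2 * n \<le> m \<Longrightarrow> char_inner m (?\<pi> m) (\<omega> m) = G"
    using less.prems by (auto simp: stable_pairings_def)
  have IH: "\<exists>k. \<forall>m\<ge>2 * n. mult m (\<omega>' m) (padded \<sigma> m) = k" if "\<sigma> \<in> ?L'" "stable_pairings n \<omega>'" for \<sigma> \<omega>'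
    using less.hyps[of \<sigma> \<omega>'] that less.prems(1) by (auto simp: s_def)
  define k1 where "k1 \<sigma> = (SOME k. \<forall>m\<ge>2 * n. mult m (\<omega> m) (padded \<sigma> m) = k)" for \<sigma>
  have k1: "mult m (\<omega> m) (padded \<sigma> m) = k1 \<sigma>" if "\<sigma> \<in> ?L'" "2 * n \<le> m" for \<sigma> m
    using someI_ex[OF IH[OF that(1) less.prems(4)]] that(2) unfolding k1_def by blast
  define k2 where "k2 \<sigma> = (SOME k. \<forall>m\<ge>2 * n. mult m (?\<pi> m) (padded \<sigma> m) = k)" for \<sigma>
  have k2: "mult m (?\<pi> m) (padded \<sigma> m) = k2 \<sigma>" if "\<sigma> \<in> ?L'" "2 * n \<le> m" for \<sigma> m
    using someI_ex[OF IH[OF that(1) T.stable_pairings_W[OF less.prems(3)]]] that(2) unfolding k2_def by blast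
  have "mult m (\<omega> m) (padded \<rho> m) = G - (\<Sum>\<sigma>\<in>?L'. k2 \<sigma> * k1 \<sigma>)" if m: "2 * n \<le> m" for m
  proof -
    have small: "sum_list \<sigma> < m" "padded \<sigma> m \<in> partitions_of m" if "\<sigma> \<in> ?L" for \<sigma>
    proof -
      show "sum_list \<sigma> < m" using that m less.prems(1) by auto
      then show "padded \<sigma> m \<in> partitions_of m"
        using that m first_part_le[of \<sigma>] by (intro padded_partition) auto
    qed
    have \<rho>: "\<rho> \<in> ?L" using less.prems by simp
    have rs: "row_sum (padded \<sigma> m) = s \<sigma>" if "\<sigma> \<in> ?L" for \<sigma>
      using padded_eq[of \<sigma> m] small(1)[OF that] that row_sum_Cons[of _ \<sigma>] by (simp add: s_def)
    have inj: "inj_on (\<lambda>\<sigma>. padded \<sigma> m) ?L"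
      by (rule inj_on_subset[OF inj_on_padded]) (use small(1) in auto)
    have K: "mult m (?\<pi> m) (padded \<sigma> m) = mult m (character (tabloid_module (padded \<rho> m))) (padded \<sigma> m)"
      if "\<sigma> \<in> ?L" for \<sigma>
      by (rule mult_tabloid_character) (use less.prems small[OF \<rho>] small[OF that] in auto)
    have K1: "mult m (?\<pi> m) (padded \<rho> m) = 1"
      using K[OF \<rho>] mult_tabloid_one[OF small(2)[OF \<rho>]] by simp
    have K0: "mult m (?\<pi> m) (padded \<sigma> m) = 0" if \<sigma>: "\<sigma> \<in> ?L" "\<sigma> \<noteq> \<rho>" "\<not> s \<sigma> < s \<rho>" for \<sigma>
      unfolding K[OF \<sigma>(1)]
      by (rule mult_tabloid_zero[OF small(2)[OF \<sigma>(1)] small(2)[OF \<rho>]])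
        (use rs[OF \<sigma>(1)] rs[OF \<rho>] \<sigma> inj \<rho> in \<open>auto simp: inj_on_def\<close>)
    have "G = char_inner m (?\<pi> m) (\<omega> m)" using G[OF m] by simp
    also have "\<dots> = char_inner m (\<lambda>g. \<Sum>\<nu>\<in>partitions_of m. mult m (?\<pi> m) \<nu> * character (specht \<nu>) g) (\<omega> m)"
      by (rule char_inner_cong) (use character_expansion[OF T.W_Sm] in auto)
    also have "\<dots> = (\<Sum>\<nu>\<in>partitions_of m. mult m (?\<pi> m) \<nu> * mult m (\<omega> m) \<nu>)"
      by (simp add: char_inner_sum char_inner_scale mult_def char_inner_commute[of m "\<omega> m"])
    also have "\<dots> = (\<Sum>\<nu>\<in>(\<lambda>\<sigma>. padded \<sigma> m) ` ?L. mult m (?\<pi> m) \<nu> * mult m (\<omega> m) \<nu>)"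
    proof (rule sum.mono_neutral_right[OF finite_partitions_of])
      show "(\<lambda>\<sigma>. padded \<sigma> m) ` ?L \<subseteq> partitions_of m" using small(2) by auto
      show "\<forall>\<nu>\<in>partitions_of m - (\<lambda>\<sigma>. padded \<sigma> m) ` ?L. mult m (?\<pi> m) \<nu> * mult m (\<omega> m) \<nu> = 0"
      proof (rule ballI, rule ccontr)
        fix \<nu> assume \<nu>: "\<nu> \<in> partitions_of m - (\<lambda>\<sigma>. padded \<sigma> m) ` ?L" "mult m (?\<pi> m) \<nu> * mult m (\<omega> m) \<nu> \<noteq> 0"
        then have "partition_weight \<nu> \<le> n" using T.mult_weight[of \<nu> m] less.prems(3) by auto
        then have "tl \<nu> \<in> ?L" "\<nu> = padded (tl \<nu>) m"
          using partition_of_small_weight[of \<nu> m n] \<nu>(1) m less.prems(1) by auto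
        then show False using \<nu>(1) by blast
      qed
    qed
    also have "\<dots> = (\<Sum>\<sigma>\<in>?L. mult m (?\<pi> m) (padded \<sigma> m) * mult m (\<omega> m) (padded \<sigma> m))"
      by (rule sum.reindex[OF inj, unfolded comp_def])
    also have "\<dots> = (\<Sum>\<sigma>\<in>insert \<rho> ?L'. mult m (?\<pi> m) (padded \<sigma> m) * mult m (\<omega> m) (padded \<sigma> m))"
      by (rule sum.mono_neutral_right[OF finL]) (use \<rho> K0 in auto)
    also have "\<dots> = mult m (\<omega> m) (padded \<rho> m) + (\<Sum>\<sigma>\<in>?L'. mult m (?\<pi> m) (padded \<sigma> m) * mult m (\<omega> m) (padded \<sigma> m))"
    proof -
      have "finite ?L'" by (rule finite_subset[OF _ finL]) auto
      then show ?thesis by (subst sum.insert) (simp_all add: K1)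
    qed
    also have "(\<Sum>\<sigma>\<in>?L'. mult m (?\<pi> m) (padded \<sigma> m) * mult m (\<omega> m) (padded \<sigma> m)) = (\<Sum>\<sigma>\<in>?L'. k2 \<sigma> * k1 \<sigma>)"
      by (intro sum.cong refl) (simp add: k1 k2 m)
    finally show ?thesis by simp
  qed
  then show ?case by blast
qed

section \<open>Ranks\<close>

lemma rank_eqI:
  assumes "Q N" "\<And>M. Q M \<Longrightarrow> N \<le> M"
  shows "Inf {enat M | M. Q M} = enat N"
proof (rule antisym)
  show "Inf {enat M | M. Q M} \<le> enat N" by (rule Inf_lower) (use assms(1) in blast)
  show "enat N \<le> Inf {enat M | M. Q M}" by (rule Inf_greatest) (use assms(2) in auto)
qed

lemma component_hom:
  assumes fin: "finite I" and i: "i \<in> I"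
  shows "module_hom_on m (direct_sum I V) (V i) (component i)"
proof -
  have "component i (act (direct_sum I V) g x) = act (V i) g (component i x)" for g x
  proof -
    have "component i (act (direct_sum I V) g x) = (\<Sum>j\<in>I. component i (inject j (act (V j) g (component j x))))"
      unfolding act_direct_sum
      by (rule poly_mapping_eqI) (simp add: lookup_sum)
    also have "\<dots> = (\<Sum>j\<in>I. if j = i then act (V i) g (component i x) else 0)"
      by (intro sum.cong refl) (simp add: component_inject)
    finally show ?thesis using fin i by simp
  qed
  then show ?thesis
    using i by (auto simp: module_hom_on_def equivariant_def linear_on_def component_add component_scale space_direct_sum)
qed

lemma specht_nonzero_hom_eq:
  assumes \<nu>: "\<nu> \<in> partitions_of m" and \<mu>: "\<mu> \<in> partitions_of m"
    and f: "module_hom_on m (specht \<nu>) (specht \<mu>) f" "x \<in> space (specht \<nu>)" "f x \<noteq> 0"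
  shows "\<nu> = \<mu>"
proof (rule ccontr)
  assume ne: "\<nu> \<noteq> \<mu>"
  note S\<nu> = partitions_of_Sm[OF \<nu>] and S\<mu> = partitions_of_Sm[OF \<mu>]
  have "rep_iso m (specht \<nu>) (specht \<mu>)"
    using schur[OF partitions_of_simple[OF \<nu>] partitions_of_simple[OF \<mu>] f] f(1) by (auto simp: rep_iso_iff)
  then have "character (specht \<nu>) g = character (specht \<mu>) g" if "g permutes {1..m}" for g
    using character_rep_iso[OF S\<nu> S\<mu> _ that] by simp
  then have "char_inner m (character (specht \<nu>)) (character (specht \<nu>)) =
      char_inner m (character (specht \<nu>)) (character (specht \<mu>))"
    by (intro char_inner_cong) auto
  then show False using specht_orthonormal[OF \<nu> \<nu>] specht_orthonormal[OF \<nu> \<mu>] ne by simp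
qed

context fi_set
begin

text \<open>
  Constituents have at most \<open>n\<close> boxes below the first row, and the multiplicities of these shapes are
  stable from \<open>2 * n\<close> on. The other labels allowed in rank \<open>2 * n\<close> get multiplicity \<open>0\<close>.
\<close>

lemma RS_from_double:
  assumes n: "0 < n"
  shows "RS_from (2 * n) (\<lambda>m. W m)"
proof -
  let ?\<omega> = "\<lambda>m. character (W m)"
  let ?L = "{\<mu>. is_partition \<mu> \<and> sum_list \<mu> + first_part \<mu> \<le> 2 * n}"
  have small: "sum_list \<mu> < m" "padded \<mu> m \<in> partitions_of m" if "\<mu> \<in> ?L" "2 * n \<le> m" for \<mu> m
  proof -
    have "first_part \<mu> > 0" if "\<mu> \<noteq> []" "is_partition \<mu>" using that by (cases \<mu>) (auto simp: first_part_def is_partition_def)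
    then show "sum_list \<mu> < m" using that n by (cases "\<mu> = []") auto
    then show "padded \<mu> m \<in> partitions_of m" using that by (intro padded_partition) auto
  qed
  have le: "\<mu> \<in> ?L" if "is_partition \<mu>" "sum_list \<mu> \<le> n" for \<mu>
    using that first_part_le[of \<mu>] by simp
  have "\<exists>c. mult (2 * n) (?\<omega> (2 * n)) (padded \<mu> (2 * n)) = of_nat c" if "\<mu> \<in> ?L" for \<mu>
    by (rule mult_nat[OF W_Sm small(2)[OF that order_refl]])
  then have c_ex: "\<forall>\<mu>. \<exists>c. \<mu> \<in> ?L \<longrightarrow> mult (2 * n) (?\<omega> (2 * n)) (padded \<mu> (2 * n)) = of_nat c" by blast
  then obtain c where c0: "\<And>\<mu>. \<mu> \<in> ?L \<Longrightarrow> mult (2 * n) (?\<omega> (2 * n)) (padded \<mu> (2 * n)) = of_nat (c \<mu>)"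
    using choice[OF c_ex] by blast
  have c: "mult m (?\<omega> m) (padded \<mu> m) = of_nat (c \<mu>)" if \<mu>: "\<mu> \<in> ?L" and m: "2 * n \<le> m" for \<mu> m
  proof (cases "sum_list \<mu> \<le> n")
    case True
    obtain k where k: "\<forall>m\<ge>2 * n. mult m (?\<omega> m) (padded \<mu> m) = k"
      using stable_multiplicities[OF n _ True stable_pairings_W[OF order_refl]] \<mu> by blast
    then show ?thesis using c0[OF \<mu>] m by (metis order_refl)
  next
    case False
    have z: "mult l (?\<omega> l) (padded \<mu> l) = 0" if l: "2 * n \<le> l" for l
    proof (rule ccontr)
      assume "mult l (?\<omega> l) (padded \<mu> l) \<noteq> 0"
      then have "partition_weight (padded \<mu> l) \<le> n" by (rule mult_weight[OF small(2)[OF \<mu> l]])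
      then show False using padded_eq[of \<mu> l] small(1)[OF \<mu> l] \<mu> False by (simp add: partition_weight_def)
    qed
    then show ?thesis using c0[OF \<mu>] m by simp
  qed
  have finL: "finite ?L" by (rule finite_subset[OF _ finite_bounded_partitions[of "2 * n"]]) auto
  show ?thesis unfolding RS_from_def
  proof (intro exI[of _ c] allI impI)
    fix m assume m: "2 * n \<le> m"
    have "rep_iso m (W m) (direct_sum {(\<mu>, k). \<mu> \<in> ?L \<and> k < c \<mu>} (\<lambda>(\<mu>, k). specht (padded \<mu> m)))"
    proof (rule direct_sum_decomposition[OF W_Sm finL])
      show "inj_on (\<lambda>\<mu>. padded \<mu> m) ?L"
        by (rule inj_on_subset[OF inj_on_padded]) (use small(1)[OF _ m] in auto)
      show "(\<lambda>\<mu>. padded \<mu> m) ` ?L \<subseteq> partitions_of m" using small(2)[OF _ m] by blast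
      show "mult m (?\<omega> m) (padded \<mu> m) = of_nat (c \<mu>)" if "\<mu> \<in> ?L" for \<mu> by (rule c[OF that m])
      fix \<nu> assume \<nu>: "\<nu> \<in> partitions_of m" "mult m (?\<omega> m) \<nu> \<noteq> 0"
      then have "tl \<nu> \<in> {\<rho>. is_partition \<rho> \<and> sum_list \<rho> \<le> n}" "\<nu> = padded (tl \<nu>) m"
        using partition_of_small_weight[OF \<nu>(1) mult_weight[OF \<nu>] m n] by blast+
      then show "\<nu> \<in> (\<lambda>\<mu>. padded \<mu> m) ` ?L" using le by blast
    qed
    moreover have "{(\<mu>, k). \<mu> \<in> ?L \<and> k < c \<mu>} =
       {(\<mu>, k). is_partition \<mu> \<and> sum_list \<mu> + first_part \<mu> \<le> 2 * n \<and> k < c \<mu>}" by auto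
    ultimately show "rep_iso m (W m) (direct_sum {(\<mu>, k). is_partition \<mu> \<and> sum_list \<mu> + first_part \<mu> \<le> 2 * n \<and> k < c \<mu>}
             (\<lambda>(\<mu>, k). specht (padded \<mu> m)))" by simp
  qed
qed

text \<open>
  If some element has full support \<open>{1..n}\<close>, then sending an \<open>n\<close>-subset to the sum of the elements with
  this support embeds the tabloid module of \<open>[n, n]\<close>, and with it \<open>specht [n, n]\<close>, into degree
  \<open>2 * n\<close>. Since \<open>[n, n]\<close> is \<open>padded [n] (2 * n)\<close>, this constituent is not allowed below rank \<open>2 * n\<close>.
\<close>

lemma RS_from_bound:
  assumes n: "0 < n" and full: "a0 \<in> A n" "supp a0 = {1..n}" and RS: "RS_from N (\<lambda>m. W m)"
  shows "2 * n \<le> N"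
proof (rule ccontr)
  assume "\<not> 2 * n \<le> N"
  then have N: "N < 2 * n" by simp
  let ?m = "2 * n" and ?\<nu> = "[n, n]"
  have \<nu>: "?\<nu> \<in> partitions_of ?m" using n by (simp add: partitions_of_def is_partition_def)
  have sm: "sum_list ?\<nu> = ?m" by (simp add: mult_2)
  note actT = perm_action_tabloids[of ?\<nu>, unfolded sm]
  obtain c :: "nat list \<Rightarrow> nat" where "\<forall>m\<ge>N. rep_iso m (W m)
      (direct_sum {(\<mu>, k). is_partition \<mu> \<and> sum_list \<mu> + first_part \<mu> \<le> N \<and> k < c \<mu>} (\<lambda>(\<mu>, k). specht (padded \<mu> m)))"
    using RS unfolding RS_from_def by (elim exE)
  moreover have "N \<le> ?m" using N by simp
  ultimately have c: "rep_iso ?m (W ?m)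
      (direct_sum {(\<mu>, k). is_partition \<mu> \<and> sum_list \<mu> + first_part \<mu> \<le> N \<and> k < c \<mu>} (\<lambda>(\<mu>, k). specht (padded \<mu> ?m)))"
    by blast
  define I where "I = {(\<mu>, k). is_partition \<mu> \<and> sum_list \<mu> + first_part \<mu> \<le> N \<and> k < c \<mu>}"
  define V where "V = (\<lambda>(\<mu>, k :: nat). specht (padded \<mu> ?m))"
  have finI: "finite I"
  proof (rule finite_subset)
    show "I \<subseteq> Sigma {\<mu>. is_partition \<mu> \<and> sum_list \<mu> \<le> N} (\<lambda>\<mu>. {..<c \<mu>})" by (auto simp: I_def)
    show "finite (Sigma {\<mu>. is_partition \<mu> \<and> sum_list \<mu> \<le> N} (\<lambda>\<mu>. {..<c \<mu>}))"
      using finite_bounded_partitions by (intro finite_SigmaI) auto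
  qed
  obtain F where F: "module_hom_on ?m (W ?m) (direct_sum I V) F" "bij_betw F (space (W ?m)) (space (direct_sum I V))"
    using c unfolding rep_iso_iff I_def V_def by blast
  note finA = perm_actionD(1)[OF action[of ?m]]
  define \<theta> where "\<theta> = lin_ext (\<lambda>t. \<Sum>a | a \<in> A ?m \<and> supp a = t ! 1. bvec a :: 'a \<Rightarrow>\<^sub>0 rat)"
  have \<theta>lin: "qlinear \<theta>" by (simp add: \<theta>_def)
  have \<theta>b: "\<theta> (bvec t) = (\<Sum>a | a \<in> A ?m \<and> supp a = t ! 1. bvec a)" for t by (simp add: \<theta>_def)
  have \<theta>sp: "\<theta> x \<in> space (W ?m)" if "Poly_Mapping.keys x \<subseteq> tabloids ?\<nu>" for x
    unfolding \<theta>_def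
    by (rule lin_ext_in_subspace[OF Sm_subspace[OF W_Sm] that]) (intro qvs.subspace_sum[OF Sm_subspace[OF W_Sm]], auto)
  have \<theta>eq: "\<theta> (act (tabloid_module ?\<nu>) g x) = act (W ?m) g (\<theta> x)"
    if g: "g permutes {1..?m}" and x: "x \<in> space (tabloid_module ?\<nu>)" for g x
  proof (rule linear_on_eq_on_span[where B = "bvec ` tabloids ?\<nu>"])
    note M = tabloid_module_Sm[of ?\<nu>, unfolded sm]
    show "qvs.subspace (space (tabloid_module ?\<nu>))" by (rule Sm_subspace[OF M])
    show "linear_on (space (tabloid_module ?\<nu>)) (\<lambda>x. \<theta> (act (tabloid_module ?\<nu>) g x))"
      by (rule linear_on_comp[OF Sm_linear[OF M g] qlinear_imp_linear_on[OF \<theta>lin] subset_UNIV])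
    show "linear_on (space (tabloid_module ?\<nu>)) (\<lambda>x. act (W ?m) g (\<theta> x))"
      by (rule linear_on_comp[OF qlinear_imp_linear_on[OF \<theta>lin] Sm_linear[OF W_Sm g]]) (use \<theta>sp in auto)
    show "space (tabloid_module ?\<nu>) \<subseteq> qvs.span (bvec ` tabloids ?\<nu>)" by (simp add: span_bvec)
    show "x \<in> space (tabloid_module ?\<nu>)" by (rule x)
    fix b assume "b \<in> bvec ` tabloids ?\<nu>"
    then obtain t where t: "t \<in> tabloids ?\<nu>" "b = bvec t" by blast
    have "length t = 2" using tabloidsD(1)[OF t(1)] by simp
    then have t1: "tabloid_action g t ! 1 = g ` (t ! 1)" by (simp add: tabloid_action_def)
    have "act (W ?m) g (\<theta> b) = (\<Sum>a | a \<in> A ?m \<and> supp a = t ! 1. bvec (\<alpha> g a))"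
      unfolding t(2) \<theta>b
      by (subst linear_on_sum[OF Sm_subspace[OF W_Sm] Sm_linear[OF W_Sm g]]) auto
    also have "\<dots> = (\<Sum>a | a \<in> A ?m \<and> supp a = g ` (t ! 1). bvec a)"
    proof (rule sum.reindex_bij_witness[of _ "\<alpha> (inv g)" "\<alpha> g"])
      note g' = perms_inv[OF g]
      fix a assume a: "a \<in> {a. a \<in> A ?m \<and> supp a = t ! 1}"
      then show "\<alpha> (inv g) (\<alpha> g a) = a" using perm_action_inv[OF action g] by simp
      show "\<alpha> g a \<in> {a. a \<in> A ?m \<and> supp a = g ` (t ! 1)}"
        using a supp_action[OF _ g] perm_actionD(3)[OF action g] by auto
    next
      note g' = perms_inv[OF g]
      fix a assume a: "a \<in> {a. a \<in> A ?m \<and> supp a = g ` (t ! 1)}"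
      then show "\<alpha> g (\<alpha> (inv g) a) = a" using perm_action_inv[OF action g] by simp
      have "inv g ` g ` (t ! 1) = t ! 1" using permutes_inv_o(2)[OF g] by (simp add: image_comp)
      then show "\<alpha> (inv g) a \<in> {a. a \<in> A ?m \<and> supp a = t ! 1}"
        using a supp_action[OF _ g'] perm_actionD(3)[OF action g'] by auto
    qed simp
    also have "\<dots> = \<theta> (act (tabloid_module ?\<nu>) g b)"
      unfolding t(2) act_perm_module_bvec \<theta>b t1 ..
    finally show "\<theta> (act (tabloid_module ?\<nu>) g b) = act (W ?m) g (\<theta> b)" by simp
  qed auto
  have \<theta>inj: "x = 0" if x: "Poly_Mapping.keys x \<subseteq> tabloids ?\<nu>" "\<theta> x = 0" for x
  proof (rule poly_mapping_eqI)
    fix t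
    show "Poly_Mapping.lookup x t = Poly_Mapping.lookup 0 t"
    proof (cases "t \<in> tabloids ?\<nu>")
      case False then show ?thesis using x(1) by (auto simp: in_keys_iff)
    next
      case True
      note tD = tabloidsD[OF True]
      have "t ! 1 \<in> set t" using tD(1) by simp
      then have t1: "t ! 1 \<subseteq> {1..?m}" using tD(4)[unfolded sm] by (metis Union_upper)
      have "card (t ! 1) = card {1..n}" using tD(2)[of 1] by simp
      then obtain h where h: "bij_betw h {1..n} (t ! 1)"
        using finite_same_card_bij[of "{1..n}" "t ! 1"] finite_subset[OF t1] by auto
      obtain g where g: "g permutes {1..?m}" "\<And>y. y \<in> {1..n} \<Longrightarrow> g y = h y"
        using extend_to_permutation[of "{1..?m}" "{1..n}" h] h t1 by (auto simp: bij_betw_def)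
      have a0: "a0 \<in> A ?m" using full(1) mono[of n ?m] by auto
      define a where "a = \<alpha> g a0"
      have a: "a \<in> A ?m" unfolding a_def by (rule perm_actionD(3)[OF action g(1) a0])
      have sa: "supp a = t ! 1"
        using supp_action[OF a0 g(1)] full(2) g(2) h by (simp add: a_def bij_betw_def)
      have uniq: "t' = t" if t': "t' \<in> tabloids ?\<nu>" "t' ! 1 = t ! 1" for t'
      proof -
        have hd: "s ! 0 = {1..?m} - s ! 1" "length s = 2" if s: "s \<in> tabloids ?\<nu>" for s
        proof -
          note sD = tabloidsD[OF s]
          show l: "length s = 2" using sD(1) by simp
          then have "set s = {s ! 0, s ! 1}" by (auto simp: set_conv_nth less_2_cases_iff One_nat_def)
          then have "s ! 0 \<union> s ! 1 = {1..?m}" using sD(4)[unfolded sm] by simp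
          moreover have "s ! 0 \<inter> s ! 1 = {}" using sD(3)[of 0 1] by simp
          ultimately show "s ! 0 = {1..?m} - s ! 1" by blast
        qed
        show ?thesis
          using hd[OF t'(1)] hd[OF True] t'(2) by (intro nth_equalityI) (auto simp: less_2_cases_iff One_nat_def)
      qed
      have "Poly_Mapping.lookup (\<theta> x) a = (\<Sum>t'\<in>tabloids ?\<nu>. Poly_Mapping.lookup x t' * (if t' = t then 1 else 0))"
        unfolding \<theta>_def lin_ext_alt[OF finite_tabloids x(1)] lookup_sum lookup_qscale
      proof (intro sum.cong refl arg_cong2[where f = "(*)"])
        fix t' assume t': "t' \<in> tabloids ?\<nu>"
        have "(\<Sum>b | b \<in> A ?m \<and> supp b = t' ! 1. Poly_Mapping.lookup (bvec b) a) = (if supp a = t' ! 1 then 1 else (0 :: rat))"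
          using a finA by (simp add: lookup_single when_def)
        also have "\<dots> = (if t' = t then 1 else 0)" using sa uniq[OF t'] by auto
        finally show "(\<Sum>b | b \<in> A ?m \<and> supp b = t' ! 1. Poly_Mapping.lookup (bvec b) a) = (if t' = t then 1 else (0 :: rat))" .
      qed
      also have "\<dots> = Poly_Mapping.lookup x t" using True by (simp add: if_distrib cong: if_cong)
      finally show ?thesis using x(2) by simp
    qed
  qed
  obtain T where T: "T \<in> tableaux ?\<nu>" using tableaux_exists .
  let ?e = "polytabloid T"
  note e = polytabloid_in_specht[OF T]
  have sub: "space (specht ?\<nu>) \<subseteq> {x. Poly_Mapping.keys x \<subseteq> tabloids ?\<nu>}" by (rule specht_subset)
  have "\<theta> ?e \<noteq> 0" using \<theta>inj[of ?e] polytabloid_nonzero[OF T] sub e \<nu> by (auto simp: partitions_of_def)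
  moreover have "\<theta> ?e \<in> space (W ?m)" using \<theta>sp sub e by blast
  ultimately have Fe: "F (\<theta> ?e) \<noteq> 0" "F (\<theta> ?e) \<in> space (direct_sum I V)"
    using F(2) linear_on_inj_iff[OF Sm_subspace[OF W_Sm] module_hom_onD(1)[OF F(1)]] by (auto simp: bij_betw_def)
  have "\<exists>i\<in>I. component i (F (\<theta> ?e)) \<noteq> 0"
  proof (rule ccontr)
    assume "\<not> (\<exists>i\<in>I. component i (F (\<theta> ?e)) \<noteq> 0)"
    then have "(\<Sum>i\<in>I. inject i (component i (F (\<theta> ?e)))) = 0" by simp
    then show False using sum_inject_component[OF finI, of "F (\<theta> ?e)"] Fe by (simp add: space_direct_sum)
  qed
  then obtain \<mu> k where i: "(\<mu>, k) \<in> I" "component (\<mu>, k) (F (\<theta> ?e)) \<noteq> 0" by auto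
  have "module_hom_on ?m (specht ?\<nu>) (W ?m) \<theta>"
    unfolding module_hom_on_def equivariant_def
  proof (intro conjI allI impI ballI)
    show "linear_on (space (specht ?\<nu>)) \<theta>" by (rule qlinear_imp_linear_on[OF \<theta>lin])
    show "\<theta> ` space (specht ?\<nu>) \<subseteq> space (W ?m)" using \<theta>sp sub by blast
    fix g x assume "g permutes {1..?m}" "x \<in> space (specht ?\<nu>)"
    then show "\<theta> (act (specht ?\<nu>) g x) = act (W ?m) g (\<theta> x)"
      unfolding act_specht using sub by (intro \<theta>eq) auto
  qed
  then have hom: "module_hom_on ?m (specht ?\<nu>) (V (\<mu>, k)) (\<lambda>x. component (\<mu>, k) (F (\<theta> x)))"
    by (intro module_hom_on_comp[OF module_hom_on_comp[OF _ F(1)] component_hom[OF finI i(1)]])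
  have \<mu>: "is_partition \<mu>" "sum_list \<mu> + first_part \<mu> \<le> N" using i(1) by (auto simp: I_def)
  have "sum_list \<mu> < ?m" using \<mu>(2) N by simp
  then have p\<mu>: "padded \<mu> ?m \<in> partitions_of ?m" using \<mu> N by (intro padded_partition) auto
  have hom': "module_hom_on ?m (specht ?\<nu>) (specht (padded \<mu> ?m)) (\<lambda>x. component (\<mu>, k) (F (\<theta> x)))"
    using hom by (simp add: V_def)
  have "?\<nu> = padded \<mu> ?m"
    by (rule specht_nonzero_hom_eq[OF \<nu> p\<mu> hom' e]) (rule i(2))
  then have "\<mu> = [n]" using padded_eq[OF \<mu>(1) \<open>sum_list \<mu> < ?m\<close>] by simp
  then show False using \<mu>(2) N by (simp add: first_part_def)
qed

text \<open>
  A basis element in degree \<open>m + 1\<close> can be moved into degree \<open>m\<close> as soon as \<open>m\<close> bounds the size of its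
  support.
\<close>

lemma exhaustive_W:
  assumes nm: "n \<le> m" and \<phi>: "\<And>x. x \<in> space (W m) \<Longrightarrow> \<phi> m x = x"
  shows "exhaustive (\<lambda>m. W m) \<phi> m"
  unfolding exhaustive_def
proof
  let ?G = "{act (W (Suc m)) g (\<phi> m x) | g x. g permutes {1..Suc m} \<and> x \<in> space (W m)}"
  have sub: "space (W m) \<subseteq> space (W (Suc m))" using mono[of m "Suc m"] by auto
  show "qvs.span ?G \<subseteq> space (W (Suc m))"
  proof (rule qvs.span_minimal[OF _ Sm_subspace[OF W_Sm]])
    show "?G \<subseteq> space (W (Suc m))"
    proof
      fix y assume "y \<in> ?G"
      then obtain g x where g: "g permutes {1..Suc m}" "x \<in> space (W m)" "y = act (W (Suc m)) g (\<phi> m x)" by blast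
      then have "y = act (W (Suc m)) g x" "x \<in> space (W (Suc m))" using \<phi> sub by auto
      then show "y \<in> space (W (Suc m))" using Sm_closed[OF W_Sm g(1)] by blast
    qed
  qed
  have "bvec a \<in> ?G" if a: "a \<in> A (Suc m)" for a
  proof -
    obtain g where g: "g permutes {1..Suc m}" "\<alpha> g a \<in> A m" using move_into[OF a nm] by auto
    have "bvec a = act (W (Suc m)) (inv g) (\<phi> m (bvec (\<alpha> g a)))"
      using \<phi>[of "bvec (\<alpha> g a)"] g(2) perm_action_inv(1)[OF action g(1) a] by simp
    then show ?thesis using perms_inv[OF g(1)] g(2) by (intro CollectI exI[of _ "inv g"] exI[of _ "bvec (\<alpha> g a)"]) simp
  qed
  then have "qvs.span (bvec ` A (Suc m)) \<subseteq> qvs.span ?G" by (intro qvs.span_mono) blast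
  then show "space (W (Suc m)) \<subseteq> qvs.span ?G"
    using perm_actionD(1)[OF action[of "Suc m"]] by (simp add: span_bvec)
qed

lemma FI_module_W:
  assumes \<phi>: "\<And>m x. x \<in> space (W m) \<Longrightarrow> \<phi> m x = x"
  shows "FI_module (\<lambda>m. W m) \<phi>"
  unfolding FI_module_def FB_module_def
proof (intro conjI allI impI ballI)
  show "Sm_module m (W m)" for m by (rule W_Sm)
  have sub: "space (W m) \<subseteq> space (W k)" if "m \<le> k" for m k using mono[OF that] by auto
  fix m
  show "linear_on (space (W m)) (\<phi> m)"
    using qvs.subspace_add[OF Sm_subspace[OF W_Sm[of m]]] qvs.subspace_scale[OF Sm_subspace[OF W_Sm[of m]]]
    unfolding linear_on_def by (metis \<phi>)
  show "\<phi> m ` space (W m) \<subseteq> space (W (Suc m))" using \<phi>[of _ m] sub[of m "Suc m"] by fastforce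
  show "equivariant m (W m) (W (Suc m)) (\<phi> m)"
    unfolding equivariant_def
  proof (intro allI impI ballI)
    fix g x assume g: "g permutes {1..m}" and x: "x \<in> space (W m)"
    have "\<phi> m (act (W m) g x) = act (W m) g x" by (rule \<phi>[OF Sm_closed[OF W_Sm g x]])
    then show "\<phi> m (act (W m) g x) = act (W (Suc m)) g (\<phi> m x)" unfolding \<phi>[OF x] by (simp add: act_perm_module)
  qed
next
  have sub: "space (W m) \<subseteq> space (W k)" if "m \<le> k" for m k using mono[OF that] by auto
  have ic: "interior_comp \<phi> m k x = x" if "x \<in> space (W m)" for m k x
  proof (induction k)
    case (Suc k)
    have "x \<in> space (W (m + k))" using that sub[of m "m + k"] by auto
    then show ?case using Suc \<phi> by simp
  qed simp
  fix m k :: nat and g x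
  assume mk: "m \<le> k" and g: "g permutes {m + 1..k}" and x: "x \<in> space (W m)"
  have gk: "g permutes {1..k}" by (rule permutes_subset[OF g]) auto
  have "act (W k) g x = x"
    unfolding act_perm_module
  proof (rule lin_ext_eqI[where A = "A m"])
    show "Poly_Mapping.keys x \<subseteq> A m" using x by simp
    fix a assume a: "a \<in> A m"
    have "\<alpha> g a = a"
    proof (rule supp_fixed[OF _ gk])
      show "a \<in> A k" using a mono[OF mk] by blast
      fix y assume "y \<in> supp a"
      then have "y \<notin> {m + 1..k}" using supp_subset[OF a] by auto
      then show "g y = y" using permutes_not_in[OF g] by blast
    qed
    then show "bvec (\<alpha> g a) = bvec a" by simp
  qed (auto intro: qlinearI)
  then show "act (W k) g (interior_comp \<phi> m (k - m) x) = interior_comp \<phi> m (k - m) x" by (simp only: ic[OF x])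
qed

lemma rank_RS_W:
  assumes "0 < n" "a0 \<in> A n" "supp a0 = {1..n}"
  shows "rank_RS (\<lambda>m. W m) = enat (2 * n)"
  unfolding rank_RS_def
proof (rule rank_eqI)
  show "RS_from (2 * n) (\<lambda>m. W m)" by (rule RS_from_double[OF assms(1)])
  show "2 * n \<le> M" if "RS_from M (\<lambda>m. W m)" for M by (rule RS_from_bound[OF assms that])
qed

lemma rank_FI_RS_W:
  assumes "0 < n" "a0 \<in> A n" "supp a0 = {1..n}" and \<phi>: "\<And>m x. x \<in> space (W m) \<Longrightarrow> \<phi> m x = x"
  shows "rank_FI_RS (\<lambda>m. W m) \<phi> = enat (2 * n)"
  unfolding rank_FI_RS_def
proof (rule rank_eqI)
  have "inj_on (\<phi> m) (space (W m))" for m by (rule inj_onI) (metis \<phi>)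
  then show "FI_RS_from (2 * n) (\<lambda>m. W m) \<phi>"
    unfolding FI_RS_from_def using RS_from_double[OF assms(1)] exhaustive_W[of _ \<phi>, OF _ \<phi>] by auto
  show "2 * n \<le> M" if "FI_RS_from M (\<lambda>m. W m) \<phi>" for M
    using RS_from_bound[OF assms(1-3)] that by (auto simp: FI_RS_from_def)
qed

end

lemma rank_PC_zero:
  assumes "P \<in> polys_in {1..}" "\<And>m. expresses_character m P (W m)"
  shows "rank_PC W = 0"
proof -
  have "Inf {enat N | N. PC_from N W} \<le> enat 0"
    by (rule Inf_lower) (use assms in \<open>auto simp: PC_from_def\<close>)
  then show ?thesis by (simp add: rank_PC_def flip: zero_enat_def)
qed

section \<open>The modules of cycles\<close>

definition cycle_support :: "nat list set \<Rightarrow> nat set" where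
  "cycle_support c = \<Union> (set ` c)"

text \<open>
  The rotation by the full length is used instead of the rotation by \<open>0\<close>, so that the numbers \<open>k\<close> of
  places with a given \<open>gcd k l\<close> are counted by the totient function.
\<close>

lemma cyclic_class_eq:
  assumes "xs \<noteq> []"
  shows "cyclic_class xs = (\<lambda>k. rotate k xs) ` {0<..length xs}"
proof
  show "(\<lambda>k. rotate k xs) ` {0<..length xs} \<subseteq> cyclic_class xs" by (auto simp: cyclic_class_def)
  show "cyclic_class xs \<subseteq> (\<lambda>k. rotate k xs) ` {0<..length xs}"
  proof
    fix ys assume "ys \<in> cyclic_class xs"
    then obtain k where k: "ys = rotate k xs" by (auto simp: cyclic_class_def)
    show "ys \<in> (\<lambda>k. rotate k xs) ` {0<..length xs}"
    proof (cases "k mod length xs = 0")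
      case True
      then have "ys = rotate (length xs) xs" using k by (simp add: rotate_conv_mod[of k])
      then show ?thesis using assms by (intro image_eqI[of _ _ "length xs"]) auto
    next
      case False
      then show ?thesis using k rotate_conv_mod[of k xs] assms
        by (intro image_eqI[of _ _ "k mod length xs"]) (auto simp: less_imp_le)
    qed
  qed
qed

lemma self_in_cyclic_class: "xs \<in> cyclic_class xs"
  unfolding cyclic_class_def by (metis (mono_tags, lifting) mem_Collect_eq rotate0 id_apply)

lemma cyclic_class_memD:
  assumes "ys \<in> cyclic_class xs"
  shows "cyclic_class ys = cyclic_class xs" "set ys = set xs" "length ys = length xs" "distinct ys = distinct xs"
proof -
  obtain k where k: "ys = rotate k xs" using assms by (auto simp: cyclic_class_def)
  then show "set ys = set xs" "length ys = length xs" "distinct ys = distinct xs" by auto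
  have "rotate j xs \<in> cyclic_class ys" for j
  proof (cases "xs = []")
    case True then show ?thesis using k self_in_cyclic_class[of ys] by simp
  next
    case False
    have "(j + (length xs - k mod length xs) + k) mod length xs = (j + (length xs - k mod length xs) + k mod length xs) mod length xs"
      by (metis mod_add_right_eq)
    also have "j + (length xs - k mod length xs) + k mod length xs = j + length xs"
    proof -
      have "k mod length xs < length xs" using False by simp
      then show ?thesis by simp
    qed
    also have "(j + length xs) mod length xs = j mod length xs" by simp
    finally have "rotate (j + (length xs - k mod length xs)) ys = rotate j xs"
      unfolding k rotate_rotate by (metis rotate_conv_mod)
    then show ?thesis unfolding cyclic_class_def by (metis (mono_tags, lifting) mem_Collect_eq)
  qed
  then have "cyclic_class xs \<subseteq> cyclic_class ys" unfolding cyclic_class_def[of xs] by blast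
  moreover have "cyclic_class ys \<subseteq> cyclic_class xs"
    unfolding cyclic_class_def k by (auto simp: rotate_rotate)
  ultimately show "cyclic_class ys = cyclic_class xs" by blast
qed

lemma cycle_support_class: "cycle_support (cyclic_class xs) = set xs"
proof -
  have "set ` cyclic_class xs = {set xs}"
  proof
    show "set ` cyclic_class xs \<subseteq> {set xs}" using cyclic_class_memD(2)[of _ xs] by blast
    show "{set xs} \<subseteq> set ` cyclic_class xs" using self_in_cyclic_class[of xs] by blast
  qed
  then show ?thesis by (simp add: cycle_support_def)
qed

lemma cycle_action_class: "cycle_action g (cyclic_class xs) = cyclic_class (map g xs)"
  unfolding cycle_action_def cyclic_class_def by (auto simp: rotate_map)

definition cycle_lists :: "nat \<Rightarrow> nat \<Rightarrow> nat list set" where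
  "cycle_lists l m = {xs. length xs = l \<and> distinct xs \<and> set xs \<subseteq> {1..m}}"

lemma cycles_eq: "cycles l m = cyclic_class ` cycle_lists l m"
  by (auto simp: cycles_def cycle_lists_def)

lemma finite_cycle_lists [simp]: "finite (cycle_lists l m)"
  by (rule finite_subset[OF _ finite_lists_length_eq[of "{1..m}" l]]) (auto simp: cycle_lists_def)

lemma cycle_lists_map:
  assumes "xs \<in> cycle_lists l m" "g permutes {1..m}"
  shows "map g xs \<in> cycle_lists l m"
  using assms permutes_image[OF assms(2)] inj_on_subset[OF permutes_inj[OF assms(2)] subset_UNIV]
  by (auto simp: cycle_lists_def distinct_map)

lemma fi_set_cycles: "fi_set (cycles l) cycle_action cycle_support l"
proof
  fix m
  show "perm_action m (cycles l m) cycle_action"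
    unfolding perm_action_def
  proof (intro conjI allI impI ballI)
    show "finite (cycles l m)" by (simp add: cycles_eq)
    show "cycle_action id a = a" for a by (simp add: cycle_action_def)
    show "cycle_action (g \<circ> h) a = cycle_action g (cycle_action h a)" for g h a
      by (simp add: cycle_action_def image_comp comp_def)
    show "cycle_action g ` cycles l m \<subseteq> cycles l m" if "g permutes {1..m}" for g
      using cycle_lists_map[OF _ that] by (auto simp: cycles_eq cycle_action_class)
  qed
next
  fix c m assume "c \<in> cycles l m"
  then obtain xs where xs: "xs \<in> cycle_lists l m" "c = cyclic_class xs" by (auto simp: cycles_eq)
  show "cycle_support c \<subseteq> {1..m}" using xs by (simp add: cycle_support_class cycle_lists_def)
  show "card (cycle_support c) \<le> l"
    using xs by (auto simp: cycle_support_class cycle_lists_def distinct_card)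
  show "c \<in> cycles l k" if "cycle_support c \<subseteq> {1..k}" for k
    using xs that by (auto simp: cycles_eq cycle_support_class cycle_lists_def)
  fix g
  show "cycle_support (cycle_action g c) = g ` cycle_support c"
    by (simp add: xs(2) cycle_action_class cycle_support_class)
  assume "\<And>x. x \<in> cycle_support c \<Longrightarrow> g x = x"
  then have "map g xs = xs" unfolding xs(2) cycle_support_class by (intro map_idI) auto
  then show "cycle_action g c = c" by (simp add: xs(2) cycle_action_class)
qed

subsection \<open>Tensor products of permutation modules\<close>

lemma in_listset: "w \<in> listset As \<longleftrightarrow> length w = length As \<and> (\<forall>i<length As. w ! i \<in> As ! i)"
proof (induction As arbitrary: w)
  case (Cons A As)
  show ?case
  proof (cases w)
    case Nil then show ?thesis by (auto simp: set_Cons_def)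
  next
    case (Cons a v)
    then show ?thesis using Cons.IH[of v] by (auto simp: set_Cons_def nth_Cons less_Suc_eq_0_disj split: nat.split)
  qed
qed auto

lemma set_Cons_image: "set_Cons A B = (\<lambda>(a, b). a # b) ` (A \<times> B)"
  by (auto simp: set_Cons_def)

lemma card_listset: "card (listset As) = prod_list (map card As)"
proof (induction As)
  case (Cons A As)
  have "card (set_Cons A (listset As)) = card (A \<times> listset As)"
    unfolding set_Cons_image by (rule card_image) (auto simp: inj_on_def)
  then show ?case using Cons by (simp add: card_cartesian_product)
qed simp

lemma finite_listset: "(\<And>A. A \<in> set As \<Longrightarrow> finite A) \<Longrightarrow> finite (listset As)"
  by (induction As) (auto simp: set_Cons_image)

lemma listset_singletons: "listset (map (\<lambda>a. {a}) w) = {w}"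
  by (induction w) (auto simp: set_Cons_def)

lemma pure_tensor_bvec: "pure_tensor (map bvec w) = bvec w"
proof -
  have "map Poly_Mapping.keys (map bvec w) = map (\<lambda>a. {a}) w" by simp
  then show ?thesis
    unfolding pure_tensor_def by (simp only: listset_singletons) (simp add: prod.neutral)
qed

lemma keys_pure_tensor: "Poly_Mapping.keys (pure_tensor vs) \<subseteq> listset (map Poly_Mapping.keys vs)"
proof
  fix w assume "w \<in> Poly_Mapping.keys (pure_tensor vs)"
  then obtain u where "u \<in> listset (map Poly_Mapping.keys vs)"
    "w \<in> Poly_Mapping.keys (Poly_Mapping.single u (\<Prod>i<length vs. Poly_Mapping.lookup (vs ! i) (u ! i)))"
    using keys_sum unfolding pure_tensor_def by fast
  then show "w \<in> listset (map Poly_Mapping.keys vs)" by (auto split: if_splits)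
qed

lemma span_pure_tensors:
  assumes fin: "\<And>A. A \<in> set As \<Longrightarrow> finite A"
  shows "qvs.span {pure_tensor vs | vs. list_all2 (\<lambda>v A. Poly_Mapping.keys v \<subseteq> A) vs As} =
    {x. Poly_Mapping.keys x \<subseteq> listset As}"
proof
  show "qvs.span {pure_tensor vs | vs. list_all2 (\<lambda>v A. Poly_Mapping.keys v \<subseteq> A) vs As} \<subseteq> {x. Poly_Mapping.keys x \<subseteq> listset As}"
  proof (rule qvs.span_minimal[OF _ subspace_keys], clarify)
    fix vs w assume vs: "list_all2 (\<lambda>v A. Poly_Mapping.keys v \<subseteq> A) vs As" and "w \<in> Poly_Mapping.keys (pure_tensor vs)"
    then have "w \<in> listset (map Poly_Mapping.keys vs)" using keys_pure_tensor by blast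
    then show "w \<in> listset As" using vs by (auto simp: in_listset list_all2_conv_all_nth subset_iff)
  qed
  have "bvec w \<in> {pure_tensor vs | vs. list_all2 (\<lambda>v A. Poly_Mapping.keys v \<subseteq> A) vs As}" if "w \<in> listset As" for w
    using that pure_tensor_bvec[of w, symmetric]
    by (intro CollectI exI[of _ "map bvec w"]) (auto simp: in_listset list_all2_conv_all_nth)
  then have "qvs.span (bvec ` listset As) \<subseteq> qvs.span {pure_tensor vs | vs. list_all2 (\<lambda>v A. Poly_Mapping.keys v \<subseteq> A) vs As}"
    by (intro qvs.span_mono) blast
  then show "{x. Poly_Mapping.keys x \<subseteq> listset As} \<subseteq> qvs.span {pure_tensor vs | vs. list_all2 (\<lambda>v A. Poly_Mapping.keys v \<subseteq> A) vs As}"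
    using span_bvec[OF finite_listset[OF fin]] by simp
qed

text \<open>
  Taking the prefix makes the action agree with \<^const>\<open>tensor_map\<close> also on words of the wrong length, so
  that the tensor products are equal to permutation modules.
\<close>

definition word_action :: "nat list \<Rightarrow> (nat \<Rightarrow> nat) \<Rightarrow> nat list set list \<Rightarrow> nat list set list" where
  "word_action us g w = take (length us) (map (cycle_action g) w)"

definition cycle_words :: "nat list \<Rightarrow> nat \<Rightarrow> nat list set list set" where
  "cycle_words us m = listset (map (\<lambda>l. cycles l m) us)"

lemma in_cycle_words: "w \<in> cycle_words us m \<longleftrightarrow> length w = length us \<and> (\<forall>i<length us. w ! i \<in> cycles (us ! i) m)"
  by (auto simp: cycle_words_def in_listset)

lemma map2_bvec:
  "map2 (\<lambda>f a. f (bvec a)) (map (\<lambda>u. F u) us) w = map bvec (take (length us) (map h w))"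
  if "\<And>u a. F u (bvec a) = bvec (h a)"
  by (rule nth_equalityI) (use that in auto)

text \<open>
  A tensor product of permutation modules is the permutation module of the words of basis elements.
\<close>

lemma E_nu_rep_eq: "E_nu_rep \<nu> m = perm_module (cycle_words (rev \<nu>) m) (word_action (rev \<nu>))"
proof -
  let ?us = "rev \<nu>"
  have la: "list_all2 (\<lambda>v W. v \<in> space W) vs (map (\<lambda>l. E_rep l m) ?us) \<longleftrightarrow>
      list_all2 (\<lambda>v A. Poly_Mapping.keys v \<subseteq> A) vs (map (\<lambda>l. cycles l m) ?us)" for vs
    by (simp add: list_all2_map2 E_rep_def)
  have fin: "finite A" if "A \<in> set (map (\<lambda>l. cycles l m) ?us)" for A
    using that by (auto simp: cycles_eq)
  have act: "tensor_map (map (\<lambda>W. act W g) (map (\<lambda>l. E_rep l m) ?us)) = lin_ext (\<lambda>w. bvec (word_action ?us g w))" for g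
  proof -
    have "pure_tensor (map2 (\<lambda>f a. f (bvec a)) (map (\<lambda>W. act W g) (map (\<lambda>l. E_rep l m) ?us)) w) = bvec (word_action ?us g w)" for w
      unfolding map_map comp_def word_action_def pure_tensor_bvec[symmetric]
      by (subst map2_bvec[where h = "cycle_action g"]) (simp_all add: E_rep_def)
    then show ?thesis unfolding tensor_map_def by simp
  qed
  show ?thesis
    unfolding E_nu_rep_def tensor_rep_def perm_module_def act la cycle_words_def
    using span_pure_tensors[of "map (\<lambda>l. cycles l m) ?us", OF fin] by simp
qed

lemma E_nu_map_id:
  assumes "x \<in> space (perm_module (cycle_words (rev \<nu>) m) (word_action (rev \<nu>)))"
  shows "E_nu_map \<nu> m x = x"
  unfolding E_nu_map_def tensor_map_def
proof (rule lin_ext_eqI)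
  show "Poly_Mapping.keys x \<subseteq> cycle_words (rev \<nu>) m" using assms by simp
  fix w assume "w \<in> cycle_words (rev \<nu>) m"
  then have "length w = length \<nu>" by (simp add: in_cycle_words)
  then show "pure_tensor (map2 (\<lambda>f a. f (bvec a)) (map (\<lambda>l. E_map l m) (rev \<nu>)) w) = bvec w"
    using map2_bvec[of "\<lambda>l. E_map l m" id "rev \<nu>" w] by (simp add: E_map_def pure_tensor_bvec)
qed (auto intro: qlinearI)

lemma word_action_eq: "w \<in> cycle_words us m \<Longrightarrow> word_action us g w = map (cycle_action g) w"
  by (simp add: word_action_def in_cycle_words)

lemma fi_set_cycle_words:
  "fi_set (cycle_words us) (word_action us) (\<lambda>w. \<Union> (cycle_support ` set w)) (sum_list us)"
proof -
  have fi: "fi_set (cycles l) cycle_action cycle_support l" for l by (rule fi_set_cycles)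
  note act = fi_set.action[OF fi]
  show ?thesis
  proof
    fix m
    have cl: "word_action us g w \<in> cycle_words us m" if "g permutes {1..m}" "w \<in> cycle_words us m" for g w
      unfolding word_action_eq[OF that(2)] using that perm_actionD(3)[OF act that(1)] by (simp add: in_cycle_words)
    show "perm_action m (cycle_words us m) (word_action us)"
      unfolding perm_action_def
    proof (intro conjI allI impI ballI)
      show "finite (cycle_words us m)"
        unfolding cycle_words_def by (rule finite_listset) (auto simp: cycles_eq)
      show "word_action us id w = w" if "w \<in> cycle_words us m" for w
        unfolding word_action_eq[OF that] by (intro map_idI) (simp add: cycle_action_def)
      show "word_action us g ` cycle_words us m \<subseteq> cycle_words us m" if "g permutes {1..m}" for g
        using cl[OF that] by blast
      show "word_action us (g \<circ> h) w = word_action us g (word_action us h w)"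
        if "h permutes {1..m}" "w \<in> cycle_words us m" for g h w
        using word_action_eq[OF that(2)] word_action_eq[OF cl[OF that]]
        by (simp add: cycle_action_def image_comp comp_def)
    qed
  next
    fix w m assume w: "w \<in> cycle_words us m"
    then have wi: "length w = length us" "\<And>i. i < length us \<Longrightarrow> w ! i \<in> cycles (us ! i) m"
      by (auto simp: in_cycle_words)
    have S: "\<Union> (cycle_support ` set w) = (\<Union>i\<in>{..<length us}. cycle_support (w ! i))"
      using wi(1) by (auto simp: set_conv_nth)
    show "\<Union> (cycle_support ` set w) \<subseteq> {1..m}"
      unfolding S using fi_set.supp_subset[OF fi wi(2)] by blast
    have "card (\<Union>i\<in>{..<length us}. cycle_support (w ! i)) \<le> (\<Sum>i<length us. card (cycle_support (w ! i)))"
      by (rule card_UN_le) simp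
    also have "\<dots> \<le> (\<Sum>i<length us. us ! i)" by (intro sum_mono fi_set.supp_card[OF fi wi(2)]) simp
    finally show "card (\<Union> (cycle_support ` set w)) \<le> sum_list us"
      unfolding S by (simp add: sum_list_sum_nth atLeast0LessThan)
    show "w \<in> cycle_words us k" if k: "\<Union> (cycle_support ` set w) \<subseteq> {1..k}" for k
      unfolding in_cycle_words
    proof (intro conjI allI impI)
      fix i assume i: "i < length us"
      have "cycle_support (w ! i) \<subseteq> {1..k}" using k i unfolding S by blast
      then show "w ! i \<in> cycles (us ! i) k" by (rule fi_set.restrict[OF fi wi(2)[OF i]])
    qed (rule wi(1))
    fix g assume g: "g permutes {1..m}"
    have "cycle_support (cycle_action g (w ! i)) = g ` cycle_support (w ! i)" if "i < length us" for i
      by (rule fi_set.supp_action[OF fi wi(2)[OF that] g])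
    then show "\<Union> (cycle_support ` set (word_action us g w)) = g ` \<Union> (cycle_support ` set w)"
      unfolding word_action_eq[OF w] set_map using wi(1) by (auto simp: set_conv_nth image_UN)
    assume fixed: "\<And>x. x \<in> \<Union> (cycle_support ` set w) \<Longrightarrow> g x = x"
    show "word_action us g w = w"
      unfolding word_action_eq[OF w]
    proof (rule map_idI)
      fix c assume c: "c \<in> set w"
      then obtain i where i: "i < length us" "c = w ! i" using wi(1) by (metis in_set_conv_nth)
      have "g x = x" if "x \<in> cycle_support c" for x using fixed c that by blast
      then show "cycle_action g c = c" unfolding i(2) using fi_set.supp_fixed[OF fi wi(2)[OF i(1)] g] by simp
    qed
  qed
qed

lemma full_cycle: "cyclic_class [1..<Suc l] \<in> cycles l l" "cycle_support (cyclic_class [1..<Suc l]) = {1..l}"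
proof -
  have "[1..<Suc l] \<in> cycle_lists l l" unfolding cycle_lists_def by auto
  then show "cyclic_class [1..<Suc l] \<in> cycles l l" by (simp only: cycles_eq imageI)
  show "cycle_support (cyclic_class [1..<Suc l]) = {1..l}" unfolding cycle_support_class by auto
qed

lemma full_cycle_word:
  obtains w where "w \<in> cycle_words us (sum_list us)" "\<Union> (cycle_support ` set w) = {1..sum_list us}"
proof -
  obtain T where T: "T \<in> tableaux us" using tableaux_exists .
  note TD = tableauxD[OF T]
  have "map cyclic_class T \<in> cycle_words us (sum_list us)"
    using TD by (auto simp: in_cycle_words cycles_eq cycle_lists_def intro!: imageI)
  moreover have "\<Union> (cycle_support ` set (map cyclic_class T)) = {1..sum_list us}"
    using TD(5) by (simp add: image_image cycle_support_class)
  ultimately show ?thesis by (rule that)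
qed

lemma of_nat_prod_list: "of_nat (prod_list xs) = prod_list (map of_nat xs)"
  by (induction xs) auto

lemma character_E_nu:
  assumes g: "g permutes {1..m}"
  shows "character (E_nu_rep \<nu> m) g = prod_list (map (\<lambda>l. character (E_rep l m) g) \<nu>)"
proof -
  interpret F: fi_set "cycle_words (rev \<nu>)" "word_action (rev \<nu>)" "\<lambda>w. \<Union> (cycle_support ` set w)" "sum_list (rev \<nu>)"
    by (rule fi_set_cycle_words)
  have "{w \<in> cycle_words (rev \<nu>) m. word_action (rev \<nu>) g w = w} =
     listset (map (\<lambda>l. {c \<in> cycles l m. cycle_action g c = c}) (rev \<nu>))" (is "?L = ?R")
  proof (rule set_eqI)
    fix w
    show "w \<in> ?L \<longleftrightarrow> w \<in> ?R"
    proof (cases "w \<in> cycle_words (rev \<nu>) m")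
      case True
      then have len: "length w = length \<nu>" by (simp add: in_cycle_words)
      have "word_action (rev \<nu>) g w = w \<longleftrightarrow> (\<forall>i<length \<nu>. cycle_action g (w ! i) = w ! i)"
        unfolding word_action_eq[OF True] using len by (auto simp: list_eq_iff_nth_eq)
      then show ?thesis using True len by (auto simp: in_cycle_words in_listset)
    next
      case False then show ?thesis by (auto simp: in_cycle_words in_listset)
    qed
  qed
  then have "character (E_nu_rep \<nu> m) g = of_nat (prod_list (map (\<lambda>l. card {c \<in> cycles l m. cycle_action g c = c}) (rev \<nu>)))"
    unfolding E_nu_rep_eq character_perm_module[OF F.action g] by (simp add: card_listset comp_def)
  also have "\<dots> = prod_list (map (\<lambda>l. character (E_rep l m) g) (rev \<nu>))"
    unfolding E_rep_def character_perm_module[OF fi_set.action[OF fi_set_cycles] g]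
    by (simp add: of_nat_prod_list comp_def)
  also have "\<dots> = prod_list (map (\<lambda>l. character (E_rep l m) g) \<nu>)"
    by (simp add: rev_map[symmetric] prod_list.rev)
  finally show ?thesis .
qed

section \<open>Counting the cycles fixed by a permutation\<close>

definition rotated_lists :: "nat \<Rightarrow> nat \<Rightarrow> (nat \<Rightarrow> nat) \<Rightarrow> nat \<Rightarrow> nat list set" where
  "rotated_lists l m g k = {xs \<in> cycle_lists l m. map g xs = rotate k xs}"

definition orbit_transversals :: "nat \<Rightarrow> nat \<Rightarrow> nat \<Rightarrow> (nat \<Rightarrow> nat) \<Rightarrow> nat list set" where
  "orbit_transversals e d m g = {ys. length ys = e \<and> set ys \<subseteq> {x \<in> {1..m}. card (orbit g x) = d} \<and>
     distinct (map (orbit g) ys)}"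

lemma rotated_lists_funpow:
  assumes xs: "xs \<in> rotated_lists l m g k" and i: "i < l"
  shows "(g ^^ t) (xs ! i) = xs ! ((i + t * k) mod l)"
proof (induction t)
  case 0 then show ?case using i by simp
next
  case (Suc t)
  have len: "length xs = l" and rot: "map g xs = rotate k xs"
    using xs by (auto simp: rotated_lists_def cycle_lists_def)
  have l: "0 < l" using i by simp
  let ?j = "(i + t * k) mod l"
  have j: "?j < l" using l by simp
  have "g (xs ! ?j) = map g xs ! ?j" using j len by simp
  also have "\<dots> = xs ! ((k + ?j) mod l)" unfolding rot using j len by (simp add: nth_rotate)
  also have "(k + ?j) mod l = (i + Suc t * k) mod l" by (simp add: mod_add_right_eq algebra_simps)
  finally show ?case using Suc by simp
qed

text \<open>
  If \<open>g\<close> rotates the list \<open>xs\<close> of length \<open>l\<close> by \<open>k\<close> places and \<open>e = gcd k l\<close>, then the positions of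
  each residue class modulo \<open>e\<close> carry one cycle of \<open>g\<close>, of length \<open>d = l div e\<close>. So the first \<open>e\<close>
  entries lie in different \<open>d\<close>-cycles, and they determine \<open>xs\<close>: with \<open>k * x \<equiv> e\<close> modulo \<open>l\<close>, the
  entry at \<open>r + e * q\<close> is the image of the entry at \<open>r\<close> under the power \<open>x * q\<close> of \<open>g\<close>.
\<close>

lemma rotated_lists_bij:
  assumes g: "g permutes {1..m}" and l: "0 < l" and e_def: "e = gcd k l" and d_def: "d = l div e"
  shows "bij_betw (take e) (rotated_lists l m g k) (orbit_transversals e d m g)"
proof -
  note gp = permutes_permutation[OF g]
  have e0: "0 < e" using l by (simp add: e_def)
  have led: "l = e * d" by (simp add: d_def e_def)
  have d0: "0 < d" using led l by (cases d) auto
  obtain k' where k': "k = e * k'" using e_def by (metis dvdE gcd_dvd1)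
  obtain x0 where x0: "[k * x0 = e] (mod l)" using cong_solve_nat[of k l] e_def by auto
  have "(e * (k' * x0)) mod (e * d) = (e * 1) mod (e * d)"
    using x0 unfolding cong_def k' led by (simp only: mult.assoc mult_1_right)
  then have inv: "[k' * x0 = 1] (mod d)" using e0 unfolding mod_mult_mult1 by (simp add: cong_def)
  then have cop: "coprime k' d" unfolding coprime_iff_invertible_nat by (metis One_nat_def)
  have ldvd: "l dvd t * k \<longleftrightarrow> d dvd t" for t
  proof -
    have "l dvd t * k \<longleftrightarrow> e * d dvd e * (t * k')" by (simp add: led k' mult.left_commute)
    also have "\<dots> \<longleftrightarrow> d dvd t * k'" using e0 by simp
    also have "\<dots> \<longleftrightarrow> d dvd t" using cop by (simp add: coprime_commute coprime_dvd_mult_left_iff)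
    finally show ?thesis .
  qed
  define f where "f ys i = (g ^^ (x0 * (i div e))) (ys ! (i mod e))" for ys i
  have q_less: "i div e < d" if "i < l" for i using that led by (simp add: less_mult_imp_div_less mult.commute)
  show ?thesis
  proof (rule bij_betw_byWitness[of _ "\<lambda>ys. map (f ys) [0..<l]"])
    show "\<forall>xs\<in>rotated_lists l m g k. map (f (take e xs)) [0..<l] = xs"
    proof
      fix xs assume xs: "xs \<in> rotated_lists l m g k"
      then have len: "length xs = l" by (auto simp: rotated_lists_def cycle_lists_def)
      show "map (f (take e xs)) [0..<l] = xs"
      proof (rule nth_equalityI)
        fix i assume "i < length (map (f (take e xs)) [0..<l])"
        then have i: "i < l" by simp
        let ?r = "i mod e" and ?q = "i div e"
        have r: "?r < e" using e0 by simp
        have rl: "?r < l" using i by (meson le_less_trans mod_less_eq_dividend)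
        have "f (take e xs) i = xs ! ((?r + x0 * ?q * k) mod l)"
          using rotated_lists_funpow[OF xs rl] r by (simp add: f_def)
        also have "(?r + x0 * ?q * k) mod l = i"
        proof -
          have "[?r + x0 * ?q * k = ?r + e * ?q] (mod l)"
            using cong_scalar_left[OF x0, of ?q] by (intro cong_add) (simp_all add: algebra_simps)
          then show ?thesis using i by (simp add: cong_def)
        qed
        finally show "map (f (take e xs)) [0..<l] ! i = xs ! i" using i by simp
      qed (simp add: len)
    qed
  next
    show "\<forall>ys\<in>orbit_transversals e d m g. take e (map (f ys) [0..<l]) = ys"
    proof
      fix ys assume "ys \<in> orbit_transversals e d m g"
      then have len: "length ys = e" by (simp add: orbit_transversals_def)
      have "e \<le> l" using led d0 by simp
      then show "take e (map (f ys) [0..<l]) = ys"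
        by (intro nth_equalityI) (use len in \<open>auto simp: f_def\<close>)
    qed
  next
    show "take e ` rotated_lists l m g k \<subseteq> orbit_transversals e d m g"
    proof
      fix ys assume "ys \<in> take e ` rotated_lists l m g k"
      then obtain xs where xs: "xs \<in> rotated_lists l m g k" "ys = take e xs" by blast
      then have len: "length xs = l" and dist: "distinct xs" and sub: "set xs \<subseteq> {1..m}"
        by (auto simp: rotated_lists_def cycle_lists_def)
      have el: "e \<le> l" using led d0 by simp
      have pow: "(g ^^ t) (xs ! r) = xs ! ((r + t * k) mod l)" if "r < e" for r t
        using rotated_lists_funpow[OF xs(1)] that el by simp
      have card: "card (orbit g (xs ! r)) = d" if r: "r < e" for r
      proof -
        have "card (orbit g (xs ! r)) dvd t \<longleftrightarrow> d dvd t" for t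
        proof -
          have "card (orbit g (xs ! r)) dvd t \<longleftrightarrow> (g ^^ t) (xs ! r) = (g ^^ 0) (xs ! r)"
            unfolding funpow_eq_iff_cong[OF gp] by (simp add: cong_0_iff)
          also have "\<dots> \<longleftrightarrow> xs ! ((r + t * k) mod l) = xs ! r" using pow[OF r] by simp
          also have "\<dots> \<longleftrightarrow> (r + t * k) mod l = r"
            using dist len r el l by (intro nth_eq_iff_index_eq) auto
          also have "\<dots> \<longleftrightarrow> [r + t * k = r + 0] (mod l)" using r el by (simp add: cong_def)
          also have "\<dots> \<longleftrightarrow> l dvd t * k" unfolding cong_add_lcancel_nat by (simp add: cong_0_iff)
          finally show ?thesis by (simp add: ldvd)
        qed
        then show ?thesis by (metis dvd_antisym dvd_refl)
      qed
      have "distinct (map (orbit g) ys)"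
        unfolding distinct_conv_nth
      proof (intro allI impI notI)
        fix r s assume "r < length (map (orbit g) ys)" "s < length (map (orbit g) ys)" "r \<noteq> s"
          and eq: "map (orbit g) ys ! r = map (orbit g) ys ! s"
        then have r: "r < e" "s < e" using xs(2) len el by auto
        have "orbit g (xs ! r) = orbit g (xs ! s)" using eq r len el by (simp add: xs(2))
        then have "xs ! s \<in> orbit g (xs ! r)" using self_in_orbit[OF g] by simp
        then obtain t where "(g ^^ t) (xs ! r) = xs ! s" by (auto simp: orbit_altdef)
        then have "(r + t * k) mod l = s"
          using pow[OF r(1)] dist len r el l by (simp add: nth_eq_iff_index_eq)
        then have "(r + t * k) mod l mod e = s mod e" by simp
        moreover have "e dvd l" using led by simp
        ultimately have "(r + t * k) mod e = s mod e" by (simp add: mod_mod_cancel)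
        moreover have "r + t * k = r + e * (t * k')" by (simp add: k' mult.left_commute)
        ultimately have "r mod e = s mod e" by simp
        then show False using r \<open>r \<noteq> s\<close> by simp
      qed
      moreover have "set ys \<subseteq> {x \<in> {1..m}. card (orbit g x) = d}"
      proof
        fix y assume "y \<in> set ys"
        then obtain r where "r < e" "y = xs ! r" using xs(2) len el by (auto simp: in_set_conv_nth)
        then have "y \<in> set xs" using len el by simp
        then show "y \<in> {x \<in> {1..m}. card (orbit g x) = d}" using card sub \<open>r < e\<close> \<open>y = xs ! r\<close> by auto
      qed
      ultimately show "ys \<in> orbit_transversals e d m g" using xs(2) len el by (simp add: orbit_transversals_def)
    qed
  next
    show "(\<lambda>ys. map (f ys) [0..<l]) ` orbit_transversals e d m g \<subseteq> rotated_lists l m g k"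
    proof
      fix xs assume "xs \<in> (\<lambda>ys. map (f ys) [0..<l]) ` orbit_transversals e d m g"
      then obtain ys where ys: "ys \<in> orbit_transversals e d m g" "xs = map (f ys) [0..<l]" by blast
      then have len: "length ys = e" and dist: "distinct (map (orbit g) ys)"
        and sub: "set ys \<subseteq> {x \<in> {1..m}. card (orbit g x) = d}" by (auto simp: orbit_transversals_def)
      have y: "ys ! r \<in> {1..m}" "card (orbit g (ys ! r)) = d" if "r < e" for r
        using sub len that by (auto dest: nth_mem)
      have fo: "f ys i \<in> orbit g (ys ! (i mod e))" for i
        unfolding f_def by (rule funpow_in_orbit[OF self_in_orbit[OF g]])
      have fm: "f ys i \<in> {1..m}" for i
        using fo[of i] permutes_orbit_subset[OF g y(1)[of "i mod e"]] e0 by auto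
      have inj: "i = j" if i: "i < l" and j: "j < l" and eq: "f ys i = f ys j" for i j
      proof -
        have "orbit g (ys ! (a mod e)) = orbit g (f ys a)" for a
          by (rule orbits_orbit(1)[OF g _ fo]) (use y(1)[of "a mod e"] e0 in \<open>auto simp: orbits_def\<close>)
        then have "orbit g (ys ! (i mod e)) = orbit g (ys ! (j mod e))" using eq by simp
        then have "map (orbit g) ys ! (i mod e) = map (orbit g) ys ! (j mod e)" using len e0 by simp
        then have r: "i mod e = j mod e"
          using nth_eq_iff_index_eq[OF dist] len e0 by simp
        then have "[x0 * (i div e) = x0 * (j div e)] (mod d)"
          using eq y(2)[of "j mod e"] e0 by (simp add: f_def funpow_eq_iff_cong[OF gp])
        then have "[k' * x0 * (i div e) = k' * x0 * (j div e)] (mod d)"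
          by (metis cong_scalar_left mult.assoc)
        then have "[1 * (i div e) = 1 * (j div e)] (mod d)"
          using inv by (meson cong_scalar_right cong_sym cong_trans)
        then have "i div e = j div e" using q_less[OF i] q_less[OF j] by (simp add: cong_def)
        then show ?thesis using r by (metis div_mult_mod_eq)
      qed
      have "map g xs = rotate k xs"
      proof (rule nth_equalityI)
        fix i assume "i < length (map g xs)"
        then have i: "i < l" using ys(2) by simp
        let ?j = "(k + i) mod l"
        have jm: "?j mod e = i mod e"
          using led k' by (simp add: mod_mod_cancel)
        have jd: "?j div e = (k' + i div e) mod d"
        proof -
          have "?j = e * ((k + i) div e mod d) + (k + i) mod e" unfolding led by (rule mod_mult2_eq)
          then have "?j div e = (k + i) div e mod d" using e0 by simp
          also have "(k + i) div e = k' + i div e" using e0 by (simp add: k')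
          finally show ?thesis .
        qed
        have "[x0 * (?j div e) = Suc (x0 * (i div e))] (mod d)"
        proof -
          have "[x0 * (?j div e) = x0 * (k' + i div e)] (mod d)" unfolding jd by (intro cong_scalar_left) simp
          also have "x0 * (k' + i div e) = k' * x0 + x0 * (i div e)" by (simp add: algebra_simps)
          also have "[k' * x0 + x0 * (i div e) = 1 + x0 * (i div e)] (mod d)" using inv by (intro cong_add) simp_all
          finally show ?thesis by (simp only: plus_1_eq_Suc)
        qed
        then have "f ys ?j = g (f ys i)"
          unfolding f_def jm using y(2)[of "i mod e"] e0
          by (simp add: funpow_eq_iff_cong[OF gp] flip: funpow.simps(2)[unfolded comp_def])
            (metis comp_apply funpow.simps(2) funpow_eq_iff_cong[OF gp])
        then show "map g xs ! i = rotate k xs ! i"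
          using i ys(2) l by (simp add: nth_rotate)
      qed (simp add: ys(2))
      moreover have "distinct xs" unfolding ys(2) using inj by (simp add: distinct_map inj_on_def)
      ultimately show "xs \<in> rotated_lists l m g k"
        using fm ys(2) by (auto simp: rotated_lists_def cycle_lists_def)
    qed
  qed
qed

lemma num_cycles_eq: "num_cycles m d g = card {C \<in> orbits m g. card C = d}"
  unfolding num_cycles_def orbits_def by (rule arg_cong[of _ _ card]) auto

lemma card_points_in_cycles:
  assumes g: "g permutes {1..m}"
  shows "card {x \<in> {1..m}. card (orbit g x) = d} = d * num_cycles m d g"
proof -
  have "{x \<in> {1..m}. card (orbit g x) = d} = \<Union> {C \<in> orbits m g. card C = d}"
  proof
    show "{x \<in> {1..m}. card (orbit g x) = d} \<subseteq> \<Union> {C \<in> orbits m g. card C = d}"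
    proof
      fix x assume x: "x \<in> {x \<in> {1..m}. card (orbit g x) = d}"
      then have "orbit g x \<in> {C \<in> orbits m g. card C = d}" by (simp add: orbits_def)
      then show "x \<in> \<Union> {C \<in> orbits m g. card C = d}" using self_in_orbit[OF g, of x] by blast
    qed
    show "\<Union> {C \<in> orbits m g. card C = d} \<subseteq> {x \<in> {1..m}. card (orbit g x) = d}"
      using orbits_orbit[OF g] by blast
  qed
  also have "card \<dots> = (\<Sum>C\<in>{C \<in> orbits m g. card C = d}. card C)"
  proof (rule card_Union_disjoint)
    show "pairwise disjnt {C \<in> orbits m g. card C = d}"
      using orbits_disjoint[OF g] by (auto simp: pairwise_def disjnt_def)
    show "finite C" if "C \<in> {C \<in> orbits m g. card C = d}" for C
      using that orbits_orbit(2)[OF g] by (intro finite_subset[of C "{1..m}"]) auto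
  qed
  finally show ?thesis by (simp add: num_cycles_eq mult.commute)
qed

text \<open>
  The entries are chosen one after the other; each choice excludes the points of one more cycle.
\<close>

lemma card_orbit_transversals:
  assumes g: "g permutes {1..m}"
  shows "card (orbit_transversals e d m g) = (\<Prod>j<e. d * (num_cycles m d g - j))"
proof (induction e)
  case 0
  have "orbit_transversals 0 d m g = {[]}" by (auto simp: orbit_transversals_def)
  then show ?case by simp
next
  case (Suc e)
  let ?U = "{x \<in> {1..m}. card (orbit g x) = d}" and ?X = "num_cycles m d g"
  let ?R = "\<lambda>ys. ?U - \<Union> (orbit g ` set ys)"
  have fin: "finite (orbit_transversals e d m g)"
    by (rule finite_subset[OF _ finite_lists_length_eq[of "{1..m}" e]]) (auto simp: orbit_transversals_def)
  have R: "card (?R ys) = d * (?X - e)" if ys: "ys \<in> orbit_transversals e d m g" for ys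
  proof -
    have len: "length ys = e" and sub: "set ys \<subseteq> ?U" and dist: "distinct (map (orbit g) ys)"
      using ys by (auto simp: orbit_transversals_def)
    have oU: "orbit g ` set ys \<subseteq> {C \<in> orbits m g. card C = d}" using sub by (auto simp: orbits_def)
    have "\<Union> (orbit g ` set ys) \<subseteq> ?U"
    proof
      fix x assume "x \<in> \<Union> (orbit g ` set ys)"
      then obtain C where C: "C \<in> orbits m g" "card C = d" "x \<in> C" using oU by blast
      then show "x \<in> ?U" using orbits_orbit[OF g C(1,3)] by simp
    qed
    moreover have "card (\<Union> (orbit g ` set ys)) = d * e"
    proof -
      have "card (\<Union> (orbit g ` set ys)) = (\<Sum>C\<in>orbit g ` set ys. card C)"
      proof (rule card_Union_disjoint)
        show "pairwise disjnt (orbit g ` set ys)"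
        proof (rule pairwiseI)
          fix C D assume "C \<in> orbit g ` set ys" "D \<in> orbit g ` set ys" "C \<noteq> D"
          then show "disjnt C D" using orbits_disjoint[OF g, of C D] oU by (auto simp: disjnt_def)
        qed
        show "finite C" if "C \<in> orbit g ` set ys" for C
        proof (rule finite_subset[of _ "{1..m}"])
          have "C \<in> orbits m g" using that oU by blast
          then show "C \<subseteq> {1..m}" using orbits_orbit(2)[OF g] by blast
        qed simp
      qed
      also have "\<dots> = (\<Sum>C\<in>orbit g ` set ys. d)" using oU by (intro sum.cong refl) auto
      also have "card (orbit g ` set ys) = e" using distinct_card[OF dist] len by simp
      then have "(\<Sum>C\<in>orbit g ` set ys. d) = d * e" by simp
      finally show ?thesis .
    qed
    moreover have "finite (\<Union> (orbit g ` set ys))"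
      by (rule finite_subset[OF \<open>\<Union> (orbit g ` set ys) \<subseteq> ?U\<close>]) simp
    ultimately have "card (?R ys) = card ?U - d * e" by (simp add: card_Diff_subset)
    then show ?thesis unfolding card_points_in_cycles[OF g] by (simp add: diff_mult_distrib2)
  qed
  have "orbit_transversals (Suc e) d m g = (\<lambda>(ys, y). y # ys) ` (SIGMA ys:orbit_transversals e d m g. ?R ys)"
  proof
    show "orbit_transversals (Suc e) d m g \<subseteq> (\<lambda>(ys, y). y # ys) ` (SIGMA ys:orbit_transversals e d m g. ?R ys)"
    proof
      fix zs assume zs: "zs \<in> orbit_transversals (Suc e) d m g"
      then obtain y ys where z: "zs = y # ys" by (cases zs) (auto simp: orbit_transversals_def)
      have ys: "ys \<in> orbit_transversals e d m g" using zs z by (auto simp: orbit_transversals_def)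
      have yU: "y \<in> ?U" and yo: "orbit g y \<notin> orbit g ` set ys" using zs z by (auto simp: orbit_transversals_def)
      have "y \<notin> \<Union> (orbit g ` set ys)"
      proof
        assume "y \<in> \<Union> (orbit g ` set ys)"
        then obtain x where x: "x \<in> set ys" "y \<in> orbit g x" by blast
        then have "orbit g x \<in> orbits m g" using ys by (auto simp: orbit_transversals_def orbits_def)
        then have "orbit g x = orbit g y" using orbits_orbit(1)[OF g _ x(2)] by blast
        then show False using yo x(1) by (metis imageI)
      qed
      then show "zs \<in> (\<lambda>(ys, y). y # ys) ` (SIGMA ys:orbit_transversals e d m g. ?R ys)"
        using ys yU z by (intro image_eqI[of _ _ "(ys, y)"]) auto
    qed
    show "(\<lambda>(ys, y). y # ys) ` (SIGMA ys:orbit_transversals e d m g. ?R ys) \<subseteq> orbit_transversals (Suc e) d m g"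
      using self_in_orbit[OF g] by (auto simp: orbit_transversals_def)
  qed
  then have "card (orbit_transversals (Suc e) d m g) = card (SIGMA ys:orbit_transversals e d m g. ?R ys)"
    by (simp add: card_image inj_on_def split_def)
  also have "\<dots> = (\<Sum>ys\<in>orbit_transversals e d m g. card (?R ys))"
    by (rule card_SigmaI[OF fin]) simp
  also have "\<dots> = (\<Sum>ys\<in>orbit_transversals e d m g. d * (?X - e))" by (intro sum.cong refl R)
  also have "\<dots> = card (orbit_transversals e d m g) * (d * (?X - e))" by simp
  finally show ?case using Suc by simp
qed

text \<open>For \<open>e > X\<close> both sides vanish, so that the truncated subtraction does no harm.\<close>

lemma of_nat_falling_product:
  "of_nat (\<Prod>j<e. d * (X - j)) = (of_nat d ^ e * (\<Prod>j<e. of_nat X - of_nat j) :: rat)"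
proof (cases "e \<le> X")
  case True
  then have "of_nat (\<Prod>j<e. d * (X - j)) = (\<Prod>j<e. of_nat d * (of_nat X - of_nat j) :: rat)"
    unfolding of_nat_prod by (intro prod.cong refl) (simp add: of_nat_diff)
  then show ?thesis by (simp add: prod.distrib)
next
  case False
  then have z1: "(\<Prod>j<e. of_nat X - of_nat j :: rat) = 0" and z2: "(\<Prod>j<e. d * (X - j)) = 0"
    by (auto intro!: bexI[of _ X])
  show ?thesis unfolding z1 z2 by simp
qed

lemma rotate_eq_iff:
  assumes "distinct xs" "k \<in> {0<..length xs}" "j \<in> {0<..length xs}"
  shows "rotate k xs = rotate j xs \<longleftrightarrow> k = j"
proof
  assume eq: "rotate k xs = rotate j xs"
  have l: "0 < length xs" using assms(2) by auto
  then have "xs ! (k mod length xs) = xs ! (j mod length xs)"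
    using arg_cong[OF eq, of "\<lambda>ys. ys ! 0"] by (simp add: nth_rotate)
  then have "k mod length xs = j mod length xs"
    using assms(1) l by (simp add: nth_eq_iff_index_eq)
  then show "k = j" using assms(2,3) by (cases "k = length xs"; cases "j = length xs") auto
qed simp

text \<open>
  Count the pairs of a list and a number \<open>k\<close> of places by which \<open>g\<close> rotates it in two ways: each
  fixed cycle is represented by \<open>l\<close> lists, for each of which \<open>k\<close> is unique.
\<close>

lemma card_fixed_cycles:
  assumes g: "g permutes {1..m}" and l: "0 < l"
  shows "l * card {c \<in> cycles l m. cycle_action g c = c} = (\<Sum>k\<in>{0<..l}. card (rotated_lists l m g k))"
proof -
  let ?F = "{c \<in> cycles l m. cycle_action g c = c}"
  let ?L = "{xs \<in> cycle_lists l m. cyclic_class xs \<in> ?F}"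
  have finF: "finite ?F" by (simp add: cycles_eq)
  have lists: "{xs \<in> ?L. cyclic_class xs = c} = c" if c: "c \<in> ?F" for c
  proof -
    obtain xs where xs: "xs \<in> cycle_lists l m" "c = cyclic_class xs" using c by (auto simp: cycles_eq)
    show ?thesis
    proof
      show "{xs \<in> ?L. cyclic_class xs = c} \<subseteq> c" using self_in_cyclic_class by blast
      show "c \<subseteq> {xs \<in> ?L. cyclic_class xs = c}"
      proof
        fix ys assume "ys \<in> c"
        then have ys: "ys \<in> cyclic_class xs" using xs(2) by simp
        note yD = cyclic_class_memD[OF ys]
        have "ys \<in> cycle_lists l m" using xs(1) yD(2-4) by (simp add: cycle_lists_def)
        then show "ys \<in> {xs \<in> ?L. cyclic_class xs = c}" using yD(1) xs(2) c by simp
      qed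
    qed
  qed
  have card_c: "card c = l" if c: "c \<in> ?F" for c
  proof -
    obtain xs where xs: "length xs = l" "distinct xs" "c = cyclic_class xs"
      using c by (auto simp: cycles_eq cycle_lists_def)
    have "c = (\<lambda>k. rotate k xs) ` {0<..l}" using cyclic_class_eq[of xs] xs l by auto
    moreover have "inj_on (\<lambda>k. rotate k xs) {0<..l}" using rotate_eq_iff[OF xs(2)] xs(1) by (auto simp: inj_on_def)
    ultimately show ?thesis by (simp add: card_image)
  qed
  have "card ?L = (\<Sum>c\<in>?F. card {xs \<in> ?L. cyclic_class xs = c})"
  proof -
    have "cyclic_class ` ?L \<subseteq> ?F" by blast
    then have "(\<Sum>c\<in>?F. \<Sum>xs | xs \<in> ?L \<and> cyclic_class xs = c. 1 :: nat) = (\<Sum>xs\<in>?L. 1)"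
      by (intro sum.group finF) simp
    then show ?thesis by (simp only: card_eq_sum)
  qed
  also have "\<dots> = (\<Sum>c\<in>?F. l)" using lists card_c by (intro sum.cong refl) simp
  finally have 1: "card ?L = l * card ?F" by simp
  have "?L = (\<Union>k\<in>{0<..l}. rotated_lists l m g k)"
  proof (rule set_eqI)
    fix xs
    show "xs \<in> ?L \<longleftrightarrow> xs \<in> (\<Union>k\<in>{0<..l}. rotated_lists l m g k)"
    proof (cases "xs \<in> cycle_lists l m")
      case True
      then have ne: "xs \<noteq> []" and len: "length xs = l" using l by (auto simp: cycle_lists_def)
      have "cycle_action g (cyclic_class xs) = cyclic_class xs \<longleftrightarrow> map g xs \<in> cyclic_class xs"
        unfolding cycle_action_class using self_in_cyclic_class[of "map g xs"] cyclic_class_memD(1) by metis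
      also have "\<dots> \<longleftrightarrow> (\<exists>k\<in>{0<..l}. map g xs = rotate k xs)"
        unfolding cyclic_class_eq[OF ne] len by blast
      finally show ?thesis using True by (auto simp: rotated_lists_def cycles_eq)
    qed (auto simp: rotated_lists_def)
  qed
  also have "card \<dots> = (\<Sum>k\<in>{0<..l}. card (rotated_lists l m g k))"
  proof (rule card_UN_disjoint)
    show "\<forall>k\<in>{0<..l}. \<forall>j\<in>{0<..l}. k \<noteq> j \<longrightarrow> rotated_lists l m g k \<inter> rotated_lists l m g j = {}"
    proof (intro ballI impI equals0I)
      fix k j xs assume "k \<in> {0<..l}" "j \<in> {0<..l}" "k \<noteq> j" "xs \<in> rotated_lists l m g k \<inter> rotated_lists l m g j"
      then show False using rotate_eq_iff[of xs k j] by (auto simp: rotated_lists_def cycle_lists_def)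
    qed
  qed (auto simp: rotated_lists_def)
  finally show ?thesis using 1 by simp
qed

lemma card_fixed_cycles_formula:
  assumes g: "g permutes {1..m}" and l: "0 < l"
  shows "of_nat l * of_nat (card {c \<in> cycles l m. cycle_action g c = c}) =
    (\<Sum>e | e dvd l. of_nat (totient (l div e)) * (of_nat (l div e) ^ e *
       (\<Prod>j<e. of_nat (num_cycles m (l div e) g) - of_nat j) :: rat))"
proof -
  let ?f = "\<lambda>e. \<Prod>j<e. (l div e) * (num_cycles m (l div e) g - j)"
  have "card (rotated_lists l m g k) = ?f (gcd k l)" for k
    using bij_betw_same_card[OF rotated_lists_bij[OF g l refl refl, of k]]
    by (simp add: card_orbit_transversals[OF g])
  then have "l * card {c \<in> cycles l m. cycle_action g c = c} = (\<Sum>k\<in>{0<..l}. ?f (gcd k l))"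
    using card_fixed_cycles[OF g l] by simp
  also have "\<dots> = (\<Sum>e | e dvd l. \<Sum>k | k \<in> {0<..l} \<and> gcd k l = e. ?f (gcd k l))"
    by (rule sum.group[symmetric]) (use l in auto)
  also have "\<dots> = (\<Sum>e | e dvd l. totient (l div e) * ?f e)"
  proof (intro sum.cong refl)
    fix e assume "e \<in> {e. e dvd l}"
    then have "card {k \<in> {0<..l}. gcd k l = e} = totient (l div e)" using card_gcd_eq_totient[OF l] by simp
    then show "(\<Sum>k | k \<in> {0<..l} \<and> gcd k l = e. ?f (gcd k l)) = totient (l div e) * ?f e" by simp
  qed
  finally have "of_nat (l * card {c \<in> cycles l m. cycle_action g c = c}) = (of_nat (\<Sum>e | e dvd l. totient (l div e) * ?f e) :: rat)"
    by simp
  then show ?thesis by (simp only: of_nat_mult of_nat_sum of_nat_falling_product)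
qed

section \<open>Character polynomials\<close>

definition monomial_value :: "nat \<Rightarrow> (nat \<Rightarrow> nat) \<Rightarrow> (nat \<Rightarrow>\<^sub>0 nat) \<Rightarrow> rat" where
  "monomial_value m g a = (\<Prod>i\<in>Poly_Mapping.keys a. of_nat (num_cycles m i g) ^ Poly_Mapping.lookup a i)"

lemma monomial_value_superset:
  assumes "finite S" "Poly_Mapping.keys a \<subseteq> S"
  shows "monomial_value m g a = (\<Prod>i\<in>S. of_nat (num_cycles m i g) ^ Poly_Mapping.lookup a i)"
  unfolding monomial_value_def by (rule prod.mono_neutral_left) (use assms in \<open>auto simp: in_keys_iff\<close>)

lemma monomial_value_add: "monomial_value m g (a + b) = monomial_value m g a * monomial_value m g b"
proof -
  let ?S = "Poly_Mapping.keys a \<union> Poly_Mapping.keys b"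
  have "monomial_value m g (a + b) = (\<Prod>i\<in>?S. of_nat (num_cycles m i g) ^ Poly_Mapping.lookup (a + b) i)"
    by (rule monomial_value_superset) (use Poly_Mapping.keys_add[of a b] in auto)
  then show ?thesis
    by (simp add: monomial_value_superset[of ?S] lookup_add power_add prod.distrib)
qed

lemma rho_superset:
  assumes "finite S" "Poly_Mapping.keys P \<subseteq> S"
  shows "rho m P g = (\<Sum>a\<in>S. Poly_Mapping.lookup P a * monomial_value m g a)"
  unfolding rho_def monomial_value_def[symmetric]
  by (rule sum.mono_neutral_left) (use assms in \<open>auto simp: in_keys_iff\<close>)

lemma rho_add: "rho m (P + Q) g = rho m P g + rho m Q g"
proof -
  let ?S = "Poly_Mapping.keys P \<union> Poly_Mapping.keys Q"
  have "rho m (P + Q) g = (\<Sum>a\<in>?S. Poly_Mapping.lookup (P + Q) a * monomial_value m g a)"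
    by (rule rho_superset) (use Poly_Mapping.keys_add[of P Q] in auto)
  then show ?thesis by (simp add: rho_superset[of ?S] lookup_add algebra_simps sum.distrib)
qed

lemma rho_scale: "rho m (qscale c P) g = c * rho m P g"
proof -
  have "rho m (qscale c P) g = (\<Sum>a\<in>Poly_Mapping.keys P. Poly_Mapping.lookup (qscale c P) a * monomial_value m g a)"
    by (rule rho_superset) (auto simp: in_keys_iff)
  then show ?thesis by (simp add: rho_superset[of "Poly_Mapping.keys P" P] sum_distrib_left mult.assoc)
qed

lemma rho_zero [simp]: "rho m 0 g = 0"
  by (simp add: rho_def)

lemma rho_sum: "rho m (\<Sum>i\<in>I. P i) g = (\<Sum>i\<in>I. rho m (P i) g)"
  by (induction I rule: infinite_finite_induct) (auto simp: rho_add)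

lemma rho_single: "rho m (Poly_Mapping.single a c) g = c * monomial_value m g a"
proof -
  have "rho m (Poly_Mapping.single a c) g = (\<Sum>b\<in>{a}. Poly_Mapping.lookup (Poly_Mapping.single a c) b * monomial_value m g b)"
    by (rule rho_superset) auto
  then show ?thesis by simp
qed

lemma qpoly_expansion: "P = (\<Sum>a\<in>Poly_Mapping.keys P. Poly_Mapping.single a (Poly_Mapping.lookup P a :: rat))"
proof -
  have "qscale c (bvec a) = Poly_Mapping.single a c" for c and a :: 'a
    by (rule poly_mapping_eqI) (simp add: lookup_single when_def)
  then show ?thesis using bvec_expansion[of "Poly_Mapping.keys P" P] by simp
qed

lemma rho_mult: "rho m (P * Q) g = rho m P g * rho m Q g"
proof -
  let ?s = "\<lambda>P a. Poly_Mapping.single a (Poly_Mapping.lookup P a) :: qpoly"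
  have "P * Q = (\<Sum>a\<in>Poly_Mapping.keys P. ?s P a) * (\<Sum>b\<in>Poly_Mapping.keys Q. ?s Q b)"
    using qpoly_expansion[of P] qpoly_expansion[of Q] by simp
  also have "\<dots> = (\<Sum>a\<in>Poly_Mapping.keys P. \<Sum>b\<in>Poly_Mapping.keys Q.
      Poly_Mapping.single (a + b) (Poly_Mapping.lookup P a * Poly_Mapping.lookup Q b))"
    by (simp add: sum_product mult_single)
  finally have "rho m (P * Q) g = (\<Sum>a\<in>Poly_Mapping.keys P. \<Sum>b\<in>Poly_Mapping.keys Q.
      Poly_Mapping.lookup P a * Poly_Mapping.lookup Q b * (monomial_value m g a * monomial_value m g b))"
    by (simp add: rho_sum rho_single monomial_value_add)
  also have "\<dots> = (\<Sum>a\<in>Poly_Mapping.keys P. Poly_Mapping.lookup P a * monomial_value m g a) *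
      (\<Sum>b\<in>Poly_Mapping.keys Q. Poly_Mapping.lookup Q b * monomial_value m g b)"
    by (simp add: sum_product algebra_simps)
  finally show ?thesis by (simp add: rho_superset[OF finite_keys order_refl])
qed

lemma rho_of_nat: "rho m (of_nat j) g = of_nat j"
  unfolding single_of_nat[symmetric] rho_single by (simp add: monomial_value_def)

lemma rho_one [simp]: "rho m 1 g = 1"
  using rho_of_nat[of m 1 g] by simp

lemma rho_diff_of_nat: "rho m (P - of_nat j) g = rho m P g - of_nat j"
  using rho_add[of m "P - of_nat j" "of_nat j" g] by (simp add: rho_of_nat)

lemma rho_prod: "rho m (\<Prod>i\<in>I. P i) g = (\<Prod>i\<in>I. rho m (P i) g)"
  by (induction I rule: infinite_finite_induct) (auto simp: rho_mult)

lemma rho_prod_list: "rho m (prod_list Ps) g = prod_list (map (\<lambda>P. rho m P g) Ps)"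
  by (induction Ps) (auto simp: rho_mult)

lemma rho_X_var: "rho m (X_var i) g = of_nat (num_cycles m i g)"
  by (simp add: X_var_def rho_single monomial_value_def)

text \<open>
  The part of \<open>E_poly l\<close> without the variable \<open>X_var l\<close>.
\<close>

definition E_tail :: "nat \<Rightarrow> qpoly" where
  "E_tail l = (\<Sum>(e, d)\<in>{(e, d). e * d = l \<and> e \<noteq> 1}.
     qscale (of_nat (totient d) * of_nat d ^ e / of_nat l) (\<Prod>j<e. X_var d - of_nat j))"

lemma E_poly_eq: "E_poly l = qscale (of_nat (totient l)) (X_var l) + E_tail l"
  by (simp add: E_poly_def E_tail_def)

text \<open>
  In the number of fixed cycles, the divisor \<open>e = 1\<close> of \<open>l\<close> contributes the term that \<^const>\<open>E_poly\<close> lists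
  separately.
\<close>

lemma E_rep_expressed:
  assumes l: "0 < l"
  shows "expresses_character m (E_poly l) (E_rep l m)"
  unfolding expresses_character_def
proof (intro allI impI)
  fix g assume g: "g permutes {1..m}"
  let ?X = "\<lambda>d. of_nat (num_cycles m d g) :: rat"
  let ?t = "\<lambda>e d. of_nat (totient d) * (of_nat d ^ e * (\<Prod>j<e. ?X d - of_nat j)) :: rat"
  have fin: "finite {e. e dvd l}" using l by simp
  have l0: "(of_nat l :: rat) \<noteq> 0" using l by simp
  have "of_nat l * character (E_rep l m) g = (\<Sum>e | e dvd l. ?t e (l div e))"
    unfolding E_rep_def character_perm_module[OF fi_set.action[OF fi_set_cycles] g]
    by (rule card_fixed_cycles_formula[OF g l])
  also have "\<dots> = ?t 1 l + (\<Sum>e\<in>{e. e dvd l} - {1}. ?t e (l div e))"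
    using sum.remove[OF fin, of 1 "\<lambda>e. ?t e (l div e)"] by simp
  also have "(\<Sum>e\<in>{e. e dvd l} - {1}. ?t e (l div e)) = (\<Sum>(e, d)\<in>{(e, d). e * d = l \<and> e \<noteq> 1}. ?t e d)"
    by (rule sum.reindex_bij_witness[of _ fst "\<lambda>e. (e, l div e)"]) (use l in auto)
  finally have c: "of_nat l * character (E_rep l m) g = ?t 1 l + (\<Sum>(e, d)\<in>{(e, d). e * d = l \<and> e \<noteq> 1}. ?t e d)" .
  have "rho m (E_tail l) g = (\<Sum>(e, d)\<in>{(e, d). e * d = l \<and> e \<noteq> 1}. ?t e d) / of_nat l"
    unfolding E_tail_def rho_sum sum_divide_distrib
    by (intro sum.cong refl) (auto simp: rho_scale rho_prod rho_diff_of_nat rho_X_var)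
  then have t: "of_nat l * rho m (E_tail l) g = (\<Sum>(e, d)\<in>{(e, d). e * d = l \<and> e \<noteq> 1}. ?t e d)"
    using l0 by simp
  have "(\<Prod>j<(1::nat). ?X l - of_nat j) = ?X l" by (simp add: One_nat_def)
  then have "of_nat l * character (E_rep l m) g = of_nat l * rho m (E_poly l) g"
    unfolding c E_poly_eq rho_add rho_scale rho_X_var distrib_left t by simp
  then show "character (E_rep l m) g = rho m (E_poly l) g" using l0 by simp
qed

lemma E_nu_rep_expressed:
  assumes "0 \<notin> set \<nu>"
  shows "expresses_character m (prod_list (map E_poly \<nu>)) (E_nu_rep \<nu> m)"
  unfolding expresses_character_def
proof (intro allI impI)
  fix g assume g: "g permutes {1..m}"
  have "character (E_rep l m) g = rho m (E_poly l) g" if "l \<in> set \<nu>" for l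
  proof -
    have "0 < l" using assms that by (cases l) auto
    then show ?thesis using E_rep_expressed g by (simp add: expresses_character_def)
  qed
  then show "character (E_nu_rep \<nu> m) g = rho m (prod_list (map E_poly \<nu>)) g"
    unfolding character_E_nu[OF g] rho_prod_list map_map comp_def by (metis (no_types, lifting) map_cong)
qed

section \<open>Filtrations of the polynomial ring\<close>

text \<open>
  Three filtrations are used: the constant one by polynomials in given variables, the one by
  weight, and the spans of the bounded monomials in given polynomials.
\<close>

definition filtration :: "(nat \<Rightarrow> qpoly set) \<Rightarrow> bool" where
  "filtration F \<longleftrightarrow> (\<forall>d. qvs.subspace (F d)) \<and> 1 \<in> F 0 \<and> (\<forall>c d. c \<le> d \<longrightarrow> F c \<subseteq> F d) \<and>
     (\<forall>c d P Q. P \<in> F c \<longrightarrow> Q \<in> F d \<longrightarrow> P * Q \<in> F (c + d))"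

lemma filtrationD:
  assumes "filtration F"
  shows "qvs.subspace (F d)" "1 \<in> F 0" "c \<le> d \<Longrightarrow> P \<in> F c \<Longrightarrow> P \<in> F d"
    "P \<in> F c \<Longrightarrow> Q \<in> F d \<Longrightarrow> P * Q \<in> F (c + d)"
  using assms unfolding filtration_def by blast+

lemma filtration_of_nat:
  assumes F: "filtration F"
  shows "of_nat j \<in> F d"
proof -
  have "of_nat j = qscale (of_nat j) (1 :: qpoly)"
    by (rule poly_mapping_eqI) (simp add: lookup_of_nat lookup_one when_def)
  then have "of_nat j \<in> F 0"
    using qvs.subspace_scale[OF filtrationD(1)[OF F] filtrationD(2)[OF F]] by metis
  then show ?thesis by (rule filtrationD(3)[OF F le0])
qed

lemma filtration_falling_product:
  assumes F: "filtration F" and P: "P \<in> F d"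
  shows "(\<Prod>j<e. P - of_nat j) \<in> F (e * d)"
proof (induction e)
  case 0 then show ?case using filtrationD(2)[OF F] by simp
next
  case (Suc e)
  have "P - of_nat e \<in> F d"
    by (rule qvs.subspace_diff[OF filtrationD(1)[OF F] P filtration_of_nat[OF F]])
  then show ?case using filtrationD(4)[OF F Suc] by (simp add: add.commute)
qed

lemma filtration_power:
  assumes F: "filtration F" and P: "P \<in> F d"
  shows "P ^ a \<in> F (d * a)"
proof (induction a)
  case 0 then show ?case using filtrationD(2)[OF F] by simp
next
  case (Suc a)
  then show ?case using filtrationD(4)[OF F P Suc] by simp
qed

lemma filtration_prod:
  assumes F: "filtration F" and P: "\<And>i. i \<in> I \<Longrightarrow> P i \<in> F (w i)" and fin: "finite I"
  shows "(\<Prod>i\<in>I. P i) \<in> F (\<Sum>i\<in>I. w i)"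
  using fin P
proof (induction I)
  case empty then show ?case using filtrationD(2)[OF F] by simp
next
  case (insert i I)
  then show ?case using filtrationD(4)[OF F, of "P i" "w i" "\<Prod>i\<in>I. P i" "\<Sum>i\<in>I. w i"] by simp
qed

text \<open>
  All variables in \<open>E_tail l\<close> have an index \<open>d < l\<close>, and the product of \<open>e\<close> factors \<open>X_var d - j\<close> stays in
  level \<open>e * d = l\<close>.
\<close>

lemma E_tail_filtration:
  assumes F: "filtration F" and l: "0 < l" and X: "\<And>d. 1 \<le> d \<Longrightarrow> d < l \<Longrightarrow> X_var d \<in> F d"
  shows "E_tail l \<in> F l"
  unfolding E_tail_def
proof (rule qvs.subspace_sum[OF filtrationD(1)[OF F]], clarify)
  fix e d assume ed: "l = e * d" "e \<noteq> 1"
  then have "0 < d" "0 < e" using l by auto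
  then have "1 \<le> d" "d < e * d" using ed(2) by (auto simp: One_nat_def)
  then show "qscale (of_nat (totient d) * of_nat d ^ e / of_nat (e * d)) (\<Prod>j<e. X_var d - of_nat j) \<in> F (e * d)"
    using filtration_falling_product[OF F X, of d e] ed(1) by (intro qvs.subspace_scale[OF filtrationD(1)[OF F]]) simp
qed

lemma E_poly_filtration:
  assumes F: "filtration F" and l: "0 < l" and X: "\<And>d. 1 \<le> d \<Longrightarrow> d \<le> l \<Longrightarrow> X_var d \<in> F d"
  shows "E_poly l \<in> F l"
  unfolding E_poly_eq
  using l X E_tail_filtration[OF F l]
  by (intro qvs.subspace_add[OF filtrationD(1)[OF F]] qvs.subspace_scale[OF filtrationD(1)[OF F]]) auto

lemma X_var_filtration:
  assumes F: "filtration F" and E: "\<And>d. 1 \<le> d \<Longrightarrow> d \<le> N \<Longrightarrow> E_poly d \<in> F d" and l: "1 \<le> l" "l \<le> N"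
  shows "X_var l \<in> F l"
  using l
proof (induction l rule: less_induct)
  case (less l)
  have l: "0 < l" using less.prems by simp
  have t: "(of_nat (totient l) :: rat) \<noteq> 0" using l by (simp add: totient_gt_0_iff[THEN iffD2] less_imp_neq[THEN not_sym])
  have "E_tail l \<in> F l"
    by (rule E_tail_filtration[OF F l]) (use less in simp)
  then have "E_poly l - E_tail l \<in> F l"
    using E less.prems by (intro qvs.subspace_diff[OF filtrationD(1)[OF F]]) auto
  then have "qscale (1 / of_nat (totient l)) (E_poly l - E_tail l) \<in> F l"
    by (rule qvs.subspace_scale[OF filtrationD(1)[OF F]])
  then show ?case using t by (simp add: E_poly_eq)
qed

lemma keys_qpoly_mult:
  fixes P Q :: qpoly
  assumes "a \<in> Poly_Mapping.keys (P * Q)"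
  obtains b c where "b \<in> Poly_Mapping.keys P" "c \<in> Poly_Mapping.keys Q" "a = b + c"
  using assms keys_mult[of P Q] by auto

lemma subspace_keys_Ball: "qvs.subspace {P :: 'a \<Rightarrow>\<^sub>0 rat. \<forall>a\<in>Poly_Mapping.keys P. Q a}"
proof -
  have "{P :: 'a \<Rightarrow>\<^sub>0 rat. \<forall>a\<in>Poly_Mapping.keys P. Q a} = {P. Poly_Mapping.keys P \<subseteq> Collect Q}" by auto
  then show ?thesis by simp
qed

lemma filtration_polys_in: "filtration (\<lambda>_. polys_in I)"
  unfolding filtration_def
proof (intro conjI allI impI)
  show "qvs.subspace (polys_in I)" unfolding polys_in_def by (rule subspace_keys_Ball)
  show "1 \<in> polys_in I" by (simp add: polys_in_def)
  fix P Q assume P: "P \<in> polys_in I" and Q: "Q \<in> polys_in I"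
  show "P * Q \<in> polys_in I"
    unfolding polys_in_def
  proof (intro CollectI ballI)
    fix a assume "a \<in> Poly_Mapping.keys (P * Q)"
    then obtain b c where "b \<in> Poly_Mapping.keys P" "c \<in> Poly_Mapping.keys Q" "a = b + c" by (rule keys_qpoly_mult)
    moreover from this have "Poly_Mapping.keys b \<subseteq> I" "Poly_Mapping.keys c \<subseteq> I" using P Q by (auto simp: polys_in_def)
    ultimately show "Poly_Mapping.keys a \<subseteq> I" using Poly_Mapping.keys_add[of b c] by blast
  qed
qed simp

lemma X_var_in: "i \<in> I \<Longrightarrow> X_var i \<in> polys_in I"
  by (simp add: X_var_def polys_in_def)

lemma mono_weight_add: "mono_weight (a + b) = mono_weight a + mono_weight b"
proof -
  let ?S = "Poly_Mapping.keys a \<union> Poly_Mapping.keys b"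
  have w: "mono_weight c = (\<Sum>i\<in>?S. i * Poly_Mapping.lookup c i)" if "Poly_Mapping.keys c \<subseteq> ?S" for c
    unfolding mono_weight_def by (rule sum.mono_neutral_left) (use that in \<open>auto simp: in_keys_iff\<close>)
  show ?thesis
    using Poly_Mapping.keys_add[of a b] by (simp add: w lookup_add algebra_simps sum.distrib)
qed

lemma filtration_weight: "filtration (\<lambda>d. {P. \<forall>a\<in>Poly_Mapping.keys P. mono_weight a \<le> d})"
  unfolding filtration_def
proof (intro conjI allI impI)
  show "qvs.subspace {P :: qpoly. \<forall>a\<in>Poly_Mapping.keys P. mono_weight a \<le> d}" for d by (rule subspace_keys_Ball)
  show "(1 :: qpoly) \<in> {P. \<forall>a\<in>Poly_Mapping.keys P. mono_weight a \<le> 0}" by (simp add: mono_weight_def)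
  fix c d :: nat
  show "{P :: qpoly. \<forall>a\<in>Poly_Mapping.keys P. mono_weight a \<le> c} \<subseteq> {P. \<forall>a\<in>Poly_Mapping.keys P. mono_weight a \<le> d}" if "c \<le> d"
    using that by auto
  fix P Q :: qpoly
  assume P: "P \<in> {P. \<forall>a\<in>Poly_Mapping.keys P. mono_weight a \<le> c}" and Q: "Q \<in> {P. \<forall>a\<in>Poly_Mapping.keys P. mono_weight a \<le> d}"
  show "P * Q \<in> {P. \<forall>a\<in>Poly_Mapping.keys P. mono_weight a \<le> c + d}"
  proof (intro CollectI ballI)
    fix a assume "a \<in> Poly_Mapping.keys (P * Q)"
    then obtain b b' where "b \<in> Poly_Mapping.keys P" "b' \<in> Poly_Mapping.keys Q" "a = b + b'" by (rule keys_qpoly_mult)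
    then show "mono_weight a \<le> c + d" using P Q by (auto simp: mono_weight_add intro: add_mono)
  qed
qed

lemma mono_weight_single: "mono_weight (Poly_Mapping.single i k) = i * k"
  by (simp add: mono_weight_def)

lemma E_poly_in: "0 < l \<Longrightarrow> E_poly l \<in> polys_in {1..l}"
  by (rule E_poly_filtration[OF filtration_polys_in]) (auto intro: X_var_in)

lemma E_poly_weight:
  assumes l: "0 < l"
  shows "poly_weight (E_poly l) = l"
proof -
  have "E_poly l \<in> {P. \<forall>a\<in>Poly_Mapping.keys P. mono_weight a \<le> l}"
    by (rule E_poly_filtration[OF filtration_weight l]) (simp add: X_var_def mono_weight_single)
  then have le: "\<forall>a\<in>Poly_Mapping.keys (E_poly l). mono_weight a \<le> l" by simp
  have "E_tail l \<in> polys_in {1..<l}"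
    by (rule E_tail_filtration[OF filtration_polys_in l]) (auto intro: X_var_in)
  then have "Poly_Mapping.single l 1 \<notin> Poly_Mapping.keys (E_tail l)" by (auto simp: polys_in_def)
  then have "Poly_Mapping.lookup (E_poly l) (Poly_Mapping.single l 1) = of_nat (totient l)"
    by (simp add: E_poly_eq lookup_add X_var_def in_keys_iff)
  moreover have "totient l \<noteq> 0" using l by simp
  ultimately have "Poly_Mapping.single l 1 \<in> Poly_Mapping.keys (E_poly l)" by (simp add: in_keys_iff)
  then have "l \<in> mono_weight ` Poly_Mapping.keys (E_poly l)"
    using mono_weight_single[of l 1] by (metis imageI mult_1_right)
  then show ?thesis unfolding poly_weight_def using le by (intro Max_eqI) auto
qed

lemma filtration_bounded_span: "filtration (\<lambda>d. bounded_span d N Z)"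
proof -
  let ?S = "\<lambda>d. {\<Prod>i=1..N. Z i ^ a i | a :: nat \<Rightarrow> nat. (\<Sum>i=1..N. i * a i) \<le> d}"
  have base: "x * y \<in> ?S (c + d)" if "x \<in> ?S c" "y \<in> ?S d" for x y c d
  proof -
    obtain a b where ab: "x = (\<Prod>i=1..N. Z i ^ a i)" "(\<Sum>i=1..N. i * a i) \<le> c"
      "y = (\<Prod>i=1..N. Z i ^ b i)" "(\<Sum>i=1..N. i * b i) \<le> d" using \<open>x \<in> ?S c\<close> \<open>y \<in> ?S d\<close> by blast
    have "x * y = (\<Prod>i=1..N. Z i ^ (a i + b i))" by (simp add: ab power_add prod.distrib)
    moreover have "(\<Sum>i=1..N. i * (a i + b i)) \<le> c + d"
      using ab by (simp add: algebra_simps sum.distrib)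
    ultimately show ?thesis by (intro CollectI exI[of _ "\<lambda>i. a i + b i"]) simp
  qed
  have sc: "qscale k x * y = qscale k (x * y)" for k and x y :: qpoly
    unfolding qscale_def mult_map_scale_conv_mult by (simp add: mult.assoc)
  have half: "x * Q \<in> qvs.span (?S (c + d))" if x: "x \<in> ?S c" and Q: "Q \<in> qvs.span (?S d)" for x Q c d
    using Q
  proof (induction rule: qvs.span_induct_alt)
    case base then show ?case by (simp add: qvs.span_zero)
  next
    case (step k y Q)
    have "x * (qscale k y + Q) = qscale k (x * y) + x * Q"
      using sc[of k y x] by (simp add: algebra_simps)
    then show ?case
      using step base[OF x step(1)] by (simp add: qvs.span_add qvs.span_base qvs.span_scale)
  qed
  have full: "P * Q \<in> qvs.span (?S (c + d))" if P: "P \<in> qvs.span (?S c)" and Q: "Q \<in> qvs.span (?S d)" for P Q c d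
    using P
  proof (induction rule: qvs.span_induct_alt)
    case base then show ?case by (simp add: qvs.span_zero)
  next
    case (step k x P)
    have "(qscale k x + P) * Q = qscale k (x * Q) + P * Q" using sc by (simp add: algebra_simps)
    then show ?case using step half[OF step(1) Q] by (simp add: qvs.span_add qvs.span_scale)
  qed
  have one: "1 \<in> ?S 0" by (intro CollectI exI[of _ "\<lambda>_. 0"]) simp
  have mono: "?S c \<subseteq> ?S d" if "c \<le> d" for c d using that order_trans by blast
  show ?thesis
    unfolding filtration_def bounded_span_def
  proof (intro conjI allI impI)
    show "1 \<in> qvs.span (?S 0)" using one by (rule qvs.span_base)
    show "qvs.span (?S c) \<subseteq> qvs.span (?S d)" if "c \<le> d" for c d by (rule qvs.span_mono[OF mono[OF that]])
    show "P * Q \<in> qvs.span (?S (c + d))" if "P \<in> qvs.span (?S c)" "Q \<in> qvs.span (?S d)" for P Q c d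
      using that by (rule full)
  qed (rule qvs.subspace_span)
qed

lemma bounded_span_minimal:
  assumes F: "filtration F" and Z: "\<And>i. 1 \<le> i \<Longrightarrow> i \<le> N \<Longrightarrow> Z i \<in> F i"
  shows "bounded_span d N Z \<subseteq> F d"
  unfolding bounded_span_def
proof (rule qvs.span_minimal[OF _ filtrationD(1)[OF F]], clarify)
  fix a :: "nat \<Rightarrow> nat" assume a: "(\<Sum>i=1..N. i * a i) \<le> d"
  have "(\<Prod>i=1..N. Z i ^ a i) \<in> F (\<Sum>i=1..N. i * a i)"
    by (rule filtration_prod[OF F]) (use filtration_power[OF F Z] in auto)
  then show "(\<Prod>i=1..N. Z i ^ a i) \<in> F d" by (rule filtrationD(3)[OF F a])
qed

lemma generator_in_bounded_span:
  assumes "1 \<le> i" "i \<le> N"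
  shows "Z i \<in> bounded_span i N Z"
  unfolding bounded_span_def
proof (rule qvs.span_base, intro CollectI exI conjI)
  have i: "i \<in> {1..N}" using assms by simp
  have "(\<Prod>k=1..N. Z k ^ (if k = i then 1 else 0)) = (\<Prod>k=1..N. if k = i then Z k else 1)"
    by (intro prod.cong refl) simp
  then show "Z i = (\<Prod>k=1..N. Z k ^ (if k = i then 1 else 0))" using i by simp
  have "(\<Sum>k=1..N. k * (if k = i then 1 else 0)) = (\<Sum>k=1..N. if k = i then k else 0)"
    by (intro sum.cong refl) simp
  then show "(\<Sum>k=1..N. k * (if k = i then 1 else 0)) \<le> i" using i by simp
qed

text \<open>
  \<open>E_poly l\<close> is a nonzero multiple of \<open>X_var l\<close> plus a polynomial of weight at most \<open>l\<close> in the
  earlier variables, so the two sequences generate each other without leaving the filtrations.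
\<close>

theorem bounded_span_E_poly: "bounded_span d N E_poly = bounded_span d N X_var"
proof
  have "E_poly l \<in> bounded_span l N X_var" if "1 \<le> l" "l \<le> N" for l
    by (rule E_poly_filtration[OF filtration_bounded_span]) (use that in \<open>auto intro: generator_in_bounded_span\<close>)
  then show "bounded_span d N E_poly \<subseteq> bounded_span d N X_var"
    by (intro bounded_span_minimal[OF filtration_bounded_span])
  have "X_var l \<in> bounded_span l N E_poly" if "1 \<le> l" "l \<le> N" for l
    by (rule X_var_filtration[OF filtration_bounded_span generator_in_bounded_span that])
  then show "bounded_span d N X_var \<subseteq> bounded_span d N E_poly"
    by (intro bounded_span_minimal[OF filtration_bounded_span])
qed

lemma E_nu_poly_in:
  assumes "0 \<notin> set \<nu>"
  shows "prod_list (map E_poly \<nu>) \<in> polys_in {1..}"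
  using assms
proof (induction \<nu>)
  case Nil then show ?case using filtrationD(2)[OF filtration_polys_in] by simp
next
  case (Cons l \<nu>)
  then have "E_poly l \<in> polys_in {1..}"
    by (intro E_poly_filtration[OF filtration_polys_in]) (auto intro: X_var_in)
  then show ?case using Cons filtrationD(4)[OF filtration_polys_in] by auto
qed

section \<open>The ranks of the modules of cycles\<close>

lemma E_rep_eq: "E_rep l = (\<lambda>m. perm_module (cycles l m) cycle_action)"
  by (rule ext) (simp add: E_rep_def)

lemma E_nu_rep_eq_fun: "E_nu_rep \<nu> = (\<lambda>m. perm_module (cycle_words (rev \<nu>) m) (word_action (rev \<nu>)))"
  by (rule ext) (rule E_nu_rep_eq)

theorem proposition2p3p4:
  shows
    "(\<forall>l::nat. l \<ge> 1 \<longrightarrow>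
        E_poly l \<in> polys_in {1..l} \<and>
        poly_weight (E_poly l) = l \<and>
        (\<forall>m. expresses_character m (E_poly l) (E_rep l m)) \<and>
        FI_module (E_rep l) (E_map l) \<and>
        rank_PC (E_rep l) = 0 \<and>
        rank_RS (E_rep l) = enat (2 * l) \<and>
        rank_FI_RS (E_rep l) (E_map l) = enat (2 * l))
   \<and> (\<forall>N d :: nat. bounded_span d N E_poly = bounded_span d N X_var)
   \<and> (\<forall>\<nu>. is_partition \<nu> \<and> \<nu> \<noteq> [] \<longrightarrow>
        (\<forall>m. rep_weight m (E_nu_rep \<nu> m) \<le> ereal (real (min m (sum_list \<nu>)))) \<and>
        FI_module (E_nu_rep \<nu>) (E_nu_map \<nu>) \<and>
        rank_PC (E_nu_rep \<nu>) = 0 \<and>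
        rank_RS (E_nu_rep \<nu>) = enat (2 * sum_list \<nu>) \<and>
        rank_FI_RS (E_nu_rep \<nu>) (E_nu_map \<nu>) = enat (2 * sum_list \<nu>))"
proof (intro conjI allI impI)
  fix l :: nat assume "1 \<le> l"
  then have l: "0 < l" by simp
  interpret E: fi_set "cycles l" cycle_action cycle_support l by (rule fi_set_cycles)
  have E_map: "E_map l m x = x" for m x by (simp add: E_map_def)
  show E: "E_poly l \<in> polys_in {1..l}" "poly_weight (E_poly l) = l"
    by (rule E_poly_in[OF l]) (rule E_poly_weight[OF l])
  show ex: "expresses_character m (E_poly l) (E_rep l m)" for m by (rule E_rep_expressed[OF l])
  have "E_poly l \<in> polys_in {1..}" using E(1) by (fastforce simp: polys_in_def)
  then show "rank_PC (E_rep l) = 0" using ex by (rule rank_PC_zero)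
  show "FI_module (E_rep l) (E_map l)"
    unfolding E_rep_eq by (rule E.FI_module_W) (rule E_map)
  show "rank_RS (E_rep l) = enat (2 * l)"
    unfolding E_rep_eq by (rule E.rank_RS_W[OF l full_cycle])
  show "rank_FI_RS (E_rep l) (E_map l) = enat (2 * l)"
    unfolding E_rep_eq by (rule E.rank_FI_RS_W[OF l full_cycle]) (rule E_map)
next
  show "bounded_span d N E_poly = bounded_span d N X_var" for N d by (rule bounded_span_E_poly)
next
  fix \<nu> assume \<nu>: "is_partition \<nu> \<and> \<nu> \<noteq> []"
  then have z: "0 \<notin> set \<nu>" by (simp add: is_partition_def)
  interpret E: fi_set "cycle_words (rev \<nu>)" "word_action (rev \<nu>)" "\<lambda>w. \<Union> (cycle_support ` set w)" "sum_list \<nu>"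
    using fi_set_cycle_words[of "rev \<nu>"] by simp
  have pos: "0 < sum_list \<nu>" using \<nu> z by (cases \<nu>) auto
  obtain w where w: "w \<in> cycle_words (rev \<nu>) (sum_list \<nu>)" "\<Union> (cycle_support ` set w) = {1..sum_list \<nu>}"
    using full_cycle_word[of "rev \<nu>"] by auto
  show "rep_weight m (E_nu_rep \<nu> m) \<le> ereal (real (min m (sum_list \<nu>)))" for m
    unfolding E_nu_rep_eq by (rule E.rep_weight_bound)
  show "rank_PC (E_nu_rep \<nu>) = 0"
    by (rule rank_PC_zero[OF E_nu_poly_in[OF z] E_nu_rep_expressed[OF z]])
  show "FI_module (E_nu_rep \<nu>) (E_nu_map \<nu>)"
    unfolding E_nu_rep_eq_fun by (rule E.FI_module_W) (rule E_nu_map_id)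
  show "rank_RS (E_nu_rep \<nu>) = enat (2 * sum_list \<nu>)"
    unfolding E_nu_rep_eq_fun by (rule E.rank_RS_W[OF pos w])
  show "rank_FI_RS (E_nu_rep \<nu>) (E_nu_map \<nu>) = enat (2 * sum_list \<nu>)"
    unfolding E_nu_rep_eq_fun by (rule E.rank_FI_RS_W[OF pos w]) (rule E_nu_map_id)
qed

end
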